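(* Let $p$ be a prime, let $G$ be a finitely generated pro-$p$ group, and let $L$ be a $\mathbb{Z}_p$-lattice equipped with a (continuous, right) $G$-action. Then the lower $p$-series of the $\mathbb{Z}_pG$-module $L$ admits a stratification, and any two stratifications of it have the same growth rate. Moreover, if $d = \dim_{\mathbb{Z}_p} L$ and if $(x_1,\ldots,x_d)$ is a frame for a stratification of the lower $p$-series of $L$ with growth rate $(\xi_1,\ldots,\xi_d)$, then (1) $\frac{1}{d} \le \xi_1 \le \ldots \le \xi_d \le 1$ are rational numbers; (2) for every $e \in \{1,\ldots,d-1\}$ with $\xi_e < \xi_{e+1}$ the sublattice $\bigoplus_{k=1}^e \mathbb{Z}_p x_k$ is $G$-invariant; and (3) the entire stratification is given by $G$-invariant sublattices, i.e. for every $i \in \mathbb{N}_0$ the lattice $\bigoplus_{k=1}^d p^{\lfloor i\xi_k\rfloor}\mathbb{Z}_p x_k$ is $G$-invariant.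
   Context: $\mathbb{N}=\{1,2,\ldots\}$, $\mathbb{N}_0=\mathbb{N}\cup\{0\}$. Finitely generated means topologically finitely generated. A $\mathbb{Z}_p$-lattice $L$ is a finitely generated free $\mathbb{Z}_p$-module; $\dim_{\mathbb{Z}_p}L$ is its rank. "Equipped with a $G$-action" means that $L$ is a right $\mathbb{Z}_pG$-module, with $G$ acting continuously by $\mathbb{Z}_p$-linear automorphisms. The $p$-augmentation ideal of $\mathbb{Z}_pG$ is $\mathfrak{a}_G=\sum_{g\in G}(g-1)\mathbb{Z}_pG+p\mathbb{Z}_pG$. The lower $p$-series of the $\mathbb{Z}_pG$-module $L$ is the series $\lambda_i(L)=L.\mathfrak{a}_G^{\,i}$, $i\in\mathbb{N}_0$. It consists of open $\mathbb{Z}_pG$-submodules with $\bigcap_i\lambda_i(L)=\{0\}$. A filtration series of $L$ (as a $\mathbb{Z}_p$-lattice) is a descending chain $\mathcal{S}\colon L=L_0\supseteq L_1\supseteq\ldots$ of open $\mathbb{Z}_p$-sublattices with $\bigcap_{i}L_i=\{0\}$. Two filtration series $(L_i)$, $(L_i^* )$ are $c$-equivalent, for $c\in\mathbb{N}_0$, if $p^cL_i\subseteq L_i^*$ and $p^cL_i^*\subseteq L_i$ for all $i\in\mathbb{N}$; they are equivalent if they are $c$-equivalent for some $c\in\mathbb{N}_0$. Let $d=\dim_{\mathbb{Z}_p}L$ and let $x_1,\ldots,x_d$ be a $\mathbb{Z}_p$-basis of $L$. A filtration series $\mathcal{S}$ of $L$ has a stratification given by the frame $(x_1,\ldots,x_d)$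 if there are positive real numbers $\xi_1\le\ldots\le\xi_d$ such that $\mathcal{S}$ is equivalent to the filtration series $\mathcal{S}^*\colon L_i^*=\bigoplus_{k=1}^d p^{\lfloor i\xi_k\rfloor}\mathbb{Z}_p x_k$, $i\in\mathbb{N}_0$. The tuple $(\xi_1,\ldots,\xi_d)$ is called the growth rate of the stratification; it is uniquely determined by the frame. The stratification $\mathcal{S}^*$ is given by $G$-invariant sublattices if all terms $L_i^*$ are $G$-invariant. "$\mathcal{S}$ admits a stratification" means it has one for some frame. *)

theory Defs
  imports "HOL-Analysis.Analysis" "HOL-Algebra.Algebra"
begin

section \<open>The ring of p-adic integers\<close>

text \<open>The inverse limit of the rings of residues modulo \<open>p^n\<close>: an element is the sequence of its
  least nonnegative residues modulo \<open>p^n\<close>.\<close>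

definition padic_int :: "nat \<Rightarrow> (nat \<Rightarrow> int) ring" where
  "padic_int p =
    \<lparr> carrier = {a. \<forall>n. a n \<in> {0..<int p ^ n} \<and> a (Suc n) mod int p ^ n = a n},
      mult = (\<lambda>a b n. (a n * b n) mod int p ^ n),
      one = (\<lambda>n. 1 mod int p ^ n),
      ring.zero = (\<lambda>n. 0),
      add = (\<lambda>a b n. (a n + b n) mod int p ^ n) \<rparr>"

lemma cring_padic_int:
  assumes "p > 0"
  shows "cring (padic_int p)"
proof (rule cringI)
  have pos: "int p ^ n > 0" for n
    using assms by simp
  have red: "(x mod int p ^ Suc n) mod int p ^ n = x mod int p ^ n" for x n
    by (simp add: mod_mod_cancel)
  have compat_add: "((a + b) mod int p ^ Suc n) mod int p ^ n = (a mod int p ^ n + b mod int p ^ n) mod int p ^ n"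
    for a b n unfolding red by (simp add: mod_add_eq)
  have compat_mult: "((a * b) mod int p ^ Suc n) mod int p ^ n = (a mod int p ^ n * (b mod int p ^ n)) mod int p ^ n"
    for a b n unfolding red by (simp add: mod_mult_eq)
  show "abelian_group (padic_int p)"
  proof (rule abelian_groupI)
    fix a b assume "a \<in> carrier (padic_int p)" "b \<in> carrier (padic_int p)"
    then show "a \<oplus>\<^bsub>padic_int p\<^esub> b \<in> carrier (padic_int p)"
      using compat_add pos by (simp add: padic_int_def del: power_Suc)
  next
    show "\<zero>\<^bsub>padic_int p\<^esub> \<in> carrier (padic_int p)"
      using assms by (simp add: padic_int_def)
  next
    fix a assume a: "a \<in> carrier (padic_int p)"
    then show "\<zero>\<^bsub>padic_int p\<^esub> \<oplus>\<^bsub>padic_int p\<^esub> a = a"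
      by (auto simp: padic_int_def)
    have "(- a (Suc n)) mod int p ^ Suc n mod int p ^ n = (- a n) mod int p ^ n" for n
      unfolding red using a by (simp add: padic_int_def) (metis mod_minus_eq)
    then show "\<exists>b\<in>carrier (padic_int p). b \<oplus>\<^bsub>padic_int p\<^esub> a = \<zero>\<^bsub>padic_int p\<^esub>"
      using pos
      by (intro bexI[of _ "\<lambda>n. (- a n) mod int p ^ n"])
        (simp_all add: padic_int_def mod_simps del: power_Suc)
  qed (auto simp: padic_int_def mod_simps algebra_simps)
  show "Group.comm_monoid (padic_int p)"
  proof (rule comm_monoidI)
    fix a b assume "a \<in> carrier (padic_int p)" "b \<in> carrier (padic_int p)"
    then show "a \<otimes>\<^bsub>padic_int p\<^esub> b \<in> carrier (padic_int p)"
      using compat_mult pos by (simp add: padic_int_def del: power_Suc)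
  next
    show "\<one>\<^bsub>padic_int p\<^esub> \<in> carrier (padic_int p)"
      using pos by (simp add: padic_int_def mod_mod_cancel)
  next
    fix a assume "a \<in> carrier (padic_int p)"
    then show "\<one>\<^bsub>padic_int p\<^esub> \<otimes>\<^bsub>padic_int p\<^esub> a = a"
      by (auto simp: padic_int_def mod_simps)
  qed (auto simp: padic_int_def mod_simps algebra_simps)
qed (auto simp: padic_int_def mod_simps algebra_simps)


section \<open>Lattices over the p-adic integers\<close>

definition lattice_basis ::
  "nat \<Rightarrow> nat \<Rightarrow> (nat \<Rightarrow> int, 'a, 'n) module_scheme \<Rightarrow> (nat \<Rightarrow> 'a) \<Rightarrow> bool" where
  "lattice_basis p d L x \<longleftrightarrow>
     x \<in> {1..d} \<rightarrow> carrier L \<and>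
     (\<forall>v\<in>carrier L. \<exists>!c. c \<in> {1..d} \<rightarrow>\<^sub>E carrier (padic_int p) \<and>
        v = (\<Oplus>\<^bsub>L\<^esub>k\<in>{1..d}. c k \<odot>\<^bsub>L\<^esub> x k))"

text \<open>Finitely generated free, of rank \<open>d\<close>.\<close>

definition padic_lattice :: "nat \<Rightarrow> nat \<Rightarrow> (nat \<Rightarrow> int, 'a, 'n) module_scheme \<Rightarrow> bool" where
  "padic_lattice p d L \<longleftrightarrow> Module.module (padic_int p) L \<and> (\<exists>x. lattice_basis p d L x)"

text \<open>The multiple of a subset by the integer \<open>p^c\<close>.\<close>

definition p_multiple :: "nat \<Rightarrow> (nat \<Rightarrow> int, 'a, 'n) module_scheme \<Rightarrow> nat \<Rightarrow> 'a set \<Rightarrow> 'a set" where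
  "p_multiple p L c M = (\<lambda>v. add_pow L (p ^ c) v) ` M"

text \<open>The natural topology of a lattice, with the cosets of the sublattices \<open>p^n L\<close> as a base; for
  any choice of a basis it is the product topology coming from the p-adic topology on the
  coordinates.\<close>

definition lattice_topology :: "nat \<Rightarrow> (nat \<Rightarrow> int, 'a, 'n) module_scheme \<Rightarrow> 'a topology" where
  "lattice_topology p L =
     topology_generated_by {x <+\<^bsub>L\<^esub> p_multiple p L n (carrier L) | x n. x \<in> carrier L}"


section \<open>Pro-p groups and continuous actions\<close>

definition topological_group ::
  "('g, 'm) monoid_scheme \<Rightarrow> 'g topology \<Rightarrow> bool" where
  "topological_group G T \<longleftrightarrow>
     group G \<and> topspace T = carrier G \<and>
     continuous_map (prod_topology T T) T (\<lambda>(g, h). g \<otimes>\<^bsub>G\<^esub> h) \<and>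
     continuous_map T T (\<lambda>g. inv\<^bsub>G\<^esub> g)"

text \<open>A compact Hausdorff topological group whose open subgroups form a base for the neighbourhoods
  of the identity.\<close>

definition profinite_group ::
  "('g, 'm) monoid_scheme \<Rightarrow> 'g topology \<Rightarrow> bool" where
  "profinite_group G T \<longleftrightarrow>
     topological_group G T \<and> compact_space T \<and> Hausdorff_space T \<and>
     (\<forall>U. openin T U \<and> \<one>\<^bsub>G\<^esub> \<in> U \<longrightarrow> (\<exists>H. subgroup H G \<and> openin T H \<and> H \<subseteq> U))"

definition pro_p_group ::
  "nat \<Rightarrow> ('g, 'm) monoid_scheme \<Rightarrow> 'g topology \<Rightarrow> bool" where
  "pro_p_group p G T \<longleftrightarrow>
     profinite_group G T \<and>
     (\<forall>N. N \<lhd> G \<and> openin T N \<longrightarrow> (\<exists>k. card (rcosets\<^bsub>G\<^esub> N) = p ^ k))"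

definition topologically_finitely_generated ::
  "('g, 'm) monoid_scheme \<Rightarrow> 'g topology \<Rightarrow> bool" where
  "topologically_finitely_generated G T \<longleftrightarrow>
     (\<exists>S. finite S \<and> S \<subseteq> carrier G \<and> Abstract_Topology.closure_of T (generate G S) = carrier G)"

text \<open>\<open>act v g\<close> is the image of \<open>v\<close> under the right action of \<open>g\<close>.\<close>

definition continuous_linear_right_action ::
  "nat \<Rightarrow> ('g, 'm) monoid_scheme \<Rightarrow> 'g topology \<Rightarrow> (nat \<Rightarrow> int, 'a, 'n) module_scheme
     \<Rightarrow> ('a \<Rightarrow> 'g \<Rightarrow> 'a) \<Rightarrow> bool" where
  "continuous_linear_right_action p G T L act \<longleftrightarrow>
     (\<forall>v\<in>carrier L. \<forall>g\<in>carrier G. act v g \<in> carrier L) \<and>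
     (\<forall>v\<in>carrier L. act v \<one>\<^bsub>G\<^esub> = v) \<and>
     (\<forall>v\<in>carrier L. \<forall>g\<in>carrier G. \<forall>h\<in>carrier G. act v (g \<otimes>\<^bsub>G\<^esub> h) = act (act v g) h) \<and>
     (\<forall>v\<in>carrier L. \<forall>w\<in>carrier L. \<forall>g\<in>carrier G.
        act (v \<oplus>\<^bsub>L\<^esub> w) g = act v g \<oplus>\<^bsub>L\<^esub> act w g) \<and>
     (\<forall>a\<in>carrier (padic_int p). \<forall>v\<in>carrier L. \<forall>g\<in>carrier G.
        act (a \<odot>\<^bsub>L\<^esub> v) g = a \<odot>\<^bsub>L\<^esub> act v g) \<and>
     continuous_map (prod_topology (lattice_topology p L) T) (lattice_topology p L)
       (\<lambda>(v, g). act v g)"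

definition group_invariant ::
  "('g, 'm) monoid_scheme \<Rightarrow> ('a \<Rightarrow> 'g \<Rightarrow> 'a) \<Rightarrow> 'a set \<Rightarrow> bool" where
  "group_invariant G act M \<longleftrightarrow> (\<forall>v\<in>M. \<forall>g\<in>carrier G. act v g \<in> M)"


section \<open>The group ring and the lower p-series\<close>

text \<open>Elements are the finitely supported coefficient functions on \<open>G\<close>, multiplied by convolution.\<close>

definition group_ring ::
  "('r, 'k) ring_scheme \<Rightarrow> ('g, 'm) monoid_scheme \<Rightarrow> ('g \<Rightarrow> 'r) ring" where
  "group_ring R G =
    \<lparr> carrier = {a. (\<forall>g\<in>carrier G. a g \<in> carrier R) \<and> (\<forall>g. g \<notin> carrier G \<longrightarrow> a g = \<zero>\<^bsub>R\<^esub>) \<and>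
                    finite {g. a g \<noteq> \<zero>\<^bsub>R\<^esub>}},
      mult = (\<lambda>a b g. if g \<in> carrier G
                then \<Oplus>\<^bsub>R\<^esub>h\<in>{h. a h \<noteq> \<zero>\<^bsub>R\<^esub>}. a h \<otimes>\<^bsub>R\<^esub> b (inv\<^bsub>G\<^esub> h \<otimes>\<^bsub>G\<^esub> g)
                else \<zero>\<^bsub>R\<^esub>),
      one = (\<lambda>g. if g = \<one>\<^bsub>G\<^esub> then \<one>\<^bsub>R\<^esub> else \<zero>\<^bsub>R\<^esub>),
      ring.zero = (\<lambda>g. \<zero>\<^bsub>R\<^esub>),
      add = (\<lambda>a b g. a g \<oplus>\<^bsub>R\<^esub> b g) \<rparr>"

definition group_ring_of ::
  "('r, 'k) ring_scheme \<Rightarrow> 'g \<Rightarrow> 'g \<Rightarrow> 'r" where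
  "group_ring_of R g = (\<lambda>h. if h = g then \<one>\<^bsub>R\<^esub> else \<zero>\<^bsub>R\<^esub>)"

text \<open>A sum of additive subgroups is the additive subgroup generated by their union, so this is
  \<open>(\<Sum>g\<in>G. (g - 1) Z\<^sub>p G) + p Z\<^sub>p G\<close>.\<close>

definition p_augmentation_ideal ::
  "nat \<Rightarrow> ('g, 'm) monoid_scheme \<Rightarrow> ('g \<Rightarrow> nat \<Rightarrow> int) set" where
  "p_augmentation_ideal p G =
     (let A = group_ring (padic_int p) G in
      generate (add_monoid A)
        ({(group_ring_of (padic_int p) g \<ominus>\<^bsub>A\<^esub> \<one>\<^bsub>A\<^esub>) \<otimes>\<^bsub>A\<^esub> a | g a. g \<in> carrier G \<and> a \<in> carrier A} \<union>
         {add_pow A p a | a. a \<in> carrier A}))"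

primrec p_augmentation_power ::
  "nat \<Rightarrow> ('g, 'm) monoid_scheme \<Rightarrow> nat \<Rightarrow> ('g \<Rightarrow> nat \<Rightarrow> int) set" where
  "p_augmentation_power p G 0 = carrier (group_ring (padic_int p) G)"
| "p_augmentation_power p G (Suc i) =
     ideal_prod (group_ring (padic_int p) G) (p_augmentation_power p G i) (p_augmentation_ideal p G)"

definition group_ring_act ::
  "nat \<Rightarrow> (nat \<Rightarrow> int, 'a, 'n) module_scheme \<Rightarrow> ('a \<Rightarrow> 'g \<Rightarrow> 'a)
     \<Rightarrow> 'a \<Rightarrow> ('g \<Rightarrow> nat \<Rightarrow> int) \<Rightarrow> 'a" where
  "group_ring_act p L act v a = (\<Oplus>\<^bsub>L\<^esub>g\<in>{g. a g \<noteq> \<zero>\<^bsub>padic_int p\<^esub>}. a g \<odot>\<^bsub>L\<^esub> act v g)"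

definition lower_p_series ::
  "nat \<Rightarrow> ('g, 'm) monoid_scheme \<Rightarrow> (nat \<Rightarrow> int, 'a, 'n) module_scheme \<Rightarrow> ('a \<Rightarrow> 'g \<Rightarrow> 'a)
     \<Rightarrow> nat \<Rightarrow> 'a set" where
  "lower_p_series p G L act i =
     generate (add_monoid L)
       {group_ring_act p L act v a | v a. v \<in> carrier L \<and> a \<in> p_augmentation_power p G i}"


section \<open>Filtration series and stratifications\<close>

definition filtration_series ::
  "nat \<Rightarrow> (nat \<Rightarrow> int, 'a, 'n) module_scheme \<Rightarrow> (nat \<Rightarrow> 'a set) \<Rightarrow> bool" where
  "filtration_series p L S \<longleftrightarrow>
     S 0 = carrier L \<and>
     (\<forall>i. S (Suc i) \<subseteq> S i) \<and>
     (\<forall>i. submodule (S i) (padic_int p) L \<and> openin (lattice_topology p L) (S i)) \<and>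
     (\<Inter>i. S i) = {\<zero>\<^bsub>L\<^esub>}"

definition filtration_equivalent ::
  "nat \<Rightarrow> (nat \<Rightarrow> int, 'a, 'n) module_scheme \<Rightarrow> (nat \<Rightarrow> 'a set) \<Rightarrow> (nat \<Rightarrow> 'a set) \<Rightarrow> bool" where
  "filtration_equivalent p L S S' \<longleftrightarrow>
     (\<exists>c. \<forall>i\<ge>1. p_multiple p L c (S i) \<subseteq> S' i \<and> p_multiple p L c (S' i) \<subseteq> S i)"

text \<open>The sublattice with basis \<open>p^(m 1) x 1, \<dots>, p^(m e) x e\<close>.\<close>

definition frame_sublattice ::
  "nat \<Rightarrow> (nat \<Rightarrow> int, 'a, 'n) module_scheme \<Rightarrow> (nat \<Rightarrow> 'a) \<Rightarrow> nat \<Rightarrow> (nat \<Rightarrow> nat) \<Rightarrow> 'a set" where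
  "frame_sublattice p L x e m =
     {\<Oplus>\<^bsub>L\<^esub>k\<in>{1..e}. add_pow L (p ^ m k) (c k \<odot>\<^bsub>L\<^esub> x k) | c. c \<in> {1..e} \<rightarrow> carrier (padic_int p)}"

definition stratification_term ::
  "nat \<Rightarrow> nat \<Rightarrow> (nat \<Rightarrow> int, 'a, 'n) module_scheme \<Rightarrow> (nat \<Rightarrow> 'a) \<Rightarrow> (nat \<Rightarrow> real) \<Rightarrow> nat \<Rightarrow> 'a set" where
  "stratification_term p d L x \<xi> i = frame_sublattice p L x d (\<lambda>k. nat \<lfloor>real i * \<xi> k\<rfloor>)"

text \<open>The series \<open>S\<close> has a stratification given by the frame \<open>(x 1, \<dots>, x d)\<close>, with growth rate
  \<open>(\<xi> 1, \<dots>, \<xi> d)\<close>; the values of \<open>x\<close> and \<open>\<xi>\<close> outside \<open>{1..d}\<close> are irrelevant.\<close>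

definition has_stratification ::
  "nat \<Rightarrow> nat \<Rightarrow> (nat \<Rightarrow> int, 'a, 'n) module_scheme \<Rightarrow> (nat \<Rightarrow> 'a set)
     \<Rightarrow> (nat \<Rightarrow> 'a) \<Rightarrow> (nat \<Rightarrow> real) \<Rightarrow> bool" where
  "has_stratification p d L S x \<xi> \<longleftrightarrow>
     filtration_series p L S \<and> lattice_basis p d L x \<and>
     (\<forall>k\<in>{1..d}. 0 < \<xi> k) \<and> mono_on {1..d} \<xi> \<and>
     filtration_equivalent p L S (stratification_term p d L x \<xi>)"

end

theory Submission
  imports Defs "HOL-Number_Theory.Cong" "HOL-Library.Set_Algebras" "HOL-Library.Function_Algebras"
begin

text \<open>Let \<open>aug N\<close> be the sum of the images of \<open>N\<close> under \<open>p\<close> and under the finitely many operators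
  \<open>s - 1\<close>, where \<open>s\<close> or its inverse is a chosen generator of \<open>G\<close>; then the lower \<open>p\<close>-series
  is \<open>aug^i L\<close>.

  Let \<open>W\<close> be a pure \<open>G\<close>-submodule of \<open>L\<close>. If \<open>L/W\<close> is rationally irreducible, then the lattices
  \<open>(W + aug^i L)/W\<close>, rescaled by the largest power of \<open>p\<close> that divides them, contain a common
  \<open>p^c L/W\<close> by compactness. Hence they are finite in number, and \<open>aug^r E = p^s E\<close> modulo \<open>W\<close> for
  one of them and some \<open>r > 0\<close>. Gluing along a composition series gives in general an open
  submodule \<open>E\<close> with \<open>aug^r E \<subseteq> W + p^s E\<close>, where \<open>s/r\<close> is the best possible slope. The
  intersection \<open>M\<close> of the decreasing sequence \<open>p^(-s j) (W + aug^(r j) E)\<close> is then strictly larger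
  than \<open>W\<close> and satisfies \<open>p^s M \<subseteq> W + aug^r M\<close>: modulo \<open>W\<close> the series restricted to \<open>M\<close> decays
  exactly at rate \<open>s/r\<close>, and on all of \<open>L\<close> at least at that rate. A basis of the pure closure of \<open>M\<close>
  modulo \<open>W\<close> is the next block of the frame, and one continues with this closure in place of \<open>W\<close>.

  Conversely, an endomorphism that preserves every \<open>aug^i L\<close> cannot have a nonzero \<open>x_j\<close>-coefficient
  at \<open>x_k\<close> when \<open>\<xi>_j > \<xi>_k\<close>, since this coefficient is divisible by
  \<open>p^(\<lfloor>i \<xi>_j\<rfloor> - \<lfloor>i \<xi>_k\<rfloor> - 2 c)\<close> for all \<open>i\<close>. This gives the invariance statements, and counting
  independent vectors modulo \<open>p\<close> in the same way gives uniqueness of the growth rate. The bound \<open>1/d\<close>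
  expresses that a \<open>p\<close>-group acts unipotently on the \<open>d\<close>-dimensional space \<open>L/pL\<close>.\<close>

section \<open>Closed submodules of a compact lattice\<close>

text \<open>The rate at which \<open>aug^i\<close> shrinks a lattice is a joint growth rate of
  several operators that need not commute, so there is no characteristic polynomial to read it from.
  The slowest block has to be split off first. A relation known modulo the pure closure of
  \<open>M\<close> lifts to \<open>L\<close> with an error in that closure, and nothing bounds this
  error directly. It is, however, congruent to a vector of the series modulo the terms of the later
  blocks, and these terms are divisible by \<open>p^\<lfloor>i \<eta>\<rfloor>\<close>, where
  \<open>\<eta> = s/r\<close> is the current slope, because the later slopes are at least
  \<open>\<eta>\<close>. As the whole series decays at least at rate \<open>\<eta>\<close> modulo
  \<open>W\<close>, a bounded multiple of the error is divisible by the same power of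
  \<open>p\<close>, and this is exactly what the new block of the frame can absorb. So no complement
  of the pure closure has to be invariant, and only a bounded power of \<open>p\<close> is lost at
  each of the finitely many blocks.\<close>

text \<open>\<open>P\<close> stands for multiplication by \<open>p\<close>. The last assumption is sequential compactness in the
  \<open>p\<close>-adic topology, with the rate of convergence normalised by passing to a further subsequence.\<close>

locale compact_lattice =
  fixes \<Lambda> :: "'v::ab_group_add set" and P :: "'v \<Rightarrow> 'v"
  assumes zero_in: "0 \<in> \<Lambda>"
    and diff_in: "x \<in> \<Lambda> \<Longrightarrow> y \<in> \<Lambda> \<Longrightarrow> x - y \<in> \<Lambda>"
    and P_in: "x \<in> \<Lambda> \<Longrightarrow> P x \<in> \<Lambda>"
    and P_add: "x \<in> \<Lambda> \<Longrightarrow> y \<in> \<Lambda> \<Longrightarrow> P (x + y) = P x + P y"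
    and P_eq_0: "x \<in> \<Lambda> \<Longrightarrow> P x = 0 \<Longrightarrow> x = 0"
    and separated: "x \<in> \<Lambda> \<Longrightarrow> (\<And>n. x \<in> (P ^^ n) ` \<Lambda>) \<Longrightarrow> x = 0"
    and seq_compact: "(\<And>n. u n \<in> \<Lambda>) \<Longrightarrow>
      \<exists>\<sigma> l. strict_mono (\<sigma> :: nat \<Rightarrow> nat) \<and> l \<in> \<Lambda> \<and> (\<forall>n. u (\<sigma> n) - l \<in> (P ^^ n) ` \<Lambda>)"
begin

definition endo :: "('v \<Rightarrow> 'v) \<Rightarrow> bool" where
  "endo t \<longleftrightarrow> (\<forall>x\<in>\<Lambda>. t x \<in> \<Lambda>) \<and> (\<forall>x\<in>\<Lambda>. \<forall>y\<in>\<Lambda>. t (x + y) = t x + t y) \<and>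
     (\<forall>x\<in>\<Lambda>. t (P x) = P (t x))"

definition pw :: "nat \<Rightarrow> 'v set \<Rightarrow> 'v set" where
  "pw n N = (P ^^ n) ` N"

text \<open>A \<open>p\<close>-adically closed subgroup is automatically a submodule over the \<open>p\<close>-adic integers, so no
  scalars are needed at this stage.\<close>

definition csub :: "'v set \<Rightarrow> bool" where
  "csub N \<longleftrightarrow> N \<subseteq> \<Lambda> \<and> 0 \<in> N \<and> (\<forall>x\<in>N. \<forall>y\<in>N. x - y \<in> N) \<and> (\<forall>x\<in>N. P x \<in> N) \<and>
     (\<forall>v\<in>\<Lambda>. (\<forall>n. v \<in> N + pw n \<Lambda>) \<longrightarrow> v \<in> N)"

text \<open>For a subgroup \<open>N\<close> this says that the quotient of \<open>\<Lambda>\<close>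
  by \<open>N\<close> has no \<open>p\<close>-torsion, so that powers of \<open>p\<close> may be
  cancelled modulo \<open>N\<close>.\<close>

definition pure :: "'v set \<Rightarrow> bool" where
  "pure N \<longleftrightarrow> (\<forall>x\<in>\<Lambda>. P x \<in> N \<longrightarrow> x \<in> N)"

lemma csubI:
  assumes "N \<subseteq> \<Lambda>" "0 \<in> N" "\<And>x y. x \<in> N \<Longrightarrow> y \<in> N \<Longrightarrow> x - y \<in> N" "\<And>x. x \<in> N \<Longrightarrow> P x \<in> N"
    and "\<And>v. v \<in> \<Lambda> \<Longrightarrow> (\<And>n. v \<in> N + pw n \<Lambda>) \<Longrightarrow> v \<in> N"
  shows "csub N"
  using assms unfolding csub_def by blast

lemma csubD:
  assumes "csub N"
  shows csub_le: "N \<subseteq> \<Lambda>" and csub_in: "x \<in> N \<Longrightarrow> x \<in> \<Lambda>" and csub_0: "0 \<in> N"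
    and csub_diff: "x \<in> N \<Longrightarrow> y \<in> N \<Longrightarrow> x - y \<in> N"
    and csub_P: "x \<in> N \<Longrightarrow> P x \<in> N"
    and csub_closed: "v \<in> \<Lambda> \<Longrightarrow> (\<And>n. v \<in> N + pw n \<Lambda>) \<Longrightarrow> v \<in> N"
  using assms unfolding csub_def by blast+

lemma csub_uminus: "csub N \<Longrightarrow> x \<in> N \<Longrightarrow> - x \<in> N"
  using csub_diff[of N 0 x] csub_0[of N] by simp

lemma csub_add: "csub N \<Longrightarrow> x \<in> N \<Longrightarrow> y \<in> N \<Longrightarrow> x + y \<in> N"
  using csub_diff[of N x "- y"] csub_uminus[of N y] by simp

lemma csub_sum: "csub N \<Longrightarrow> (\<And>i. i \<in> I \<Longrightarrow> f i \<in> N) \<Longrightarrow> sum f I \<in> N"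
  by (induction I rule: infinite_finite_induct) (auto simp: csub_0 csub_add)

lemma csub_Lambda: "csub \<Lambda>"
  using zero_in diff_in P_in by (intro csubI) auto

lemmas uminus_in = csub_uminus[OF csub_Lambda]
lemmas add_in = csub_add[OF csub_Lambda]
lemmas sum_in = csub_sum[OF csub_Lambda]

lemma endoD:
  assumes "endo t"
  shows endo_in: "x \<in> \<Lambda> \<Longrightarrow> t x \<in> \<Lambda>"
    and endo_add: "x \<in> \<Lambda> \<Longrightarrow> y \<in> \<Lambda> \<Longrightarrow> t (x + y) = t x + t y"
    and endo_P: "x \<in> \<Lambda> \<Longrightarrow> t (P x) = P (t x)"
  using assms unfolding endo_def by blast+

lemma endo_0: "endo t \<Longrightarrow> t 0 = 0"
  using endo_add[of t 0 0] zero_in by simp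

lemma endo_uminus: "endo t \<Longrightarrow> x \<in> \<Lambda> \<Longrightarrow> t (- x) = - t x"
  using endo_add[of t x "- x"] uminus_in endo_0[of t] by (metis add.right_inverse minus_unique)

lemma endo_diff: "endo t \<Longrightarrow> x \<in> \<Lambda> \<Longrightarrow> y \<in> \<Lambda> \<Longrightarrow> t (x - y) = t x - t y"
  using endo_add[of t x "- y"] uminus_in endo_uminus[of t y] by simp

lemma endo_sum: "endo t \<Longrightarrow> (\<And>i. i \<in> I \<Longrightarrow> f i \<in> \<Lambda>) \<Longrightarrow> t (sum f I) = (\<Sum>i\<in>I. t (f i))"
  by (induction I rule: infinite_finite_induct) (auto simp: endo_0 endo_add sum_in)

lemma endo_id: "endo id" "endo (\<lambda>x. x)" and endo_P': "endo P"
  using P_in P_add by (auto simp: endo_def)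

lemma endo_comp: "endo s \<Longrightarrow> endo t \<Longrightarrow> endo (s \<circ> t)"
  by (auto simp: endo_def)

lemma endo_pow: "endo t \<Longrightarrow> endo (t ^^ n)"
  by (induction n) (auto intro: endo_comp simp: endo_id)

lemma endo_Pow: "endo (P ^^ n)"
  by (rule endo_pow[OF endo_P'])

lemma endo_Pow_comm: "endo t \<Longrightarrow> x \<in> \<Lambda> \<Longrightarrow> t ((P ^^ n) x) = (P ^^ n) (t x)"
  by (induction n) (auto simp: endo_P endo_in[OF endo_Pow])

lemmas Pow_in = endo_in[OF endo_Pow]

lemma Pow_inj: "x \<in> \<Lambda> \<Longrightarrow> y \<in> \<Lambda> \<Longrightarrow> (P ^^ n) x = (P ^^ n) y \<Longrightarrow> x = y"
proof (induction n)
  case (Suc n)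
  have "P ((P ^^ n) x - (P ^^ n) y) = 0"
    using Suc.prems endo_diff[OF endo_P' Pow_in[of x n] Pow_in[of y n]] by simp
  then have "(P ^^ n) x - (P ^^ n) y = 0"
    using Suc.prems by (blast intro: P_eq_0[rotated] diff_in Pow_in)
  then show ?case using Suc.IH Suc.prems by simp
qed simp

lemma Pow_in_csub: "csub N \<Longrightarrow> x \<in> N \<Longrightarrow> (P ^^ n) x \<in> N"
  by (induction n) (auto simp: csub_P)

lemma pw_0 [simp]: "pw 0 N = N"
  by (simp add: pw_def)

lemma pw_pw: "pw m (pw n N) = pw (m + n) N"
  by (auto simp: pw_def funpow_add image_comp)

lemma pw_mono: "A \<subseteq> B \<Longrightarrow> pw n A \<subseteq> pw n B"
  by (auto simp: pw_def)

lemma pw_csub_le: "csub N \<Longrightarrow> pw n N \<subseteq> N"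
  by (auto simp: pw_def Pow_in_csub)

lemma pw_antimono: "csub N \<Longrightarrow> m \<le> n \<Longrightarrow> pw n N \<subseteq> pw m N"
  using pw_mono[OF pw_csub_le[of N "n - m"], of m] by (simp add: pw_pw)

lemma pw_in: "x \<in> pw n \<Lambda> \<Longrightarrow> x \<in> \<Lambda>"
  using pw_csub_le[OF csub_Lambda] by blast

lemma pw_plus: "A \<subseteq> \<Lambda> \<Longrightarrow> B \<subseteq> \<Lambda> \<Longrightarrow> pw n (A + B) = pw n A + pw n B"
proof (intro equalityI subsetI)
  fix x assume AB: "A \<subseteq> \<Lambda>" "B \<subseteq> \<Lambda>" and "x \<in> pw n (A + B)"
  then obtain a b where "a \<in> A" "b \<in> B" "x = (P ^^ n) (a + b)"
    by (auto simp: pw_def elim!: set_plus_elim)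
  then show "x \<in> pw n A + pw n B"
    using AB by (auto simp: pw_def endo_add[OF endo_Pow] subset_iff)
next
  fix x assume AB: "A \<subseteq> \<Lambda>" "B \<subseteq> \<Lambda>" and "x \<in> pw n A + pw n B"
  then obtain a b where "a \<in> A" "b \<in> B" "x = (P ^^ n) a + (P ^^ n) b"
    by (auto simp: pw_def elim!: set_plus_elim)
  then show "x \<in> pw n (A + B)"
    using AB unfolding pw_def
    by (intro image_eqI[where x = "a + b"]) (auto simp: endo_add[OF endo_Pow] subset_iff)
qed

lemma plus_le: "A \<subseteq> N \<Longrightarrow> B \<subseteq> N \<Longrightarrow> csub N \<Longrightarrow> A + B \<subseteq> N"
  by (auto elim!: set_plus_elim intro: csub_add)

lemma csub_plus_self: "csub N \<Longrightarrow> N + N = N"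
  by (meson csub_0 equalityI order_refl plus_le set_zero_plus2)

lemma le_plus_left: "0 \<in> B \<Longrightarrow> A \<subseteq> A + (B :: 'v set)"
  by (metis add.commute set_zero_plus2)

lemma le_plus_right: "0 \<in> A \<Longrightarrow> B \<subseteq> A + (B :: 'v set)"
  by (rule set_zero_plus2)

lemma zero_pw: "0 \<in> N \<Longrightarrow> 0 \<in> pw n N"
  unfolding pw_def by (metis endo_0[OF endo_Pow] imageI)

lemma pw_diff: "x \<in> pw n \<Lambda> \<Longrightarrow> y \<in> pw n \<Lambda> \<Longrightarrow> x - y \<in> pw n \<Lambda>"
proof -
  assume "x \<in> pw n \<Lambda>" "y \<in> pw n \<Lambda>"
  then obtain a b where "a \<in> \<Lambda>" "b \<in> \<Lambda>" "x = (P ^^ n) a" "y = (P ^^ n) b" by (auto simp: pw_def)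
  then show ?thesis unfolding pw_def
    by (intro image_eqI[where x = "a - b"]) (auto simp: endo_diff[OF endo_Pow] diff_in)
qed

lemma pw_uminus: "x \<in> pw n \<Lambda> \<Longrightarrow> - x \<in> pw n \<Lambda>"
  using pw_diff[of 0 n x] zero_pw[OF zero_in] by simp

lemma pw_add: "x \<in> pw n \<Lambda> \<Longrightarrow> y \<in> pw n \<Lambda> \<Longrightarrow> x + y \<in> pw n \<Lambda>"
  using pw_diff[of x n "- y"] pw_uminus[of y n] by simp

lemma pw_sum: "(\<And>i. i \<in> I \<Longrightarrow> f i \<in> pw n \<Lambda>) \<Longrightarrow> sum f I \<in> pw n \<Lambda>"
  by (induction I rule: infinite_finite_induct) (auto simp: zero_pw zero_in pw_add)

lemma endo_pw: "endo t \<Longrightarrow> x \<in> pw n \<Lambda> \<Longrightarrow> t x \<in> pw n \<Lambda>"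
  by (auto simp: pw_def endo_Pow_comm endo_in)

lemma mem_plusD: "v \<in> A + B \<Longrightarrow> \<exists>a\<in>A. \<exists>b\<in>B. v = a + b" for A B :: "'v set"
  by (auto simp: set_plus_def)

lemma mem_plus_iff: "v \<in> A + B \<longleftrightarrow> (\<exists>a\<in>A. v - a \<in> B)" for A B :: "'v set"
proof
  assume "\<exists>a\<in>A. v - a \<in> B"
  then obtain a where "a \<in> A" "v - a \<in> B" by blast
  then have "a + (v - a) \<in> A + B" by blast
  then show "v \<in> A + B" by simp
next
  assume "v \<in> A + B"
  then show "\<exists>a\<in>A. v - a \<in> B" by (metis add_diff_cancel_left' mem_plusD)
qed

section \<open>Consequences of compactness: closedness of sums and images\<close>

lemma csub_Inter:
  assumes "\<And>N. N \<in> F \<Longrightarrow> csub N" "F \<noteq> {}"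
  shows "csub (\<Inter>F)"
proof (rule csubI)
  show "\<Inter>F \<subseteq> \<Lambda>" using csub_le[OF assms(1)] assms(2) by blast
  fix v assume v: "v \<in> \<Lambda>" "\<And>n. v \<in> \<Inter>F + pw n \<Lambda>"
  have "v \<in> N" if "N \<in> F" for N
  proof (rule csub_closed[OF assms(1)[OF that] v(1)])
    have "\<Inter>F \<subseteq> N" using that by blast
    then show "v \<in> N + pw n \<Lambda>" for n using v(2)[of n] set_plus_mono2[of "\<Inter>F" N] by blast
  qed
  then show "v \<in> \<Inter>F" by blast
qed (auto intro: csub_0[OF assms(1)] csub_diff[OF assms(1)] csub_P[OF assms(1)])

text \<open>Subsequences are extracted one index at a time. A further subsequence
  \<open>\<tau>\<close> does not spoil the earlier rates because
  \<open>n \<le> \<tau> n\<close>.\<close>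

lemma cong_family:
  assumes "finite I" "\<And>n i. i \<in> I \<Longrightarrow> f n i \<in> \<Lambda>"
  shows "\<exists>\<sigma> l. strict_mono (\<sigma> :: nat \<Rightarrow> nat) \<and> (\<forall>i\<in>I. l i \<in> \<Lambda> \<and> (\<forall>n. f (\<sigma> n) i - l i \<in> pw n \<Lambda>))"
  using assms
proof (induction I)
  case empty
  show ?case by (rule exI[of _ id]) (auto simp: strict_mono_def)
next
  case (insert j I)
  then obtain \<sigma> l where \<sigma>: "strict_mono (\<sigma> :: nat \<Rightarrow> nat)"
    and l: "\<forall>i\<in>I. l i \<in> \<Lambda> \<and> (\<forall>n. f (\<sigma> n) i - l i \<in> pw n \<Lambda>)" by (metis insertCI)
  obtain \<tau> m where \<tau>: "strict_mono (\<tau> :: nat \<Rightarrow> nat)" "m \<in> \<Lambda>"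
    "\<forall>n. f (\<sigma> (\<tau> n)) j - m \<in> pw n \<Lambda>"
    using seq_compact[of "\<lambda>n. f (\<sigma> n) j"] insert.prems by (auto simp: pw_def)
  have "f (\<sigma> (\<tau> n)) i - l i \<in> pw n \<Lambda>" if "i \<in> I" for i n
    using l that pw_antimono[OF csub_Lambda strict_mono_imp_increasing[OF \<tau>(1), of n]] by blast
  then show ?case
    using \<sigma> \<tau> l insert.hyps
    by (intro exI[of _ "\<sigma> \<circ> \<tau>"] exI[of _ "l(j := m)"]) (auto simp: strict_mono_def)
qed

text \<open>The form in which compactness is used for submodules: approximate solutions modulo every
  \<open>p^n\<close>, with the unknowns in decreasing closed submodules, have a limit that is an
  exact solution in all of them. Constant families give closedness of sums and images; decreasing
  families let intersections pass through sums and through \<open>aug\<close>.\<close>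

lemma sum_closed:
  assumes "finite I" "\<And>i. i \<in> I \<Longrightarrow> endo (t i)" "\<And>i n. i \<in> I \<Longrightarrow> csub (C i n)"
    and dec: "\<And>i n. i \<in> I \<Longrightarrow> C i (Suc n) \<subseteq> C i n"
    and v: "v \<in> \<Lambda>" "\<And>n. \<exists>f. (\<forall>i\<in>I. f i \<in> C i n) \<and> v - (\<Sum>i\<in>I. t i (f i)) \<in> pw n \<Lambda>"
  shows "\<exists>f. (\<forall>i\<in>I. \<forall>n. f i \<in> C i n) \<and> v = (\<Sum>i\<in>I. t i (f i))"
proof -
  obtain f where f: "\<And>n i. i \<in> I \<Longrightarrow> f n i \<in> C i n" "\<And>n. v - (\<Sum>i\<in>I. t i (f n i)) \<in> pw n \<Lambda>"
    using v(2) by metis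
  have f_in: "f n i \<in> \<Lambda>" if "i \<in> I" for n i
    using f(1) that assms(3) csub_in by blast
  then obtain \<sigma> l where \<sigma>: "strict_mono (\<sigma> :: nat \<Rightarrow> nat)"
    and l: "\<And>i. i \<in> I \<Longrightarrow> l i \<in> \<Lambda>" "\<And>i n. i \<in> I \<Longrightarrow> f (\<sigma> n) i - l i \<in> pw n \<Lambda>"
    using cong_family[OF assms(1), of f] by blast
  have anti: "C i m \<subseteq> C i n" if "i \<in> I" "n \<le> m" for i m n
    using lift_Suc_antimono_le[of "C i"] dec that by blast
  have "l i \<in> C i n" if i: "i \<in> I" for i n
  proof (rule csub_closed[OF assms(3)[OF i] l(1)[OF i]])
    fix k
    \<comment> \<open>Beyond \<open>n\<close> the approximants lie in \<open>C i n\<close>, and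
      beyond \<open>k\<close> they agree with the limit modulo \<open>p^k\<close>.\<close>
    define m where "m = max n k"
    have "f (\<sigma> m) i \<in> C i n"
      using f(1)[OF i] anti[OF i, of n "\<sigma> m"] strict_mono_imp_increasing[OF \<sigma>, of m]
      unfolding m_def by auto
    moreover have "l i - f (\<sigma> m) i \<in> pw k \<Lambda>"
      using pw_uminus[OF l(2)[OF i, of m]] pw_antimono[OF csub_Lambda, of k m] unfolding m_def by auto
    ultimately show "l i \<in> C i n + pw k \<Lambda>" unfolding mem_plus_iff by blast
  qed
  moreover have "v - (\<Sum>i\<in>I. t i (l i)) \<in> pw n \<Lambda>" for n
  proof -
    have "v - (\<Sum>i\<in>I. t i (l i)) = (v - (\<Sum>i\<in>I. t i (f (\<sigma> n) i))) + (\<Sum>i\<in>I. t i (f (\<sigma> n) i - l i))"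
      using assms(2) l(1) f_in by (simp add: endo_diff sum_subtractf)
    moreover have "v - (\<Sum>i\<in>I. t i (f (\<sigma> n) i)) \<in> pw n \<Lambda>"
      by (rule subsetD[OF pw_antimono[OF csub_Lambda strict_mono_imp_increasing[OF \<sigma>, of n]] f(2)])
    moreover have "(\<Sum>i\<in>I. t i (f (\<sigma> n) i - l i)) \<in> pw n \<Lambda>"
      using endo_pw[OF assms(2) l(2)] by (intro pw_sum) auto
    ultimately show ?thesis by (metis pw_add)
  qed
  then have "v - (\<Sum>i\<in>I. t i (l i)) = 0"
    using v(1) l(1) assms(2)
    by (intro separated) (auto simp: pw_def endo_in intro!: diff_in sum_in)
  ultimately show ?thesis by (intro exI[of _ l]) auto
qed

lemma csub_plus:
  assumes M: "csub M" and N: "csub N"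
  shows "csub (M + N)"
proof (rule csubI)
  show "M + N \<subseteq> \<Lambda>" using plus_le[OF csub_le[OF M] csub_le[OF N] csub_Lambda] .
  show "0 \<in> M + N" using csub_0[OF M] csub_0[OF N] by (metis add.right_neutral set_plus_intro)
  fix v assume v: "v \<in> \<Lambda>" "\<And>n. v \<in> M + N + pw n \<Lambda>"
  \<comment> \<open>The two summands are indexed by \<open>bool\<close>, which makes the claim an
    instance of \<open>sum_closed\<close>.\<close>
  have "\<exists>f. (\<forall>i\<in>UNIV. \<forall>n::nat. f i \<in> (if i then M else N)) \<and> v = (\<Sum>i\<in>UNIV. id (f i))"
  proof (rule sum_closed[OF finite])
    fix n
    from v(2)[of n] obtain a b where "a \<in> M" "b \<in> N" "v - (a + b) \<in> pw n \<Lambda>"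
      unfolding mem_plus_iff by (metis mem_plusD mem_plus_iff)
    then show "\<exists>f. (\<forall>i\<in>UNIV. f i \<in> (if i then M else N)) \<and> v - (\<Sum>i\<in>UNIV. id (f i)) \<in> pw n \<Lambda>"
      by (intro exI[of _ "\<lambda>i. if i then a else b"]) (simp add: UNIV_bool add.commute)
  qed (use M N v endo_id in auto)
  then obtain f where f: "\<forall>i\<in>UNIV. \<forall>n::nat. f i \<in> (if i then M else N)"
      "v = (\<Sum>i\<in>UNIV. id (f i))" by blast
  then have "f True \<in> M" "f False \<in> N" by (auto dest: spec[of _ True] spec[of _ False])
  then have "f True + f False \<in> M + N" by blast
  then show "v \<in> M + N" using f(2) by (simp add: UNIV_bool add.commute)
next
  fix x y assume "x \<in> M + N" "y \<in> M + N"
  then obtain a b c d where "a \<in> M" "b \<in> N" "c \<in> M" "d \<in> N" "x = a + b" "y = c + d"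
    by (auto dest!: mem_plusD)
  then have "a - c \<in> M" "b - d \<in> N" "x - y = (a - c) + (b - d)"
    using csub_diff M N by auto
  then show "x - y \<in> M + N" by auto
next
  fix x assume "x \<in> M + N"
  then obtain a b where "a \<in> M" "b \<in> N" "x = a + b" by (auto dest!: mem_plusD)
  then show "P x \<in> M + N"
    using csub_P[OF M] csub_P[OF N] csub_in[OF M] csub_in[OF N] by (auto simp: P_add)
qed

text \<open>The decomposition of \<open>v\<close> may change with \<open>n\<close>; compactness
  selects a single one that serves all \<open>n\<close>.\<close>

lemma INT_plus:
  assumes W: "csub W" and C: "\<And>n. csub (C n)" "\<And>n. C (Suc n) \<subseteq> C n"
    and v: "\<And>n. v \<in> W + C n"
  shows "v \<in> W + (\<Inter>n. C n)"
proof -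
  have "\<exists>f. (\<forall>i\<in>UNIV. \<forall>n::nat. f i \<in> (if i then W else C n)) \<and> v = (\<Sum>i\<in>UNIV. id (f i))"
  proof (rule sum_closed[OF finite])
    fix n
    from v[of n] obtain a b where "a \<in> W" "b \<in> C n" "v = a + b" by (auto dest!: mem_plusD)
    then show "\<exists>f. (\<forall>i\<in>UNIV. f i \<in> (if i then W else C n)) \<and> v - (\<Sum>i\<in>UNIV. id (f i)) \<in> pw n \<Lambda>"
      by (intro exI[of _ "\<lambda>i. if i then a else b"]) (simp add: UNIV_bool add.commute zero_pw zero_in)
    show "v \<in> \<Lambda>" using v[of 0] csub_plus[OF W C(1)] csub_in by blast
  qed (use W C endo_id in auto)
  then obtain f where f: "\<forall>i\<in>UNIV. \<forall>n::nat. f i \<in> (if i then W else C n)"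
      "v = (\<Sum>i\<in>UNIV. id (f i))" by blast
  then have "f True \<in> W" "f False \<in> (\<Inter>n. C n)" by (auto split: if_splits)
  then have "f True + f False \<in> W + (\<Inter>n. C n)" by blast
  then show ?thesis using f(2) by (simp add: UNIV_bool add.commute)
qed

lemma csub_pw: "csub N \<Longrightarrow> csub (pw k N)"
proof (rule csubI)
  assume N: "csub N"
  show "pw k N \<subseteq> \<Lambda>" "0 \<in> pw k N" 
    using pw_csub_le[OF N] csub_le[OF N] zero_pw[OF csub_0[OF N]] by auto
  { fix x y assume "x \<in> pw k N" "y \<in> pw k N"
    then show "x - y \<in> pw k N" using N csub_diff[OF N] csub_in[OF N] unfolding pw_def
      by (smt (verit, ccfv_SIG) endo_Pow endo_diff imageE imageI) }
  { fix x assume "x \<in> pw k N"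
    then show "P x \<in> pw k N" using csub_P[OF N] unfolding pw_def
      by (metis (no_types, opaque_lifting) funpow_swap1 image_iff) }
  fix v assume v: "v \<in> \<Lambda>" "\<And>n. v \<in> pw k N + pw n \<Lambda>"
  have "\<exists>f. (\<forall>i\<in>{()}. \<forall>n::nat. f i \<in> N) \<and> v = (\<Sum>i\<in>{()}. (P ^^ k) (f i))"
  proof (rule sum_closed)
    fix n
    from v(2)[of n] obtain a where "a \<in> N" "v - (P ^^ k) a \<in> pw n \<Lambda>"
      unfolding mem_plus_iff by (auto simp: pw_def)
    then show "\<exists>f. (\<forall>i\<in>{()}. f i \<in> N) \<and> v - (\<Sum>i\<in>{()}. (P ^^ k) (f i)) \<in> pw n \<Lambda>"
      by (intro exI[of _ "\<lambda>_. a"]) auto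
  qed (use N v endo_Pow in auto)
  then show "v \<in> pw k N" by (auto simp: pw_def)
qed

section \<open>Pure submodules, the modular law and Nakayama's lemma\<close>

lemma pure_Pow: "pure Y \<Longrightarrow> x \<in> \<Lambda> \<Longrightarrow> (P ^^ n) x \<in> Y \<Longrightarrow> x \<in> Y"
proof (induction n)
  case (Suc n)
  then have "P ((P ^^ n) x) \<in> Y" "(P ^^ n) x \<in> \<Lambda>" by (auto simp: Pow_in)
  then show ?case using Suc unfolding pure_def by blast
qed simp

lemma pure_pw: "pure Y \<Longrightarrow> x \<in> pw n \<Lambda> \<Longrightarrow> x \<in> Y \<Longrightarrow> x \<in> pw n Y"
  by (auto simp: pw_def dest: pure_Pow)

lemma pure_Lambda: "pure \<Lambda>"
  by (simp add: pure_def)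

lemma csub_zero: "csub {0}"
proof (rule csubI)
  fix v assume v: "v \<in> \<Lambda>" "\<And>n. v \<in> {0} + pw n \<Lambda>"
  then show "v \<in> {0}" using separated[of v] by (auto simp: mem_plus_iff pw_def)
qed (auto simp: zero_in endo_0[OF endo_P'])

lemma pure_zero: "pure {0}"
  by (auto simp: pure_def P_eq_0)

text \<open>A modular law: if \<open>x - w\<close> lies in \<open>Y\<close> and is divisible by
  \<open>p^n\<close> in \<open>\<Lambda>\<close>, purity makes it divisible in
  \<open>Y\<close>.\<close>

lemma pure_modular:
  assumes "pure Y" "csub Y" "W \<subseteq> Y" "x \<in> Y" "x \<in> W + pw n \<Lambda>"
  shows "x \<in> W + pw n Y"
proof -
  obtain w where w: "w \<in> W" "x - w \<in> pw n \<Lambda>" using assms(5) by (auto simp: mem_plus_iff)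
  then have "x - w \<in> pw n Y" using pure_pw[OF assms(1)] csub_diff[OF assms(2,4)] assms(3) by blast
  then show ?thesis using w by (auto simp: mem_plus_iff)
qed

text \<open>Multiplication by \<open>p\<close> is injective modulo the pure submodule
  \<open>W\<close>.\<close>

lemma pure_cancel:
  assumes "pure W" "csub W" "csub Y" "x \<in> \<Lambda>" "(P ^^ a) x \<in> W + pw (a + b) Y"
  shows "x \<in> W + pw b Y"
proof -
  obtain y where y: "y \<in> Y" "(P ^^ a) x - (P ^^ (a + b)) y \<in> W"
    using assms(5) unfolding mem_plus_iff add.commute[of W] by (auto simp: pw_def)
  have "(P ^^ a) (x - (P ^^ b) y) = (P ^^ a) x - (P ^^ (a + b)) y"
    using assms(4) y(1) csub_in[OF assms(3)]
    by (simp add: endo_diff[OF endo_Pow] Pow_in funpow_add)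
  then have "x - (P ^^ b) y \<in> W"
    using pure_Pow[OF assms(1), of "x - (P ^^ b) y" a] y assms(4) csub_in[OF assms(3)]
    by (simp add: diff_in Pow_in)
  then show ?thesis unfolding mem_plus_iff add.commute[of W] using y(1) by (auto simp: pw_def)
qed

text \<open>Iteration gives \<open>M \<subseteq> W + pw n M\<close> for every \<open>n\<close>, and
  \<open>W\<close> is closed. Closedness plays the part that finite generation has in the usual
  version.\<close>

lemma nakayama:
  assumes W: "csub W" and M: "csub M" and le: "M \<subseteq> W + pw 1 M"
  shows "M \<subseteq> W"
proof -
  have step: "M \<subseteq> W + pw n M" for n
  proof (induction n)
    case (Suc n)
    have "pw n M \<subseteq> pw n W + pw (n + 1) M"
      using pw_mono[OF le, of n] pw_plus[OF csub_le[OF W], of "pw 1 M" n] csub_le[OF csub_pw[OF M]]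
      by (simp add: pw_pw)
    then have "W + pw n M \<subseteq> W + (W + pw (Suc n) M)"
      using pw_csub_le[OF W, of n] by (intro set_plus_mono2) (auto dest!: mem_plusD)
    then show ?case using Suc by (simp add: add.assoc[symmetric] csub_plus_self[OF W])
  qed (use le_plus_right csub_0[OF W] in auto)
  show ?thesis
  proof
    fix x assume x: "x \<in> M"
    then have "x \<in> W + pw n \<Lambda>" for n
      using step[of n] set_plus_mono2[OF order_refl[of W] pw_mono[OF csub_le[OF M], of n]] by blast
    then show "x \<in> W" using csub_closed[OF W] csub_in[OF M x] by blast
  qed
qed

lemma nakayama_pure:
  assumes W: "csub W" and M: "csub M" "pure M" and "W \<subseteq> M" "M \<subseteq> W + pw 1 \<Lambda>"
  shows "M = W"
proof -
  have "M \<subseteq> W + pw 1 M" using pure_modular[OF M(2,1) assms(4)] assms(5) by blast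
  then show ?thesis using nakayama[OF W M(1)] assms(4) by blast
qed

section \<open>Residue classes modulo \<open>p^n\<close> and a substitute for the rank\<close>

definition cs :: "nat \<Rightarrow> 'v \<Rightarrow> 'v set" where
  "cs n v = {u \<in> \<Lambda>. u - v \<in> pw n \<Lambda>}"

lemma cs_eq_iff: "u \<in> \<Lambda> \<Longrightarrow> v \<in> \<Lambda> \<Longrightarrow> cs n u = cs n v \<longleftrightarrow> u - v \<in> pw n \<Lambda>"
proof
  assume "u \<in> \<Lambda>" "v \<in> \<Lambda>" "cs n u = cs n v"
  moreover have "u \<in> cs n u" using \<open>u \<in> \<Lambda>\<close> by (auto simp: cs_def zero_pw zero_in)
  ultimately show "u - v \<in> pw n \<Lambda>" by (auto simp: cs_def)
next
  assume a: "u \<in> \<Lambda>" "v \<in> \<Lambda>" "u - v \<in> pw n \<Lambda>"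
  have "x - u \<in> pw n \<Lambda> \<longleftrightarrow> x - v \<in> pw n \<Lambda>" for x
    using pw_diff[of "x - v" n "u - v"] pw_add[of "x - u" n "u - v"] a(3) by auto
  then show "cs n u = cs n v" unfolding cs_def by blast
qed

text \<open>Infinitely many classes modulo \<open>p^n\<close> would contain a convergent sequence of
  representatives, but from index \<open>n\<close> on its terms share one class.\<close>

lemma finite_cs: "finite (cs n ` \<Lambda>)"
proof (rule ccontr)
  assume "infinite (cs n ` \<Lambda>)"
  from iffD1[OF infinite_iff_countable_subset this]
  obtain q :: "nat \<Rightarrow> 'v set" where q: "inj q" "range q \<subseteq> cs n ` \<Lambda>" by auto
  have "\<forall>m. \<exists>v. v \<in> \<Lambda> \<and> q m = cs n v" using q(2) by blast
  then obtain u where u: "\<And>m. u m \<in> \<Lambda>" "\<And>m. q m = cs n (u m)" by metis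
  obtain \<sigma> l where \<sigma>: "strict_mono (\<sigma> :: nat \<Rightarrow> nat)" "l \<in> \<Lambda>" "\<And>m. u (\<sigma> m) - l \<in> pw m \<Lambda>"
    using seq_compact[of u, OF u(1)] unfolding pw_def by blast
  have "q (\<sigma> m) = cs n l" if "m \<ge> n" for m
    using subsetD[OF pw_antimono[OF csub_Lambda that] \<sigma>(3)] cs_eq_iff[OF u(1) \<sigma>(2)] u(2) by simp
  then have "q (\<sigma> n) = q (\<sigma> (Suc n))" by simp
  then show False using q(1) \<sigma>(1) by (simp add: inj_eq strict_mono_eq)
qed

lemma finite_cs_sub: "N \<subseteq> \<Lambda> \<Longrightarrow> finite (cs n ` N)"
  using finite_subset[OF image_mono finite_cs] .

text \<open>A substitute for the rank: \<open>p\<close> to the rank if \<open>W\<close> is pure, and strictly monotone on pure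
  submodules by Nakayama's lemma.\<close>

definition rk :: "'v set \<Rightarrow> nat" where
  "rk W = card (cs 1 ` W)"

lemma rk_less:
  assumes "csub W" "csub M" "pure M" "W \<subset> M"
  shows "rk W < rk M"
  unfolding rk_def
proof (rule psubset_card_mono)
  show "finite (cs 1 ` M)" using finite_cs_sub csub_le[OF assms(2)] .
  have "\<not> M \<subseteq> W + pw 1 \<Lambda>" using nakayama_pure assms by blast
  then obtain m where m: "m \<in> M" "m \<notin> W + pw 1 \<Lambda>" by blast
  then have "cs 1 m \<notin> cs 1 ` W"
    using cs_eq_iff csub_in[OF assms(1)] csub_in[OF assms(2)] by (auto simp: mem_plus_iff)
  then show "cs 1 ` W \<subset> cs 1 ` M" using m assms(4) by blast
qed

lemma rk_le: "csub W \<Longrightarrow> rk W \<le> rk \<Lambda>"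
  unfolding rk_def by (intro card_mono finite_cs image_mono csub_le)

text \<open>A submodule between \<open>pw k Y\<close> and \<open>Y\<close> is recovered from its
  residues modulo \<open>p^k\<close>, because elements of \<open>Y\<close> congruent modulo
  \<open>pw k \<Lambda>\<close> already differ by an element of \<open>pw k Y\<close>.\<close>

lemma finite_csubs:
  assumes "pure Y" "csub Y"
  shows "finite {N. csub N \<and> pw k Y \<subseteq> N \<and> N \<subseteq> Y}"
proof (rule inj_on_finite[of "\<lambda>N. cs k ` N" _ "Pow (cs k ` \<Lambda>)"])
  have "M \<subseteq> N" if "csub M" "M \<subseteq> Y" "csub N" "pw k Y \<subseteq> N" "N \<subseteq> Y" "cs k ` M = cs k ` N" for M N
  proof
    fix m assume m: "m \<in> M"
    have "cs k m \<in> cs k ` N" using m that(6) by blast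
    then obtain n where n: "n \<in> N" "cs k m = cs k n" by blast
    then have "m - n \<in> pw k Y"
      using m that cs_eq_iff[of m n k] csub_in[OF that(1)] csub_in[OF that(3)]
      by (auto intro!: pure_pw[OF assms(1)] csub_diff[OF assms(2)])
    then show "m \<in> N" using n(1) that(3,4) csub_add[of N n "m - n"] by auto
  qed
  then show "inj_on (\<lambda>N. cs k ` N) {N. csub N \<and> pw k Y \<subseteq> N \<and> N \<subseteq> Y}"
    by (intro inj_onI) (simp add: subset_antisym)
qed (use csub_le finite_cs in auto)

text \<open>An open subgroup is closed: containing \<open>pw k Y\<close>, it absorbs the error of an
  approximation modulo \<open>p^k\<close>.\<close>

lemma csub_open:
  assumes Y: "csub Y" "pure Y" and N: "pw k Y \<subseteq> N" "N \<subseteq> Y"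
    "\<And>x y. x \<in> N \<Longrightarrow> y \<in> N \<Longrightarrow> x - y \<in> N" "\<And>x. x \<in> N \<Longrightarrow> P x \<in> N"
  shows "csub N"
proof (rule csubI)
  show "N \<subseteq> \<Lambda>" "0 \<in> N" using N zero_pw[OF csub_0[OF Y(1)], of k] csub_le[OF Y(1)] by auto
  fix v assume v: "v \<in> \<Lambda>" "\<And>n. v \<in> N + pw n \<Lambda>"
  have "v \<in> Y"
    using v set_plus_mono2[OF N(2) order_refl] by (intro csub_closed[OF Y(1)]) blast+
  then have "v \<in> N + pw k Y" using pure_modular[OF Y(2,1) N(2)] v(2) by blast
  then obtain a b where "a \<in> N" "b \<in> N" "v = a + b" using N(1) by (auto dest!: mem_plusD)
  then show "v \<in> N" using N(3)[of a "0 - b"] N(3)[of 0 b] \<open>0 \<in> N\<close> by simp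
qed (use N in auto)

lemma csub_preimage:
  assumes "csub N" "csub Y"
  shows "csub {x \<in> Y. (P ^^ n) x \<in> N}"
proof (rule csubI)
  fix v assume v: "v \<in> \<Lambda>" "\<And>m. v \<in> {x \<in> Y. (P ^^ n) x \<in> N} + pw m \<Lambda>"
  have "v \<in> Y"
    using v set_plus_mono2[of "{x \<in> Y. (P ^^ n) x \<in> N}" Y, OF _ order_refl]
    by (intro csub_closed[OF assms(2)]) blast+
  moreover have "(P ^^ n) v \<in> N"
  proof (rule csub_closed[OF assms(1)])
    fix m
    obtain x where x: "x \<in> Y" "(P ^^ n) x \<in> N" "v - x \<in> pw m \<Lambda>"
      using v(2)[of m] by (auto simp: mem_plus_iff)
    then have "(P ^^ n) v - (P ^^ n) x \<in> pw m \<Lambda>"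
      using endo_pw[OF endo_Pow, of "v - x" m n] v(1) csub_in[OF assms(2)]
      by (simp add: endo_diff[OF endo_Pow])
    then show "(P ^^ n) v \<in> N + pw m \<Lambda>" using x by (auto simp: mem_plus_iff)
  qed (simp add: v(1) Pow_in)
  ultimately show "v \<in> {x \<in> Y. (P ^^ n) x \<in> N}" by blast
next
  fix x y assume "x \<in> {x \<in> Y. (P ^^ n) x \<in> N}" "y \<in> {x \<in> Y. (P ^^ n) x \<in> N}"
  then show "x - y \<in> {x \<in> Y. (P ^^ n) x \<in> N}"
    using assms csub_diff csub_in by (auto simp: endo_diff[OF endo_Pow])
next
  fix x assume "x \<in> {x \<in> Y. (P ^^ n) x \<in> N}"
  then show "P x \<in> {x \<in> Y. (P ^^ n) x \<in> N}"
    using assms csub_P by (auto simp: funpow_swap1[symmetric])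
qed (use assms csub_0 csub_le in \<open>auto simp: endo_0[OF endo_Pow]\<close>)

section \<open>The pure closure of a closed submodule\<close>

definition pure_closure :: "'v set \<Rightarrow> 'v set" where
  "pure_closure M = {x \<in> \<Lambda>. \<exists>n. (P ^^ n) x \<in> M}"

text \<open>The torsion of \<open>\<Lambda>/M\<close> has bounded exponent. The kernels
  \<open>Q n\<close> of \<open>p^n\<close> modulo \<open>M\<close> increase, so their finite sets of
  residues modulo \<open>p\<close> become stationary, and successive approximation lifts this to the
  kernels themselves.\<close>

lemma pure_closure:
  assumes M: "csub M"
  shows "\<exists>n. pure_closure M = {x \<in> \<Lambda>. (P ^^ n) x \<in> M}"
proof -
  define Q where "Q n = {x \<in> \<Lambda>. (P ^^ n) x \<in> M}" for n
  have Q: "csub (Q n)" for n using csub_preimage[OF M csub_Lambda] unfolding Q_def .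
  have mono: "Q m \<subseteq> Q n" if "m \<le> n" for m n
  proof
    fix x assume "x \<in> Q m"
    then have "(P ^^ (n - m)) ((P ^^ m) x) \<in> M" "x \<in> \<Lambda>"
      by (auto simp: Q_def Pow_in_csub[OF M])
    then show "x \<in> Q n" using that funpow_add[of "n - m" m P] by (simp add: Q_def)
  qed
  have "\<exists>n. \<forall>m. cs 1 ` Q m \<subseteq> cs 1 ` Q n"
  proof -
    obtain n where "\<forall>m. card (cs 1 ` Q m) \<le> card (cs 1 ` Q n)"
      using ex_has_greatest_nat[of "\<lambda>_. True" 0 "\<lambda>m. card (cs 1 ` Q m)" "Suc (rk \<Lambda>)"]
        rk_le[OF Q] unfolding rk_def by (metis le_imp_less_Suc)
    then have "cs 1 ` Q m \<subseteq> cs 1 ` Q n" for m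
    proof -
      have "cs 1 ` Q n = cs 1 ` Q (max m n)"
        using \<open>\<forall>m. card (cs 1 ` Q m) \<le> card (cs 1 ` Q n)\<close>
        by (intro card_seteq finite_cs_sub csub_le[OF Q] image_mono mono) auto
      then show ?thesis using image_mono[OF mono[of m "max m n"], of "cs 1"] by auto
    qed
    then show ?thesis by blast
  qed
  then obtain n where n: "\<And>m. cs 1 ` Q m \<subseteq> cs 1 ` Q n" by metis
  \<comment> \<open>The claim is made for all \<open>m\<close> at once: \<open>x - y\<close> lies in
    the kernel \<open>Q (max m n)\<close>, but its quotient by \<open>p\<close> is only known to lie
    in the next one, where the induction hypothesis is then applied.\<close>
  have step: "\<forall>m. Q m \<subseteq> Q n + pw k \<Lambda>" for k
  proof (induction k)
    case (Suc k)
    show ?case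
    proof (intro allI subsetI)
      fix m x assume x: "x \<in> Q m"
      then have "cs 1 x \<in> cs 1 ` Q n" using n[of m] by (meson imageI subsetD)
      then obtain y where y: "y \<in> Q n" "cs 1 x = cs 1 y" by (meson imageE)
      then have "x - y \<in> pw 1 \<Lambda>"
        using cs_eq_iff[OF csub_in[OF Q x] csub_in[OF Q y(1)], of 1] by simp
      note y = y(1) this
      from y(2) obtain z where z: "z \<in> \<Lambda>" "x - y = P z" by (auto simp: pw_def)
      have "x - y \<in> Q (max m n)"
        using x y mono[of m "max m n"] mono[of n "max m n"] by (intro csub_diff[OF Q]) auto
      then have "z \<in> Q (Suc (max m n))" using z by (auto simp: Q_def funpow_swap1)
      then have "z \<in> Q n + pw k \<Lambda>" using Suc by (meson subsetD)
      then obtain a where a: "a \<in> Q n" "z - a \<in> pw k \<Lambda>" by (auto simp: mem_plus_iff)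
      have "x - (y + P a) = P (z - a)"
        using z a csub_in[OF Q] by (simp add: endo_diff[OF endo_P'] algebra_simps)
      moreover have "P (z - a) \<in> pw (Suc k) \<Lambda>" using a(2) by (auto simp: pw_def)
      moreover have "y + P a \<in> Q n" using y a csub_add[OF Q] csub_P[OF Q] by blast
      ultimately show "x \<in> Q n + pw (Suc k) \<Lambda>" unfolding mem_plus_iff by metis
    qed
  next
    case 0
    have "\<Lambda> \<subseteq> Q n + \<Lambda>" by (rule le_plus_right[OF csub_0[OF Q]])
    then show ?case using csub_le[OF Q] by (simp add: order_trans[OF csub_le[OF Q]])
  qed
  have "Q m \<subseteq> Q n" for m
    using subsetD[OF step[rule_format]] by (intro subsetI csub_closed[OF Q[of n]] csub_in[OF Q[of m]])
  then have "pure_closure M = Q n" unfolding pure_closure_def Q_def by blast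
  then show ?thesis unfolding Q_def by blast
qed

lemma csub_pure_closure: "csub M \<Longrightarrow> csub (pure_closure M)"
  using pure_closure[of M] csub_preimage[OF _ csub_Lambda, of M] by auto

lemma pure_pure_closure: "pure (pure_closure M)"
  unfolding pure_def pure_closure_def by (auto simp: funpow_swap1 intro: exI[of _ "Suc _"])

lemma le_pure_closure: "csub M \<Longrightarrow> M \<subseteq> pure_closure M"
  using csub_in by (auto simp: pure_closure_def intro: exI[of _ 0])

lemma pw_pure_closure: "csub M \<Longrightarrow> \<exists>n. pw n (pure_closure M) \<subseteq> M"
  using pure_closure[of M] by (auto simp: pw_def)

end

section \<open>The augmentation operator\<close>

locale lattice_ops = compact_lattice +
  fixes \<Theta> :: "('a \<Rightarrow> 'a) set"
  assumes finite_ops: "finite \<Theta>" and P_op: "P \<in> \<Theta>" and endo_op: "t \<in> \<Theta> \<Longrightarrow> endo t"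
begin

definition aug :: "'a set \<Rightarrow> 'a set" where
  "aug N = {(\<Sum>t\<in>\<Theta>. t (f t)) | f. \<forall>t\<in>\<Theta>. f t \<in> N}"

abbreviation augp :: "nat \<Rightarrow> 'a set \<Rightarrow> 'a set" where
  "augp r N \<equiv> (aug ^^ r) N"

text \<open>For the operators attached to the generators of \<open>G\<close> below, these are the
  closed \<open>G\<close>-submodules.\<close>

definition stable :: "'a set \<Rightarrow> bool" where
  "stable N \<longleftrightarrow> csub N \<and> (\<forall>t\<in>\<Theta>. \<forall>x\<in>N. t x \<in> N)"

lemma stable_csub: "stable N \<Longrightarrow> csub N"
  by (simp add: stable_def)

lemma stable_op: "stable N \<Longrightarrow> t \<in> \<Theta> \<Longrightarrow> x \<in> N \<Longrightarrow> t x \<in> N"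
  by (simp add: stable_def)

lemma augI: "(\<And>t. t \<in> \<Theta> \<Longrightarrow> f t \<in> N) \<Longrightarrow> (\<Sum>t\<in>\<Theta>. t (f t)) \<in> aug N"
  unfolding aug_def by blast

lemma op_mem_aug:
  assumes "0 \<in> N" "t \<in> \<Theta>" "x \<in> N"
  shows "t x \<in> aug N"
proof -
  have "(\<Sum>s\<in>\<Theta>. s (if s = t then x else 0)) = (\<Sum>s\<in>\<Theta>. if s = t then t x else 0)"
    using endo_0[OF endo_op] by (intro sum.cong) auto
  then have "(\<Sum>s\<in>\<Theta>. s (if s = t then x else 0)) = t x"
    using assms finite_ops by simp
  then show ?thesis using augI[of "\<lambda>s. if s = t then x else 0" N] assms by auto
qed

lemma aug_mono: "A \<subseteq> B \<Longrightarrow> aug A \<subseteq> aug B"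
  unfolding aug_def by blast

lemma augp_mono: "A \<subseteq> B \<Longrightarrow> augp r A \<subseteq> augp r B"
  by (induction r) (auto dest: aug_mono)

lemma aug_le: 
  assumes "N \<subseteq> \<Lambda>"
  shows "aug N \<subseteq> \<Lambda>"
proof
  fix v assume "v \<in> aug N"
  then obtain f where f: "\<And>t. t \<in> \<Theta> \<Longrightarrow> f t \<in> N" "v = (\<Sum>t\<in>\<Theta>. t (f t))" unfolding aug_def by blast
  have "t (f t) \<in> \<Lambda>" if "t \<in> \<Theta>" for t
    using endo_in[OF endo_op[OF that]] f(1)[OF that] assms by blast
  then show "v \<in> \<Lambda>" using f(2) by (simp add: sum_in)
qed

text \<open>Compactness picks one family \<open>f\<close> that works for all \<open>C n\<close>. The
  constant sequence gives closedness of \<open>aug N\<close>.\<close>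

lemma aug_INT:
  assumes C: "\<And>n. csub (C n)" "\<And>n. C (Suc n) \<subseteq> C n"
    and v: "v \<in> \<Lambda>" "\<And>n. v \<in> aug (C n) + pw n \<Lambda>"
  shows "v \<in> aug (\<Inter>n. C n)"
proof -
  have "\<exists>f. (\<forall>t\<in>\<Theta>. \<forall>n. f t \<in> C n) \<and> v = (\<Sum>t\<in>\<Theta>. t (f t))"
  proof (rule sum_closed[OF finite_ops])
    fix n
    obtain a where a: "a \<in> aug (C n)" "v - a \<in> pw n \<Lambda>" using v(2)[of n] by (auto simp: mem_plus_iff)
    then obtain f where "\<And>t. t \<in> \<Theta> \<Longrightarrow> f t \<in> C n" "a = (\<Sum>t\<in>\<Theta>. t (f t))" unfolding aug_def by blast
    then show "\<exists>f. (\<forall>t\<in>\<Theta>. f t \<in> C n) \<and> v - (\<Sum>t\<in>\<Theta>. t (f t)) \<in> pw n \<Lambda>" using a by blast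
  qed (use C v endo_op in auto)
  then show ?thesis unfolding aug_def by blast
qed

lemma csub_aug:
  assumes N: "csub N"
  shows "csub (aug N)"
proof (rule csubI)
  show "aug N \<subseteq> \<Lambda>" using aug_le csub_le[OF N] .
  show "0 \<in> aug N" using op_mem_aug[OF csub_0[OF N] P_op csub_0[OF N]] endo_0[OF endo_P'] by simp
  { fix x y assume "x \<in> aug N" "y \<in> aug N"
    obtain f where f: "\<And>t. t \<in> \<Theta> \<Longrightarrow> f t \<in> N" "x = (\<Sum>t\<in>\<Theta>. t (f t))"
      using \<open>x \<in> aug N\<close> unfolding aug_def by blast
    obtain g where g: "\<And>t. t \<in> \<Theta> \<Longrightarrow> g t \<in> N" "y = (\<Sum>t\<in>\<Theta>. t (g t))"
      using \<open>y \<in> aug N\<close> unfolding aug_def by blast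
    have "x - y = (\<Sum>t\<in>\<Theta>. t (f t - g t))"
      unfolding f(2) g(2) sum_subtractf[symmetric]
      using endo_diff[OF endo_op] csub_in[OF N] f(1) g(1) by (intro sum.cong) auto
    then show "x - y \<in> aug N" using augI[of "\<lambda>t. f t - g t"] f(1) g(1) csub_diff[OF N] by simp }
  { fix x assume "x \<in> aug N"
    then obtain f where f: "\<And>t. t \<in> \<Theta> \<Longrightarrow> f t \<in> N" "x = (\<Sum>t\<in>\<Theta>. t (f t))" unfolding aug_def by blast
    have "P x = (\<Sum>t\<in>\<Theta>. P (t (f t)))"
      unfolding f(2) using endo_in[OF endo_op] csub_in[OF N] f(1) by (intro endo_sum[OF endo_P']) auto
    also have "\<dots> = (\<Sum>t\<in>\<Theta>. t (P (f t)))"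
      using endo_P[OF endo_op] csub_in[OF N] f(1) by (intro sum.cong) auto
    finally show "P x \<in> aug N" using augI[of "\<lambda>t. P (f t)"] f(1) csub_P[OF N] by simp }
  fix v assume "v \<in> \<Lambda>" "\<And>n. v \<in> aug N + pw n \<Lambda>"
  then show "v \<in> aug N" using aug_INT[of "\<lambda>_. N"] N by simp
qed

lemma csub_augp: "csub N \<Longrightarrow> csub (augp r N)"
  by (induction r) (auto intro: csub_aug)

lemma augp_INT:
  assumes C: "\<And>n. csub (C n)" "\<And>n. C (Suc n) \<subseteq> C n"
    and v: "\<And>n. v \<in> augp r (C n)"
  shows "v \<in> augp r (\<Inter>n. C n)"
  using v
proof (induction r arbitrary: v)
  case (Suc r)
  have "v \<in> aug (\<Inter>n. augp r (C n))"
  proof (rule aug_INT)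
    show "v \<in> \<Lambda>" using Suc.prems[of 0] csub_in[OF csub_augp[OF C(1), of "Suc r"]] by blast
    show "v \<in> aug (augp r (C n)) + pw n \<Lambda>" for n
      using Suc.prems[of n] le_plus_left[OF zero_pw[OF zero_in], of "aug (augp r (C n))" n] by auto
  qed (use csub_augp[OF C(1)] augp_mono[OF C(2)] in auto)
  moreover have "(\<Inter>n. augp r (C n)) \<subseteq> augp r (\<Inter>n. C n)" using Suc.IH by blast
  ultimately show ?case using aug_mono by auto
qed auto

lemma aug_plus:
  assumes A: "A \<subseteq> \<Lambda>" and B: "B \<subseteq> \<Lambda>"
  shows "aug (A + B) = aug A + aug B"
proof (intro equalityI subsetI)
  fix x assume "x \<in> aug (A + B)"
  then obtain f where f: "\<And>t. t \<in> \<Theta> \<Longrightarrow> f t \<in> A + B" "x = (\<Sum>t\<in>\<Theta>. t (f t))" unfolding aug_def by blast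
  have "\<forall>t\<in>\<Theta>. \<exists>a b. a \<in> A \<and> b \<in> B \<and> f t = a + b" using mem_plusD[OF f(1)] by blast
  then obtain a b where ab: "\<And>t. t \<in> \<Theta> \<Longrightarrow> a t \<in> A \<and> b t \<in> B \<and> f t = a t + b t" by metis
  have "t (f t) = t (a t) + t (b t)" if "t \<in> \<Theta>" for t
    using endo_add[OF endo_op[OF that], of "a t" "b t"] ab[OF that] A B by (metis subsetD)
  then have "x = (\<Sum>t\<in>\<Theta>. t (a t)) + (\<Sum>t\<in>\<Theta>. t (b t))"
    unfolding f(2) sum.distrib[symmetric] by (intro sum.cong) auto
  then show "x \<in> aug A + aug B" using ab augI by auto
next
  fix x assume "x \<in> aug A + aug B"
  then obtain y z where yz: "y \<in> aug A" "z \<in> aug B" "x = y + z" by (auto dest!: mem_plusD)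
  obtain a where a: "\<And>t. t \<in> \<Theta> \<Longrightarrow> a t \<in> A" "y = (\<Sum>t\<in>\<Theta>. t (a t))" using yz unfolding aug_def by blast
  obtain b where b: "\<And>t. t \<in> \<Theta> \<Longrightarrow> b t \<in> B" "z = (\<Sum>t\<in>\<Theta>. t (b t))" using yz unfolding aug_def by blast
  have "t (a t) + t (b t) = t (a t + b t)" if "t \<in> \<Theta>" for t
    using endo_add[OF endo_op[OF that], of "a t" "b t"] a(1)[OF that] b(1)[OF that] A B by (metis subsetD)
  then have "x = (\<Sum>t\<in>\<Theta>. t (a t + b t))"
    unfolding yz(3) a(2) b(2) sum.distrib[symmetric] by (intro sum.cong) auto
  moreover have "a t + b t \<in> A + B" if "t \<in> \<Theta>" for t using a(1) b(1) that by blast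
  ultimately show "x \<in> aug (A + B)" using augI[of "\<lambda>t. a t + b t" "A + B"] by simp
qed

lemma augp_plus: "csub A \<Longrightarrow> csub B \<Longrightarrow> augp r (A + B) = augp r A + augp r B"
  by (induction r) (auto simp: aug_plus csub_le[OF csub_augp])

lemma aug_pw:
  assumes "csub N"
  shows "aug (pw n N) = pw n (aug N)"
proof -
  have *: "(P ^^ n) (\<Sum>t\<in>\<Theta>. t (g t)) = (\<Sum>t\<in>\<Theta>. t ((P ^^ n) (g t)))"
    if g: "\<And>t. t \<in> \<Theta> \<Longrightarrow> g t \<in> N" for g
  proof -
    have "(P ^^ n) (\<Sum>t\<in>\<Theta>. t (g t)) = (\<Sum>t\<in>\<Theta>. (P ^^ n) (t (g t)))"
      using endo_in[OF endo_op] csub_in[OF assms] g by (intro endo_sum[OF endo_Pow]) auto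
    also have "\<dots> = (\<Sum>t\<in>\<Theta>. t ((P ^^ n) (g t)))"
      using endo_Pow_comm[OF endo_op] csub_in[OF assms] g by (intro sum.cong) auto
    finally show ?thesis .
  qed
  show ?thesis
  proof (intro equalityI subsetI)
    fix x assume "x \<in> aug (pw n N)"
    then obtain f where f: "\<And>t. t \<in> \<Theta> \<Longrightarrow> f t \<in> pw n N" "x = (\<Sum>t\<in>\<Theta>. t (f t))" unfolding aug_def by blast
    from f(1) have "\<forall>t\<in>\<Theta>. \<exists>a. a \<in> N \<and> f t = (P ^^ n) a" by (auto simp: pw_def)
    then obtain g where g: "\<And>t. t \<in> \<Theta> \<Longrightarrow> g t \<in> N \<and> f t = (P ^^ n) (g t)" by metis
    then have "x = (P ^^ n) (\<Sum>t\<in>\<Theta>. t (g t))" using f(2) * by simp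
    then show "x \<in> pw n (aug N)" using augI[of g N] g by (auto simp: pw_def)
  next
    fix x assume "x \<in> pw n (aug N)"
    then obtain y where y: "y \<in> aug N" "x = (P ^^ n) y" by (auto simp: pw_def)
    then obtain g where g: "\<And>t. t \<in> \<Theta> \<Longrightarrow> g t \<in> N" "y = (\<Sum>t\<in>\<Theta>. t (g t))" unfolding aug_def by blast
    then show "x \<in> aug (pw n N)"
      using y(2) * augI[of "\<lambda>t. (P ^^ n) (g t)" "pw n N"] by (auto simp: pw_def)
  qed
qed

lemma augp_pw: "csub N \<Longrightarrow> augp r (pw n N) = pw n (augp r N)"
  by (induction r) (auto simp: aug_pw csub_augp)

lemma augp_add: "augp r (augp s N) = augp (r + s) N"
  by (simp add: funpow_add)

lemma pw_le_augp: "csub N \<Longrightarrow> pw r N \<subseteq> augp r N"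
proof (induction r)
  case (Suc r)
  have "pw (Suc r) N = P ` pw r N" by (simp add: pw_def image_comp)
  also have "\<dots> \<subseteq> P ` augp r N" using Suc by blast
  also have "\<dots> \<subseteq> aug (augp r N)"
    using op_mem_aug[OF csub_0[OF csub_augp[OF Suc.prems]] P_op] by blast
  finally show ?case by simp
qed simp

lemma stable_aug_le: "stable N \<Longrightarrow> aug N \<subseteq> N"
  unfolding aug_def by (auto intro!: csub_sum[OF stable_csub] simp: stable_op)

lemma stable_aug: "stable N \<Longrightarrow> stable (aug N)"
  using stable_aug_le[of N] op_mem_aug[OF csub_0[OF stable_csub]] csub_aug[OF stable_csub] unfolding stable_def
  by blast

lemma stable_augp: "stable N \<Longrightarrow> stable (augp r N)"
  by (induction r) (auto intro: stable_aug)

lemma augp_antimono: "stable N \<Longrightarrow> r \<le> s \<Longrightarrow> augp s N \<subseteq> augp r N"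
  using lift_Suc_antimono_le[of "\<lambda>r. augp r N" r s] stable_aug_le[OF stable_augp] by simp

lemma stable_augp_le: "stable N \<Longrightarrow> augp r N \<subseteq> N"
  using augp_antimono[of N 0 r] by simp

lemma stable_Lambda: "stable \<Lambda>"
  using csub_Lambda endo_op endo_in unfolding stable_def by blast

lemma stable_zero: "stable {0}"
  using csub_zero endo_0[OF endo_op] by (simp add: stable_def)

lemma stable_plus: "stable A \<Longrightarrow> stable B \<Longrightarrow> stable (A + B)"
proof -
  assume A: "stable A" and B: "stable B"
  have "t x \<in> A + B" if t: "t \<in> \<Theta>" and "x \<in> A + B" for t x
  proof -
    obtain a b where ab: "a \<in> A" "b \<in> B" "x = a + b" using mem_plusD[OF \<open>x \<in> A + B\<close>] by blast
    then have "t x = t a + t b"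
      using endo_add[OF endo_op[OF t]] csub_in[OF stable_csub[OF A]] csub_in[OF stable_csub[OF B]] by simp
    then show ?thesis using ab stable_op[OF A t] stable_op[OF B t] by auto
  qed
  then show ?thesis using csub_plus[OF stable_csub[OF A] stable_csub[OF B]] by (simp add: stable_def)
qed

lemma stable_pw: "stable N \<Longrightarrow> stable (pw n N)"
proof -
  assume N: "stable N"
  have "t ((P ^^ n) x) \<in> pw n N" if "t \<in> \<Theta>" "x \<in> N" for t x
    using endo_Pow_comm[OF endo_op[OF that(1)] csub_in[OF stable_csub[OF N] that(2)], of n]
      stable_op[OF N that] by (auto simp: pw_def)
  then show ?thesis using csub_pw[OF stable_csub[OF N], of n] by (auto simp: stable_def pw_def)
qed

lemma stable_preimage: "stable N \<Longrightarrow> stable Y \<Longrightarrow> stable {x \<in> Y. (P ^^ n) x \<in> N}"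
proof -
  assume N: "stable N" and Y: "stable Y"
  have "(P ^^ n) (t x) \<in> N" if "t \<in> \<Theta>" "x \<in> Y" "(P ^^ n) x \<in> N" for t x
    using endo_Pow_comm[OF endo_op[OF that(1)] csub_in[OF stable_csub[OF Y] that(2)], of n]
      stable_op[OF N that(1,3)] by simp
  then show ?thesis
    using csub_preimage[OF stable_csub[OF N] stable_csub[OF Y], of n] stable_op[OF Y] by (simp add: stable_def)
qed

lemma stable_pure_closure: "stable M \<Longrightarrow> stable (pure_closure M)"
  using pure_closure[of M] stable_preimage[OF _ stable_Lambda, of M] by (metis stable_csub)

lemma stable_Inter: "(\<And>N. N \<in> F \<Longrightarrow> stable N) \<Longrightarrow> F \<noteq> {} \<Longrightarrow> stable (\<Inter>F)"
  using csub_Inter[of F] by (auto simp: stable_def)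

section \<open>Inclusions modulo \<open>W\<close> and their iteration\<close>

lemma plus_plus_le:
  assumes "csub W" "A \<subseteq> W + B" "csub B"
  shows "W + A \<subseteq> W + B"
  using set_plus_mono2[OF order_refl[of W] assms(2)] csub_plus_self[OF assms(1)]
  by (simp add: add.assoc[symmetric])

lemma pw_plus_le:
  assumes "csub W" "csub B" "A \<subseteq> W + B"
  shows "pw n A \<subseteq> W + pw n B"
  using pw_mono[OF assms(3), of n] pw_plus[OF csub_le[OF assms(1)] csub_le[OF assms(2)], of n]
    set_plus_mono2[OF pw_csub_le[OF assms(1)] order_refl[of "pw n B"], of n] by blast

lemma augp_plus_le:
  assumes "stable W" "csub B" "A \<subseteq> W + B"
  shows "augp r A \<subseteq> W + augp r B"
  using augp_mono[OF assms(3), of r] augp_plus[OF stable_csub[OF assms(1)] assms(2), of r]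
    set_plus_mono2[OF stable_augp_le[OF assms(1)] order_refl[of "augp r B"], of r] by blast

lemma le_plus_trans:
  assumes "csub W" "A \<subseteq> W + B" "B \<subseteq> W + C"
  shows "A \<subseteq> W + C"
  using assms(2) set_plus_mono2[OF order_refl[of W] assms(3)] csub_plus_self[OF assms(1)]
  by (simp add: add.assoc[symmetric])

text \<open>Each further \<open>aug^r\<close> gains another factor \<open>p^s\<close>, since
  \<open>aug\<close> commutes with multiplication by \<open>p\<close>; the summand \<open>W\<close>
  reproduces itself because it is stable.\<close>

lemma augp_iterate_le:
  assumes "stable W" "csub E" "augp r E \<subseteq> W + pw s E"
  shows "augp (r * j) E \<subseteq> W + pw (s * j) E"
proof (induction j)
  case (Suc j)
  have "augp r (augp (r * j) E) \<subseteq> W + pw (s * j) (augp r E)"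
    using augp_plus_le[OF assms(1) csub_pw[OF assms(2)] Suc] by (simp add: augp_pw[OF assms(2)])
  moreover have "pw (s * j) (augp r E) \<subseteq> W + pw (s * Suc j) E"
    using pw_plus_le[OF stable_csub[OF assms(1)] csub_pw[OF assms(2)] assms(3), of "s * j"]
    by (simp add: pw_pw add.commute)
  ultimately show ?case
    using le_plus_trans[OF stable_csub[OF assms(1)]] by (simp add: augp_add)
qed (use le_plus_right[OF csub_0[OF stable_csub[OF assms(1)]]] in simp)

lemma augp_iterate_ge:
  assumes "stable W" "csub E" "pw s E \<subseteq> W + augp r E"
  shows "pw (s * j) E \<subseteq> W + augp (r * j) E"
proof (induction j)
  case (Suc j)
  have 1: "pw (s * j) (pw s E) \<subseteq> W + pw (s * j) (augp r E)"
    using pw_plus_le[OF stable_csub[OF assms(1)] csub_augp[OF assms(2)] assms(3)] .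
  have 2: "pw (s * j) (augp r E) \<subseteq> W + augp (r * Suc j) E"
    using augp_plus_le[OF assms(1) csub_augp[OF assms(2)] Suc, of r]
    by (simp add: augp_pw[OF assms(2)] augp_add)
  show ?case
    using le_plus_trans[OF stable_csub[OF assms(1)] 1 2] by (simp add: pw_pw add.commute)
qed (use le_plus_right[OF csub_0[OF stable_csub[OF assms(1)]]] in simp)

section \<open>Slopes\<close>

text \<open>Modulo \<open>W\<close>, the operator \<open>aug^r\<close> gains a factor \<open>p^s\<close> on the open submodule \<open>E\<close> of \<open>Y\<close>; the last
  clause says that \<open>s/r\<close> is the best possible rate.\<close>

definition slope :: "'a set \<Rightarrow> 'a set \<Rightarrow> nat \<Rightarrow> nat \<Rightarrow> nat \<Rightarrow> 'a set \<Rightarrow> bool" where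
  "slope W Y r s C E \<longleftrightarrow> 0 < r \<and> stable E \<and> pw C Y \<subseteq> E \<and> E \<subseteq> Y \<and>
     augp r E \<subseteq> W + pw s E \<and> (\<forall>j. \<not> augp (r * j) Y \<subseteq> W + pw (s * j + C) Y)"

text \<open>Brings two slopes to a common denominator \<open>r\<close> before they are
  combined.\<close>

lemma slope_mult:
  assumes "slope W Y r s C E" "stable W" "0 < m"
  shows "slope W Y (r * m) (s * m) C E"
  using assms augp_iterate_le[OF assms(2) stable_csub, of E r s m]
  unfolding slope_def by (simp add: mult.assoc)

text \<open>The slope of an extension is the smaller of the two slopes: both pieces satisfy the
  slower bound, and the slower piece already violates any faster one.\<close>

lemma slope_combine:
  assumes W: "stable W" and W1: "stable W1" "pure W1" "W \<subseteq> W1" and Y: "stable Y" "pure Y" "W1 \<subseteq> Y"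
    and 1: "slope W W1 r s1 C1 E1" and 2: "slope W1 Y r s2 C2 E2"
  shows "\<exists>s C E. slope W Y r s C E"
proof -
  note csub = stable_csub[OF W] stable_csub[OF W1(1)] stable_csub[OF Y(1)]
  define s where "s = min s1 s2"
  \<comment> \<open>\<open>aug^r\<close> maps \<open>E2\<close> into \<open>pw s2 E2\<close> only up
    to an error in \<open>W1\<close>. The factor \<open>p^(C1 + s)\<close> moves this error into
    \<open>pw s (pw C1 W1)\<close>, which lies in \<open>pw s E1\<close>. The constant
    \<open>C\<close> is chosen so that \<open>pw C Y\<close> lies in
    \<open>pw (C1 + s) E2\<close>.\<close>
  define E where "E = E1 + pw (C1 + s) E2"
  define C where "C = C1 + C2 + s"
  from 1 have E1: "stable E1" "pw C1 W1 \<subseteq> E1" "E1 \<subseteq> W1" "augp r E1 \<subseteq> W + pw s1 E1" "0 < r"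
    and not1: "\<And>j. \<not> augp (r * j) W1 \<subseteq> W + pw (s1 * j + C1) W1" by (auto simp: slope_def)
  from 2 have E2: "stable E2" "pw C2 Y \<subseteq> E2" "E2 \<subseteq> Y" "augp r E2 \<subseteq> W1 + pw s2 E2"
    and not2: "\<And>j. \<not> augp (r * j) Y \<subseteq> W1 + pw (s2 * j + C2) Y" by (auto simp: slope_def)
  note cE = stable_csub[OF E1(1)] stable_csub[OF E2(1)]
  have E: "stable E" unfolding E_def using stable_plus[OF E1(1) stable_pw[OF E2(1)]] .
  have le1: "pw s1 E1 \<subseteq> pw s E1" "pw s2 E2 \<subseteq> pw s E2"
    using pw_antimono cE by (auto simp: s_def)
  have pwE: "pw s E = pw s E1 + pw s (pw (C1 + s) E2)"
    unfolding E_def using pw_plus[OF csub_le csub_le] cE csub_pw by blast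
  have "pw C Y \<subseteq> pw (C1 + s) E2"
    using pw_mono[OF E2(2), of "C1 + s"] by (simp add: pw_pw C_def ac_simps)
  then have inE: "pw C Y \<subseteq> E"
    unfolding E_def using le_plus_right[OF csub_0[OF cE(1)]] by blast
  have leY: "E \<subseteq> Y"
    unfolding E_def using E1(3) Y(3) E2(3) pw_csub_le[OF cE(2)] by (intro plus_le[OF _ _ csub(3)]) blast+
  have "augp r E \<subseteq> W + pw s E"
  proof -
    have "augp r E1 \<subseteq> W + pw s E"
    proof -
      have "pw s1 E1 \<subseteq> pw s E"
        using le1 le_plus_left[OF zero_pw[OF zero_pw[OF csub_0[OF cE(2)]]], of "pw s E1" s "C1 + s"]
        unfolding pwE by blast
      then show ?thesis using E1(4) set_plus_mono2[OF order_refl[of W], of "pw s1 E1" "pw s E"] by blast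
    qed
    moreover have "augp r (pw (C1 + s) E2) \<subseteq> W + pw s E"
    proof -
      have "augp r (pw (C1 + s) E2) \<subseteq> pw (C1 + s) (W1 + pw s E2)"
        unfolding augp_pw[OF cE(2)]
        using E2(4) set_plus_mono2[OF order_refl[of W1] le1(2)] by (intro pw_mono) blast
      also have "\<dots> = pw s (pw C1 W1) + pw s (pw (C1 + s) E2)"
        using pw_plus[OF csub_le[OF csub(2)] csub_le[OF csub_pw[OF cE(2)]]]
        by (simp add: pw_pw ac_simps)
      also have "\<dots> \<subseteq> pw s E"
        unfolding pwE using pw_mono[OF E1(2)] by (intro set_plus_mono2) auto
      also have "\<dots> \<subseteq> W + pw s E" using le_plus_right[OF csub_0[OF csub(1)]] .
      finally show ?thesis .
    qed
    ultimately show ?thesis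
      unfolding E_def augp_plus[OF cE(1) csub_pw[OF cE(2)]]
      by (intro plus_le csub_plus csub_pw csub(1) stable_csub[OF E, unfolded E_def])
  qed
  moreover have "\<not> augp (r * j) Y \<subseteq> W + pw (s * j + C) Y" for j
  proof
    assume a: "augp (r * j) Y \<subseteq> W + pw (s * j + C) Y"
    show False
    proof (cases "s1 \<le> s2")
      case True
      then have s: "s = s1" by (simp add: s_def)
      \<comment> \<open>Restricting the supposed bound from \<open>Y\<close> to the pure submodule
        \<open>W1\<close> by the modular law contradicts the optimality of the first slope.\<close>
      have "augp (r * j) W1 \<subseteq> W + pw (s1 * j + C1) W1"
      proof
        fix x assume x: "x \<in> augp (r * j) W1"
        then have "x \<in> W1" using stable_augp_le[OF W1(1)] by blast
        moreover have "x \<in> W + pw (s * j + C) Y" using a x augp_mono[OF Y(3)] by blast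
        moreover have "pw (s * j + C) Y \<subseteq> pw (s1 * j + C1) \<Lambda>"
          using pw_antimono[OF csub_Lambda, of "s1 * j + C1" "s * j + C"] 
            pw_mono[OF csub_le[OF csub(3)], of "s * j + C"] by (auto simp: s C_def)
        ultimately show "x \<in> W + pw (s1 * j + C1) W1"
          using set_plus_mono2[OF order_refl[of W]] by (intro pure_modular[OF W1(2) csub(2) W1(3)]) blast+
      qed
      then show False using not1 by blast
    next
      case False
      then have s: "s = s2" by (simp add: s_def)
      have "W + pw (s * j + C) Y \<subseteq> W1 + pw (s2 * j + C2) Y"
        using pw_antimono[OF csub(3), of "s2 * j + C2" "s * j + C"] W1(3)
        by (intro set_plus_mono2) (auto simp: s C_def)
      then show False using a not2[of j] by blast
    qed
  qed
  ultimately have "slope W Y r s C E"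
    using E inE leY E1(5) by (simp add: slope_def)
  then show ?thesis by blast
qed

text \<open>A limit of elements \<open>b \<in> B\<close> for worse and worse \<open>B\<close> lies outside \<open>W\<close>, so by irreducibility the stable
  submodule that it generates with \<open>W\<close> contains some \<open>p^k Y\<close>; by Nakayama's lemma so do the \<open>B\<close> whose
  \<open>b\<close> is close to the limit.\<close>

lemma irreducible_bound:
  assumes W: "stable W" and Y: "stable Y" "pure Y" "W \<subseteq> Y"
    and irr: "\<And>M. stable M \<Longrightarrow> pure M \<Longrightarrow> W \<subseteq> M \<Longrightarrow> M \<subseteq> Y \<Longrightarrow> M = W \<or> M = Y"
  shows "\<exists>c. \<forall>B. stable B \<longrightarrow> W \<subseteq> B \<longrightarrow> B \<subseteq> Y \<longrightarrow> \<not> B \<subseteq> W + pw 1 \<Lambda> \<longrightarrow> pw c Y \<subseteq> B"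
proof (rule ccontr)
  note csub = stable_csub[OF W] stable_csub[OF Y(1)]
  assume "\<not> ?thesis"
  then have "\<forall>c. \<exists>B. stable B \<and> W \<subseteq> B \<and> B \<subseteq> Y \<and> \<not> B \<subseteq> W + pw 1 \<Lambda> \<and> \<not> pw c Y \<subseteq> B"
    by meson
  from choice[OF this] obtain B where "\<forall>c. stable (B c) \<and> W \<subseteq> B c \<and> B c \<subseteq> Y \<and>
      \<not> B c \<subseteq> W + pw 1 \<Lambda> \<and> \<not> pw c Y \<subseteq> B c" by (elim exE)
  then have B: "\<And>c. stable (B c)" "\<And>c. W \<subseteq> B c" "\<And>c. B c \<subseteq> Y" "\<And>c. \<not> pw c Y \<subseteq> B c"
    and "\<And>c. \<not> B c \<subseteq> W + pw 1 \<Lambda>" by auto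
  then have "\<forall>c. \<exists>b. b \<in> B c \<and> b \<notin> W + pw 1 \<Lambda>" by (meson subsetI)
  from choice[OF this] obtain b where b: "\<And>c. b c \<in> B c" "\<And>c. b c \<notin> W + pw 1 \<Lambda>" by auto
  have "b c \<in> \<Lambda>" for c using csub_in[OF stable_csub[OF B(1)] b(1)] .
  from seq_compact[of b, OF this] obtain \<sigma> l where \<sigma>: "strict_mono (\<sigma> :: nat \<Rightarrow> nat)"
    and l: "l \<in> \<Lambda>" "\<And>n. b (\<sigma> n) - l \<in> pw n \<Lambda>" unfolding pw_def by blast
  have bY: "b c \<in> Y" for c using B(3) b(1) by blast
  have "l \<in> Y"
  proof (rule csub_closed[OF csub(2) l(1)])
    fix n
    have "l - b (\<sigma> n) \<in> pw n \<Lambda>" using pw_uminus[OF l(2)[of n]] by simp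
    then show "l \<in> Y + pw n \<Lambda>" using bY unfolding mem_plus_iff by blast
  qed
  have "l \<notin> W"
  proof
    assume "l \<in> W"
    then have "b (\<sigma> 1) \<in> W + pw 1 \<Lambda>" using l(2)[of 1] unfolding mem_plus_iff by blast
    then show False using b(2) by blast
  qed
  define F where "F = {N. stable N \<and> W \<subseteq> N \<and> l \<in> N}"
  have YF: "Y \<in> F" using Y \<open>l \<in> Y\<close> by (simp add: F_def)
  define D where "D = \<Inter>F"
  have D: "stable D" "W \<subseteq> D" "l \<in> D" "D \<subseteq> Y"
    using stable_Inter[of F] YF unfolding D_def by (auto simp: F_def)
  have "pure_closure D = W \<or> pure_closure D = Y"
  proof (rule irr)
    show "W \<subseteq> pure_closure D" using le_pure_closure[OF stable_csub[OF D(1)]] D(2) by blast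
    show "pure_closure D \<subseteq> Y"
      using D(4) pure_Pow[OF Y(2)] unfolding pure_closure_def by blast
  qed (use stable_pure_closure[OF D(1)] pure_pure_closure in auto)
  moreover have "pure_closure D \<noteq> W"
    using le_pure_closure[OF stable_csub[OF D(1)]] D(3) \<open>l \<notin> W\<close> by blast
  ultimately obtain k where k: "pw k Y \<subseteq> D"
    using pw_pure_closure[OF stable_csub[OF D(1)]] by auto
  \<comment> \<open>One more than \<open>k\<close>, so that the error \<open>pw m Y\<close> is
    \<open>p\<close> times \<open>pw k Y\<close> and Nakayama's lemma applies to
    \<open>pw k Y\<close>.\<close>
  define m where "m = Suc k"
  have "D \<subseteq> B (\<sigma> m) + pw m Y"
  proof -
    have "W \<subseteq> B (\<sigma> m) + pw m Y"
      using B(2) le_plus_left[OF zero_pw[OF csub_0[OF csub(2)]]] by blast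
    moreover have "l \<in> B (\<sigma> m) + pw m Y"
    proof -
      have "b (\<sigma> m) - l \<in> pw m Y"
        using l(2) csub_diff[OF csub(2) bY \<open>l \<in> Y\<close>] by (intro pure_pw[OF Y(2)])
      then have "l - b (\<sigma> m) \<in> pw m Y"
        using csub_uminus[OF csub_pw[OF csub(2)]] by fastforce
      then show ?thesis using b(1) unfolding mem_plus_iff by blast
    qed
    ultimately have "B (\<sigma> m) + pw m Y \<in> F"
      using stable_plus[OF B(1) stable_pw[OF Y(1)]] by (simp add: F_def)
    then show ?thesis unfolding D_def by blast
  qed
  then have "pw k Y \<subseteq> B (\<sigma> m) + pw 1 (pw k Y)"
    using k by (simp add: m_def pw_pw) 
  then have "pw k Y \<subseteq> B (\<sigma> m)"
    by (rule nakayama[OF stable_csub[OF B(1)] csub_pw[OF csub(2)]])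
  moreover have "pw (\<sigma> m) Y \<subseteq> pw k Y"
    using strict_mono_imp_increasing[OF \<sigma>, of m] by (intro pw_antimono[OF csub(2)]) (simp add: m_def)
  ultimately show False using B(4)[of "\<sigma> m"] by blast
qed

text \<open>After cancelling \<open>p^i\<close> this is Nakayama's lemma for
  \<open>W \<subset> Y\<close>. It bounds the divisibility modulo \<open>W\<close> of every lattice
  that contains \<open>pw i Y\<close>.\<close>

lemma pw_not_le:
  assumes "csub W" "pure W" "csub Y" "pure Y" "W \<subset> Y"
  shows "\<not> pw i Y \<subseteq> W + pw (i + Suc n) \<Lambda>"
proof
  assume a: "pw i Y \<subseteq> W + pw (i + Suc n) \<Lambda>"
  have "Y \<subseteq> W + pw 1 \<Lambda>"
  proof
    fix x assume x: "x \<in> Y"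
    then have "(P ^^ i) x \<in> W + pw (i + Suc n) \<Lambda>" using a by (auto simp: pw_def)
    then have "x \<in> W + pw (Suc n) \<Lambda>"
      using pure_cancel[OF assms(2,1) csub_Lambda] csub_in[OF assms(3) x] by blast
    then show "x \<in> W + pw 1 \<Lambda>"
      using set_plus_mono2[OF order_refl[of W] pw_antimono[OF csub_Lambda, of 1 "Suc n"]] by auto
  qed
  then show False using nakayama_pure[OF assms(1,3,4)] assms(5) by blast
qed

text \<open>Of the two inclusions that make up the equality of \<open>aug^r E\<close> and
  \<open>p^s E\<close> modulo \<open>W\<close>, one is the gain required of a slope, and the reverse
  one, iterated, gives optimality.\<close>

lemma slope_irreducible:
  assumes W: "stable W" "pure W" and Y: "stable Y" "pure Y" "W \<subset> Y"
    and irr: "\<And>M. stable M \<Longrightarrow> pure M \<Longrightarrow> W \<subseteq> M \<Longrightarrow> M \<subseteq> Y \<Longrightarrow> M = W \<or> M = Y"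
  shows "\<exists>r s C E. slope W Y r s C E"
proof -
  note csub = stable_csub[OF W(1)] stable_csub[OF Y(1)]
  obtain c where c: "\<And>B. stable B \<Longrightarrow> W \<subseteq> B \<Longrightarrow> B \<subseteq> Y \<Longrightarrow> \<not> B \<subseteq> W + pw 1 \<Lambda> \<Longrightarrow> pw c Y \<subseteq> B"
    using irreducible_bound[OF W(1) Y(1,2) _ irr] Y(3) by blast
  define F where "F i = W + augp i Y" for i
  have F: "stable (F i)" "W \<subseteq> F i" "F i \<subseteq> Y" "pw i Y \<subseteq> F i" for i
    unfolding F_def using stable_plus[OF W(1) stable_augp[OF Y(1)]]
      le_plus_left[OF csub_0[OF stable_csub[OF stable_augp[OF Y(1)]]], of W i]
      plus_le[of W Y "augp i Y"] stable_augp_le[OF Y(1), of i] Y(3) csub(2)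
      pw_le_augp[OF csub(2), of i] le_plus_right[OF csub_0[OF csub(1)], of "augp i Y"] by blast+
  have "\<exists>e. F i \<subseteq> W + pw e \<Lambda> \<and> \<not> F i \<subseteq> W + pw (Suc e) \<Lambda>" for i
  proof (rule ccontr)
    assume "\<not> ?thesis"
    then have step: "F i \<subseteq> W + pw e \<Lambda> \<Longrightarrow> F i \<subseteq> W + pw (Suc e) \<Lambda>" for e by blast
    have "F i \<subseteq> W + pw e \<Lambda>" for e
    proof (induction e)
      case 0
      show ?case using csub_le[OF stable_csub[OF F(1)]] le_plus_right[OF csub_0[OF csub(1)], of \<Lambda>] by auto
    qed (rule step)
    then show False using pw_not_le[OF csub(1) W(2) csub(2) Y(2,3), of i 0] F(4)[of i] by (metis order_trans)
  qed
  \<comment> \<open>\<open>e i\<close> is the exact power of \<open>p\<close> that divides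
    \<open>F i\<close> modulo \<open>W\<close>; it exists because \<open>F i\<close> contains
    \<open>pw i Y\<close>.\<close>
  then obtain e where e: "\<And>i. F i \<subseteq> W + pw (e i) \<Lambda>" "\<And>i. \<not> F i \<subseteq> W + pw (Suc (e i)) \<Lambda>" by metis
  define B where "B i = {x \<in> Y. (P ^^ e i) x \<in> F i}" for i
  have stB: "stable (B i)" for i unfolding B_def by (rule stable_preimage[OF F(1) Y(1)])
  have WB: "W \<subseteq> B i" "B i \<subseteq> Y" for i
    unfolding B_def using Y(3) Pow_in_csub[OF csub(1)] F(2) by blast+
  have FB: "F i = W + pw (e i) (B i)" for i
  proof (intro equalityI subsetI)
    fix x assume x: "x \<in> F i"
    then have "x \<in> W + pw (e i) Y"
      using e(1)[of i] F(3)[of i] Y(3) by (intro pure_modular[OF Y(2) csub(2)]) blast+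
    then obtain w y where wy: "w \<in> W" "y \<in> Y" "x - w = (P ^^ e i) y"
      by (auto simp: mem_plus_iff pw_def)
    moreover have "x - w \<in> F i" using csub_diff[OF stable_csub[OF F(1)] x] wy(1) F(2) by blast
    ultimately show "x \<in> W + pw (e i) (B i)"
      unfolding mem_plus_iff by (intro bexI[of _ w]) (auto simp: pw_def B_def)
  next
    fix x assume "x \<in> W + pw (e i) (B i)"
    moreover have "pw (e i) (B i) \<subseteq> F i" by (auto simp: pw_def B_def)
    ultimately show "x \<in> F i" using plus_le[OF F(2) _ stable_csub[OF F(1)]] by blast
  qed
  have "\<not> B i \<subseteq> W + pw 1 \<Lambda>" for i
  proof
    assume "B i \<subseteq> W + pw 1 \<Lambda>"
    then have "pw (e i) (B i) \<subseteq> W + pw (Suc (e i)) \<Lambda>"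
      using pw_plus_le[OF csub(1) csub_pw[OF csub_Lambda], of "B i" 1 "e i"] by (simp add: pw_pw)
    then have "F i \<subseteq> W + pw (Suc (e i)) \<Lambda>"
      unfolding FB by (rule plus_plus_le[OF csub(1) _ csub_pw[OF csub_Lambda]])
    then show False using e(2) by blast
  qed
  then have "pw c Y \<subseteq> B i" for i using c[OF stB WB] by blast
  then have "range B \<subseteq> {N. csub N \<and> pw c Y \<subseteq> N \<and> N \<subseteq> Y}"
    using WB stable_csub[OF stB] by blast
  then have "finite (range B)" by (rule finite_subset[OF _ finite_csubs[OF Y(2) csub(2)]])
  then have "\<not> inj B" by (metis finite_imageD infinite_UNIV_nat)
  then have "\<exists>i i'. i < i' \<and> B i = B i'"
    by (meson linorder_injI)
  then obtain i i' where ii: "i < i'" "B i = B i'" by (elim exE conjE)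
  have "e i \<le> e i'"
  proof (rule ccontr)
    assume "\<not> e i \<le> e i'"
    then have "pw (e i) \<Lambda> \<subseteq> pw (Suc (e i')) \<Lambda>" by (intro pw_antimono[OF csub_Lambda]) auto
    moreover have "F i' \<subseteq> F i"
      unfolding F_def using augp_antimono[OF Y(1), of i i'] ii(1) by (intro set_plus_mono2) auto
    ultimately have "F i' \<subseteq> W + pw (Suc (e i')) \<Lambda>"
      using e(1)[of i] set_plus_mono2[OF order_refl[of W]] by blast
    then show False using e(2) by blast
  qed
  define r where "r = i' - i"
  define s where "s = e i' - e i"
  define E where "E = F i"
  \<comment> \<open>\<open>E\<close> contains \<open>pw i Y\<close>, so it is not divisible by
    \<open>p^(i + 1)\<close> modulo \<open>W\<close>; a violation of optimality would give this
    divisibility after cancelling \<open>p^(s j)\<close>.\<close>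
  define C where "C = i + 1"
  have cE: "csub E" "stable E" using stable_csub[OF F(1)] F(1) by (auto simp: E_def)
  have F': "F i' = W + pw s (pw (e i) (B i))"
    using \<open>e i \<le> e i'\<close> FB[of i'] by (simp add: pw_pw s_def ii(2))
  have pwE: "pw s (pw (e i) (B i)) \<subseteq> pw s E"
    unfolding E_def FB using le_plus_right[OF csub_0[OF csub(1)]] by (intro pw_mono)
  have aug_i': "augp r (augp i Y) = augp i' Y" using ii(1) by (simp add: augp_add r_def)
  have "augp r E \<subseteq> W + pw s E"
  proof -
    have "augp r E \<subseteq> W + augp r (augp i Y)"
      by (rule augp_plus_le[OF W(1) csub_augp[OF csub(2)]]) (simp add: E_def F_def)
    also have "\<dots> = F i'" by (simp add: F_def aug_i')
    also have "\<dots> \<subseteq> W + pw s E" unfolding F' by (intro set_plus_mono2 pwE order_refl)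
    finally show ?thesis .
  qed
  moreover have "pw s E \<subseteq> W + augp r E"
  proof -
    have "pw s E \<subseteq> W + pw s (pw (e i) (B i))"
      by (rule pw_plus_le[OF csub(1) csub_pw[OF stable_csub[OF stB]]]) (simp add: E_def FB)
    also have "\<dots> = W + augp r (augp i Y)" using F' by (simp add: F_def aug_i')
    also have "\<dots> \<subseteq> W + augp r E"
      unfolding E_def F_def using le_plus_right[OF csub_0[OF csub(1)]]
      by (intro set_plus_mono2 augp_mono order_refl)
    finally show ?thesis .
  qed
  then have ge: "pw (s * j) E \<subseteq> W + augp (r * j) E" for j by (rule augp_iterate_ge[OF W(1) cE(1)])
  have "\<not> augp (r * j) Y \<subseteq> W + pw (s * j + C) Y" for j
  proof
    assume a: "augp (r * j) Y \<subseteq> W + pw (s * j + C) Y"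
    have "augp (r * j) E \<subseteq> W + pw (s * j + C) \<Lambda>"
      using a augp_mono[OF F(3), of "r * j" i] pw_mono[OF csub_le[OF csub(2)], of "s * j + C"]
        set_plus_mono2[OF order_refl[of W]] unfolding E_def by blast
    then have 1: "pw (s * j) E \<subseteq> W + pw (s * j + C) \<Lambda>" using le_plus_trans[OF csub(1) ge] by blast
    have "E \<subseteq> W + pw C \<Lambda>"
    proof
      fix x assume x: "x \<in> E"
      then have "(P ^^ (s * j)) x \<in> W + pw (s * j + C) \<Lambda>" using 1 by (auto simp: pw_def)
      then show "x \<in> W + pw C \<Lambda>"
        using pure_cancel[OF W(2) csub(1) csub_Lambda] csub_in[OF cE(1) x] by blast
    qed
    then show False
      using pw_not_le[OF csub(1) W(2) csub(2) Y(2,3), of i 0] F(4)[of i] by (auto simp: E_def C_def)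
  qed
  moreover have "pw C Y \<subseteq> E"
    using pw_antimono[OF csub(2), of i C] F(4)[of i] by (auto simp: E_def C_def)
  ultimately have "slope W Y r s C E"
    using cE F(3)[of i] ii(1) by (simp add: slope_def E_def r_def)
  then show ?thesis by blast
qed

lemma slope_exists:
  assumes "stable W" "pure W" "W \<subset> \<Lambda>"
  shows "\<exists>r s C E. slope W \<Lambda> r s C E"
  using assms
proof (induction "rk \<Lambda> - rk W" arbitrary: W rule: less_induct)
  case less
  note W = less.prems
  define Q where "Q M \<longleftrightarrow> stable M \<and> pure M \<and> W \<subset> M" for M
  have "Q \<Lambda>" using W stable_Lambda pure_Lambda by (simp add: Q_def)
  \<comment> \<open>Minimality of \<open>rk\<close> makes \<open>Y/W\<close> irreducible with
    respect to pure stable submodules, since \<open>rk\<close> is strictly monotone on them.\<close>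
  then obtain Y where "Q Y" and min: "\<And>M. Q M \<Longrightarrow> rk Y \<le> rk M"
    using ex_has_least_nat[of Q \<Lambda> rk] by blast
  then have Y: "stable Y" "pure Y" "W \<subset> Y" by (auto simp: Q_def)
  have "M = W \<or> M = Y" if "stable M" "pure M" "W \<subseteq> M" "M \<subseteq> Y" for M
  proof (rule ccontr)
    assume a: "\<not> (M = W \<or> M = Y)"
    then have "Q M" "M \<subset> Y" using that by (auto simp: Q_def)
    then show False
      using min[of M] rk_less[OF stable_csub[OF that(1)] stable_csub[OF Y(1)] Y(2)] by simp
  qed
  from slope_irreducible[OF W(1,2) Y this] obtain r1 s1 C1 E1 where 1: "slope W Y r1 s1 C1 E1" by blast
  show ?case
  proof (cases "Y = \<Lambda>")
    case True
    then show ?thesis using 1 by blast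
  next
    case False
    then have "Y \<subset> \<Lambda>" using csub_le[OF stable_csub[OF Y(1)]] by blast
    moreover have "rk \<Lambda> - rk Y < rk \<Lambda> - rk W"
      using rk_less[OF stable_csub[OF W(1)] stable_csub[OF Y(1)] Y(2,3)]
        rk_less[OF stable_csub[OF Y(1)] csub_Lambda pure_Lambda \<open>Y \<subset> \<Lambda>\<close>] by simp
    ultimately obtain r2 s2 C2 E2 where 2: "slope Y \<Lambda> r2 s2 C2 E2"
      using less.hyps[of Y] Y(1,2) by blast
    have "slope W Y (r1 * r2) (s1 * r2) C1 E1" "slope Y \<Lambda> (r1 * r2) (s2 * r1) C2 E2"
      using slope_mult[OF 1 W(1), of r2] slope_mult[OF 2 Y(1), of r1] 1 2
      by (simp_all add: slope_def mult.commute)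
    from slope_combine[OF W(1) Y(1,2) _ stable_Lambda pure_Lambda _ this] \<open>Y \<subset> \<Lambda>\<close> Y(3)
    show ?thesis by blast
  qed
qed

text \<open>\<open>M\<close> is the intersection of the sets \<open>D j\<close> of all \<open>x\<close> in \<open>E\<close> with \<open>p^(s j) x \<in> W + aug^(r j) E\<close>;
  optimality of the slope keeps \<open>D j\<close> outside \<open>W + p^(2 C) L\<close>, hence \<open>M\<close> outside \<open>W\<close>.\<close>

lemma slow_submodule:
  assumes W: "stable W" "pure W" "W \<subset> \<Lambda>" and "slope W \<Lambda> r s C E0"
  shows "\<exists>M. stable M \<and> W \<subset> M \<and> pw s M \<subseteq> W + augp r M"
proof -
  note cW = stable_csub[OF W(1)]
  from assms(4) have E0: "stable E0" "pw C \<Lambda> \<subseteq> E0" "augp r E0 \<subseteq> W + pw s E0" "0 < r"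
    and not: "\<And>j. \<not> augp (r * j) \<Lambda> \<subseteq> W + pw (s * j + C) \<Lambda>" by (auto simp: slope_def)
  note cE0 = stable_csub[OF E0(1)]
  \<comment> \<open>Adding \<open>W\<close> keeps the bound modulo \<open>W\<close> and makes every
    \<open>D j\<close> contain \<open>W\<close>.\<close>
  define E where "E = W + E0"
  have E: "stable E" "W \<subseteq> E" "E0 \<subseteq> E"
    unfolding E_def using stable_plus[OF W(1) E0(1)] le_plus_left[OF csub_0[OF cE0]]
      le_plus_right[OF csub_0[OF cW]] by blast+
  note cE = stable_csub[OF E(1)]
  have augE: "augp r E \<subseteq> W + pw s E"
    using augp_plus_le[OF W(1) cE0, of E r] E0(3) pw_mono[OF E(3), of s]
      le_plus_trans[OF cW, of "augp r E" "augp r E0" "pw s E"] set_plus_mono2[OF order_refl[of W]]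
    unfolding E_def by blast
  define D where "D j = {x \<in> E. (P ^^ (s * j)) x \<in> W + augp (r * j) E}" for j
  have stA: "stable (W + augp j E)" for j using stable_plus[OF W(1) stable_augp[OF E(1)]] .
  have D: "stable (D j)" for j unfolding D_def by (rule stable_preimage[OF stA E(1)])
  have DW: "W \<subseteq> D j" for j
    unfolding D_def using E(2) Pow_in_csub[OF cW] le_plus_left[OF csub_0[OF csub_augp[OF cE]], of W "r * j"] by blast
  \<comment> \<open>A further \<open>aug^r\<close> has gained \<open>p^s\<close>, and purity of
    \<open>W\<close> allows this factor to be cancelled.\<close>
  have dec: "D (Suc j) \<subseteq> D j" for j
  proof
    fix x assume "x \<in> D (Suc j)"
    then have x: "x \<in> E" "(P ^^ (s * Suc j)) x \<in> W + augp (r * Suc j) E" by (auto simp: D_def)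
    have "augp (r * j) (augp r E) \<subseteq> W + augp (r * j) (pw s E)"
      by (rule augp_plus_le[OF W(1) csub_pw[OF cE] augE])
    then have "augp (r * Suc j) E \<subseteq> W + pw s (augp (r * j) E)"
      by (simp add: augp_add augp_pw[OF cE] add.commute)
    then have "W + augp (r * Suc j) E \<subseteq> W + pw s (augp (r * j) E)"
      by (rule plus_plus_le[OF cW _ csub_pw[OF csub_augp[OF cE]]])
    then have "(P ^^ s) ((P ^^ (s * j)) x) \<in> W + pw (s + 0) (augp (r * j) E)"
      using x(2) by (auto simp: funpow_add)
    then have "(P ^^ (s * j)) x \<in> W + pw 0 (augp (r * j) E)"
      using pure_cancel[OF W(2) cW csub_augp[OF cE] Pow_in[OF csub_in[OF cE x(1)]]] by blast
    then show "x \<in> D j" using x(1) by (simp add: D_def)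
  qed
  have WD: "augp (r * j) E \<subseteq> W + pw (s * j) (D j)" for j
  proof
    fix x assume x: "x \<in> augp (r * j) E"
    then have "x \<in> W + pw (s * j) E" using augp_iterate_le[OF W(1) cE augE] by blast
    then obtain w y where wy: "w \<in> W" "y \<in> E" "x - w = (P ^^ (s * j)) y"
      by (auto simp: mem_plus_iff pw_def)
    have "x - w \<in> W + augp (r * j) E"
    proof (rule csub_diff[OF stable_csub[OF stA]])
      show "x \<in> W + augp (r * j) E" using x le_plus_right[OF csub_0[OF cW]] by blast
      show "w \<in> W + augp (r * j) E" using wy(1) le_plus_left[OF csub_0[OF csub_augp[OF cE]]] by blast
    qed
    then have "y \<in> D j" using wy by (simp add: D_def)
    then have "x - w \<in> pw (s * j) (D j)" using wy(3) by (simp add: pw_def)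
    then show "x \<in> W + pw (s * j) (D j)" using wy(1) unfolding mem_plus_iff by blast
  qed
  have step: "pw s (D (Suc j)) \<subseteq> W + augp r (D j)" for j
  proof
    fix x assume "x \<in> pw s (D (Suc j))"
    then obtain y where y: "y \<in> E" "(P ^^ (s * Suc j)) y \<in> W + augp (r * Suc j) E" "x = (P ^^ s) y"
      by (auto simp: pw_def D_def)
    have "augp r (augp (r * j) E) \<subseteq> W + augp r (pw (s * j) (D j))"
      by (rule augp_plus_le[OF W(1) csub_pw[OF stable_csub[OF D]] WD])
    then have "augp (r * Suc j) E \<subseteq> W + pw (s * j) (augp r (D j))"
      by (simp add: augp_add augp_pw[OF stable_csub[OF D]])
    then have "W + augp (r * Suc j) E \<subseteq> W + pw (s * j) (augp r (D j))"
      by (rule plus_plus_le[OF cW _ csub_pw[OF csub_augp[OF stable_csub[OF D]]]])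
    moreover have "(P ^^ (s * j)) x = (P ^^ (s * Suc j)) y"
      by (simp add: y(3) funpow_add[symmetric] add.commute flip: comp_apply[of "P ^^ _"])
    ultimately have "(P ^^ (s * j)) x \<in> W + pw (s * j + 0) (augp r (D j))"
      using y(2) by auto
    then have "x \<in> W + pw 0 (augp r (D j))"
      using y(1,3) pure_cancel[OF W(2) cW csub_augp[OF stable_csub[OF D]]] Pow_in[OF csub_in[OF cE]] by blast
    then show "x \<in> W + augp r (D j)" by simp
  qed
  define M where "M = (\<Inter>j. D j)"
  have M: "stable M" unfolding M_def using D by (intro stable_Inter) auto
  have "pw s M \<subseteq> W + augp r M"
  proof
    fix x assume x: "x \<in> pw s M"
    have "x \<in> W + augp r (D j)" for j
      using x step[of j] pw_mono[of M "D (Suc j)" s] unfolding M_def by blast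
    then have "x \<in> W + (\<Inter>j. augp r (D j))"
      by (intro INT_plus[OF cW]) (use csub_augp[OF stable_csub[OF D]] augp_mono[OF dec] in auto)
    moreover have "(\<Inter>j. augp r (D j)) \<subseteq> augp r M"
      unfolding M_def using augp_INT[of D, OF stable_csub[OF D] dec] by blast
    ultimately show "x \<in> W + augp r M" using set_plus_mono2[OF order_refl[of W]] by blast
  qed
  moreover have "\<not> M \<subseteq> W"
  proof
    assume MW: "M \<subseteq> W"
    \<comment> \<open>One \<open>C\<close> is the cost of passing from \<open>\<Lambda>\<close> to
      \<open>E\<close>, the other is the slack in the optimality clause.\<close>
    define n where "n = 2 * C"
    have "\<not> D j \<subseteq> W + pw n \<Lambda>" for j
    proof
      assume "D j \<subseteq> W + pw n \<Lambda>"
      then have "pw (s * j) (D j) \<subseteq> W + pw (s * j) (pw n \<Lambda>)"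
        by (rule pw_plus_le[OF cW csub_pw[OF csub_Lambda]])
      then have 1: "augp (r * j) E \<subseteq> W + pw (s * j + n) \<Lambda>"
        using le_plus_trans[OF cW WD] by (simp add: pw_pw)
      have 0: "pw C (augp (r * j) \<Lambda>) \<subseteq> augp (r * j) E"
        unfolding augp_pw[OF csub_Lambda, symmetric] using E0(2) E(3) by (intro augp_mono) blast
      have n: "C + (s * j + C) = s * j + n" by (simp add: n_def)
      have 2: "pw C (augp (r * j) \<Lambda>) \<subseteq> W + pw (C + (s * j + C)) \<Lambda>"
        unfolding n by (rule order_trans[OF 0 1])
      have "augp (r * j) \<Lambda> \<subseteq> W + pw (s * j + C) \<Lambda>"
      proof
        fix x assume x: "x \<in> augp (r * j) \<Lambda>"
        then have "(P ^^ C) x \<in> W + pw (C + (s * j + C)) \<Lambda>" using 2 by (auto simp: pw_def)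
        then show "x \<in> W + pw (s * j + C) \<Lambda>"
          using pure_cancel[OF W(2) cW csub_Lambda] csub_in[OF csub_augp[OF csub_Lambda] x] by blast
      qed
      then show False using not by blast
    qed
    \<comment> \<open>The vectors \<open>u j\<close> accumulate at a point of \<open>M\<close>,
      which lies in \<open>W\<close> by assumption, although all of them avoid the neighbourhood
      \<open>W + pw n \<Lambda>\<close> of \<open>W\<close>.\<close>
    then have "\<forall>j. \<exists>x. x \<in> D j \<and> x \<notin> W + pw n \<Lambda>" by blast
    then obtain u where u: "\<And>j. u j \<in> D j" "\<And>j. u j \<notin> W + pw n \<Lambda>" by metis
    have "u j \<in> \<Lambda>" for j using csub_in[OF stable_csub[OF D] u(1)] .
    from seq_compact[of u, OF this] obtain \<sigma> l where \<sigma>: "strict_mono (\<sigma> :: nat \<Rightarrow> nat)"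
      and l: "l \<in> \<Lambda>" "\<And>n. u (\<sigma> n) - l \<in> pw n \<Lambda>" unfolding pw_def by blast
    have anti: "D m \<subseteq> D k" if "k \<le> m" for k m
      using lift_Suc_antimono_le[of D] dec that by blast
    have "l \<in> D k" for k
    proof (rule csub_closed[OF stable_csub[OF D] l(1)])
      fix m
      define j where "j = max k m"
      have "l - u (\<sigma> j) \<in> pw m \<Lambda>"
        using pw_uminus[OF l(2)[of j]] pw_antimono[OF csub_Lambda, of m j] by (auto simp: j_def)
      moreover have "u (\<sigma> j) \<in> D k"
        using u(1)[of "\<sigma> j"] anti[of k "\<sigma> j"] strict_mono_imp_increasing[OF \<sigma>, of j] by (auto simp: j_def)
      ultimately show "l \<in> D k + pw m \<Lambda>" unfolding mem_plus_iff by blast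
    qed
    then have "l \<in> W" using MW by (auto simp: M_def)
    then have "u (\<sigma> n) \<in> W + pw n \<Lambda>" using l(2)[of n] unfolding mem_plus_iff by blast
    then show False using u(2) by blast
  qed
  moreover have "W \<subseteq> M" using DW by (auto simp: M_def)
  ultimately show ?thesis using M by blast
qed

end

section \<open>p-adic scalars\<close>

definition padic_of_int :: "nat \<Rightarrow> int \<Rightarrow> nat \<Rightarrow> int" where
  "padic_of_int p a = (\<lambda>n. a mod int p ^ n)"

lemma padic_carrier: "a \<in> carrier (padic_int p) \<longleftrightarrow>
    (\<forall>n. 0 \<le> a n \<and> a n < int p ^ n \<and> a (Suc n) mod int p ^ n = a n)"
  by (auto simp: padic_int_def)

lemma padic_mod:
  assumes "a \<in> carrier (padic_int p)" "m \<le> n"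
  shows "a n mod int p ^ m = a m"
  using assms(2)
proof (induction n rule: dec_induct)
  case base
  show ?case using assms(1) by (simp add: padic_carrier)
next
  case (step n)
  have "a (Suc n) mod int p ^ m = a (Suc n) mod int p ^ n mod int p ^ m"
    using step by (simp add: mod_mod_cancel le_imp_power_dvd)
  then show ?case using assms(1) step by (simp add: padic_carrier)
qed

lemma padic_of_int_closed: "p > 0 \<Longrightarrow> padic_of_int p a \<in> carrier (padic_int p)"
  by (auto simp: padic_carrier padic_of_int_def mod_mod_cancel)

lemma padic_of_int_add: "padic_of_int p (a + b) = padic_of_int p a \<oplus>\<^bsub>padic_int p\<^esub> padic_of_int p b"
  by (auto simp: padic_of_int_def padic_int_def mod_simps)

lemma padic_of_int_mult: "padic_of_int p (a * b) = padic_of_int p a \<otimes>\<^bsub>padic_int p\<^esub> padic_of_int p b"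
  by (auto simp: padic_of_int_def padic_int_def mod_simps)

lemma padic_of_int_one: "padic_of_int p 1 = \<one>\<^bsub>padic_int p\<^esub>"
  by (auto simp: padic_of_int_def padic_int_def)

lemma padic_zero: "\<zero>\<^bsub>padic_int p\<^esub> = (\<lambda>n. 0)"
  by (simp add: padic_int_def)

lemma padic_add: "(a \<oplus>\<^bsub>padic_int p\<^esub> b) n = (a n + b n) mod int p ^ n"
  by (simp add: padic_int_def)

lemma padic_mult: "(a \<otimes>\<^bsub>padic_int p\<^esub> b) n = (a n * b n) mod int p ^ n"
  by (simp add: padic_int_def)

text \<open>Division with remainder by \<open>p^n\<close>: dividing costs \<open>n\<close> places of
  precision, so the residue of the quotient modulo \<open>p^m\<close> is read off from
  \<open>c (m + n)\<close>.\<close>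

lemma padic_decompose:
  assumes p: "p > 0" and c: "c \<in> carrier (padic_int p)"
  shows "\<exists>c'\<in>carrier (padic_int p).
    c = padic_of_int p (c n) \<oplus>\<^bsub>padic_int p\<^esub> padic_of_int p (int p ^ n) \<otimes>\<^bsub>padic_int p\<^esub> c'"
proof -
  define c' where "c' m = c (m + n) div int p ^ n" for m
  have pos: "int p ^ m > 0" for m using p by simp
  have c0: "0 \<le> c m" "c m < int p ^ m" for m using c by (auto simp: padic_carrier)
  have "c' m < int p ^ m" for m
  proof (rule ccontr)
    assume "\<not> c' m < int p ^ m"
    then have "int p ^ m * int p ^ n \<le> c (m + n) div int p ^ n * int p ^ n"
      using pos[of n] by (intro mult_right_mono) (auto simp: c'_def)
    also have "\<dots> \<le> c (m + n)"
      using pos_mod_sign[OF pos[of n], of "c (m + n)"] div_mult_mod_eq[of "c (m + n)" "int p ^ n"] by linarith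
    finally show False using c0(2)[of "m + n"] by (simp add: power_add)
  qed
  moreover have "c' (Suc m) mod int p ^ m = c' m" for m
  proof -
    have "c (Suc m + n) mod int p ^ (m + n) = c (m + n)" using padic_mod[OF c, of "m + n" "Suc m + n"] by simp
    then have "c' m = (c (Suc m + n) mod (int p ^ n * int p ^ m)) div int p ^ n"
      by (simp add: c'_def power_add mult.commute)
    also have "\<dots> = c (Suc m + n) div int p ^ n mod int p ^ m"
    proof -
      have "c (Suc m + n) mod (int p ^ n * int p ^ m) =
          int p ^ n * (c (Suc m + n) div int p ^ n mod int p ^ m) + c (Suc m + n) mod int p ^ n"
        using pos[of m] by (intro zmod_zmult2_eq) auto
      also have "\<dots> div int p ^ n = c (Suc m + n) div int p ^ n mod int p ^ m"
        using pos[of n] by simp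
      finally show ?thesis .
    qed
    finally show ?thesis by (simp add: c'_def)
  qed
  ultimately have "c' \<in> carrier (padic_int p)"
    using c0(1) pos by (auto simp: padic_carrier c'_def pos_imp_zdiv_nonneg_iff)
  moreover have "c = padic_of_int p (c n) \<oplus>\<^bsub>padic_int p\<^esub> padic_of_int p (int p ^ n) \<otimes>\<^bsub>padic_int p\<^esub> c'"
  proof
    fix m
    have "c n = c (m + n) mod int p ^ n" using padic_mod[OF c, of n "m + n"] by simp
    then have "c n + int p ^ n * c' m = c (m + n)" by (simp add: c'_def)
    then have "(c n + int p ^ n * c' m) mod int p ^ m = c m" using padic_mod[OF c, of m "m + n"] by simp
    then show "c m = (padic_of_int p (c n) \<oplus>\<^bsub>padic_int p\<^esub> padic_of_int p (int p ^ n) \<otimes>\<^bsub>padic_int p\<^esub> c') m"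
      by (simp add: padic_add padic_mult padic_of_int_def mod_simps)
  qed
  ultimately show ?thesis by blast
qed

text \<open>Inverses modulo every \<open>p^n\<close> exist because \<open>c 1 \<noteq> 0\<close>,
  and their uniqueness makes them compatible.\<close>

lemma padic_inverse:
  assumes p: "normalization_semidom_class.prime p" and c: "c \<in> carrier (padic_int p)" "c 1 \<noteq> 0"
  shows "\<exists>u\<in>carrier (padic_int p). u \<otimes>\<^bsub>padic_int p\<^esub> c = \<one>\<^bsub>padic_int p\<^esub>"
proof -
  have pos: "int p ^ m > 0" for m using p prime_gt_0_nat by simp
  have cop: "coprime (c n) (int p ^ n)" for n
  proof (cases n)
    case (Suc m)
    have "c n mod int p = c 1" using padic_mod[OF c(1), of 1 n] Suc by simp
    then have "\<not> int p dvd c n" using c(2) by (auto simp: dvd_eq_mod_eq_0)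
    then have "coprime (int p) (c n)" using p by (simp add: prime_imp_coprime)
    then show ?thesis by (simp add: coprime_commute)
  qed simp
  have "\<exists>x. (c n * x) mod int p ^ n = 1 mod int p ^ n" for n
    using cong_solve_coprime_int[OF cop[of n]] by (auto simp: cong_def)
  then obtain x where x: "\<And>n. (c n * x n) mod int p ^ n = 1 mod int p ^ n" by metis
  define u where "u n = x n mod int p ^ n" for n
  have u: "(c n * u n) mod int p ^ n = 1 mod int p ^ n" for n using x by (simp add: u_def mod_simps)
  have "u (Suc n) mod int p ^ n = u n" for n
  proof -
    have "int p ^ n dvd int p ^ Suc n" by simp
    then have "(c (Suc n) * u (Suc n)) mod int p ^ n = 1 mod int p ^ n"
      using u[of "Suc n"] by (metis mod_mod_cancel)
    then have "(c n * u (Suc n)) mod int p ^ n = 1 mod int p ^ n"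
      using c(1) unfolding padic_carrier by (metis mod_mult_left_eq)
    then have "[c n * u (Suc n) = c n * u n] (mod int p ^ n)" using u[of n] by (simp add: cong_def)
    then have "[u (Suc n) = u n] (mod int p ^ n)" using cop cong_mult_lcancel by blast
    then show ?thesis using pos[of n] by (simp add: cong_def u_def)
  qed
  then have "u \<in> carrier (padic_int p)" using pos by (simp add: padic_carrier u_def)
  moreover have "u \<otimes>\<^bsub>padic_int p\<^esub> c = \<one>\<^bsub>padic_int p\<^esub>"
    using u by (auto simp: padic_int_def mult.commute)
  ultimately show ?thesis by blast
qed

text \<open>Koenig's argument: nested infinite sets of indices on which one residue after another is
  constant, followed by a diagonal choice.\<close>

lemma padic_seq_compact:
  assumes p: "p > 0" and c: "\<And>n. c n \<in> carrier (padic_int p)"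
  shows "\<exists>\<sigma> l. strict_mono (\<sigma> :: nat \<Rightarrow> nat) \<and> l \<in> carrier (padic_int p) \<and> (\<forall>n. c (\<sigma> n) n = l n)"
proof -
  have fin: "finite (range (\<lambda>i. c i n))" for n
  proof (rule finite_subset)
    show "range (\<lambda>i. c i n) \<subseteq> {0..<int p ^ n}" using c by (auto simp: padic_carrier)
  qed simp
  have inf: "\<exists>v. infinite {i \<in> A. c i n = v}" if "infinite A" for A n
  proof -
    have "finite ((\<lambda>i. c i n) ` A)" by (rule finite_subset[OF image_mono[OF subset_UNIV] fin])
    from pigeonhole_infinite[OF that this] show ?thesis by auto
  qed
  define step where "step n A = {i \<in> A. c i n = (SOME v. infinite {i \<in> A. c i n = v})}" for n A
  define A where "A = rec_nat UNIV (\<lambda>n. step n)"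
  have A: "A 0 = UNIV" "A (Suc n) = step n (A n)" for n by (simp_all add: A_def)
  have infA: "infinite (A n)" for n
  proof (induction n)
    case (Suc n)
    then show ?case unfolding A step_def using someI_ex[OF inf[OF Suc, of n]] by simp
  qed (simp add: A)
  have dec: "A n \<subseteq> A m" if "m \<le> n" for m n
    using lift_Suc_antimono_le[of A] that by (auto simp: A step_def)
  have const: "c i n = c j n" if "i \<in> A (Suc n)" "j \<in> A (Suc n)" for i j n
    using that by (auto simp: A step_def)
  define \<sigma> where "\<sigma> = rec_nat (SOME i. i \<in> A 1) (\<lambda>n k. SOME i. i \<in> A (Suc (Suc n)) \<and> i > k)"
  have ex: "\<exists>i. i \<in> A n \<and> i > k" for n k
    using infA[of n] unfolding infinite_nat_iff_unbounded by blast
  have S: "\<sigma> (Suc n) \<in> A (Suc (Suc n)) \<and> \<sigma> (Suc n) > \<sigma> n" for n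
    unfolding \<sigma>_def using someI_ex[OF ex[of "Suc (Suc n)"]] by simp
  \<comment> \<open>\<open>A (Suc n)\<close> is the set on which the residue modulo
    \<open>p^n\<close> has been fixed, hence the shift.\<close>
  have A1: "\<sigma> n \<in> A (Suc n)" for n
  proof (cases n)
    case 0
    have "\<exists>i. i \<in> A 1" using ex by blast
    then show ?thesis using 0 someI_ex[of "\<lambda>i. i \<in> A 1"] by (simp add: \<sigma>_def)
  qed (use S in simp)
  define l where "l n = c (\<sigma> n) n" for n
  have "l (Suc n) mod int p ^ n = l n" for n
  proof -
    have "l (Suc n) mod int p ^ n = c (\<sigma> (Suc n)) n"
      using c by (simp add: l_def padic_carrier)
    also have "\<dots> = l n"
      unfolding l_def using A1[of "Suc n"] dec[of "Suc n" "Suc (Suc n)"] A1[of n]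
      by (intro const) auto
    finally show ?thesis .
  qed
  then have "l \<in> carrier (padic_int p)" using c by (simp add: padic_carrier l_def)
  moreover have "strict_mono \<sigma>" using S by (simp add: strict_mono_Suc_iff)
  ultimately show ?thesis by (intro exI[of _ \<sigma>] exI[of _ l]) (simp add: l_def)
qed

text \<open>Separatedness in a form that tolerates a factor \<open>p^m\<close> depending on
  \<open>N\<close>; at precision \<open>m + N\<close> this factor cancels. The comparison of
  coefficients in the growth estimates produces exactly such equations.\<close>

lemma padic_eq_0I:
  assumes p: "p > 0" and a: "a \<in> carrier (padic_int p)"
    and "\<And>N. \<exists>m b. b \<in> carrier (padic_int p) \<and>
      padic_of_int p (int p ^ m) \<otimes>\<^bsub>padic_int p\<^esub> a = padic_of_int p (int p ^ (m + N)) \<otimes>\<^bsub>padic_int p\<^esub> b"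
  shows "a = \<zero>\<^bsub>padic_int p\<^esub>"
proof
  fix N
  obtain m b where b: "b \<in> carrier (padic_int p)"
    and eq: "padic_of_int p (int p ^ m) \<otimes>\<^bsub>padic_int p\<^esub> a = padic_of_int p (int p ^ (m + N)) \<otimes>\<^bsub>padic_int p\<^esub> b"
    using assms(3) by blast
  from fun_cong[OF eq, of "m + N"] have "int p ^ (m + N) dvd int p ^ m * a (m + N)"
    by (simp add: padic_mult padic_of_int_def mod_simps dvd_eq_mod_eq_0)
  then have "int p ^ N dvd a (m + N)" using p by (simp add: power_add)
  then show "a N = \<zero>\<^bsub>padic_int p\<^esub> N"
    using padic_mod[OF a, of N "m + N"] by (simp add: padic_zero dvd_eq_mod_eq_0)
qed

section \<open>Modules over the \<open>p\<close>-adic integers with a finite basis\<close>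

locale padic_module =
  fixes \<Lambda> :: "'a::ab_group_add set" and p :: nat and smul :: "(nat \<Rightarrow> int) \<Rightarrow> 'a \<Rightarrow> 'a"
  assumes prime_p: "normalization_semidom_class.prime p"
    and module_zero: "0 \<in> \<Lambda>" and module_diff: "v \<in> \<Lambda> \<Longrightarrow> w \<in> \<Lambda> \<Longrightarrow> v - w \<in> \<Lambda>"
    and smul_in: "c \<in> carrier (padic_int p) \<Longrightarrow> v \<in> \<Lambda> \<Longrightarrow> smul c v \<in> \<Lambda>"
    and smul_add_right: "c \<in> carrier (padic_int p) \<Longrightarrow> v \<in> \<Lambda> \<Longrightarrow> w \<in> \<Lambda> \<Longrightarrow>
      smul c (v + w) = smul c v + smul c w"
    and smul_add_left: "b \<in> carrier (padic_int p) \<Longrightarrow> c \<in> carrier (padic_int p) \<Longrightarrow> v \<in> \<Lambda> \<Longrightarrow>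
      smul (b \<oplus>\<^bsub>padic_int p\<^esub> c) v = smul b v + smul c v"
    and smul_mult: "b \<in> carrier (padic_int p) \<Longrightarrow> c \<in> carrier (padic_int p) \<Longrightarrow> v \<in> \<Lambda> \<Longrightarrow>
      smul (b \<otimes>\<^bsub>padic_int p\<^esub> c) v = smul b (smul c v)"
    and smul_one: "v \<in> \<Lambda> \<Longrightarrow> smul \<one>\<^bsub>padic_int p\<^esub> v = v"
begin

abbreviation Zp where "Zp \<equiv> carrier (padic_int p)"
abbreviation dig where "dig \<equiv> padic_of_int p"

lemma p_pos: "p > 0" using prime_p prime_gt_0_nat by blast

interpretation R: cring "padic_int p" by (rule cring_padic_int[OF p_pos])

lemmas dig_in = padic_of_int_closed[OF p_pos]

lemma smul_zero: "v \<in> \<Lambda> \<Longrightarrow> smul \<zero>\<^bsub>padic_int p\<^esub> v = 0"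
  using smul_add_left[of "\<zero>\<^bsub>padic_int p\<^esub>" "\<zero>\<^bsub>padic_int p\<^esub>" v] by simp

lemma smul_uminus: "c \<in> Zp \<Longrightarrow> v \<in> \<Lambda> \<Longrightarrow> smul (\<ominus>\<^bsub>padic_int p\<^esub> c) v = - smul c v"
  using smul_add_left[of "\<ominus>\<^bsub>padic_int p\<^esub> c" c v] by (simp add: R.l_neg smul_zero eq_neg_iff_add_eq_0)

lemma smul_diff: "b \<in> Zp \<Longrightarrow> c \<in> Zp \<Longrightarrow> v \<in> \<Lambda> \<Longrightarrow> smul (b \<ominus>\<^bsub>padic_int p\<^esub> c) v = smul b v - smul c v"
  by (simp add: R.minus_eq smul_add_left smul_uminus)

lemma module_sum: "(\<And>i. i \<in> I \<Longrightarrow> f i \<in> \<Lambda>) \<Longrightarrow> sum f I \<in> \<Lambda>"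
proof (induction I rule: infinite_finite_induct)
  case (insert i I)
  then have "f i - (0 - sum f I) \<in> \<Lambda>" by (intro module_diff module_zero) auto
  then show ?case using insert.hyps by simp
qed (simp_all add: module_zero)

lemma smul_zero_right: "c \<in> Zp \<Longrightarrow> smul c 0 = 0"
  using smul_add_right[of c 0 0] module_zero by simp

lemma smul_sum: "c \<in> Zp \<Longrightarrow> (\<And>i. i \<in> I \<Longrightarrow> f i \<in> \<Lambda>) \<Longrightarrow> smul c (sum f I) = (\<Sum>i\<in>I. smul c (f i))"
  by (induction I rule: infinite_finite_induct) (auto simp: smul_zero_right smul_add_right module_sum)

definition basis :: "nat \<Rightarrow> (nat \<Rightarrow> 'a) \<Rightarrow> bool" where
  "basis d x \<longleftrightarrow> x ` {1..d} \<subseteq> \<Lambda> \<and>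
     (\<forall>v\<in>\<Lambda>. \<exists>!c. c \<in> {1..d} \<rightarrow>\<^sub>E Zp \<and> v = (\<Sum>k\<in>{1..d}. smul (c k) (x k)))"

lemma basis_in: "basis d x \<Longrightarrow> x ` {1..d} \<subseteq> \<Lambda>" "basis d x \<Longrightarrow> k \<in> {1..d} \<Longrightarrow> x k \<in> \<Lambda>"
  by (auto simp: basis_def)

lemma basis_coeffs:
  assumes "basis d x" "v \<in> \<Lambda>"
  shows "\<exists>c. (\<forall>k\<in>{1..d}. c k \<in> Zp) \<and> v = (\<Sum>k\<in>{1..d}. smul (c k) (x k))"
proof -
  have "\<exists>!c. c \<in> {1..d} \<rightarrow>\<^sub>E Zp \<and> v = (\<Sum>k\<in>{1..d}. smul (c k) (x k))"
    using assms(1) unfolding basis_def by (rule conjunct2[THEN bspec]) (rule assms(2))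
  from ex1_implies_ex[OF this] show ?thesis by (auto simp: PiE_iff)
qed

lemma basis_unique:
  assumes "basis d x" "\<And>k. k \<in> {1..d} \<Longrightarrow> a k \<in> Zp" "\<And>k. k \<in> {1..d} \<Longrightarrow> b k \<in> Zp"
    and eq: "(\<Sum>k\<in>{1..d}. smul (a k) (x k)) = (\<Sum>k\<in>{1..d}. smul (b k) (x k))" and "k \<in> {1..d}"
  shows "a k = b k"
proof -
  have v: "(\<Sum>k\<in>{1..d}. smul (a k) (x k)) \<in> \<Lambda>" (is "?v \<in> _")
    using assms(2) basis_in(2)[OF assms(1)] by (intro module_sum smul_in) auto
  have ex1: "\<exists>!c. c \<in> {1..d} \<rightarrow>\<^sub>E Zp \<and> ?v = (\<Sum>k\<in>{1..d}. smul (c k) (x k))"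
    using assms(1) unfolding basis_def by (rule conjunct2[THEN bspec]) (rule v)
  have "restrict a {1..d} \<in> {1..d} \<rightarrow>\<^sub>E Zp \<and> ?v = (\<Sum>k\<in>{1..d}. smul (restrict a {1..d} k) (x k))"
    using assms(2) by auto
  moreover have "restrict b {1..d} \<in> {1..d} \<rightarrow>\<^sub>E Zp \<and> ?v = (\<Sum>k\<in>{1..d}. smul (restrict b {1..d} k) (x k))"
    unfolding eq using assms(3) by auto
  ultimately have "restrict a {1..d} = restrict b {1..d}" using ex1 unfolding Ex1_def by blast
  then show ?thesis using assms(5) by (metis restrict_apply')
qed

text \<open>The substantial clauses are checked in coordinates; for compactness the coordinates are
  treated one after the other with nested subsequences.\<close>

lemma compact_lattice_of_basis:
  assumes b: "basis d x"
  shows "compact_lattice \<Lambda> (smul (dig (int p)))"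
proof
  have pow: "(smul (dig (int p)) ^^ n) v = smul (dig (int p ^ n)) v" if "v \<in> \<Lambda>" for n v
    using that
  proof (induction n)
    case (Suc n)
    then show ?case by (simp add: smul_in dig_in padic_of_int_mult smul_mult)
  qed (simp add: padic_of_int_one smul_one)
  note xk = basis_in(2)[OF b]
  have smul_coeffs: "smul a (\<Sum>k\<in>{1..d}. smul (c k) (x k)) = (\<Sum>k\<in>{1..d}. smul (a \<otimes>\<^bsub>padic_int p\<^esub> c k) (x k))"
    if "a \<in> Zp" "\<forall>k\<in>{1..d}. c k \<in> Zp" for a c
    using that xk by (subst smul_sum) (auto simp: smul_mult smul_in intro!: sum.cong)
  show "0 \<in> \<Lambda>" "\<And>v w. v \<in> \<Lambda> \<Longrightarrow> w \<in> \<Lambda> \<Longrightarrow> v - w \<in> \<Lambda>" by (rule module_zero, rule module_diff)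
  show "\<And>v. v \<in> \<Lambda> \<Longrightarrow> smul (dig (int p)) v \<in> \<Lambda>" by (intro smul_in dig_in)
  show "\<And>v w. v \<in> \<Lambda> \<Longrightarrow> w \<in> \<Lambda> \<Longrightarrow> smul (dig (int p)) (v + w) = smul (dig (int p)) v + smul (dig (int p)) w"
    by (intro smul_add_right dig_in)
  { fix v assume v: "v \<in> \<Lambda>" "smul (dig (int p)) v = 0"
    obtain c where c: "\<forall>k\<in>{1..d}. c k \<in> Zp" "v = (\<Sum>k\<in>{1..d}. smul (c k) (x k))"
      using basis_coeffs[OF b v(1)] by blast
    have "c k = \<zero>\<^bsub>padic_int p\<^esub>" if k: "k \<in> {1..d}" for k
    proof -
      have "(\<Sum>k\<in>{1..d}. smul (dig (int p) \<otimes>\<^bsub>padic_int p\<^esub> c k) (x k)) = (\<Sum>k\<in>{1..d}. smul \<zero>\<^bsub>padic_int p\<^esub> (x k))"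
        using v(2) c smul_coeffs[OF dig_in c(1)] xk by (simp add: smul_zero)
      then have 0: "dig (int p) \<otimes>\<^bsub>padic_int p\<^esub> c k = \<zero>\<^bsub>padic_int p\<^esub>"
        using c(1) k by (intro basis_unique[OF b]) (auto simp: dig_in)
      show ?thesis
      proof (rule padic_eq_0I[OF p_pos])
        show "c k \<in> Zp" using c(1) k by blast
        show "\<exists>m b. b \<in> Zp \<and> dig (int p ^ m) \<otimes>\<^bsub>padic_int p\<^esub> c k = dig (int p ^ (m + N)) \<otimes>\<^bsub>padic_int p\<^esub> b" for N
          using 0 by (intro exI[of _ 1] exI[of _ "\<zero>\<^bsub>padic_int p\<^esub>"]) (simp add: dig_in)
      qed
    qed
    then show "v = 0" unfolding c(2) using xk by (simp add: smul_zero) }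
  { fix v assume v: "v \<in> \<Lambda>" "\<And>n. v \<in> (smul (dig (int p)) ^^ n) ` \<Lambda>"
    obtain c where c: "\<forall>k\<in>{1..d}. c k \<in> Zp" "v = (\<Sum>k\<in>{1..d}. smul (c k) (x k))"
      using basis_coeffs[OF b v(1)] by blast
    have "c k = \<zero>\<^bsub>padic_int p\<^esub>" if k: "k \<in> {1..d}" for k
    proof (rule padic_eq_0I[OF p_pos])
      show "c k \<in> Zp" using c(1) k by blast
      fix N
      obtain w where w: "w \<in> \<Lambda>" "v = smul (dig (int p ^ N)) w" using v(2)[of N] pow by auto
      obtain a where a: "\<forall>k\<in>{1..d}. a k \<in> Zp" "w = (\<Sum>k\<in>{1..d}. smul (a k) (x k))"
        using basis_coeffs[OF b w(1)] by blast
      have "(\<Sum>k\<in>{1..d}. smul (c k) (x k)) = (\<Sum>k\<in>{1..d}. smul (dig (int p ^ N) \<otimes>\<^bsub>padic_int p\<^esub> a k) (x k))"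
        using w(2) c(2) a(2) smul_coeffs[OF dig_in a(1)] by simp
      then have "c k = dig (int p ^ N) \<otimes>\<^bsub>padic_int p\<^esub> a k"
        using c(1) a(1) k by (intro basis_unique[OF b]) (auto simp: dig_in)
      then show "\<exists>m b. b \<in> Zp \<and> dig (int p ^ m) \<otimes>\<^bsub>padic_int p\<^esub> c k = dig (int p ^ (m + N)) \<otimes>\<^bsub>padic_int p\<^esub> b"
        using a(1) k by (intro exI[of _ 0] exI[of _ "a k"]) (simp add: padic_of_int_one dig_in)
    qed
    then show "v = 0" unfolding c(2) using xk by (simp add: smul_zero) }
  fix u :: "nat \<Rightarrow> 'a" assume u: "\<And>n. u n \<in> \<Lambda>"
  have "\<forall>n. \<exists>c. (\<forall>k\<in>{1..d}. c k \<in> Zp) \<and> u n = (\<Sum>k\<in>{1..d}. smul (c k) (x k))"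
    using basis_coeffs[OF b u] by blast
  from choice[OF this] obtain c where
    c: "\<And>n k. k \<in> {1..d} \<Longrightarrow> c n k \<in> Zp" "\<And>n. u n = (\<Sum>k\<in>{1..d}. smul (c n k) (x k))" by blast
  have "\<exists>\<sigma> l. strict_mono (\<sigma> :: nat \<Rightarrow> nat) \<and> (\<forall>k\<in>I. l k \<in> Zp \<and> (\<forall>n. c (\<sigma> n) k n = l k n))"
    if "finite I" "I \<subseteq> {1..d}" for I
    using that
  proof (induction I)
    case empty
    show ?case by (rule exI[of _ id]) (auto simp: strict_mono_def)
  next
    case (insert j I)
    then obtain \<sigma> l where \<sigma>: "strict_mono (\<sigma> :: nat \<Rightarrow> nat)"
      and l: "\<forall>k\<in>I. l k \<in> Zp \<and> (\<forall>n. c (\<sigma> n) k n = l k n)" by auto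
    have "c (\<sigma> n) j \<in> Zp" for n using c(1) insert.prems by blast
    from padic_seq_compact[of p "\<lambda>n. c (\<sigma> n) j", OF p_pos this] obtain \<tau> m where
      \<tau>: "strict_mono (\<tau> :: nat \<Rightarrow> nat)" "m \<in> Zp" "\<forall>n. c (\<sigma> (\<tau> n)) j n = m n" by blast
    have "c (\<sigma> (\<tau> n)) k n = l k n" if k: "k \<in> I" for k n
    proof -
      have le: "n \<le> \<tau> n" using strict_mono_imp_increasing[OF \<tau>(1)] .
      have "c (\<sigma> (\<tau> n)) k n = c (\<sigma> (\<tau> n)) k (\<tau> n) mod int p ^ n"
        using padic_mod[OF c(1) le] k insert.prems by auto
      also have "\<dots> = l k (\<tau> n) mod int p ^ n" using l k by simp
      also have "\<dots> = l k n" using padic_mod[OF _ le] l k by auto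
      finally show ?thesis .
    qed
    then show ?case
      using \<sigma> \<tau> l insert.hyps
      by (intro exI[of _ "\<sigma> \<circ> \<tau>"] exI[of _ "l(j := m)"]) (auto simp: strict_mono_def)
  qed
  from this[OF finite_atLeastAtMost order_refl] obtain \<sigma> l where \<sigma>: "strict_mono (\<sigma> :: nat \<Rightarrow> nat)"
    and l: "\<And>k. k \<in> {1..d} \<Longrightarrow> l k \<in> Zp" "\<And>k n. k \<in> {1..d} \<Longrightarrow> c (\<sigma> n) k n = l k n" by blast
  define v where "v = (\<Sum>k\<in>{1..d}. smul (l k) (x k))"
  have "u (\<sigma> n) - v \<in> (smul (dig (int p)) ^^ n) ` \<Lambda>" for n
  proof -
    \<comment> \<open>Scalars with the same residue modulo \<open>p^n\<close> have the same
      remainder in \<open>padic_decompose\<close>, so they differ by \<open>p^n\<close> times the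
      difference of the quotients.\<close>
    have "\<exists>a. a \<in> Zp \<and> smul (c (\<sigma> n) k) (x k) - smul (l k) (x k) = smul (dig (int p ^ n)) (smul a (x k))"
      if k: "k \<in> {1..d}" for k
    proof -
      obtain a1 where a1: "a1 \<in> Zp"
        "c (\<sigma> n) k = dig (l k n) \<oplus>\<^bsub>padic_int p\<^esub> dig (int p ^ n) \<otimes>\<^bsub>padic_int p\<^esub> a1"
        using padic_decompose[OF p_pos c(1)[OF k], of "\<sigma> n" n] l(2)[OF k] by auto
      obtain a2 where a2: "a2 \<in> Zp" "l k = dig (l k n) \<oplus>\<^bsub>padic_int p\<^esub> dig (int p ^ n) \<otimes>\<^bsub>padic_int p\<^esub> a2"
        using padic_decompose[OF p_pos l(1)[OF k], of n] by auto
      have 1: "smul (c (\<sigma> n) k) (x k) = smul (dig (l k n)) (x k) + smul (dig (int p ^ n)) (smul a1 (x k))"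
        by (subst a1(2)) (simp add: smul_add_left smul_mult dig_in a1(1) xk[OF k])
      have 2: "smul (l k) (x k) = smul (dig (l k n)) (x k) + smul (dig (int p ^ n)) (smul a2 (x k))"
        by (subst a2(2)) (simp add: smul_add_left smul_mult dig_in a2(1) xk[OF k])
      have "smul (dig (int p ^ n)) (smul a1 (x k)) - smul (dig (int p ^ n)) (smul a2 (x k)) =
          smul (dig (int p ^ n)) (smul (a1 \<ominus>\<^bsub>padic_int p\<^esub> a2) (x k))"
        using a1(1) a2(1) xk[OF k]
        by (simp add: smul_mult[symmetric] smul_diff[symmetric] dig_in smul_in R.r_minus R.r_distr R.minus_eq)
      then show ?thesis using a1(1) a2(1) 1 2 by (intro exI[of _ "a1 \<ominus>\<^bsub>padic_int p\<^esub> a2"]) auto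
    qed
    then have "\<forall>k\<in>{1..d}. \<exists>a. a \<in> Zp \<and> smul (c (\<sigma> n) k) (x k) - smul (l k) (x k) = smul (dig (int p ^ n)) (smul a (x k))"
      by blast
    from bchoice[OF this] obtain a where a: "\<And>k. k \<in> {1..d} \<Longrightarrow> a k \<in> Zp"
      "\<And>k. k \<in> {1..d} \<Longrightarrow> smul (c (\<sigma> n) k) (x k) - smul (l k) (x k) = smul (dig (int p ^ n)) (smul (a k) (x k))" by blast
    have "u (\<sigma> n) - v = (\<Sum>k\<in>{1..d}. smul (dig (int p ^ n)) (smul (a k) (x k)))"
      unfolding v_def c(2) sum_subtractf[symmetric] by (intro sum.cong a(2) refl)
    also have "\<dots> = smul (dig (int p ^ n)) (\<Sum>k\<in>{1..d}. smul (a k) (x k))"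
      using a(1) xk by (intro smul_sum[symmetric] dig_in smul_in) auto
    finally show ?thesis using a(1) xk pow by (auto intro!: image_eqI module_sum smul_in)
  qed
  moreover have "v \<in> \<Lambda>" unfolding v_def using l(1) xk by (intro module_sum smul_in) auto
  ultimately show "\<exists>\<sigma> l. strict_mono (\<sigma> :: nat \<Rightarrow> nat) \<and> l \<in> \<Lambda> \<and> (\<forall>n. u (\<sigma> n) - l \<in> (smul (dig (int p)) ^^ n) ` \<Lambda>)"
    using \<sigma> by blast
qed

end

locale padic_lattice_ops = lattice_ops \<Lambda> P \<Theta> + padic_module \<Lambda> p smul
  for \<Lambda> :: "'a::ab_group_add set" and P \<Theta> p smul +
  assumes P_eq_smul: "v \<in> \<Lambda> \<Longrightarrow> P v = smul (padic_of_int p (int p)) v"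
begin

interpretation R: cring "padic_int p" by (rule cring_padic_int[OF p_pos])

lemma endo_smul: "c \<in> Zp \<Longrightarrow> endo (smul c)"
  unfolding endo_def using smul_in smul_add_right
  by (auto simp: P_eq_smul dig_in smul_mult[symmetric] R.m_comm)

lemma Pow_eq_smul: "v \<in> \<Lambda> \<Longrightarrow> (P ^^ n) v = smul (dig (int p ^ n)) v"
proof (induction n)
  case 0
  then show ?case by (simp add: padic_of_int_one smul_one)
next
  case (Suc n)
  then show ?case
    by (simp add: P_eq_smul Pow_in smul_in dig_in padic_of_int_mult smul_mult)
qed

lemma smul_dig_nat_in: "csub N \<Longrightarrow> x \<in> N \<Longrightarrow> smul (dig (int k)) x \<in> N"
proof (induction k)
  case 0
  have "dig 0 = \<zero>\<^bsub>padic_int p\<^esub>" by (simp add: padic_of_int_def padic_zero)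
  then show ?case using 0 csub_0 csub_in by (simp add: smul_zero)
next
  case (Suc k)
  have "smul (dig (int (Suc k))) x = smul (dig 1) x + smul (dig (int k)) x"
    using Suc csub_in by (simp add: padic_of_int_add smul_add_left dig_in)
  then show ?case using Suc csub_in csub_add by (simp add: padic_of_int_one smul_one)
qed

lemma smul_approx:
  assumes "c \<in> Zp" "v \<in> \<Lambda>"
  shows "smul c v - smul (dig (c n)) v \<in> pw n \<Lambda>"
proof -
  obtain c' where c': "c' \<in> Zp" "c = dig (c n) \<oplus>\<^bsub>padic_int p\<^esub> dig (int p ^ n) \<otimes>\<^bsub>padic_int p\<^esub> c'"
    using padic_decompose[OF p_pos assms(1)] by blast
  have "smul c v = smul (dig (c n)) v + (P ^^ n) (smul c' v)"
    using assms c'(1) by (subst c'(2)) (simp add: smul_add_left smul_mult dig_in smul_in Pow_eq_smul)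
  then show ?thesis using c'(1) assms(2) by (auto simp: pw_def smul_in)
qed

text \<open>A scalar is approximated by its residues, which act as natural numbers; closedness
  passes to the limit.\<close>

lemma csub_smul:
  assumes N: "csub N" and "c \<in> Zp" "x \<in> N"
  shows "smul c x \<in> N"
proof (rule csub_closed[OF N])
  fix n
  have "smul (dig (c n)) x \<in> N"
    using smul_dig_nat_in[OF N assms(3), of "nat (c n)"] assms(2) by (simp add: padic_carrier)
  then show "smul c x \<in> N + pw n \<Lambda>"
    using smul_approx[OF assms(2) csub_in[OF N assms(3)]] unfolding mem_plus_iff by blast
qed (use assms csub_in smul_in in blast)

lemma smul_cong:
  assumes "b \<in> Zp" "c \<in> Zp" "v \<in> \<Lambda>" "b n = c n"
  shows "smul b v - smul c v \<in> pw n \<Lambda>"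
proof -
  have "smul b v - smul (dig (b n)) v - (smul c v - smul (dig (c n)) v) \<in> pw n \<Lambda>"
    by (intro pw_diff smul_approx assms)
  then show ?thesis unfolding assms(4) by simp
qed

section \<open>Lines, frames and the terms of a stratification\<close>

definition line :: "'a \<Rightarrow> 'a set" where
  "line x = (\<lambda>c. smul c x) ` Zp"

lemma self_in_line: "x \<in> \<Lambda> \<Longrightarrow> x \<in> line x"
  unfolding line_def using smul_one by (metis R.one_closed imageI)

lemma line_le: "csub N \<Longrightarrow> x \<in> N \<Longrightarrow> line x \<subseteq> N"
  unfolding line_def using csub_smul by blast

text \<open>Compactness of the scalars: a limit of multiples of \<open>x\<close> is again a multiple
  of \<open>x\<close>.\<close>

lemma csub_line:
  assumes x: "x \<in> \<Lambda>"
  shows "csub (line x)"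
proof (rule csubI)
  show "line x \<subseteq> \<Lambda>" using smul_in x by (auto simp: line_def)
  show "0 \<in> line x" unfolding line_def using smul_zero[OF x] by (metis R.zero_closed imageI)
  { fix v w assume "v \<in> line x" "w \<in> line x"
    then obtain b c where "b \<in> Zp" "c \<in> Zp" "v = smul b x" "w = smul c x" by (auto simp: line_def)
    then show "v - w \<in> line x" unfolding line_def using x
      by (intro image_eqI[of _ _ "b \<ominus>\<^bsub>padic_int p\<^esub> c"]) (auto simp: smul_diff) }
  { fix v assume "v \<in> line x"
    then obtain c where "c \<in> Zp" "v = smul c x" by (auto simp: line_def)
    then show "P v \<in> line x" unfolding line_def using x
      by (intro image_eqI[of _ _ "dig (int p) \<otimes>\<^bsub>padic_int p\<^esub> c"]) (auto simp: P_eq_smul smul_in smul_mult dig_in) }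
  fix v assume v: "v \<in> \<Lambda>" "\<And>n. v \<in> line x + pw n \<Lambda>"
  then have "\<forall>n. \<exists>c. c \<in> Zp \<and> v - smul c x \<in> pw n \<Lambda>" by (auto simp: mem_plus_iff line_def)
  from choice[OF this] obtain c where c: "\<And>n. c n \<in> Zp" "\<And>n. v - smul (c n) x \<in> pw n \<Lambda>" by auto
  from padic_seq_compact[of p c, OF p_pos c(1)]
  obtain \<sigma> l where \<sigma>: "strict_mono (\<sigma> :: nat \<Rightarrow> nat)" and l: "l \<in> Zp" "\<And>n. c (\<sigma> n) n = l n"
    by auto
  have "v - smul l x \<in> pw n \<Lambda>" for n
  proof -
    have 1: "v - smul (c (\<sigma> n)) x \<in> pw n \<Lambda>"
      using c(2)[of "\<sigma> n"] pw_antimono[OF csub_Lambda strict_mono_imp_increasing[OF \<sigma>, of n]] by blast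
    have 2: "smul (c (\<sigma> n)) x - smul l x \<in> pw n \<Lambda>" by (rule smul_cong[OF c(1) l(1) x l(2)])
    show ?thesis using pw_add[OF 1 2] by simp
  qed
  then have "v - smul l x = 0"
    using v(1) x l(1) by (intro separated) (auto simp: smul_in pw_def intro!: diff_in)
  then show "v \<in> line x" using l(1) by (auto simp: line_def)
qed

text \<open>In \<open>P v = w + c x\<close> the scalar \<open>c\<close> cannot be a unit, since
  \<open>x\<close> would then be divisible by \<open>p\<close> modulo \<open>W\<close>. Hence
  \<open>p\<close> divides \<open>c\<close>, and purity of \<open>W\<close> allows the equation to
  be divided by \<open>p\<close> modulo \<open>W\<close>.\<close>

lemma pure_plus_line:
  assumes W: "csub W" "pure W" and x: "x \<in> \<Lambda>" "x \<notin> W + pw 1 \<Lambda>"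
  shows "pure (W + line x)"
  unfolding pure_def
proof (intro ballI impI)
  fix v assume v: "v \<in> \<Lambda>" "P v \<in> W + line x"
  then obtain w c where wc: "w \<in> W" "c \<in> Zp" "P v = w + smul c x"
    by (auto simp: line_def dest!: mem_plusD)
  have "c 1 = 0"
  proof (rule ccontr)
    assume "c 1 \<noteq> 0"
    then obtain u where u: "u \<in> Zp" "u \<otimes>\<^bsub>padic_int p\<^esub> c = \<one>\<^bsub>padic_int p\<^esub>"
      using padic_inverse[OF prime_p wc(2)] by blast
    have "x = smul u (smul c x)" using u wc x smul_mult[of u c x] by (simp add: smul_one)
    also have "smul c x = P v - w" using wc(3) by simp
    also have "smul u (P v - w) = P (smul u v) - smul u w"
      using endo_diff[OF endo_smul[OF u(1)]] endo_P[OF endo_smul[OF u(1)]] v(1) csub_in[OF W(1) wc(1)]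
      by (simp add: P_in)
    finally have "x - smul u (- w) \<in> pw 1 \<Lambda>"
      using endo_uminus[OF endo_smul[OF u(1)]] csub_in[OF W(1) wc(1)] smul_in[OF u(1) v(1)]
      by (auto simp: pw_def)
    moreover have "smul u (- w) \<in> W" using csub_smul[OF W(1) u(1) csub_uminus[OF W(1) wc(1)]] .
    ultimately show False using x(2) unfolding mem_plus_iff by blast
  qed
  then obtain c' where c': "c' \<in> Zp" "c = dig 0 \<oplus>\<^bsub>padic_int p\<^esub> dig (int p ^ 1) \<otimes>\<^bsub>padic_int p\<^esub> c'"
    using padic_decompose[OF p_pos wc(2), of 1] by auto
  have "dig 0 = \<zero>\<^bsub>padic_int p\<^esub>" by (simp add: padic_of_int_def padic_zero)
  then have "smul c x = P (smul c' x)"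
    using c' x by (simp add: smul_mult dig_in smul_in P_eq_smul)
  then have "P (v - smul c' x) = w"
    using wc(3) v(1) c'(1) x(1) by (simp add: endo_diff[OF endo_P'] smul_in)
  then have "v - smul c' x \<in> W"
    using W(2) wc(1) v(1) c'(1) x(1) unfolding pure_def by (auto intro!: diff_in smul_in)
  then show "v \<in> W + line x"
    using c'(1) unfolding mem_plus_iff add.commute[of W] line_def by blast
qed

text \<open>For pure \<open>W\<close>, the list maps to a basis of \<open>M/W\<close>.\<close>

fun frame_rel :: "'a set \<Rightarrow> 'a list \<Rightarrow> 'a set \<Rightarrow> bool" where
  "frame_rel W [] M \<longleftrightarrow> W = M"
| "frame_rel W (x # xs) M \<longleftrightarrow> x \<in> \<Lambda> \<and> x \<notin> W + pw 1 \<Lambda> \<and> frame_rel (W + line x) xs M"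

lemma frame_rel_append: "frame_rel W xs M \<Longrightarrow> frame_rel M ys N \<Longrightarrow> frame_rel W (xs @ ys) N"
  by (induction xs arbitrary: W) auto

text \<open>Nakayama's lemma supplies a vector outside \<open>W + pw 1 \<Lambda>\<close> as long as
  \<open>W\<close> is smaller than \<open>M\<close>, and adjoining it raises
  \<open>rk\<close>.\<close>

lemma frame_rel_exists:
  assumes "csub W" "pure W" "csub M" "pure M" "W \<subseteq> M"
  shows "\<exists>xs. frame_rel W xs M \<and> set xs \<subseteq> M"
  using assms
proof (induction "rk M - rk W" arbitrary: W rule: less_induct)
  case less
  show ?case
  proof (cases "W = M")
    case True
    then show ?thesis by (intro exI[of _ "[]"]) auto
  next
    case False
    then obtain x where x: "x \<in> M" "x \<notin> W + pw 1 \<Lambda>" using nakayama_pure less.prems by blast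
    note x' = csub_in[OF less.prems(3) x(1)]
    have 1: "csub (W + line x)" using csub_plus[OF less.prems(1) csub_line[OF x']] .
    have 2: "W \<subseteq> W + line x" using le_plus_left[OF csub_0[OF csub_line[OF x']]] .
    have "x \<in> W + line x"
      using self_in_line[OF x'] le_plus_right[OF csub_0[OF less.prems(1)]] by blast
    moreover have "x \<notin> W" using x(2) le_plus_left[OF zero_pw[OF zero_in], of W 1] by blast
    ultimately have "W \<subset> W + line x" using 2 by blast
    moreover have le: "W + line x \<subseteq> M"
      using plus_le[OF less.prems(5) line_le[OF less.prems(3) x(1)] less.prems(3)] .
    moreover have pure: "pure (W + line x)" using pure_plus_line[OF less.prems(1,2) x' x(2)] .
    ultimately have "rk M - rk (W + line x) < rk M - rk W"
      using rk_less[OF less.prems(1) 1 pure] rk_less[OF less.prems(1,3,4)] by (metis diff_less_mono2 psubset_subset_trans)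
    from less.hyps[OF this 1 pure less.prems(3,4) le] obtain xs
      where "frame_rel (W + line x) xs M" "set xs \<subseteq> M" by blast
    then show ?thesis using x x' by (intro exI[of _ "x # xs"]) auto
  qed
qed

lemma frame_rel_not_mem: "frame_rel W xs M \<Longrightarrow> csub W \<Longrightarrow> x \<in> set xs \<Longrightarrow> x \<in> \<Lambda> \<and> x \<notin> W + pw 1 \<Lambda>"
proof (induction xs arbitrary: W)
  case (Cons y xs)
  then have "csub (W + line y)" "W \<subseteq> W + line y"
    using csub_plus csub_line le_plus_left[OF csub_0[OF csub_line]] by auto
  then show ?case using Cons set_plus_mono2[of W "W + line y" "pw 1 \<Lambda>"] by fastforce
qed simp

definition fl :: "nat \<Rightarrow> real \<Rightarrow> nat" where
  "fl i \<xi> = nat \<lfloor>real i * \<xi>\<rfloor>"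

definition terms :: "nat \<Rightarrow> ('a \<times> real) list \<Rightarrow> 'a set" where
  "terms i zs = sum_list (map (\<lambda>(x, \<xi>). pw (fl i \<xi>) (line x)) zs)"

lemma terms_simps [simp]:
  "terms i [] = {0}" "terms i ((x, \<xi>) # zs) = pw (fl i \<xi>) (line x) + terms i zs"
  "terms i (zs @ zs') = terms i zs + terms i zs'"
  by (simp_all add: terms_def set_zero)

lemma csub_terms: "fst ` set zs \<subseteq> \<Lambda> \<Longrightarrow> csub (terms i zs)"
  by (induction zs) (auto intro!: csub_plus csub_pw csub_line csub_zero)

lemma terms_le:
  assumes "fst ` set zs \<subseteq> \<Lambda>" "\<And>z. z \<in> set zs \<Longrightarrow> n \<le> fl i (snd z)"
  shows "terms i zs \<subseteq> pw n \<Lambda>"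
  using assms
proof (induction zs)
  case (Cons z zs)
  have "pw (fl i (snd z)) (line (fst z)) \<subseteq> pw n \<Lambda>"
    using pw_antimono[OF csub_Lambda Cons.prems(2)[of z]] pw_mono[OF csub_le[OF csub_line], of "fst z"] Cons.prems(1)
    by fastforce
  then show ?case
    using Cons plus_le[OF _ _ csub_pw[OF csub_Lambda]] by (cases z) auto
qed (simp add: zero_pw zero_in)

lemma frame_rel_pw:
  "frame_rel W xs M \<Longrightarrow> csub W \<Longrightarrow> pw (fl i \<eta>) M = pw (fl i \<eta>) W + terms i (map (\<lambda>x. (x, \<eta>)) xs)"
proof (induction xs arbitrary: W)
  case (Cons x xs)
  then have x: "x \<in> \<Lambda>" and "frame_rel (W + line x) xs M" by auto
  then have "pw (fl i \<eta>) M = pw (fl i \<eta>) (W + line x) + terms i (map (\<lambda>x. (x, \<eta>)) xs)"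
    using Cons csub_plus[OF Cons.prems(2) csub_line[OF x]] by blast
  then show ?case
    using pw_plus[OF csub_le[OF Cons.prems(2)] csub_le[OF csub_line[OF x]]] by (simp add: add.assoc)
qed simp

section \<open>Existence of stratifications\<close>

text \<open>Iteration controls \<open>aug^i\<close> only at multiples of \<open>r\<close>; the
  exponent known there differs from the exponent of the stratification by at most
  \<open>s\<close>.\<close>

lemma fl_fraction:
  assumes "0 < r"
  shows "s * (i div r) \<le> fl i (real s / real r)" "fl i (real s / real r) \<le> s * (i div r) + s"
proof -
  have fl: "fl i (real s / real r) = i * s div r"
    unfolding fl_def by (metis floor_divide_of_nat_eq nat_int of_nat_mult times_divide_eq_right)
  have "s * (i div r) = (r * (i div r) * s) div r" using assms by simp
  also have "\<dots> \<le> i * s div r" by (intro div_le_mono mult_right_mono) auto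
  finally show "s * (i div r) \<le> fl i (real s / real r)" unfolding fl .
  have "i \<le> r * (i div r) + r"
    using mult_div_mod_eq[of r i] mod_less_divisor[OF assms, of i] by linarith
  then have "i * s \<le> r * (s * (i div r) + s)"
    using mult_right_mono[of i "r * (i div r) + r" s] by (simp add: algebra_simps)
  then have "i * s div r \<le> r * (s * (i div r) + s) div r" by (rule div_le_mono)
  also have "\<dots> = s * (i div r) + s" using assms by simp
  finally show "fl i (real s / real r) \<le> s * (i div r) + s" unfolding fl .
qed

lemma fl_mono: "a \<le> b \<Longrightarrow> fl i a \<le> fl i b"
  unfolding fl_def by (intro nat_mono floor_mono mult_left_mono) auto

lemma fl_le: "0 \<le> a \<Longrightarrow> real (fl i a) \<le> real i * a"
  unfolding fl_def by simp

text \<open>Lets the bounded constants of an equivalence disappear when growth rates are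
  compared.\<close>

lemma le_of_multiples:
  assumes "\<And>j. real j * a \<le> real j * b + c"
  shows "a \<le> (b::real)"
proof (rule ccontr)
  assume "\<not> a \<le> b"
  then obtain j :: nat where "c < real j * (a - b)"
    using reals_Archimedean3[of "a - b"] by auto
  then show False using assms[of j] by (simp add: algebra_simps)
qed

text \<open>\<open>zs\<close> lists a frame of \<open>L/W\<close> together with the growth rate of a stratification of the series that
  is induced there.\<close>

definition strat :: "'a set \<Rightarrow> ('a \<times> real) list \<Rightarrow> nat \<Rightarrow> bool" where
  "strat W zs c \<longleftrightarrow> frame_rel W (map fst zs) \<Lambda> \<and> sorted (map snd zs) \<and>
     (\<forall>z\<in>set zs. 0 \<le> snd z \<and> snd z \<in> \<rat>) \<and>
     (\<forall>i. pw c (augp i \<Lambda>) \<subseteq> W + terms i zs \<and>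
        (\<forall>z\<in>set zs. pw (c + fl i (snd z)) (line (fst z)) \<subseteq> W + augp i \<Lambda>))"

text \<open>Controls the error \<open>m\<close> of a lift: it is congruent modulo \<open>p^n\<close>
  to a vector \<open>x\<close> whose \<open>p^a\<close>-multiple is divisible by \<open>p^n\<close>
  modulo \<open>W\<close>, and purity of \<open>M\<close> keeps the quotient inside
  \<open>M\<close>.\<close>

lemma mem_pure_modular:
  assumes W: "csub W" and M: "csub M" "pure M" "W \<subseteq> M"
    and B: "pw a B \<subseteq> W + pw n \<Lambda>" and m: "m \<in> M" "x \<in> B" "x - m \<in> pw n \<Lambda>"
  shows "(P ^^ a) m \<in> W + pw n M"
proof (rule pure_modular[OF M(2,1,3) Pow_in_csub[OF M(1) m(1)]])
  have "(P ^^ a) x \<in> W + pw n \<Lambda>" using B m(2) by (auto simp: pw_def)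
  moreover have 1: "(P ^^ a) (x - m) \<in> pw n \<Lambda>" using endo_pw[OF endo_Pow m(3)] .
  moreover have "(P ^^ a) m = (P ^^ a) x - (P ^^ a) (x - m)"
  proof -
    have "m \<in> \<Lambda>" using csub_in[OF M(1) m(1)] .
    moreover have "x \<in> \<Lambda>" using add_in[OF pw_in[OF m(3)] \<open>m \<in> \<Lambda>\<close>] by simp
    ultimately show ?thesis by (simp add: endo_diff[OF endo_Pow])
  qed
  moreover have "(P ^^ a) (x - m) \<in> W + pw n \<Lambda>" using 1 le_plus_right[OF csub_0[OF W]] by blast
  ultimately show "(P ^^ a) m \<in> W + pw n \<Lambda>"
    using csub_diff[OF csub_plus[OF W csub_pw[OF csub_Lambda]]] by simp
qed

text \<open>The inequality \<open>ge\<close> between the new rate and the later ones serves twice: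
  for monotonicity of the rates, and for the divisibility by \<open>p^n\<close> that
  \<open>mem_pure_modular\<close> requires.\<close>

lemma strat_step:
  assumes W: "stable W" "pure W" and sl: "slope W \<Lambda> r s C E"
    and M: "stable M" "W \<subset> M" "pw s M \<subseteq> W + augp r M"
    and IH: "strat (pure_closure M) zs' c'"
  shows "\<exists>zs c. strat W zs c"
proof -
  note cW = stable_csub[OF W(1)] and cM = stable_csub[OF M(1)]
  define M1 where "M1 = pure_closure M"
  have M1: "csub M1" "pure M1" "W \<subseteq> M1"
    unfolding M1_def using csub_pure_closure[OF cM] pure_pure_closure le_pure_closure[OF cM] M(2) by auto
  obtain k where k: "pw k M1 \<subseteq> M" using pw_pure_closure[OF cM] unfolding M1_def by blast
  from sl have r: "0 < r" and E: "stable E" "pw C \<Lambda> \<subseteq> E" "augp r E \<subseteq> W + pw s E" by (auto simp: slope_def)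
  note cE = stable_csub[OF E(1)]
  define \<eta> where "\<eta> = real s / real r"
  have aug_le: "pw C (augp (r * j) \<Lambda>) \<subseteq> W + pw (s * j) \<Lambda>" for j
  proof -
    have "pw C (augp (r * j) \<Lambda>) \<subseteq> augp (r * j) E"
      unfolding augp_pw[OF csub_Lambda, symmetric] by (rule augp_mono[OF E(2)])
    also have "\<dots> \<subseteq> W + pw (s * j) E" by (rule augp_iterate_le[OF W(1) cE E(3)])
    also have "\<dots> \<subseteq> W + pw (s * j) \<Lambda>" by (intro set_plus_mono2 pw_mono csub_le cE order_refl)
    finally show ?thesis .
  qed
  \<comment> \<open>\<open>C\<close> pays for passing from \<open>\<Lambda>\<close> to
    \<open>E\<close>, and \<open>s\<close> for rounding \<open>i\<close> down to a multiple of
    \<open>r\<close>.\<close>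
  have upper: "pw (s + C) (augp i \<Lambda>) \<subseteq> W + pw (fl i \<eta>) \<Lambda>" for i
  proof -
    have "augp i \<Lambda> \<subseteq> augp (r * (i div r)) \<Lambda>" by (intro augp_antimono[OF stable_Lambda]) simp
    then have "pw C (augp i \<Lambda>) \<subseteq> W + pw (s * (i div r)) \<Lambda>"
      using pw_mono[of _ _ C] aug_le by (meson order_trans)
    then have "pw s (pw C (augp i \<Lambda>)) \<subseteq> W + pw s (pw (s * (i div r)) \<Lambda>)"
      by (rule pw_plus_le[OF cW csub_pw[OF csub_Lambda]])
    moreover have "pw s (pw (s * (i div r)) \<Lambda>) \<subseteq> pw (fl i \<eta>) \<Lambda>"
      using fl_fraction(2)[OF r, of i s] unfolding pw_pw \<eta>_def
      by (intro pw_antimono[OF csub_Lambda]) simp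
    ultimately show ?thesis using set_plus_mono2[OF order_refl[of W]] unfolding pw_pw by blast
  qed
  \<comment> \<open>\<open>k\<close> pays for passing from the pure closure to \<open>M\<close>, and
    \<open>r\<close> for raising the index from a multiple of \<open>r\<close> to at least
    \<open>i\<close>, since \<open>aug^r N\<close> contains \<open>p^r N\<close>.\<close>
  have lower: "pw (k + r + fl i \<eta>) M1 \<subseteq> W + augp i \<Lambda>" for i
  proof -
    have "pw (k + r + fl i \<eta>) M1 = pw (r + fl i \<eta>) (pw k M1)" by (simp add: pw_pw ac_simps)
    also have "\<dots> \<subseteq> pw (r + fl i \<eta>) M" by (rule pw_mono[OF k])
    also have "\<dots> \<subseteq> pw r (pw (s * (i div r)) M)"
      using fl_fraction(1)[OF r, of s i] unfolding pw_pw \<eta>_def by (intro pw_antimono[OF cM]) simp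
    also have "\<dots> \<subseteq> W + pw r (augp (r * (i div r)) M)"
      by (intro pw_plus_le cW csub_augp cM augp_iterate_ge[OF W(1) cM M(3)])
    also have "\<dots> \<subseteq> W + augp i \<Lambda>"
    proof (rule set_plus_mono2[OF order_refl])
      have "pw r (augp (r * (i div r)) M) \<subseteq> augp (r + r * (i div r)) M"
        using pw_le_augp[OF csub_augp[OF cM], of r] by (simp add: augp_add)
      also have "\<dots> \<subseteq> augp i M"
        using mult_div_mod_eq[of r i] mod_less_divisor[OF r, of i] by (intro augp_antimono[OF M(1)]) linarith
      also have "\<dots> \<subseteq> augp i \<Lambda>" by (intro augp_mono csub_le cM)
      finally show "pw r (augp (r * (i div r)) M) \<subseteq> augp i \<Lambda>" .
    qed
    finally show ?thesis .
  qed
  from IH have zs': "frame_rel M1 (map fst zs') \<Lambda>" "sorted (map snd zs')"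
      "\<And>z. z \<in> set zs' \<Longrightarrow> 0 \<le> snd z \<and> snd z \<in> \<rat>"
    and up': "\<And>i. pw c' (augp i \<Lambda>) \<subseteq> M1 + terms i zs'"
    and low': "\<And>i z. z \<in> set zs' \<Longrightarrow> pw (c' + fl i (snd z)) (line (fst z)) \<subseteq> M1 + augp i \<Lambda>"
    unfolding strat_def M1_def by blast+
  have in\<Lambda>: "fst ` set zs' \<subseteq> \<Lambda>"
    using frame_rel_not_mem[OF zs'(1) M1(1)] by fastforce
  \<comment> \<open>At the indices \<open>r * j\<close>, a multiple of the frame vector by a power
    of \<open>p\<close> lies in the series modulo \<open>M1\<close>, hence is divisible by
    \<open>p^(s j)\<close> up to a bounded factor. The vector itself is not divisible by
    \<open>p\<close> modulo \<open>M1\<close>, so the exponent of that power falls short of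
    \<open>s * j\<close> by at most a constant.\<close>
  have ge: "\<eta> \<le> snd z" if z: "z \<in> set zs'" for z
  proof (rule le_of_multiples)
    fix j
    have x: "fst z \<in> \<Lambda>" "fst z \<notin> M1 + pw 1 \<Lambda>"
      using frame_rel_not_mem[OF zs'(1) M1(1), of "fst z"] z by auto
    define a where "a = C + (c' + fl (r * j) (snd z))"
    have "(P ^^ (c' + fl (r * j) (snd z))) (fst z) \<in> M1 + augp (r * j) \<Lambda>"
      using low'[OF z, of "r * j"] self_in_line[OF x(1)] by (auto simp: pw_def)
    moreover have "M1 + augp (r * j) \<Lambda> \<subseteq> \<Lambda>"
      using csub_le[OF csub_plus[OF M1(1) csub_augp[OF csub_Lambda]]] .
    moreover have "pw C (M1 + augp (r * j) \<Lambda>) \<subseteq> M1 + pw (s * j) \<Lambda>"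
    proof -
      have "pw C (M1 + augp (r * j) \<Lambda>) \<subseteq> M1 + pw C (augp (r * j) \<Lambda>)"
        by (rule pw_plus_le[OF M1(1) csub_augp[OF csub_Lambda] order_refl])
      moreover have "pw C (augp (r * j) \<Lambda>) \<subseteq> M1 + pw (s * j) \<Lambda>"
        using aug_le set_plus_mono2[OF M1(3) order_refl] by (meson order_trans)
      ultimately show ?thesis by (rule le_plus_trans[OF M1(1)])
    qed
    ultimately have a: "(P ^^ a) (fst z) \<in> M1 + pw (s * j) \<Lambda>"
      unfolding a_def funpow_add[of C] pw_def by auto
    have "s * j \<le> a"
    proof (rule ccontr)
      assume "\<not> s * j \<le> a"
      then obtain b where b: "s * j = a + Suc b" by (metis add_Suc_right less_imp_Suc_add not_le)
      then have "fst z \<in> M1 + pw (Suc b) \<Lambda>"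
        using pure_cancel[OF M1(2,1) csub_Lambda x(1), of a "Suc b"] a by simp
      then show False
        using x(2) set_plus_mono2[OF order_refl[of M1] pw_antimono[OF csub_Lambda, of 1 "Suc b"]] by auto
    qed
    then have "real (s * j) \<le> real a" by linarith
    also have "\<dots> \<le> real (C + c') + real (r * j) * snd z"
      using fl_le[of "snd z" "r * j"] zs'(3)[OF z] by (simp add: a_def)
    finally have "real (s * j) / real r \<le> (real (C + c') + real (r * j) * snd z) / real r"
      using r by (intro divide_right_mono) auto
    then show "real j * \<eta> \<le> real j * snd z + real (C + c') / real r"
      using r by (simp add: \<eta>_def add_divide_distrib ac_simps)
  qed
  obtain ys where ys: "frame_rel W ys M1" "set ys \<subseteq> M1"
    using frame_rel_exists[OF cW W(2) M1] by blast
  define zs where "zs = map (\<lambda>y. (y, \<eta>)) ys @ zs'"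
  \<comment> \<open>The losses of \<open>lower\<close>, of \<open>upper\<close> and of the induction
    hypothesis; the later frame vectors incur all of them in succession.\<close>
  define c where "c = k + r + (s + C) + c'"
  have cT: "csub (terms i zs')" for i using csub_terms[OF in\<Lambda>] .
  have leT: "terms i zs' \<subseteq> pw (fl i \<eta>) \<Lambda>" for i
    using ge by (intro terms_le[OF in\<Lambda>] fl_mono)
  have cy: "csub (terms i (map (\<lambda>y. (y, \<eta>)) ys))" for i
    using ys(2) csub_le[OF M1(1)] by (intro csub_terms) auto
  have main1: "pw c (augp i \<Lambda>) \<subseteq> W + terms i zs" for i
  proof -
    define n where "n = fl i \<eta>"
    have "(P ^^ (s + C)) ((P ^^ c') x) \<in> W + terms i zs" if x: "x \<in> augp i \<Lambda>" for x
    proof -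
      have px: "(P ^^ c') x \<in> augp i \<Lambda>" using Pow_in_csub[OF csub_augp[OF csub_Lambda] x] .
      have "(P ^^ c') x \<in> M1 + terms i zs'" using up'[of i] x by (auto simp: pw_def)
      then obtain m f where mf: "m \<in> M1" "f \<in> terms i zs'" "(P ^^ c') x = m + f" by (auto dest!: mem_plusD)
      \<comment> \<open>The difference is \<open>f\<close>, which is divisible by \<open>p^n\<close>
        because the later rates are at least \<open>\<eta>\<close>.\<close>
      have "(P ^^ c') x - m \<in> pw n \<Lambda>" using mf leT[of i] by (auto simp: n_def)
      then have "(P ^^ (s + C)) m \<in> W + pw n M1"
        using upper[of i] px by (intro mem_pure_modular[OF cW M1 _ mf(1)]) (auto simp: n_def)
      moreover have "W + pw n M1 \<subseteq> W + terms i (map (\<lambda>y. (y, \<eta>)) ys)"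
        unfolding n_def frame_rel_pw[OF ys(1) cW]
        using pw_csub_le[OF cW] by (intro plus_plus_le[OF cW _ cy] set_plus_mono2) auto
      moreover have "(P ^^ (s + C)) f \<in> terms i zs'" using Pow_in_csub[OF cT mf(2)] .
      moreover have "(P ^^ (s + C)) ((P ^^ c') x) = (P ^^ (s + C)) m + (P ^^ (s + C)) f"
        unfolding mf(3) using csub_in[OF M1(1) mf(1)] csub_in[OF cT mf(2)] by (intro endo_add[OF endo_Pow])
      ultimately show ?thesis by (auto simp: zs_def add.assoc[symmetric] intro!: set_plus_intro)
    qed
    then have "pw (s + C + c') (augp i \<Lambda>) \<subseteq> W + terms i zs"
      by (auto simp: pw_def funpow_add)
    moreover have "pw c (augp i \<Lambda>) \<subseteq> pw (s + C + c') (augp i \<Lambda>)"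
      by (intro pw_antimono csub_augp csub_Lambda) (simp add: c_def)
    ultimately show ?thesis by blast
  qed
  have main2: "pw (c + fl i (snd z)) (line (fst z)) \<subseteq> W + augp i \<Lambda>" if z: "z \<in> set zs" for i z
  proof -
    consider "z \<in> set (map (\<lambda>y. (y, \<eta>)) ys)" | "z \<in> set zs'" using z by (auto simp: zs_def)
    then show ?thesis
    proof cases
      case 1
      then have y: "fst z \<in> M1" "snd z = \<eta>" using ys(2) by auto
      have "pw (c + fl i \<eta>) (line (fst z)) \<subseteq> pw (c + fl i \<eta>) M1"
        using line_le[OF M1(1) y(1)] by (rule pw_mono)
      also have "\<dots> \<subseteq> pw (k + r + fl i \<eta>) M1" by (intro pw_antimono M1) (simp add: c_def)
      also have "\<dots> \<subseteq> W + augp i \<Lambda>" by (rule lower)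
      finally show ?thesis by (simp add: y)
    next
      case 2
      define n where "n = fl i \<eta>"
      define b where "b = c' + fl i (snd z)"
      have cl: "csub (line (fst z))" using csub_line in\<Lambda> 2 by auto
      have cA: "csub (augp i \<Lambda>)" using csub_augp[OF csub_Lambda] .
      have "n \<le> b" using fl_mono[OF ge[OF 2], of i] by (simp add: n_def b_def)
      have "(P ^^ (k + r)) ((P ^^ (s + C)) y) \<in> W + augp i \<Lambda>" if y: "y \<in> pw b (line (fst z))" for y
      proof -
        have "y \<in> M1 + augp i \<Lambda>" using low'[OF 2, of i] y by (auto simp: b_def)
        then obtain m a where ma: "m \<in> M1" "a \<in> augp i \<Lambda>" "y = m + a" by (auto dest!: mem_plusD)
        have yn: "y \<in> pw n \<Lambda>"
          using y pw_mono[OF csub_le[OF cl], of b] pw_antimono[OF csub_Lambda \<open>n \<le> b\<close>] by blast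
        have "- y = - a - m" using ma(3) by (simp add: algebra_simps)
        \<comment> \<open>The roles are exchanged here: \<open>y\<close> itself is divisible by
          \<open>p^n\<close>, so the error \<open>m\<close> is congruent to the vector
          \<open>- a\<close> of the series.\<close>
        then have "(- a) - m \<in> pw n \<Lambda>" using pw_uminus[OF yn] by metis
        then have "(P ^^ (s + C)) m \<in> W + pw n M1"
          using upper[of i] csub_uminus[OF cA ma(2)]
          by (intro mem_pure_modular[OF cW M1 _ ma(1)]) (auto simp: n_def)
        then have "(P ^^ (k + r)) ((P ^^ (s + C)) m) \<in> pw (k + r) (W + pw n M1)" by (auto simp: pw_def)
        also have "\<dots> \<subseteq> W + pw (k + r + n) M1"
          using pw_plus_le[OF cW csub_pw[OF M1(1)] order_refl, of "k + r" n] by (simp add: pw_pw)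
        also have "\<dots> \<subseteq> W + augp i \<Lambda>"
          unfolding n_def by (intro plus_plus_le[OF cW lower cA])
        finally have 1: "(P ^^ (k + r)) ((P ^^ (s + C)) m) \<in> W + augp i \<Lambda>" .
        have 2: "(P ^^ (k + r)) ((P ^^ (s + C)) a) \<in> W + augp i \<Lambda>"
          using Pow_in_csub[OF cA Pow_in_csub[OF cA ma(2)]] le_plus_right[OF csub_0[OF cW]] by blast
        have "(P ^^ (k + r)) ((P ^^ (s + C)) y) =
            (P ^^ (k + r)) ((P ^^ (s + C)) m) + (P ^^ (k + r)) ((P ^^ (s + C)) a)"
          unfolding ma(3) using csub_in[OF M1(1) ma(1)] csub_in[OF cA ma(2)]
          by (simp add: endo_add[OF endo_Pow] Pow_in)
        then show ?thesis using csub_add[OF csub_plus[OF cW cA] 1 2] by simp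
      qed
      then have "pw (k + r) (pw (s + C) (pw b (line (fst z)))) \<subseteq> W + augp i \<Lambda>"
        unfolding pw_def[of "k + r"] pw_def[of "s + C"] by blast
      moreover have "k + r + (s + C + b) = c + fl i (snd z)" by (simp add: c_def b_def)
      ultimately show ?thesis unfolding pw_pw by simp
    qed
  qed
  have "frame_rel W (map fst zs) \<Lambda>"
    using frame_rel_append[OF ys(1) zs'(1)] by (simp add: zs_def comp_def)
  moreover have "sorted (map snd zs)"
    using zs'(2) ge by (auto simp: zs_def sorted_append comp_def map_replicate_const)
  moreover have "0 \<le> snd z \<and> snd z \<in> \<rat>" if "z \<in> set zs" for z
    using that zs'(3)[of z] by (auto simp: zs_def \<eta>_def)
  ultimately have "strat W zs c" using main1 main2 by (simp add: strat_def)
  then show ?thesis by blast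
qed

lemma strat_exists:
  assumes "stable W" "pure W"
  shows "\<exists>zs c. strat W zs c"
  using assms
proof (induction "rk \<Lambda> - rk W" arbitrary: W rule: less_induct)
  case less
  note W = less.prems
  show ?case
  proof (cases "W = \<Lambda>")
    case True
    have "augp i \<Lambda> \<subseteq> \<Lambda> + {0}" for i
      using csub_le[OF csub_augp[OF csub_Lambda], of i] le_plus_left[of "{0}" \<Lambda>] by simp
    then have "strat W [] 0" using True by (simp add: strat_def)
    then show ?thesis by blast
  next
    case False
    then have W\<Lambda>: "W \<subset> \<Lambda>" using csub_le[OF stable_csub[OF W(1)]] by blast
    from slope_exists[OF W W\<Lambda>] obtain r s C E where sl: "slope W \<Lambda> r s C E" by blast
    from slow_submodule[OF W W\<Lambda> sl] obtain M where
      M: "stable M" "W \<subset> M" "pw s M \<subseteq> W + augp r M" by blast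
    note M1 = stable_pure_closure[OF M(1)] pure_pure_closure[of M]
    have "W \<subset> pure_closure M" using M(2) le_pure_closure[OF stable_csub[OF M(1)]] by blast
    then have "rk \<Lambda> - rk (pure_closure M) < rk \<Lambda> - rk W"
      using rk_less[OF stable_csub[OF W(1)] stable_csub[OF M1(1)] M1(2)]
        rk_le[OF stable_csub[OF M1(1)]] by linarith
    from less.hyps[OF this M1] obtain zs' c' where "strat (pure_closure M) zs' c'" by blast
    then show ?thesis by (rule strat_step[OF W sl M])
  qed
qed

section \<open>Growth rates\<close>

text \<open>A sum of sets. With all exponents zero it is the span of the \<open>x k\<close>; with
  floors as exponents it is a term of a stratification.\<close>

definition tsub :: "(nat \<Rightarrow> 'a) \<Rightarrow> nat set \<Rightarrow> (nat \<Rightarrow> nat) \<Rightarrow> 'a set" where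
  "tsub x I m = (\<Sum>k\<in>I. pw (m k) (line (x k)))"

lemma csub_tsub: "x ` I \<subseteq> \<Lambda> \<Longrightarrow> csub (tsub x I m)"
  unfolding tsub_def
  by (induction I rule: infinite_finite_induct)
    (auto simp: set_zero csub_zero intro!: csub_plus csub_pw csub_line)

lemma mem_tsub:
  assumes "finite I"
  shows "v \<in> tsub x I m \<longleftrightarrow> (\<exists>c. (\<forall>k\<in>I. c k \<in> Zp) \<and> v = (\<Sum>k\<in>I. (P ^^ m k) (smul (c k) (x k))))"
proof
  assume "v \<in> tsub x I m"
  then obtain s where s: "\<forall>k\<in>I. s k \<in> pw (m k) (line (x k))" "v = sum s I"
    unfolding tsub_def set_sum_alt[OF assms] by blast
  from s(1) have "\<forall>k\<in>I. \<exists>c. c \<in> Zp \<and> s k = (P ^^ m k) (smul c (x k))"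
    by (fastforce simp: pw_def line_def)
  from bchoice[OF this] obtain c where "\<forall>k\<in>I. c k \<in> Zp \<and> s k = (P ^^ m k) (smul (c k) (x k))" by blast
  then show "\<exists>c. (\<forall>k\<in>I. c k \<in> Zp) \<and> v = (\<Sum>k\<in>I. (P ^^ m k) (smul (c k) (x k)))"
    using s(2) by (intro exI[of _ c]) auto
next
  assume "\<exists>c. (\<forall>k\<in>I. c k \<in> Zp) \<and> v = (\<Sum>k\<in>I. (P ^^ m k) (smul (c k) (x k)))"
  then obtain c where "\<forall>k\<in>I. c k \<in> Zp" "v = (\<Sum>k\<in>I. (P ^^ m k) (smul (c k) (x k)))" by blast
  then show "v \<in> tsub x I m"
    unfolding tsub_def set_sum_alt[OF assms] by (auto simp: pw_def line_def)
qed

lemma tsubE: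
  assumes "v \<in> tsub x I m" "finite I"
  obtains c where "\<And>k. k \<in> I \<Longrightarrow> c k \<in> Zp" "v = (\<Sum>k\<in>I. (P ^^ m k) (smul (c k) (x k)))"
  using assms(1) unfolding mem_tsub[OF assms(2)] by blast

lemma line_le_tsub:
  assumes "finite I" "x ` I \<subseteq> \<Lambda>" "j \<in> I" "m j \<le> n"
  shows "pw n (line (x j)) \<subseteq> tsub x I m"
proof -
  have x: "x j \<in> \<Lambda>" using assms by blast
  have "pw n (line (x j)) \<subseteq> pw (m j) (line (x j))"
    using pw_antimono[OF csub_line[OF x] assms(4)] .
  also have "\<dots> \<subseteq> pw (m j) (line (x j)) + tsub x (I - {j}) m"
    using assms(2) by (intro le_plus_left csub_0 csub_tsub) auto
  also have "\<dots> = tsub x I m" unfolding tsub_def using assms by (simp add: sum.remove)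
  finally show ?thesis .
qed

lemma tsub_le:
  assumes N: "csub N" and "\<And>k. k \<in> I \<Longrightarrow> pw (m k) (line (x k)) \<subseteq> N"
  shows "tsub x I m \<subseteq> N"
  unfolding tsub_def using assms(2)
proof (induction I rule: infinite_finite_induct)
  case (insert k I)
  then have "pw (m k) (line (x k)) + (\<Sum>k\<in>I. pw (m k) (line (x k))) \<subseteq> N"
    by (intro plus_le[OF _ _ N]) auto
  then show ?case using insert.hyps by simp
qed (auto simp: set_zero csub_0[OF N])

lemma pw_tsub:
  "x ` I \<subseteq> \<Lambda> \<Longrightarrow> pw n (tsub x I m) = tsub x I (\<lambda>k. n + m k)"
proof (induction I rule: infinite_finite_induct)
  case (insert k I)
  then have 1: "csub (tsub x I m)" "csub (pw (m k) (line (x k)))" by (auto intro: csub_tsub csub_pw csub_line)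
  have "pw n (tsub x (insert k I) m) = pw n (pw (m k) (line (x k)) + tsub x I m)"
    using insert by (simp add: tsub_def)
  also have "\<dots> = pw (n + m k) (line (x k)) + pw n (tsub x I m)"
    using pw_plus[OF csub_le[OF 1(2)] csub_le[OF 1(1)]] by (simp add: pw_pw)
  finally show ?case using insert by (simp add: tsub_def)
qed (auto simp: tsub_def set_zero pw_def endo_0[OF endo_Pow])

text \<open>The residues of \<open>c\<close> vanish one after another: once \<open>p^n\<close>
  divides \<open>c\<close> it cancels by purity, and a unit as quotient would put \<open>x\<close>
  into \<open>W\<close>.\<close>

lemma smul_mem_pure:
  assumes W: "csub W" "pure W" and x: "x \<in> \<Lambda>" "x \<notin> W + pw 1 \<Lambda>" and c: "c \<in> Zp" "smul c x \<in> W"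
  shows "c = \<zero>\<^bsub>padic_int p\<^esub>"
proof -
  have "c n = 0" for n
  proof (induction n)
    case 0
    show ?case using c(1) unfolding padic_carrier by (auto dest: spec[of _ 0])
  next
    case (Suc n)
    have "dig 0 = \<zero>\<^bsub>padic_int p\<^esub>" by (simp add: padic_of_int_def padic_zero)
    then obtain c' where c': "c' \<in> Zp" "c = dig (int p ^ n) \<otimes>\<^bsub>padic_int p\<^esub> c'"
      using padic_decompose[OF p_pos c(1), of n] Suc by (auto simp: dig_in)
    have "(P ^^ n) (smul c' x) \<in> W"
      using c(2) c' x(1) by (simp add: Pow_eq_smul smul_in smul_mult dig_in)
    then have 1: "smul c' x \<in> W" using pure_Pow[OF W(2)] smul_in c'(1) x(1) by blast
    have "c' 1 = 0"
    proof (rule ccontr)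
      assume "c' 1 \<noteq> 0"
      then obtain u where u: "u \<in> Zp" "u \<otimes>\<^bsub>padic_int p\<^esub> c' = \<one>\<^bsub>padic_int p\<^esub>"
        using padic_inverse[OF prime_p c'(1)] by blast
      then have "x = smul u (smul c' x)" using c'(1) x(1) smul_mult[of u c' x] by (simp add: smul_one)
      then have "x \<in> W" using csub_smul[OF W(1) u(1) 1] by simp
      then show False using x(2) le_plus_left[OF zero_pw[OF zero_in], of W 1] by blast
    qed
    then have "int p dvd c' (Suc n)" using padic_mod[OF c'(1), of 1 "Suc n"] by (auto simp: dvd_eq_mod_eq_0)
    then have "int p ^ Suc n dvd int p ^ n * c' (Suc n)" by (simp add: mult.commute[of "int p"] mult_dvd_mono)
    moreover have "c (Suc n) = (int p ^ n * c' (Suc n)) mod int p ^ Suc n"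
      by (subst c'(2)) (simp add: padic_mult padic_of_int_def mod_simps)
    ultimately show ?case by (simp add: dvd_eq_mod_eq_0)
  qed
  then show ?thesis by (auto simp: padic_zero)
qed

text \<open>Modulo \<open>W + line x\<close> the first vector disappears, so the induction removes
  all later coefficients before \<open>smul_mem_pure\<close> treats the first.\<close>

lemma frame_rel_independent:
  assumes "frame_rel W xs M" "csub W" "pure W" "\<And>k. k < length xs \<Longrightarrow> c k \<in> Zp"
    and "(\<Sum>k<length xs. smul (c k) (xs ! k)) \<in> W" "k < length xs"
  shows "c k = \<zero>\<^bsub>padic_int p\<^esub>"
  using assms
proof (induction xs arbitrary: W c k)
  case (Cons x xs)
  then have x: "x \<in> \<Lambda>" "x \<notin> W + pw 1 \<Lambda>" and fr: "frame_rel (W + line x) xs M" by auto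
  have csub': "csub (W + line x)" using csub_plus[OF Cons.prems(2) csub_line[OF x(1)]] .
  define v where "v = (\<Sum>k<length xs. smul (c (Suc k)) (xs ! k))"
  have c0: "c 0 \<in> Zp" using Cons.prems(4)[of 0] by simp
  have sum: "smul (c 0) x + v \<in> W"
    using Cons.prems(5) by (simp only: length_Cons sum.lessThan_Suc_shift v_def nth_Cons_0 nth_Cons_Suc)
  have "smul (\<ominus>\<^bsub>padic_int p\<^esub> c 0) x \<in> line x" using c0 by (simp add: line_def)
  from set_plus_intro[OF sum this] have v: "v \<in> W + line x" using c0 x(1) by (simp add: smul_uminus)
  have 1: "c (Suc k) = \<zero>\<^bsub>padic_int p\<^esub>" if "k < length xs" for k
  proof (rule Cons.IH[OF fr csub' pure_plus_line[OF Cons.prems(2,3) x] _ v[unfolded v_def] that])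
    fix k assume "k < length xs"
    then show "c (Suc k) \<in> Zp" using Cons.prems(4)[of "Suc k"] by simp
  qed
  have "xs ! k \<in> \<Lambda>" if "k < length xs" for k
    using frame_rel_not_mem[OF fr csub'] that by simp
  then have "v = 0" unfolding v_def using 1 by (simp add: smul_zero)
  then have "c 0 = \<zero>\<^bsub>padic_int p\<^esub>" using smul_mem_pure[OF Cons.prems(2,3) x c0] sum by simp
  then show ?case using 1 Cons.prems(6) by (cases k) auto
qed simp

lemma terms_eq_tsub:
  "terms i zs = tsub (\<lambda>k. fst (zs ! (k - 1))) {1..length zs} (\<lambda>k. fl i (snd (zs ! (k - 1))))"
proof -
  have "terms i zs = (\<Sum>k<length zs. pw (fl i (snd (zs ! k))) (line (fst (zs ! k))))"
    unfolding terms_def sum_list_sum_nth by (simp add: case_prod_unfold atLeast0LessThan)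
  then show ?thesis
    unfolding tsub_def One_nat_def sum.atLeast1_atMost_eq by simp
qed

lemma frame_rel_basis:
  assumes "frame_rel {0} xs \<Lambda>"
  shows "basis (length xs) (\<lambda>k. xs ! (k - 1))"
  unfolding basis_def
proof (intro conjI ballI)
  define x where "x k = xs ! (k - 1)" for k
  have in\<Lambda>: "set xs \<subseteq> \<Lambda>" using frame_rel_not_mem[OF assms csub_zero] by blast
  then show "(\<lambda>k. xs ! (k - 1)) ` {1..length xs} \<subseteq> \<Lambda>" by (auto simp: subset_iff)
  \<comment> \<open>With exponent zero, \<open>frame_rel_pw\<close> says that the frame
    spans.\<close>
  have "fl 0 0 = 0" by (simp add: fl_def)
  then have "\<Lambda> = {0} + terms 0 (map (\<lambda>x. (x, 0)) xs)"
    using frame_rel_pw[OF assms csub_zero, of 0 0] by simp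
  also have "terms 0 (map (\<lambda>x. (x, 0)) xs) = tsub x {1..length xs} (\<lambda>_. 0)"
    unfolding terms_eq_tsub tsub_def x_def length_map
    using \<open>fl 0 0 = 0\<close> by (intro sum.cong) auto
  finally have \<Lambda>: "\<Lambda> = tsub x {1..length xs} (\<lambda>_. 0)" by (simp add: set_zero)
  fix v assume "v \<in> \<Lambda>"
  then obtain c where c: "\<forall>k\<in>{1..length xs}. c k \<in> Zp" "v = (\<Sum>k\<in>{1..length xs}. smul (c k) (x k))"
    unfolding \<Lambda> by (auto simp: mem_tsub)
  show "\<exists>!c. c \<in> {1..length xs} \<rightarrow>\<^sub>E Zp \<and> v = (\<Sum>k\<in>{1..length xs}. smul (c k) (xs ! (k - 1)))"
  proof (intro ex1I[of _ "restrict c {1..length xs}"] conjI)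
    show "restrict c {1..length xs} \<in> {1..length xs} \<rightarrow>\<^sub>E Zp" using c(1) by auto
    show "v = (\<Sum>k\<in>{1..length xs}. smul (restrict c {1..length xs} k) (xs ! (k - 1)))"
      unfolding c(2) x_def by (intro sum.cong) auto
    fix b assume b: "b \<in> {1..length xs} \<rightarrow>\<^sub>E Zp \<and> v = (\<Sum>k\<in>{1..length xs}. smul (b k) (xs ! (k - 1)))"
    have x_in: "x k \<in> \<Lambda>" if "k \<in> {1..length xs}" for k
      using in\<Lambda> that by (auto simp: x_def subset_iff)
    have "0 = (\<Sum>k\<in>{1..length xs}. smul (b k) (x k)) - (\<Sum>k\<in>{1..length xs}. smul (c k) (x k))"
      using b c by (simp add: x_def)
    also have "\<dots> = (\<Sum>k\<in>{1..length xs}. smul (b k \<ominus>\<^bsub>padic_int p\<^esub> c k) (x k))"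
      unfolding sum_subtractf[symmetric]
    proof (intro sum.cong refl)
      fix k assume k: "k \<in> {1..length xs}"
      then have "b k \<in> Zp" "c k \<in> Zp" using b c(1) by auto
      then show "smul (b k) (x k) - smul (c k) (x k) = smul (b k \<ominus>\<^bsub>padic_int p\<^esub> c k) (x k)"
        using smul_diff x_in[OF k] by simp
    qed
    also have "\<dots> = (\<Sum>k<length xs. smul (b (Suc k) \<ominus>\<^bsub>padic_int p\<^esub> c (Suc k)) (xs ! k))"
      unfolding One_nat_def sum.atLeast1_atMost_eq by (simp add: x_def)
    finally have 0: "(\<Sum>k<length xs. smul (b (Suc k) \<ominus>\<^bsub>padic_int p\<^esub> c (Suc k)) (xs ! k)) \<in> {0}" by simp
    have "b k = c k" if k: "k \<in> {1..length xs}" for k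
    proof -
      obtain l where l: "k = Suc l" "l < length xs" using k by (cases k) auto
      have "b (Suc l) \<ominus>\<^bsub>padic_int p\<^esub> c (Suc l) = \<zero>\<^bsub>padic_int p\<^esub>"
        using b c(1) l(2)
        by (intro frame_rel_independent[OF assms csub_zero pure_zero _ 0 l(2)]) (auto intro!: R.minus_closed)
      moreover have "b k \<in> Zp" "c k \<in> Zp" using b c(1) k by auto
      ultimately show ?thesis by (simp add: l(1) R.r_right_minus_eq)
    qed
    then show "b = restrict c {1..length xs}" using b by (intro ext) (auto simp: PiE_def extensional_def)
  qed
qed

text \<open>A basis stays independent modulo \<open>p\<close>. The subset \<open>I\<close> admits
  the initial segments that occur in the comparison of growth rates.\<close>

lemma basis_independent_mod:
  assumes "basis d x" "I \<subseteq> {1..d}" "\<And>k. k \<in> I \<Longrightarrow> a k \<in> Zp" "(\<Sum>k\<in>I. smul (a k) (x k)) \<in> pw 1 \<Lambda>" "k \<in> I"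
  shows "a k 1 = 0"
proof -
  define b where "b k = (if k \<in> I then a k else \<zero>\<^bsub>padic_int p\<^esub>)" for k
  have b: "b k \<in> Zp" for k using assms(3) by (simp add: b_def)
  have "(\<Sum>k\<in>I. smul (a k) (x k)) = (\<Sum>k\<in>I. smul (b k) (x k))"
    by (intro sum.cong) (auto simp: b_def)
  also have "\<dots> = (\<Sum>k\<in>{1..d}. smul (b k) (x k))"
    using assms(2) basis_in(2)[OF assms(1)] by (intro sum.mono_neutral_left) (auto simp: b_def smul_zero)
  finally obtain v where v: "v \<in> \<Lambda>" "(\<Sum>k\<in>{1..d}. smul (b k) (x k)) = P v"
    using assms(4) by (auto simp: pw_def)
  obtain c where c: "\<forall>k\<in>{1..d}. c k \<in> Zp" "v = (\<Sum>k\<in>{1..d}. smul (c k) (x k))"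
    using basis_coeffs[OF assms(1) v(1)] by blast
  have "P v = (\<Sum>k\<in>{1..d}. P (smul (c k) (x k)))"
    unfolding c(2) using c(1) basis_in(2)[OF assms(1)] by (intro endo_sum[OF endo_P'] smul_in) auto
  also have "\<dots> = (\<Sum>k\<in>{1..d}. smul (dig (int p) \<otimes>\<^bsub>padic_int p\<^esub> c k) (x k))"
    using c(1) basis_in(2)[OF assms(1)] by (intro sum.cong) (auto simp: P_eq_smul smul_in smul_mult dig_in)
  finally have "b k = dig (int p) \<otimes>\<^bsub>padic_int p\<^esub> c k"
    using v(2) b c(1) assms(2,5) by (intro basis_unique[OF assms(1)]) (auto simp: dig_in)
  then have "a k 1 = (dig (int p) \<otimes>\<^bsub>padic_int p\<^esub> c k) 1" using assms(5) by (simp add: b_def)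
  then show ?thesis by (simp add: padic_mult padic_of_int_def)
qed

text \<open>Comparison of dimensions over the residue field by counting: the \<open>p^card I\<close>
  combinations of the \<open>y i\<close> with digits as coefficients are distinct modulo
  \<open>p\<close>, and each is represented by a vector of digits on \<open>J\<close>.\<close>

lemma card_le_span:
  fixes I :: "nat set"
  assumes I: "finite I" and J: "finite J" "x ` J \<subseteq> \<Lambda>"
    and y: "\<And>i. i \<in> I \<Longrightarrow> y i \<in> tsub x J (\<lambda>_. 0)"
    and ind: "\<And>a i. (\<And>i. i \<in> I \<Longrightarrow> a i \<in> Zp) \<Longrightarrow> (\<Sum>i\<in>I. smul (a i) (y i)) \<in> pw 1 \<Lambda> \<Longrightarrow> i \<in> I \<Longrightarrow> a i 1 = 0"
  shows "card I \<le> card J"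
proof -
  note cT = csub_tsub[OF J(2), of "\<lambda>_. 0"]
  have y_in: "y i \<in> \<Lambda>" if "i \<in> I" for i using csub_in[OF cT y[OF that]] .
  define F where "F (K :: nat set) = K \<rightarrow>\<^sub>E {0..<int p}" for K
  define v where "v a = (\<Sum>i\<in>I. smul (dig (a i)) (y i))" for a
  have ex: "\<exists>b\<in>F J. v a - (\<Sum>j\<in>J. smul (dig (b j)) (x j)) \<in> pw 1 \<Lambda>" for a
  proof -
    have "v a \<in> tsub x J (\<lambda>_. 0)" unfolding v_def using y by (intro csub_sum[OF cT] csub_smul[OF cT] dig_in)
    then obtain c where c: "\<And>j. j \<in> J \<Longrightarrow> c j \<in> Zp" "v a = (\<Sum>j\<in>J. smul (c j) (x j))"
      by (auto simp: mem_tsub[OF J(1)])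
    define b where "b = restrict (\<lambda>j. c j 1) J"
    have "c j 1 \<in> {0..<int p}" if "j \<in> J" for j
      using c(1)[OF that] unfolding padic_carrier by (auto dest: spec[of _ 1])
    then have bF: "b \<in> F J" by (auto simp: F_def b_def)
    have "v a - (\<Sum>j\<in>J. smul (dig (b j)) (x j)) = (\<Sum>j\<in>J. smul (c j) (x j) - smul (dig (c j 1)) (x j))"
      unfolding c(2) sum_subtractf by (simp add: b_def)
    also have "\<dots> \<in> pw 1 \<Lambda>" using c(1) J(2) by (intro pw_sum smul_approx) auto
    finally have "v a - (\<Sum>j\<in>J. smul (dig (b j)) (x j)) \<in> pw 1 \<Lambda>" .
    then show ?thesis by (rule bexI[OF _ bF])
  qed
  then have "\<forall>a. \<exists>b. b \<in> F J \<and> v a - (\<Sum>j\<in>J. smul (dig (b j)) (x j)) \<in> pw 1 \<Lambda>" by blast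
  from choice[OF this] obtain \<beta> where \<beta>: "\<And>a. \<beta> a \<in> F J"
    "\<And>a. v a - (\<Sum>j\<in>J. smul (dig (\<beta> a j)) (x j)) \<in> pw 1 \<Lambda>" by auto
  have "inj_on \<beta> (F I)"
  proof (rule inj_onI)
    fix a a' assume a: "a \<in> F I" "a' \<in> F I" and eq: "\<beta> a = \<beta> a'"
    have "v a - v a' \<in> pw 1 \<Lambda>" using pw_diff[OF \<beta>(2)[of a] \<beta>(2)[of a']] eq by simp
    moreover have "v a - v a' = (\<Sum>i\<in>I. smul (dig (a i) \<ominus>\<^bsub>padic_int p\<^esub> dig (a' i)) (y i))"
      unfolding v_def sum_subtractf[symmetric] using y_in by (intro sum.cong) (auto simp: smul_diff dig_in)
    ultimately have *: "(\<Sum>i\<in>I. smul (dig (a i) \<ominus>\<^bsub>padic_int p\<^esub> dig (a' i)) (y i)) \<in> pw 1 \<Lambda>" by simp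
    have "a i = a' i" if i: "i \<in> I" for i
    proof -
      have "(dig (a i) \<ominus>\<^bsub>padic_int p\<^esub> dig (a' i)) 1 = 0"
        by (rule ind[OF _ * i]) (simp add: dig_in)
      moreover have "dig (a i) = (dig (a i) \<ominus>\<^bsub>padic_int p\<^esub> dig (a' i)) \<oplus>\<^bsub>padic_int p\<^esub> dig (a' i)"
        using dig_in[of "a i"] dig_in[of "a' i"] by (simp add: R.minus_eq R.a_assoc R.l_neg)
      from fun_cong[OF this, of 1] calculation have "a i mod int p = a' i mod int p"
        by (simp add: padic_add padic_of_int_def)
      moreover have "a i \<in> {0..<int p}" "a' i \<in> {0..<int p}" using a i by (auto simp: F_def)
      ultimately show ?thesis by simp
    qed
    then show "a = a'" using a unfolding F_def by (meson PiE_ext)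
  qed
  moreover have "finite (F J)" unfolding F_def using J(1) by (intro finite_PiE) auto
  ultimately have "card (F I) \<le> card (F J)" using \<beta>(1) by (intro card_inj_on_le[of \<beta>]) auto
  then have "p ^ card I \<le> p ^ card J" using I J(1) by (simp add: F_def card_PiE)
  then show ?thesis using prime_gt_1_nat[OF prime_p] by simp
qed

lemma basis_Lambda: "basis d x \<Longrightarrow> \<Lambda> = tsub x {1..d} (\<lambda>_. 0)"
proof (intro equalityI subsetI)
  fix v assume "basis d x" "v \<in> \<Lambda>"
  then show "v \<in> tsub x {1..d} (\<lambda>_. 0)" using basis_coeffs[of d x v] by (auto simp: mem_tsub)
qed (use csub_in[OF csub_tsub] basis_in(1) in blast)

lemma basis_card_eq:
  assumes "basis d x" "basis e y"
  shows "d = e"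
proof -
  have "card {1..d} \<le> card {1..e}" if "basis d x" "basis e y" for d x e y
  proof (rule card_le_span)
    show "x k \<in> tsub y {1..e} (\<lambda>_. 0)" if "k \<in> {1..d}" for k
      using basis_in(2)[OF \<open>basis d x\<close> that] basis_Lambda[OF \<open>basis e y\<close>] by simp
  qed (use basis_in(1)[OF that(2)] basis_independent_mod[OF that(1) order_refl] in auto)
  from this[OF assms] this[OF assms(2,1)] show ?thesis by simp
qed

definition strat_term :: "nat \<Rightarrow> (nat \<Rightarrow> 'a) \<Rightarrow> (nat \<Rightarrow> real) \<Rightarrow> nat \<Rightarrow> 'a set" where
  "strat_term d x \<xi> i = tsub x {1..d} (\<lambda>k. fl i (\<xi> k))"

text \<open>The rates are only nonnegative here; for the rates found by the construction, positivity
  comes later from \<open>growth_ge\<close>.\<close>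

definition stratified :: "nat \<Rightarrow> (nat \<Rightarrow> 'a) \<Rightarrow> (nat \<Rightarrow> real) \<Rightarrow> nat \<Rightarrow> bool" where
  "stratified d x \<xi> c \<longleftrightarrow> basis d x \<and> (\<forall>k\<in>{1..d}. 0 \<le> \<xi> k) \<and> mono_on {1..d} \<xi> \<and>
     (\<forall>i\<ge>1. pw c (augp i \<Lambda>) \<subseteq> strat_term d x \<xi> i \<and> pw c (strat_term d x \<xi> i) \<subseteq> augp i \<Lambda>)"

lemma stratified_exists:
  assumes "basis d x"
  shows "\<exists>y \<xi> c. stratified d y \<xi> c \<and> (\<forall>k\<in>{1..d}. \<xi> k \<in> \<rat>)"
proof -
  obtain zs c where zs: "strat {0} zs c" using strat_exists[OF stable_zero pure_zero] by blast
  then have fr: "frame_rel {0} (map fst zs) \<Lambda>" by (simp add: strat_def)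
  define y where "y k = map fst zs ! (k - 1)" for k
  define \<xi> where "\<xi> k = snd (zs ! (k - 1))" for k
  have b: "basis (length zs) y" using frame_rel_basis[OF fr] by (simp add: y_def[abs_def])
  then have d: "d = length zs" using basis_card_eq[OF assms] by blast
  have set: "zs ! (k - 1) \<in> set zs" if "k \<in> {1..d}" for k using that d by auto
  have \<xi>: "0 \<le> \<xi> k" "\<xi> k \<in> \<rat>" if "k \<in> {1..d}" for k
    using set[OF that] zs by (auto simp: strat_def \<xi>_def)
  have "mono_on {1..d} \<xi>"
  proof (rule mono_onI)
    fix k l assume "k \<in> {1..d}" "l \<in> {1..d}" "k \<le> l"
    then show "\<xi> k \<le> \<xi> l"
      using zs sorted_nth_mono[of "map snd zs" "k - 1" "l - 1"] d by (auto simp: strat_def \<xi>_def)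
  qed
  moreover have T: "strat_term d y \<xi> i = terms i zs" for i
    unfolding terms_eq_tsub strat_term_def d tsub_def y_def \<xi>_def by (intro sum.cong) auto
  moreover have "pw c (augp i \<Lambda>) \<subseteq> terms i zs" for i using zs by (simp add: strat_def set_zero)
  moreover have "pw c (terms i zs) \<subseteq> augp i \<Lambda>" for i
  proof -
    have "pw c (strat_term d y \<xi> i) = tsub y {1..d} (\<lambda>k. c + fl i (\<xi> k))"
      unfolding strat_term_def using basis_in(1)[OF b] d by (intro pw_tsub) simp
    also have "\<dots> \<subseteq> augp i \<Lambda>"
    proof (rule tsub_le[OF csub_augp[OF csub_Lambda]])
      fix k assume k: "k \<in> {1..d}"
      have "\<forall>z\<in>set zs. pw (c + fl i (snd z)) (line (fst z)) \<subseteq> {0} + augp i \<Lambda>"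
        using zs unfolding strat_def by blast
      moreover have "k - 1 < length zs" using k d by auto
      ultimately show "pw (c + fl i (\<xi> k)) (line (y k)) \<subseteq> augp i \<Lambda>"
        using set[OF k] by (simp add: set_zero y_def \<xi>_def)
    qed
    finally show ?thesis by (simp add: T)
  qed
  ultimately show ?thesis using b \<xi> d by (intro exI[of _ y] exI[of _ \<xi>] exI[of _ c]) (simp add: stratified_def)
qed

text \<open>The difference \<open>i * (b - a)\<close> is unbounded. The clause
  \<open>i \<ge> 1\<close> is kept because the equivalence of filtrations says nothing about index
  0.\<close>

lemma fl_gap:
  assumes "a < b" "0 \<le> a"
  shows "\<exists>i\<ge>1. fl i a + N \<le> fl i b"
proof -
  obtain i :: nat where i: "real N + 1 < real i * (b - a)"
    using reals_Archimedean3[of "b - a"] assms by auto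
  then have "i \<ge> 1" by (cases i) auto
  have "real (fl i a) \<le> real i * a" using fl_le assms by blast
  moreover have "real i * b - 1 < real (fl i b)" unfolding fl_def using assms by linarith
  ultimately have "real (fl i a + N) \<le> real (fl i b)" using i by (simp add: algebra_simps)
  then show ?thesis using \<open>i \<ge> 1\<close> by (intro exI[of _ i]) linarith
qed

text \<open>A vector that enters the terms at rate \<open>\<zeta>\<close> has no component at a
  frame vector of larger rate: at an index where the two floors differ by at least
  \<open>c + N\<close>, this component is divisible by \<open>p^N\<close>. It is applied to the
  vectors of a second frame and to the images of frame vectors.\<close>

lemma coefficient_zero:
  assumes b: "basis d x" and a: "\<And>k. k \<in> {1..d} \<Longrightarrow> a k \<in> Zp" and "0 \<le> \<zeta>"
    and v: "\<And>i. i \<ge> 1 \<Longrightarrow> (P ^^ (c + fl i \<zeta>)) (\<Sum>k\<in>{1..d}. smul (a k) (x k)) \<in> strat_term d x \<xi> i"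
    and j: "j \<in> {1..d}" "\<zeta> < \<xi> j"
  shows "a j = \<zero>\<^bsub>padic_int p\<^esub>"
proof (rule padic_eq_0I[OF p_pos a[OF j(1)]])
  fix N
  obtain i where i: "i \<ge> 1" "fl i \<zeta> + (c + N) \<le> fl i (\<xi> j)" using fl_gap[OF j(2) assms(3)] by blast
  define m where "m = c + fl i \<zeta>"
  define n where "n = fl i (\<xi> j) - (m + N)"
  have n: "fl i (\<xi> j) = m + N + n" using i(2) by (simp add: n_def m_def)
  obtain b' where b': "\<And>k. k \<in> {1..d} \<Longrightarrow> b' k \<in> Zp"
    "(P ^^ m) (\<Sum>k\<in>{1..d}. smul (a k) (x k)) = (\<Sum>k\<in>{1..d}. (P ^^ fl i (\<xi> k)) (smul (b' k) (x k)))"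
    using v[OF i(1)] unfolding m_def strat_term_def by (rule tsubE) auto
  have "(P ^^ m) (\<Sum>k\<in>{1..d}. smul (a k) (x k)) = (\<Sum>k\<in>{1..d}. (P ^^ m) (smul (a k) (x k)))"
    using a basis_in(2)[OF b] by (intro endo_sum[OF endo_Pow] smul_in) auto
  also have "\<dots> = (\<Sum>k\<in>{1..d}. smul (dig (int p ^ m) \<otimes>\<^bsub>padic_int p\<^esub> a k) (x k))"
    using a basis_in(2)[OF b] by (intro sum.cong) (auto simp: Pow_eq_smul smul_in smul_mult dig_in)
  finally have "(\<Sum>k\<in>{1..d}. smul (dig (int p ^ m) \<otimes>\<^bsub>padic_int p\<^esub> a k) (x k)) =
      (\<Sum>k\<in>{1..d}. (P ^^ fl i (\<xi> k)) (smul (b' k) (x k)))" using b'(2) by simp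
  also have "\<dots> = (\<Sum>k\<in>{1..d}. smul (dig (int p ^ fl i (\<xi> k)) \<otimes>\<^bsub>padic_int p\<^esub> b' k) (x k))"
    using b'(1) basis_in(2)[OF b] by (intro sum.cong) (auto simp: Pow_eq_smul smul_in smul_mult dig_in)
  finally have "dig (int p ^ m) \<otimes>\<^bsub>padic_int p\<^esub> a j = dig (int p ^ fl i (\<xi> j)) \<otimes>\<^bsub>padic_int p\<^esub> b' j"
    using a b'(1) j(1) by (intro basis_unique[OF b]) (auto simp: dig_in)
  also have "\<dots> = dig (int p ^ (m + N)) \<otimes>\<^bsub>padic_int p\<^esub> (dig (int p ^ n) \<otimes>\<^bsub>padic_int p\<^esub> b' j)"
    unfolding n power_add[of _ "m + N"] padic_of_int_mult[of p "int p ^ (m + N)"]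
    using b'(1)[OF j(1)] by (simp add: R.m_assoc dig_in)
  finally show "\<exists>m b. b \<in> Zp \<and> dig (int p ^ m) \<otimes>\<^bsub>padic_int p\<^esub> a j = dig (int p ^ (m + N)) \<otimes>\<^bsub>padic_int p\<^esub> b"
    using b'(1)[OF j(1)] by (intro exI[of _ m] exI[of _ "dig (int p ^ n) \<otimes>\<^bsub>padic_int p\<^esub> b' j"]) (simp add: dig_in)
qed

lemma self_mem_strat_term:
  assumes "basis d x" "k \<in> {1..d}"
  shows "(P ^^ fl i (\<xi> k)) (x k) \<in> strat_term d x \<xi> i"
proof -
  have "(P ^^ fl i (\<xi> k)) (x k) \<in> pw (fl i (\<xi> k)) (line (x k))"
    using self_in_line basis_in(2)[OF assms] by (auto simp: pw_def)
  then show ?thesis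
    unfolding strat_term_def using line_le_tsub[OF _ basis_in(1)[OF assms(1)] assms(2), of "\<lambda>k. fl i (\<xi> k)"] by auto
qed

text \<open>If \<open>\<xi>' k < \<xi> k\<close>, the first \<open>k\<close> vectors of the second
  frame have rates below those of \<open>x k\<close> and all later \<open>x j\<close>. Hence they
  lie in the span of the first \<open>k - 1\<close> vectors of \<open>x\<close>, although they are
  independent modulo \<open>p\<close>.\<close>

lemma growth_le:
  assumes s: "stratified d x \<xi> c" and s': "stratified d x' \<xi>' c'" and k: "k \<in> {1..d}"
  shows "\<xi> k \<le> \<xi>' k"
proof (rule ccontr)
  assume "\<not> \<xi> k \<le> \<xi>' k"
  from s s' have b: "basis d x" "basis d x'" and mono: "mono_on {1..d} \<xi>" "mono_on {1..d} \<xi>'"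
    by (auto simp: stratified_def)
  have "card {1..k} \<le> card {1..<k}"
  proof (rule card_le_span)
    show xk: "x ` {1..<k} \<subseteq> \<Lambda>" using basis_in(1)[OF b(1)] k by auto
    fix l assume l: "l \<in> {1..k}"
    then have l': "l \<in> {1..d}" using k by auto
    obtain a where a: "\<And>j. j \<in> {1..d} \<Longrightarrow> a j \<in> Zp" "x' l = (\<Sum>j\<in>{1..d}. smul (a j) (x j))"
      using basis_coeffs[OF b(1) basis_in(2)[OF b(2) l']] by blast
    have "a j = \<zero>\<^bsub>padic_int p\<^esub>" if j: "j \<in> {1..d} - {1..<k}" for j
    proof (rule coefficient_zero[OF b(1) a(1)])
      show "0 \<le> \<xi>' l" using s' l' by (simp add: stratified_def)
      have "j \<in> {1..d}" "k \<le> j" "l \<le> k" using j l by auto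
      then have "\<xi> k \<le> \<xi> j" "\<xi>' l \<le> \<xi>' k"
        using mono_onD[OF mono(1) k] mono_onD[OF mono(2) l' k] by blast+
      then show "\<xi>' l < \<xi> j" using \<open>\<not> \<xi> k \<le> \<xi>' k\<close> by linarith
      show "j \<in> {1..d}" using j by blast
      fix i :: nat assume i: "i \<ge> 1"
      have 1: "(P ^^ fl i (\<xi>' l)) (x' l) \<in> strat_term d x' \<xi>' i" by (rule self_mem_strat_term[OF b(2) l'])
      have "pw c' (strat_term d x' \<xi>' i) \<subseteq> augp i \<Lambda>" "pw c (augp i \<Lambda>) \<subseteq> strat_term d x \<xi> i"
        using s s' i by (auto simp: stratified_def)
      then have "pw c (pw c' (strat_term d x' \<xi>' i)) \<subseteq> strat_term d x \<xi> i" using pw_mono by blast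
      then have "(P ^^ c) ((P ^^ c') ((P ^^ fl i (\<xi>' l)) (x' l))) \<in> strat_term d x \<xi> i"
        using 1 by (auto simp: pw_def)
      then show "(P ^^ (c + c' + fl i (\<xi>' l))) (\<Sum>j\<in>{1..d}. smul (a j) (x j)) \<in> strat_term d x \<xi> i"
        by (simp add: a(2) funpow_add)
    qed
    then have "(\<Sum>j\<in>{1..d}. smul (a j) (x j)) = (\<Sum>j\<in>{1..<k}. smul (a j) (x j))"
      using k basis_in(2)[OF b(1)] by (intro sum.mono_neutral_right) (auto simp: smul_zero)
    then show "x' l \<in> tsub x {1..<k} (\<lambda>_. 0)"
      unfolding a(2) mem_tsub[OF finite_atLeastLessThan] using a(1) k by (intro exI[of _ a]) auto
  next
    fix a i assume "\<And>i. i \<in> {1..k} \<Longrightarrow> a i \<in> Zp" "(\<Sum>i\<in>{1..k}. smul (a i) (x' i)) \<in> pw 1 \<Lambda>" "i \<in> {1..k}"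
    then show "a i 1 = 0" using k by (intro basis_independent_mod[OF b(2), of "{1..k}"]) auto
  qed auto
  then show False using k by (cases k) auto
qed

lemma growth_unique: "stratified d x \<xi> c \<Longrightarrow> stratified d x' \<xi>' c' \<Longrightarrow> k \<in> {1..d} \<Longrightarrow> \<xi> k = \<xi>' k"
  using growth_le by (meson order_antisym)

lemma Pow_basis_mem_pw:
  assumes b: "basis d x" "k \<in> {1..d}" and "(P ^^ m) (x k) \<in> pw n \<Lambda>"
  shows "n \<le> m"
proof (rule ccontr)
  assume "\<not> n \<le> m"
  then obtain q where q: "n = m + Suc q" by (metis add_Suc_right less_imp_Suc_add not_le)
  then obtain v where v: "v \<in> \<Lambda>" "(P ^^ m) (x k) = (P ^^ m) (P ((P ^^ q) v))"
    using assms(3) by (auto simp: pw_def funpow_add funpow_swap1)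
  then have "x k = P ((P ^^ q) v)" using Pow_inj[OF basis_in(2)[OF b]] P_in Pow_in by blast
  then have "(\<Sum>i\<in>{k}. smul (\<one>\<^bsub>padic_int p\<^esub>) (x i)) \<in> pw 1 \<Lambda>"
    using v(1) basis_in(2)[OF b] by (auto simp: smul_one pw_def Pow_in)
  then have "(\<one>\<^bsub>padic_int p\<^esub>) 1 = (0::int)"
    using basis_independent_mod[OF b(1), of "{k}" "\<lambda>_. \<one>\<^bsub>padic_int p\<^esub>" k] b(2) by auto
  then show False using prime_gt_1_nat[OF prime_p] by (simp add: padic_int_def)
qed

text \<open>The series contains \<open>p^i \<Lambda>\<close>, so \<open>p^(c + i) x k\<close> lies
  in the term of index \<open>i\<close>, where the coefficient of \<open>x k\<close> is divisible by
  \<open>p\<close> to the power \<open>fl i (\<xi> k)\<close>.\<close>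

lemma growth_le_1:
  assumes s: "stratified d x \<xi> c" and k: "k \<in> {1..d}"
  shows "\<xi> k \<le> 1"
proof (rule ccontr)
  assume "\<not> \<xi> k \<le> 1"
  then obtain i where i: "i \<ge> 1" "fl i 1 + (c + 1) \<le> fl i (\<xi> k)" using fl_gap[of 1 "\<xi> k" "c + 1"] by auto
  then have n: "i + c + 1 \<le> fl i (\<xi> k)" by (simp add: fl_def)
  from s have b: "basis d x" and "pw c (augp i \<Lambda>) \<subseteq> strat_term d x \<xi> i" using i by (auto simp: stratified_def)
  then have "(P ^^ (c + i)) (x k) \<in> strat_term d x \<xi> i"
    using pw_le_augp[OF csub_Lambda, of i] basis_in(2)[OF b k] by (fastforce simp: pw_def funpow_add)
  then obtain a where a: "\<And>j. j \<in> {1..d} \<Longrightarrow> a j \<in> Zp"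
    "(P ^^ (c + i)) (x k) = (\<Sum>j\<in>{1..d}. (P ^^ fl i (\<xi> j)) (smul (a j) (x j)))"
    unfolding strat_term_def by (rule tsubE) auto
  define e where "e j = (if j = k then dig (int p ^ (c + i)) else \<zero>\<^bsub>padic_int p\<^esub>)" for j
  have "(P ^^ (c + i)) (x k) = (\<Sum>j\<in>{1..d}. if j = k then (P ^^ (c + i)) (x j) else 0)"
    using k by simp
  also have "\<dots> = (\<Sum>j\<in>{1..d}. smul (e j) (x j))"
    using basis_in(2)[OF b] by (intro sum.cong) (auto simp: e_def Pow_eq_smul smul_zero)
  finally have "(\<Sum>j\<in>{1..d}. smul (e j) (x j)) = (\<Sum>j\<in>{1..d}. (P ^^ fl i (\<xi> j)) (smul (a j) (x j)))"
    using a(2) by simp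
  also have "\<dots> = (\<Sum>j\<in>{1..d}. smul (dig (int p ^ fl i (\<xi> j)) \<otimes>\<^bsub>padic_int p\<^esub> a j) (x j))"
    using a(1) basis_in(2)[OF b] by (intro sum.cong) (auto simp: Pow_eq_smul smul_in smul_mult dig_in)
  finally have "e k = dig (int p ^ fl i (\<xi> k)) \<otimes>\<^bsub>padic_int p\<^esub> a k"
    using a(1) k by (intro basis_unique[OF b]) (auto simp: dig_in e_def)
  then have "(P ^^ (c + i)) (x k) = (P ^^ fl i (\<xi> k)) (smul (a k) (x k))"
    using a(1)[OF k] basis_in(2)[OF b k] by (simp add: e_def Pow_eq_smul smul_in smul_mult dig_in)
  then have "(P ^^ (c + i)) (x k) \<in> pw (fl i (\<xi> k)) \<Lambda>"
    using a(1)[OF k] basis_in(2)[OF b k] by (auto simp: pw_def smul_in)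
  then show False using Pow_basis_mem_pw[OF b k] n by fastforce
qed

lemma augp_le_pw:
  assumes "augp d \<Lambda> \<subseteq> pw 1 \<Lambda>"
  shows "augp (d * i) \<Lambda> \<subseteq> pw i \<Lambda>"
  using augp_iterate_le[OF stable_zero csub_Lambda, of d 1 i] assms by (simp add: set_zero)

text \<open>A factor \<open>p\<close> is gained every \<open>d\<close> steps, so the multiple of
  \<open>x k\<close> by \<open>p\<close> to the power \<open>c + fl (d * i) (\<xi> k)\<close> is
  divisible by \<open>p^i\<close>, while \<open>x k\<close> itself is not divisible by
  \<open>p\<close>.\<close>

lemma growth_ge:
  assumes s: "stratified d x \<xi> c" and k: "k \<in> {1..d}" and nil: "augp d \<Lambda> \<subseteq> pw 1 \<Lambda>"
  shows "1 / real d \<le> \<xi> k"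
proof (rule le_of_multiples)
  from s have b: "basis d x" and \<xi>: "0 \<le> \<xi> k" using k by (auto simp: stratified_def)
  fix i
  show "real i * (1 / real d) \<le> real i * \<xi> k + real c / real d"
  proof (cases "i = 0")
    case False
    then have "pw c (strat_term d x \<xi> (d * i)) \<subseteq> augp (d * i) \<Lambda>" using s k by (auto simp: stratified_def)
    also have "\<dots> \<subseteq> pw i \<Lambda>" by (rule augp_le_pw[OF nil])
    finally have "(P ^^ (c + fl (d * i) (\<xi> k))) (x k) \<in> pw i \<Lambda>"
      using self_mem_strat_term[OF b k, of "d * i" \<xi>] by (auto simp: pw_def funpow_add)
    then have "i \<le> c + fl (d * i) (\<xi> k)" by (rule Pow_basis_mem_pw[OF b k])
    then have "real i \<le> real c + real (fl (d * i) (\<xi> k))" by linarith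
    also have "\<dots> \<le> real c + real (d * i) * \<xi> k" using fl_le[OF \<xi>, of "d * i"] by linarith
    finally have "real i / real d \<le> (real c + real (d * i) * \<xi> k) / real d"
      by (intro divide_right_mono) auto
    then show ?thesis using k by (simp add: add_divide_distrib ac_simps)
  qed simp
qed

lemma coefficient_invariant:
  assumes s: "stratified d x \<xi> c" and \<tau>: "endo \<tau>"
    and \<tau>_aug: "\<And>i v. v \<in> augp i \<Lambda> \<Longrightarrow> \<tau> v \<in> augp i \<Lambda>"
    and k: "k \<in> {1..d}" and a: "\<And>j. j \<in> {1..d} \<Longrightarrow> a j \<in> Zp" "\<tau> (x k) = (\<Sum>j\<in>{1..d}. smul (a j) (x j))"
    and j: "j \<in> {1..d}" "\<xi> k < \<xi> j"
  shows "a j = \<zero>\<^bsub>padic_int p\<^esub>"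
\<comment> \<open>One \<open>c\<close> carries the frame vector into the series, the other carries
  its image back into the term of the stratification.\<close>
proof (rule coefficient_zero[where a = a and d = d and x = x and \<xi> = \<xi> and \<zeta> = "\<xi> k" and c = "c + c"])
  show "j \<in> {1..d}" "\<xi> k < \<xi> j" and "\<And>j. j \<in> {1..d} \<Longrightarrow> a j \<in> Zp" using j a(1) by auto
  from s show b: "basis d x" and "0 \<le> \<xi> k" using k by (auto simp: stratified_def)
  fix i :: nat assume i: "i \<ge> 1"
  have "pw c (augp i \<Lambda>) \<subseteq> strat_term d x \<xi> i" and "pw c (strat_term d x \<xi> i) \<subseteq> augp i \<Lambda>"
    using s i by (auto simp: stratified_def)
  moreover have "(P ^^ fl i (\<xi> k)) (x k) \<in> strat_term d x \<xi> i" by (rule self_mem_strat_term[OF b k])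
  ultimately have "(P ^^ (c + fl i (\<xi> k))) (x k) \<in> augp i \<Lambda>" by (auto simp: pw_def funpow_add)
  then have "\<tau> ((P ^^ (c + fl i (\<xi> k))) (x k)) \<in> augp i \<Lambda>" by (rule \<tau>_aug)
  then have "(P ^^ (c + fl i (\<xi> k))) (\<tau> (x k)) \<in> augp i \<Lambda>"
    using endo_Pow_comm[OF \<tau> basis_in(2)[OF b k]] by simp
  then have "(P ^^ c) ((P ^^ (c + fl i (\<xi> k))) (\<tau> (x k))) \<in> strat_term d x \<xi> i"
    using \<open>pw c (augp i \<Lambda>) \<subseteq> strat_term d x \<xi> i\<close> by (auto simp: pw_def)
  then show "(P ^^ (c + c + fl i (\<xi> k))) (\<Sum>j\<in>{1..d}. smul (a j) (x j)) \<in> strat_term d x \<xi> i"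
    by (simp add: a(2) funpow_add)
qed

text \<open>The condition on \<open>m\<close> says that a frame vector whose rate is at most that of
  the \<open>k\<close>-th occurs among the first \<open>e\<close>, with an exponent that is not
  larger. This covers the initial blocks, with \<open>m\<close> zero, and the terms of the
  stratification, with \<open>e = d\<close>.\<close>

lemma tsub_invariant:
  assumes s: "stratified d x \<xi> c" and \<tau>: "endo \<tau>"
    and \<tau>_smul: "\<And>c v. c \<in> Zp \<Longrightarrow> v \<in> \<Lambda> \<Longrightarrow> \<tau> (smul c v) = smul c (\<tau> v)"
    and \<tau>_aug: "\<And>i v. v \<in> augp i \<Lambda> \<Longrightarrow> \<tau> v \<in> augp i \<Lambda>"
    and "e \<le> d" and m: "\<And>j k. k \<in> {1..e} \<Longrightarrow> j \<in> {1..d} \<Longrightarrow> \<xi> j \<le> \<xi> k \<Longrightarrow> j \<le> e \<and> m j \<le> m k"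
    and v: "v \<in> tsub x {1..e} m"
  shows "\<tau> v \<in> tsub x {1..e} m"
proof -
  from s have b: "basis d x" by (simp add: stratified_def)
  have xe: "x ` {1..e} \<subseteq> \<Lambda>" using basis_in(1)[OF b] assms(5) by auto
  note cT = csub_tsub[OF xe, of m]
  obtain c where c: "\<And>k. k \<in> {1..e} \<Longrightarrow> c k \<in> Zp" "v = (\<Sum>k\<in>{1..e}. (P ^^ m k) (smul (c k) (x k)))"
    using v by (rule tsubE) auto
  have "\<tau> v = (\<Sum>k\<in>{1..e}. \<tau> ((P ^^ m k) (smul (c k) (x k))))"
    unfolding c(2) using c(1) xe by (intro endo_sum[OF \<tau>] Pow_in smul_in) auto
  also have "\<dots> \<in> tsub x {1..e} m"
  proof (rule csub_sum[OF cT])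
    fix k assume k: "k \<in> {1..e}"
    then have kd: "k \<in> {1..d}" using assms(5) by auto
    note xk = basis_in(2)[OF b kd]
    obtain a where a: "\<And>j. j \<in> {1..d} \<Longrightarrow> a j \<in> Zp" "\<tau> (x k) = (\<Sum>j\<in>{1..d}. smul (a j) (x j))"
      using basis_coeffs[OF b endo_in[OF \<tau> xk]] by blast
    have "\<tau> ((P ^^ m k) (smul (c k) (x k))) = smul (c k) ((P ^^ m k) (\<tau> (x k)))"
      using c(1)[OF k] xk endo_in[OF \<tau> xk]
      by (simp add: endo_Pow_comm[OF \<tau>] smul_in \<tau>_smul endo_Pow_comm[OF endo_smul])
    also have "(P ^^ m k) (\<tau> (x k)) = (\<Sum>j\<in>{1..d}. (P ^^ m k) (smul (a j) (x j)))"
      unfolding a(2) using a(1) basis_in(2)[OF b] by (intro endo_sum[OF endo_Pow] smul_in) auto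
    also have "smul (c k) \<dots> \<in> tsub x {1..e} m"
    proof (intro csub_smul[OF cT c(1)[OF k]] csub_sum[OF cT])
      fix j assume j: "j \<in> {1..d}"
      show "(P ^^ m k) (smul (a j) (x j)) \<in> tsub x {1..e} m"
      proof (cases "\<xi> j \<le> \<xi> k")
        case True
        then have "j \<in> {1..e}" "m j \<le> m k" using m[OF k j] j by auto
        then have "pw (m k) (line (x j)) \<subseteq> tsub x {1..e} m" using line_le_tsub[OF _ xe] by simp
        then show ?thesis using a(1)[OF j] by (auto simp: pw_def line_def)
      next
        case False
        then have "a j = \<zero>\<^bsub>padic_int p\<^esub>"
          using coefficient_invariant[OF s \<tau> \<tau>_aug kd a j] by simp
        then show ?thesis using basis_in(2)[OF b j] csub_0[OF cT] by (simp add: smul_zero endo_0[OF endo_Pow])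
      qed
    qed
    finally show "\<tau> ((P ^^ m k) (smul (c k) (x k))) \<in> tsub x {1..e} m" .
  qed
  finally show ?thesis .
qed

end

section \<open>Unipotence modulo p\<close>

text \<open>All fibres over the image have the same size, since each injects into every
  other.\<close>

lemma card_image_dvd:
  assumes A: "finite A"
    and h: "\<And>y z. y \<in> f ` A \<Longrightarrow> z \<in> f ` A \<Longrightarrow>
      \<exists>h. inj_on h {a \<in> A. f a = y} \<and> h ` {a \<in> A. f a = y} \<subseteq> {a \<in> A. f a = z}"
  shows "card (f ` A) dvd card A"
proof (cases "A = {}")
  case False
  then obtain a0 where a0: "a0 \<in> A" by blast
  have le: "card {a \<in> A. f a = y} \<le> card {a \<in> A. f a = z}" if yz: "y \<in> f ` A" "z \<in> f ` A" for y z
  proof -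
    obtain h where "inj_on h {a \<in> A. f a = y}" "h ` {a \<in> A. f a = y} \<subseteq> {a \<in> A. f a = z}"
      using h[OF yz] by blast
    then show ?thesis using A by (intro card_inj_on_le[of h]) auto
  qed
  have "card A = (\<Sum>y\<in>f ` A. card {a \<in> A. f a = y})"
    using sum.image_gen[OF A, of "\<lambda>_. 1::nat" f] by simp
  also have "\<dots> = (\<Sum>y\<in>f ` A. card {a \<in> A. f a = f a0})"
    using a0 by (intro sum.cong refl order_antisym le) auto
  finally show ?thesis by simp
qed simp

context padic_lattice_ops begin

interpretation R: cring "padic_int p" by (rule cring_padic_int[OF p_pos])

lemma card_cs_1:
  assumes b: "basis d x"
  shows "card (cs 1 ` \<Lambda>) = p ^ d"
proof -
  note xk = basis_in(2)[OF b]
  define F where "F = {1..d} \<rightarrow>\<^sub>E {0..<int p}"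
  define v where "v a = (\<Sum>k\<in>{1..d}. smul (dig (a k)) (x k))" for a
  have v: "v a \<in> \<Lambda>" for a unfolding v_def using xk by (intro module_sum smul_in dig_in)
  have "inj_on (\<lambda>a. cs 1 (v a)) F"
  proof (rule inj_onI)
    fix a a' assume a: "a \<in> F" "a' \<in> F" and "cs 1 (v a) = cs 1 (v a')"
    then have "v a - v a' \<in> pw 1 \<Lambda>" using cs_eq_iff v by blast
    moreover have "v a - v a' = (\<Sum>k\<in>{1..d}. smul (dig (a k) \<ominus>\<^bsub>padic_int p\<^esub> dig (a' k)) (x k))"
      unfolding v_def sum_subtractf[symmetric] using xk by (intro sum.cong) (auto simp: smul_diff dig_in)
    ultimately have *: "(\<Sum>k\<in>{1..d}. smul (dig (a k) \<ominus>\<^bsub>padic_int p\<^esub> dig (a' k)) (x k)) \<in> pw 1 \<Lambda>" by simp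
    have "a k = a' k" if k: "k \<in> {1..d}" for k
    proof -
      have "(dig (a k) \<ominus>\<^bsub>padic_int p\<^esub> dig (a' k)) 1 = 0"
        by (rule basis_independent_mod[OF b order_refl _ * k]) (simp add: dig_in)
      moreover have "dig (a k) = (dig (a k) \<ominus>\<^bsub>padic_int p\<^esub> dig (a' k)) \<oplus>\<^bsub>padic_int p\<^esub> dig (a' k)"
        using dig_in[of "a k"] dig_in[of "a' k"] by (simp add: R.minus_eq R.a_assoc R.l_neg)
      from fun_cong[OF this, of 1] calculation have "a k mod int p = a' k mod int p"
        by (simp add: padic_add padic_of_int_def)
      moreover have "a k \<in> {0..<int p}" "a' k \<in> {0..<int p}" using a k by (auto simp: F_def)
      ultimately show ?thesis by simp
    qed
    then show "a = a'" using a unfolding F_def by (meson PiE_ext)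
  qed
  moreover have "(\<lambda>a. cs 1 (v a)) ` F = cs 1 ` \<Lambda>"
  proof (intro equalityI subsetI)
    fix C assume "C \<in> cs 1 ` \<Lambda>"
    then obtain w where w: "w \<in> \<Lambda>" "C = cs 1 w" by blast
    obtain c where c: "\<forall>k\<in>{1..d}. c k \<in> Zp" "w = (\<Sum>k\<in>{1..d}. smul (c k) (x k))"
      using basis_coeffs[OF b w(1)] by blast
    define a where "a = restrict (\<lambda>k. c k 1) {1..d}"
    have "c k 1 \<in> {0..<int p}" if "k \<in> {1..d}" for k
      using bspec[OF c(1) that] unfolding padic_carrier by (auto dest: spec[of _ 1])
    then have "a \<in> F" by (auto simp: F_def a_def)
    have "w - v a = (\<Sum>k\<in>{1..d}. smul (c k) (x k) - smul (dig (c k 1)) (x k))"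
      unfolding c(2) v_def sum_subtractf by (simp add: a_def)
    also have "\<dots> \<in> pw 1 \<Lambda>" using c(1) xk by (intro pw_sum smul_approx) auto
    finally have "C = cs 1 (v a)" using w v cs_eq_iff by simp
    then show "C \<in> (\<lambda>a. cs 1 (v a)) ` F" using \<open>a \<in> F\<close> by blast
  qed (use v in auto)
  ultimately have "card (cs 1 ` \<Lambda>) = card F" using card_image by metis
  then show ?thesis by (simp add: F_def card_PiE)
qed

definition cosets :: "'a set \<Rightarrow> 'a \<Rightarrow> 'a set" where
  "cosets F v = {u \<in> \<Lambda>. u - v \<in> F}"

lemma cosets_eq_iff:
  assumes F: "csub F" and uv: "u \<in> \<Lambda>" "v \<in> \<Lambda>"
  shows "cosets F u = cosets F v \<longleftrightarrow> u - v \<in> F"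
proof
  assume "cosets F u = cosets F v"
  moreover have "u \<in> cosets F u" using uv csub_0[OF F] by (simp add: cosets_def)
  ultimately show "u - v \<in> F" by (simp add: cosets_def)
next
  assume a: "u - v \<in> F"
  have "w - u \<in> F \<longleftrightarrow> w - v \<in> F" for w
    using csub_diff[OF F _ a, of "w - v"] csub_add[OF F _ a, of "w - u"] by auto
  then show "cosets F u = cosets F v" by (simp add: cosets_def)
qed

text \<open>The fibres of the projection from residues modulo \<open>p\<close> to cosets of
  \<open>F\<close> are translates of one another, so the index of \<open>F\<close> divides
  \<open>p^d\<close>.\<close>

lemma
  assumes b: "basis d x" and F: "csub F" "pw 1 \<Lambda> \<subseteq> F"
  shows finite_cosets: "finite (cosets F ` \<Lambda>)"
    and card_cosets: "\<exists>j\<le>d. card (cosets F ` \<Lambda>) = p ^ j"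
proof -
  \<comment> \<open>The projection, expressed on sets: it sends the class of \<open>v\<close> modulo
    \<open>p\<close> to the coset of \<open>v\<close> modulo \<open>F\<close>.\<close>
  define f where "f C = {u \<in> \<Lambda>. \<exists>c\<in>C. u - c \<in> F}" for C
  have fcs: "f (cs 1 v) = cosets F v" if v: "v \<in> \<Lambda>" for v
  proof (intro equalityI subsetI)
    fix u assume "u \<in> f (cs 1 v)"
    then obtain c where c: "u \<in> \<Lambda>" "u - c \<in> F" "c - v \<in> F" using F(2) by (auto simp: f_def cs_def)
    then show "u \<in> cosets F v" using csub_add[OF F(1) c(2,3)] by (simp add: cosets_def)
  next
    fix u assume "u \<in> cosets F v"
    moreover have "v \<in> cs 1 v" using v zero_pw[OF zero_in] by (simp add: cs_def)
    ultimately show "u \<in> f (cs 1 v)" by (auto simp: f_def cosets_def)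
  qed
  then have img: "cosets F ` \<Lambda> = f ` (cs 1 ` \<Lambda>)" by (auto simp: image_image)
  then show "finite (cosets F ` \<Lambda>)" using finite_cs by simp
  have "card (f ` (cs 1 ` \<Lambda>)) dvd card (cs 1 ` \<Lambda>)"
  proof (rule card_image_dvd[OF finite_cs])
    fix y z assume "y \<in> f ` cs 1 ` \<Lambda>" "z \<in> f ` cs 1 ` \<Lambda>"
    then obtain v w where v: "v \<in> \<Lambda>" "y = cosets F v" and w: "w \<in> \<Lambda>" "z = cosets F w"
      unfolding img[symmetric] by blast
    define h where "h C = (\<lambda>u. u + (w - v)) ` C" for C
    have hcs: "h (cs 1 u) = cs 1 (u + (w - v))" if "u \<in> \<Lambda>" for u
    proof (intro equalityI subsetI)
      fix a assume "a \<in> cs 1 (u + (w - v))"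
      then have a: "a \<in> \<Lambda>" "a - (u + (w - v)) \<in> pw 1 \<Lambda>" by (auto simp: cs_def)
      have "a - (w - v) \<in> cs 1 u"
        using a v w by (auto simp: cs_def intro!: diff_in) (simp add: algebra_simps)
      then show "a \<in> h (cs 1 u)" unfolding h_def by (rule image_eqI[rotated]) simp
    qed (use v w in \<open>auto simp: h_def cs_def intro!: add_in diff_in\<close>)
    have "inj_on h {C \<in> cs 1 ` \<Lambda>. f C = y}"
      unfolding h_def by (intro inj_onI) (simp add: inj_image_eq_iff)
    moreover have "h C \<in> cs 1 ` \<Lambda> \<and> f (h C) = z" if C: "C \<in> cs 1 ` \<Lambda>" "f C = y" for C
    proof -
      obtain u where u: "u \<in> \<Lambda>" "C = cs 1 u" using C(1) by blast
      then have "u - v \<in> F" using C(2) v fcs cosets_eq_iff[OF F(1)] by simp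
      have i: "u + (w - v) \<in> \<Lambda>" using u v w by (intro add_in diff_in)
      have "f (h C) = cosets F (u + (w - v))" using u hcs fcs[OF i] by simp
      also have "\<dots> = z" using w i \<open>u - v \<in> F\<close> cosets_eq_iff[OF F(1) i w(1)] by (simp add: algebra_simps)
      finally show ?thesis using u hcs i by auto
    qed
    ultimately show "\<exists>h. inj_on h {C \<in> cs 1 ` \<Lambda>. f C = y} \<and>
        h ` {C \<in> cs 1 ` \<Lambda>. f C = y} \<subseteq> {C \<in> cs 1 ` \<Lambda>. f C = z}"
      by (intro exI[of _ h]) auto
  qed
  then have "card (cosets F ` \<Lambda>) dvd p ^ d" using card_cs_1[OF b] img by simp
  then show "\<exists>j\<le>d. card (cosets F ` \<Lambda>) = p ^ j" using divides_primepow_nat[OF prime_p] by blast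
qed

end

text \<open>The assumption \<open>card_quotient\<close> expresses that \<open>G\<close> acts on
  \<open>\<Lambda>/p\<Lambda>\<close> through a finite \<open>p\<close>-group.\<close>

locale padic_representation = padic_lattice_ops \<Lambda> P \<Theta> p smul + group G
  for \<Lambda> :: "'a::ab_group_add set" and P \<Theta> p smul and G :: "('g, 'm) monoid_scheme" (structure) +
  fixes \<tau> :: "'g \<Rightarrow> 'a \<Rightarrow> 'a" and d :: nat and x :: "nat \<Rightarrow> 'a"
  assumes basis_x: "basis d x"
    and endo_\<tau>: "g \<in> carrier G \<Longrightarrow> endo (\<tau> g)"
    and \<tau>_smul: "g \<in> carrier G \<Longrightarrow> c \<in> carrier (padic_int p) \<Longrightarrow> v \<in> \<Lambda> \<Longrightarrow> \<tau> g (smul c v) = smul c (\<tau> g v)"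
    and \<tau>_one: "v \<in> \<Lambda> \<Longrightarrow> \<tau> \<one> v = v"
    and \<tau>_mult: "g \<in> carrier G \<Longrightarrow> h \<in> carrier G \<Longrightarrow> v \<in> \<Lambda> \<Longrightarrow> \<tau> (g \<otimes> h) v = \<tau> h (\<tau> g v)"
    and op_cases: "t \<in> \<Theta> \<Longrightarrow> (\<forall>v\<in>\<Lambda>. t v = P v) \<or> (\<exists>g\<in>carrier G. \<forall>v\<in>\<Lambda>. t v = \<tau> g v - v)"
    and card_quotient: "\<exists>k. card (rcosets {g \<in> carrier G. \<forall>v\<in>\<Lambda>. \<tau> g v - v \<in> pw 1 \<Lambda>}) = p ^ k"
begin

definition K where "K = {g \<in> carrier G. \<forall>v\<in>\<Lambda>. \<tau> g v - v \<in> pw 1 \<Lambda>}"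

lemma K_subset: "K \<subseteq> carrier G" by (auto simp: K_def)

lemma \<tau>_in: "g \<in> carrier G \<Longrightarrow> v \<in> \<Lambda> \<Longrightarrow> \<tau> g v \<in> \<Lambda>"
  using endo_in[OF endo_\<tau>] by blast

lemma one_K: "\<one> \<in> K" by (auto simp: K_def \<tau>_one zero_pw zero_in)

definition G_inv :: "'a set \<Rightarrow> bool" where
  "G_inv F \<longleftrightarrow> (\<forall>g\<in>carrier G. \<forall>v\<in>F. \<tau> g v \<in> F)"

text \<open>The orbit of a class modulo \<open>F\<close> is an image of the set of cosets of
  \<open>K\<close>, and right multiplication by \<open>inv g \<otimes> h\<close> carries the fibre
  over the class of \<open>\<tau> g v\<close> into that over the class of \<open>\<tau> h v\<close>.
  Hence its size divides a power of \<open>p\<close>.\<close>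

lemma card_orbit:
  assumes F: "csub F" "pw 1 \<Lambda> \<subseteq> F" "G_inv F" and v: "v \<in> \<Lambda>"
  shows "\<exists>j. card ((\<lambda>g. cosets F (\<tau> g v)) ` carrier G) = p ^ j"
proof -
  define f where "f C = {u \<in> \<Lambda>. \<exists>g\<in>C. u - \<tau> g v \<in> F}" for C
  have fK: "f (K #> g) = cosets F (\<tau> g v)" if g: "g \<in> carrier G" for g
  proof (intro equalityI subsetI)
    fix u assume "u \<in> f (K #> g)"
    then obtain k where k: "u \<in> \<Lambda>" "k \<in> K" "u - \<tau> (k \<otimes> g) v \<in> F" by (auto simp: f_def r_coset_def)
    then have kG: "k \<in> carrier G" using K_subset by blast
    have "\<tau> k v - v \<in> F" using k(2) v F(2) by (auto simp: K_def)
    then have "\<tau> g (\<tau> k v - v) \<in> F" using F(3) g by (simp add: G_inv_def)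
    then have "\<tau> (k \<otimes> g) v - \<tau> g v \<in> F"
      using endo_diff[OF endo_\<tau>[OF g] \<tau>_in[OF kG v] v] \<tau>_mult[OF kG g v] by simp
    from csub_add[OF F(1) k(3) this] show "u \<in> cosets F (\<tau> g v)" using k(1) by (simp add: cosets_def)
  next
    fix u assume "u \<in> cosets F (\<tau> g v)"
    moreover have "\<one> \<otimes> g \<in> K #> g" using one_K by (auto simp: r_coset_def)
    ultimately show "u \<in> f (K #> g)" using g by (auto simp: f_def cosets_def)
  qed
  have rc: "rcosets K = (\<lambda>g. K #> g) ` carrier G" by (auto simp: RCOSETS_def)
  have img: "(\<lambda>g. cosets F (\<tau> g v)) ` carrier G = f ` (rcosets K)"
    unfolding rc image_image using fK by (intro image_cong refl) simp
  obtain k where k: "card (rcosets K) = p ^ k" using card_quotient unfolding K_def[symmetric] by blast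
  have "finite (rcosets K)" using k p_pos by (metis card.infinite less_irrefl zero_less_power)
  then have "card (f ` (rcosets K)) dvd card (rcosets K)"
  proof (rule card_image_dvd)
    fix y z assume "y \<in> f ` (rcosets K)" "z \<in> f ` (rcosets K)"
    then obtain g h where g: "g \<in> carrier G" "y = cosets F (\<tau> g v)" and h: "h \<in> carrier G" "z = cosets F (\<tau> h v)"
      unfolding img[symmetric] by blast
    define a where "a = inv g \<otimes> h"
    have a: "a \<in> carrier G" using g h by (simp add: a_def)
    have mult: "(K #> c) #> a = K #> (c \<otimes> a)" if "c \<in> carrier G" for c
      using coset_mult_assoc[OF K_subset that a] .
    have "inj_on (\<lambda>C. C #> a) {C \<in> rcosets K. f C = y}"
    proof (rule inj_on_inverseI)
      fix C assume "C \<in> {C \<in> rcosets K. f C = y}"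
      then obtain c where c: "c \<in> carrier G" "C = K #> c" using rc by auto
      show "(C #> a) #> inv a = C"
        unfolding c(2) coset_mult_assoc[OF K_subset c(1) a]
          coset_mult_assoc[OF K_subset m_closed[OF c(1) a] inv_closed[OF a]]
        using c(1) a by (simp add: m_assoc)
    qed
    moreover have "C #> a \<in> rcosets K \<and> f (C #> a) = z" if C: "C \<in> rcosets K" "f C = y" for C
    proof -
      obtain c where c: "c \<in> carrier G" "C = K #> c" using C(1) rc by blast
      have 1: "\<tau> c v - \<tau> g v \<in> F"
        using C(2) c g fK[OF c(1)] cosets_eq_iff[OF F(1) \<tau>_in[OF c(1) v] \<tau>_in[OF g(1) v]] by simp
      have "\<tau> (c \<otimes> a) v - \<tau> h v = \<tau> a (\<tau> c v - \<tau> g v)"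
      proof -
        have "g \<otimes> a = h" using g h by (simp add: a_def m_assoc[symmetric])
        then have "\<tau> h v = \<tau> a (\<tau> g v)" using \<tau>_mult[OF g(1) a v] by simp
        then show ?thesis
          using endo_diff[OF endo_\<tau>[OF a] \<tau>_in[OF c(1) v] \<tau>_in[OF g(1) v]] \<tau>_mult[OF c(1) a v] by simp
      qed
      then have "\<tau> (c \<otimes> a) v - \<tau> h v \<in> F" using 1 F(3) a by (simp add: G_inv_def)
      then have "f (C #> a) = z"
        using c a h v by (simp add: mult fK cosets_eq_iff[OF F(1)] \<tau>_in)
      then show ?thesis using c a mult rc by auto
    qed
    ultimately show "\<exists>h. inj_on h {C \<in> rcosets K. f C = y} \<and>
        h ` {C \<in> rcosets K. f C = y} \<subseteq> {C \<in> rcosets K. f C = z}"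
      by (intro exI[of _ "\<lambda>C. C #> a"]) auto
  qed
  then show ?thesis unfolding img k using divides_primepow_nat[OF prime_p] by blast
qed

text \<open>The class equation of a \<open>p\<close>-group acting on \<open>\<Lambda>/F\<close>:
  without a further fixed class every orbit except that of zero would have size divisible by
  \<open>p\<close>. The orbit of zero has size 1, yet the total is divisible by
  \<open>p\<close>.\<close>

lemma fixed_vector:
  assumes F: "csub F" "pw 1 \<Lambda> \<subseteq> F" "G_inv F" "F \<noteq> \<Lambda>"
  shows "\<exists>v\<in>\<Lambda>. v \<notin> F \<and> (\<forall>g\<in>carrier G. \<tau> g v - v \<in> F)"
proof (rule ccontr)
  assume no: "\<not> ?thesis"
  define Or where "Or v = (\<lambda>g. cosets F (\<tau> g v)) ` carrier G" for v
  define Y where "Y = cosets F ` \<Lambda>"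
  have finY: "finite Y" unfolding Y_def by (rule finite_cosets[OF basis_x F(1,2)])
  have OrY: "Or v \<subseteq> Y" if "v \<in> \<Lambda>" for v using \<tau>_in that by (auto simp: Or_def Y_def)
  have self: "cosets F v \<in> Or v" if "v \<in> \<Lambda>" for v
    using \<tau>_one[OF that] unfolding Or_def by (metis imageI one_closed)
  have UnY: "\<Union>(Or ` \<Lambda>) = Y" using OrY self by (auto simp: Y_def)
  obtain w where w: "w \<in> \<Lambda>" "w \<notin> F" using F(4) csub_le[OF F(1)] by blast
  have dvdY: "p dvd card Y"
  proof -
    obtain j where j: "card Y = p ^ j" using card_cosets[OF basis_x F(1,2)] by (auto simp: Y_def)
    have "cosets F 0 \<noteq> cosets F w" using cosets_eq_iff[OF F(1) w(1) zero_in] w(2) by auto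
    moreover have "cosets F 0 \<in> Y" "cosets F w \<in> Y" using w(1) zero_in by (auto simp: Y_def)
    ultimately have "card Y \<noteq> 1" by (metis card_1_singletonE singletonD)
    then have "j \<noteq> 0" using j by auto
    then show ?thesis using j by (simp add: dvd_power)
  qed
  have dvdO: "p dvd card (Or v)" if v: "v \<in> \<Lambda>" "v \<notin> F" for v
  proof -
    obtain j where j: "card (Or v) = p ^ j" using card_orbit[OF F(1,2,3) v(1)] by (auto simp: Or_def)
    have "j \<noteq> 0"
    proof
      assume "j = 0"
      then obtain y where y: "Or v = {y}" using j by (auto simp: card_1_singleton_iff)
      have "\<tau> g v - v \<in> F" if g: "g \<in> carrier G" for g
      proof -
        have "cosets F (\<tau> g v) \<in> Or v" using g by (auto simp: Or_def)
        then have "cosets F (\<tau> g v) = cosets F v" using self[OF v(1)] y by auto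
        then show ?thesis using cosets_eq_iff[OF F(1) \<tau>_in[OF g v(1)] v(1)] by simp
      qed
      then show False using no v by blast
    qed
    then show ?thesis using j by (simp add: dvd_power)
  qed
  have O_F: "Or v = {cosets F 0}" if v: "v \<in> F" for v
  proof -
    have "cosets F (\<tau> g v) = cosets F 0" if "g \<in> carrier G" for g
      using F(3) that v csub_in[OF F(1)] cosets_eq_iff[OF F(1) _ zero_in, of "\<tau> g v"] by (auto simp: G_inv_def)
    then show ?thesis unfolding Or_def using one_closed by auto
  qed
  have disj: "Or v = Or w" if vw: "v \<in> \<Lambda>" "w \<in> \<Lambda>" "Or v \<inter> Or w \<noteq> {}" for v w
  proof -
    have sub: "Or v \<subseteq> Or w" if vw: "v \<in> \<Lambda>" "w \<in> \<Lambda>" "Or v \<inter> Or w \<noteq> {}" for v w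
    proof
      obtain g h where gh: "g \<in> carrier G" "h \<in> carrier G" "cosets F (\<tau> g v) = cosets F (\<tau> h w)"
        using vw(3) by (auto simp: Or_def)
      then have 1: "\<tau> g v - \<tau> h w \<in> F" using cosets_eq_iff[OF F(1) \<tau>_in \<tau>_in] vw by blast
      fix C assume "C \<in> Or v"
      then obtain a where a: "a \<in> carrier G" "C = cosets F (\<tau> a v)" by (auto simp: Or_def)
      define b where "b = inv g \<otimes> a"
      have b: "b \<in> carrier G" using gh a by (simp add: b_def)
      have "g \<otimes> b = a" using gh a by (simp add: b_def m_assoc[symmetric])
      then have "\<tau> a v = \<tau> b (\<tau> g v)" using \<tau>_mult[OF gh(1) b vw(1)] by simp
      moreover have "\<tau> (h \<otimes> b) w = \<tau> b (\<tau> h w)" using \<tau>_mult[OF gh(2) b vw(2)] .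
      ultimately have "\<tau> a v - \<tau> (h \<otimes> b) w = \<tau> b (\<tau> g v - \<tau> h w)"
        using endo_diff[OF endo_\<tau>[OF b]] \<tau>_in gh vw by simp
      then have "\<tau> a v - \<tau> (h \<otimes> b) w \<in> F" using 1 F(3) b by (simp add: G_inv_def)
      moreover have "h \<otimes> b \<in> carrier G" using gh b by simp
      ultimately have "C = cosets F (\<tau> (h \<otimes> b) w)"
        using a cosets_eq_iff[OF F(1) \<tau>_in[OF a(1) vw(1)] \<tau>_in[OF _ vw(2)]] by blast
      then show "C \<in> Or w" using \<open>h \<otimes> b \<in> carrier G\<close> by (auto simp: Or_def)
    qed
    show ?thesis using sub[OF vw] sub[OF vw(2,1)] vw(3) by (simp add: Int_commute subset_antisym)
  qed
  have finO: "finite (Or ` \<Lambda>)" using OrY finY by (intro finite_subset[of "Or ` \<Lambda>" "Pow Y"]) auto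
  have "card Y = (\<Sum>B\<in>Or ` \<Lambda>. card B)"
    unfolding UnY[symmetric]
  proof (rule card_Union_disjoint)
    show "pairwise disjnt (Or ` \<Lambda>)" using disj by (force simp: pairwise_def disjnt_def)
    show "\<And>B. B \<in> Or ` \<Lambda> \<Longrightarrow> finite B" using OrY finY finite_subset by blast
  qed
  also have "\<dots> = card (Or 0) + (\<Sum>B\<in>Or ` \<Lambda> - {Or 0}. card B)"
    using finO zero_in by (intro sum.remove) auto
  also have "card (Or 0) = 1" using O_F[OF csub_0[OF F(1)]] by simp
  finally have "card Y = 1 + (\<Sum>B\<in>Or ` \<Lambda> - {Or 0}. card B)" .
  moreover have "p dvd (\<Sum>B\<in>Or ` \<Lambda> - {Or 0}. card B)"
  proof (rule dvd_sum)
    fix B assume B: "B \<in> Or ` \<Lambda> - {Or 0}"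
    then obtain v where v: "v \<in> \<Lambda>" "B = Or v" by blast
    have "v \<notin> F" using B v O_F csub_0[OF F(1)] by auto
    then show "p dvd card B" using dvdO v by blast
  qed
  ultimately have "p dvd 1" using dvdY by (metis dvd_add_left_iff)
  then show False using prime_gt_1_nat[OF prime_p] by simp
qed

text \<open>\<open>F i\<close> is the preimage of the \<open>i\<close>-th term of the ascending
  series of fixed points of \<open>\<Lambda>/p\<Lambda>\<close>. Each step lowers the index by at
  least a factor \<open>p\<close> until \<open>\<Lambda>\<close> is reached, so \<open>d\<close>
  steps suffice, and every operator maps \<open>F (Suc i)\<close> into \<open>F i\<close>.\<close>

lemma augp_d_le: "augp d \<Lambda> \<subseteq> pw 1 \<Lambda>"
proof -
  define F where "F = rec_nat (pw 1 \<Lambda>) (\<lambda>i N. {v \<in> \<Lambda>. \<forall>g\<in>carrier G. \<tau> g v - v \<in> N})"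
  have F0: "F 0 = pw 1 \<Lambda>" and FS: "F (Suc i) = {v \<in> \<Lambda>. \<forall>g\<in>carrier G. \<tau> g v - v \<in> F i}" for i
    by (simp_all add: F_def)
  have F: "csub (F i) \<and> pw 1 \<Lambda> \<subseteq> F i \<and> G_inv (F i) \<and> F i \<subseteq> F (Suc i)" for i
  proof (induction i)
    case 0
    have inv: "G_inv (F 0)" unfolding G_inv_def F0 using endo_pw[OF endo_\<tau>] by blast
    have "\<tau> g v - v \<in> pw 1 \<Lambda>" if "g \<in> carrier G" "v \<in> pw 1 \<Lambda>" for g v
      using pw_diff[OF endo_pw[OF endo_\<tau>[OF that(1)] that(2)] that(2)] .
    then have "F 0 \<subseteq> F (Suc 0)" unfolding FS F0 using pw_in by blast
    then show ?case using inv csub_pw[OF csub_Lambda] F0 by simp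
  next
    case (Suc i)
    then have S: "csub (F i)" "pw 1 \<Lambda> \<subseteq> F i" "G_inv (F i)" "F i \<subseteq> F (Suc i)" by auto
    have inv: "\<tau> g v \<in> F (Suc i)" if v: "v \<in> F (Suc i)" and g: "g \<in> carrier G" for g v
    proof -
      have "\<tau> g v - v \<in> F i" "v \<in> \<Lambda>" using v g by (auto simp: FS)
      have "\<tau> h (\<tau> g v) - \<tau> g v \<in> F i" if h: "h \<in> carrier G" for h
      proof -
        have 1: "\<tau> h (\<tau> g v - v) \<in> F i" using S(3) h \<open>\<tau> g v - v \<in> F i\<close> by (simp add: G_inv_def)
        have 2: "\<tau> h v - v \<in> F i" using v h by (simp add: FS)
        have "\<tau> h (\<tau> g v) - \<tau> g v = \<tau> h (\<tau> g v - v) + (\<tau> h v - v) - (\<tau> g v - v)"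
          using endo_diff[OF endo_\<tau>[OF h] \<tau>_in[OF g \<open>v \<in> \<Lambda>\<close>] \<open>v \<in> \<Lambda>\<close>] by simp
        then show ?thesis using csub_diff[OF S(1) csub_add[OF S(1) 1 2] \<open>\<tau> g v - v \<in> F i\<close>] by simp
      qed
      then show ?thesis using \<tau>_in[OF g \<open>v \<in> \<Lambda>\<close>] by (simp add: FS)
    qed
    have diff: "v - w \<in> F (Suc i)" if vw: "v \<in> F (Suc i)" "w \<in> F (Suc i)" for v w
    proof -
      have in\<Lambda>: "v \<in> \<Lambda>" "w \<in> \<Lambda>" using vw by (auto simp: FS)
      have "\<tau> g (v - w) - (v - w) \<in> F i" if g: "g \<in> carrier G" for g
      proof -
        have "\<tau> g (v - w) - (v - w) = (\<tau> g v - v) - (\<tau> g w - w)"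
          using endo_diff[OF endo_\<tau>[OF g] in\<Lambda>] by simp
        moreover have "\<tau> g v - v \<in> F i" "\<tau> g w - w \<in> F i" using vw g by (auto simp: FS)
        then have "(\<tau> g v - v) - (\<tau> g w - w) \<in> F i" by (rule csub_diff[OF S(1)])
        ultimately show ?thesis by metis
      qed
      then show ?thesis using in\<Lambda> diff_in by (simp add: FS)
    qed
    have "csub (F (Suc i))"
    proof (rule csub_open[OF csub_Lambda pure_Lambda])
      show "pw 1 \<Lambda> \<subseteq> F (Suc i)" using S by blast
      show "F (Suc i) \<subseteq> \<Lambda>" by (auto simp: FS)
      show "P v \<in> F (Suc i)" if "v \<in> F (Suc i)" for v
      proof -
        have "P v \<in> pw 1 \<Lambda>" using that by (auto simp: FS pw_def)
        then show ?thesis using S by blast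
      qed
    qed (rule diff)
    moreover have "F (Suc i) \<subseteq> F (Suc (Suc i))"
    proof
      fix v assume v: "v \<in> F (Suc i)"
      then have "v \<in> \<Lambda>" by (simp add: FS)
      moreover have "\<tau> g v - v \<in> F (Suc i)" if "g \<in> carrier G" for g using diff inv v that by blast
      ultimately show "v \<in> F (Suc (Suc i))" using FS[of "Suc i"] by blast
    qed
    ultimately show ?case using S inv by (auto simp: G_inv_def)
  qed
  have card: "card (cosets (F i) ` \<Lambda>) \<le> p ^ (d - i)" if "i \<le> d" for i
    using that
  proof (induction i)
    case 0
    have "F 0 = pw 1 \<Lambda>" "cosets (pw 1 \<Lambda>) = cs 1" by (auto simp: F0 cosets_def cs_def)
    then show ?case using card_cs_1[OF basis_x] by simp
  next
    case (Suc i)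
    have Fi: "csub (F i)" "pw 1 \<Lambda> \<subseteq> F i" "G_inv (F i)" "F i \<subseteq> F (Suc i)" using F[of i] by auto
    have FSi: "csub (F (Suc i))" "pw 1 \<Lambda> \<subseteq> F (Suc i)" using F[of "Suc i"] by auto
    obtain j where j: "card (cosets (F (Suc i)) ` \<Lambda>) = p ^ j" using card_cosets[OF basis_x FSi] by blast
    show ?case
    proof (cases "F i = \<Lambda>")
      case True
      then have "F (Suc i) = \<Lambda>" using Fi csub_le[OF FSi(1)] by blast
      then have "cosets (F (Suc i)) ` \<Lambda> \<subseteq> {\<Lambda>}" using diff_in by (auto simp: cosets_def)
      then have "card (cosets (F (Suc i)) ` \<Lambda>) \<le> 1" using card_mono[of "{\<Lambda>}"] by simp
      then show ?thesis using p_pos by (metis One_nat_def Suc_leI le_trans zero_less_power)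
    next
      case False
      obtain v where v: "v \<in> \<Lambda>" "v \<notin> F i" "v \<in> F (Suc i)"
        using fixed_vector[OF Fi(1,2,3) False] by (auto simp: FS)
      define f where "f C = {u \<in> \<Lambda>. \<exists>c\<in>C. u - c \<in> F (Suc i)}" for C
      have f: "f (cosets (F i) u) = cosets (F (Suc i)) u" if u: "u \<in> \<Lambda>" for u
      proof (intro equalityI subsetI)
        fix w assume "w \<in> f (cosets (F i) u)"
        then obtain c where c: "w \<in> \<Lambda>" "w - c \<in> F (Suc i)" "c - u \<in> F (Suc i)"
          using Fi(4) by (auto simp: f_def cosets_def)
        then show "w \<in> cosets (F (Suc i)) u" using csub_add[OF FSi(1) c(2,3)] by (simp add: cosets_def)
      next
        fix w assume "w \<in> cosets (F (Suc i)) u"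
        moreover have "u \<in> cosets (F i) u" using u csub_0[OF Fi(1)] by (simp add: cosets_def)
        ultimately show "w \<in> f (cosets (F i) u)" by (auto simp: f_def cosets_def)
      qed
      then have img: "cosets (F (Suc i)) ` \<Lambda> = f ` (cosets (F i) ` \<Lambda>)" by (auto simp: image_image)
      note fin = finite_cosets[OF basis_x Fi(1,2)]
      have "\<not> inj_on f (cosets (F i) ` \<Lambda>)"
      proof
        assume inj: "inj_on f (cosets (F i) ` \<Lambda>)"
        have "f (cosets (F i) v) = f (cosets (F i) 0)"
          using v f zero_in cosets_eq_iff[OF FSi(1) v(1) zero_in] by simp
        then have "cosets (F i) v = cosets (F i) 0" using inj_onD[OF inj] v zero_in by blast
        then show False using v cosets_eq_iff[OF Fi(1) v(1) zero_in] by simp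
      qed
      then have "card (f ` (cosets (F i) ` \<Lambda>)) < card (cosets (F i) ` \<Lambda>)"
        using fin card_image_le[OF fin, of f] eq_card_imp_inj_on[OF fin, of f] by linarith
      then have "p ^ j < p ^ (d - i)" using j img Suc by simp
      \<comment> \<open>The index is a power of \<open>p\<close>, so a strict drop costs a whole
        exponent.\<close>
      then have "j < d - i" using prime_gt_1_nat[OF prime_p] by simp
      then show ?thesis using j p_pos by (simp add: power_increasing)
    qed
  qed
  have "F d = \<Lambda>"
  proof (rule ccontr)
    assume "F d \<noteq> \<Lambda>"
    have Fd: "csub (F d)" "pw 1 \<Lambda> \<subseteq> F d" using F[of d] by auto
    then obtain w where w: "w \<in> \<Lambda>" "w \<notin> F d" using \<open>F d \<noteq> \<Lambda>\<close> csub_le by blast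
    have "{cosets (F d) 0, cosets (F d) w} \<subseteq> cosets (F d) ` \<Lambda>" using w zero_in by auto
    moreover have "cosets (F d) w \<noteq> cosets (F d) 0" using cosets_eq_iff[OF Fd(1) w(1) zero_in] w(2) by simp
    ultimately have "2 \<le> card (cosets (F d) ` \<Lambda>)"
      using card_mono[OF finite_cosets[OF basis_x Fd], of "{cosets (F d) 0, cosets (F d) w}"] by simp
    then show False using card[of d] by simp
  qed
  moreover have "aug (F (Suc i)) \<subseteq> F i" for i
  proof
    fix v assume "v \<in> aug (F (Suc i))"
    then obtain f where f: "\<And>t. t \<in> \<Theta> \<Longrightarrow> f t \<in> F (Suc i)" "v = (\<Sum>t\<in>\<Theta>. t (f t))"
      unfolding aug_def by blast
    have "t (f t) \<in> F i" if t: "t \<in> \<Theta>" for t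
    proof -
      have 1: "f t \<in> \<Lambda>" "\<And>g. g \<in> carrier G \<Longrightarrow> \<tau> g (f t) - f t \<in> F i" using f(1)[OF t] by (auto simp: FS)
      then have "P (f t) \<in> F i" using F[of i] by (auto simp: pw_def)
      then show ?thesis using op_cases[OF t] 1 by auto
    qed
    then show "v \<in> F i" unfolding f(2) using F[of i] by (intro csub_sum) auto
  qed
  then have "augp i (F i) \<subseteq> F 0" for i
  proof (induction i)
    case (Suc i)
    have "augp (Suc i) (F (Suc i)) = augp i (aug (F (Suc i)))" by (simp add: funpow_swap1)
    also have "\<dots> \<subseteq> augp i (F i)" by (intro augp_mono Suc.prems)
    also have "\<dots> \<subseteq> F 0" by (intro Suc.IH Suc.prems)
    finally show ?case .
  qed simp
  ultimately show ?thesis using F0 by metis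
qed

end

section \<open>An additive embedding of lattices\<close>

text \<open>The submodule theory above uses the operations of a type class, whereas a lattice is given by a
  carrier set. It embeds additively into a type of that class, a \<open>p\<close>-adic integer \<open>a\<close> being recorded
  by the classes of \<open>a n / p^n\<close> in \<open>\<rat>/\<int>\<close>.\<close>

quotient_type circle = rat / "\<lambda>x y :: rat. x - y \<in> \<int>"
proof (rule equivpI)
  show "reflp (\<lambda>x y :: rat. x - y \<in> \<int>)" by (auto intro: reflpI)
  show "symp (\<lambda>x y :: rat. x - y \<in> \<int>)" by (intro sympI) (metis Ints_minus minus_diff_eq)
  show "transp (\<lambda>x y :: rat. x - y \<in> \<int>)"
  proof (rule transpI)
    fix x y z :: rat assume "x - y \<in> \<int>" "y - z \<in> \<int>"
    then have "(x - y) + (y - z) \<in> \<int>" by (rule Ints_add)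
    then show "x - z \<in> \<int>" by simp
  qed
qed

instantiation circle :: ab_group_add
begin

lift_definition zero_circle :: circle is "0 :: rat" .

lift_definition plus_circle :: "circle \<Rightarrow> circle \<Rightarrow> circle" is "(+) :: rat \<Rightarrow> rat \<Rightarrow> rat"
proof -
  fix a b c d :: rat assume "a - b \<in> \<int>" "c - d \<in> \<int>"
  then have "(a - b) + (c - d) \<in> \<int>" by (rule Ints_add)
  then show "a + c - (b + d) \<in> \<int>" by (simp add: algebra_simps)
qed

lift_definition uminus_circle :: "circle \<Rightarrow> circle" is "uminus :: rat \<Rightarrow> rat"
  by (metis Ints_minus minus_diff_eq minus_diff_minus)

lift_definition minus_circle :: "circle \<Rightarrow> circle \<Rightarrow> circle" is "(-) :: rat \<Rightarrow> rat \<Rightarrow> rat"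
proof -
  fix a b c d :: rat assume "a - b \<in> \<int>" "c - d \<in> \<int>"
  then have "(a - b) - (c - d) \<in> \<int>" by (rule Ints_diff)
  then show "a - c - (b - d) \<in> \<int>" by (simp add: algebra_simps)
qed

instance
  by (standard; transfer) (simp_all add: algebra_simps)

end

lemma abs_circle_eq_iff: "abs_circle x = abs_circle y \<longleftrightarrow> x - y \<in> \<int>"
  by (rule circle.abs_eq_iff)

lemma abs_circle_add: "abs_circle (x + y) = abs_circle x + abs_circle y"
  by (rule plus_circle.abs_eq[symmetric])

lemma lattice_basis_coeff:
  assumes "lattice_basis p d L e" "v \<in> carrier L"
  shows "\<exists>!c. c \<in> {1..d} \<rightarrow>\<^sub>E carrier (padic_int p) \<and> v = (\<Oplus>\<^bsub>L\<^esub>k\<in>{1..d}. c k \<odot>\<^bsub>L\<^esub> e k)"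
  using assms(1) unfolding lattice_basis_def by (rule conjunct2[THEN bspec]) (rule assms(2))

lemma additive_embedding:
  fixes L :: "(nat \<Rightarrow> int, 'a, 'n) module_scheme"
  assumes p: "p > 0" and L: "Module.module (padic_int p) L" and e: "lattice_basis p d L e"
  shows "\<exists>\<Phi> :: 'a \<Rightarrow> nat \<Rightarrow> nat \<Rightarrow> circle. inj_on \<Phi> (carrier L) \<and>
    (\<forall>v\<in>carrier L. \<forall>w\<in>carrier L. \<Phi> (v \<oplus>\<^bsub>L\<^esub> w) = \<Phi> v + \<Phi> w)"
proof -
  interpret L: Module.module "padic_int p" L by (rule L)
  have e_in: "e k \<in> carrier L" if "k \<in> {1..d}" for k using e that by (auto simp: lattice_basis_def)
  define coef where "coef v = (THE c. c \<in> {1..d} \<rightarrow>\<^sub>E carrier (padic_int p) \<and>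
    v = (\<Oplus>\<^bsub>L\<^esub>k\<in>{1..d}. c k \<odot>\<^bsub>L\<^esub> e k))" for v
  have coef: "coef v \<in> {1..d} \<rightarrow>\<^sub>E carrier (padic_int p)"
    "v = (\<Oplus>\<^bsub>L\<^esub>k\<in>{1..d}. coef v k \<odot>\<^bsub>L\<^esub> e k)" if "v \<in> carrier L" for v
    using theI'[OF lattice_basis_coeff[OF e that]] unfolding coef_def by blast+
  have coef_in: "coef v k \<in> carrier (padic_int p)" if "v \<in> carrier L" "k \<in> {1..d}" for v k
    using coef(1)[OF that(1)] that(2) by (auto simp: PiE_iff)
  have coef_unique: "c = coef v" if "v \<in> carrier L" "c \<in> {1..d} \<rightarrow>\<^sub>E carrier (padic_int p)"
    "v = (\<Oplus>\<^bsub>L\<^esub>k\<in>{1..d}. c k \<odot>\<^bsub>L\<^esub> e k)" for c v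
    unfolding coef_def using that by (intro the1_equality[OF lattice_basis_coeff[OF e that(1)], symmetric] conjI)
  have coef_add: "coef (v \<oplus>\<^bsub>L\<^esub> w) k = coef v k \<oplus>\<^bsub>padic_int p\<^esub> coef w k"
    if vw: "v \<in> carrier L" "w \<in> carrier L" and k: "k \<in> {1..d}" for v w k
  proof -
    define c where "c = restrict (\<lambda>k. coef v k \<oplus>\<^bsub>padic_int p\<^esub> coef w k) {1..d}"
    have "(\<Oplus>\<^bsub>L\<^esub>k\<in>{1..d}. c k \<odot>\<^bsub>L\<^esub> e k) =
        (\<Oplus>\<^bsub>L\<^esub>k\<in>{1..d}. coef v k \<odot>\<^bsub>L\<^esub> e k \<oplus>\<^bsub>L\<^esub> coef w k \<odot>\<^bsub>L\<^esub> e k)"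
      using vw e_in coef_in by (intro L.M.finsum_cong') (auto simp: c_def L.smult_l_distr)
    also have "\<dots> = (\<Oplus>\<^bsub>L\<^esub>k\<in>{1..d}. coef v k \<odot>\<^bsub>L\<^esub> e k) \<oplus>\<^bsub>L\<^esub> (\<Oplus>\<^bsub>L\<^esub>k\<in>{1..d}. coef w k \<odot>\<^bsub>L\<^esub> e k)"
      using vw e_in coef_in by (intro L.M.finsum_addf) auto
    also have "\<dots> = v \<oplus>\<^bsub>L\<^esub> w" using coef(2) vw by simp
    finally have sum: "(\<Oplus>\<^bsub>L\<^esub>k\<in>{1..d}. c k \<odot>\<^bsub>L\<^esub> e k) = v \<oplus>\<^bsub>L\<^esub> w" .
    have "c \<in> {1..d} \<rightarrow>\<^sub>E carrier (padic_int p)"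
      unfolding c_def restrict_PiE_iff using coef_in vw by (intro ballI L.R.a_closed)
    from coef_unique[OF L.M.a_closed[OF vw] this sum[symmetric]] have "c = coef (v \<oplus>\<^bsub>L\<^esub> w)" .
    from fun_cong[OF this, of k] show ?thesis using k by (simp add: c_def)
  qed
  define \<Phi> :: "'a \<Rightarrow> nat \<Rightarrow> nat \<Rightarrow> circle" where
    "\<Phi> v = (\<lambda>k n. if k \<in> {1..d} then abs_circle (of_int (coef v k n) / of_nat p ^ n) else 0)" for v
  have "\<Phi> (v \<oplus>\<^bsub>L\<^esub> w) = \<Phi> v + \<Phi> w" if vw: "v \<in> carrier L" "w \<in> carrier L" for v w
  proof (intro ext)
    fix k n
    show "\<Phi> (v \<oplus>\<^bsub>L\<^esub> w) k n = (\<Phi> v + \<Phi> w) k n"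
    proof (cases "k \<in> {1..d}")
      case True
      define a where "a = coef v k n + coef w k n"
      \<comment> \<open>Reducing \<open>a\<close> modulo \<open>p^n\<close> changes
        \<open>a / p^n\<close> by an integer, which vanishes in \<open>circle\<close>. This gives
        additivity of \<open>\<Phi>\<close>.\<close>
      have "a = a mod int p ^ n + int p ^ n * (a div int p ^ n)" by simp
      then have "(of_int (a mod int p ^ n) :: rat) = of_int a - of_nat p ^ n * of_int (a div int p ^ n)"
        by (metis add_diff_cancel_right' of_int_add of_int_mult of_int_of_nat_eq of_int_power)
      then have "of_int (a mod int p ^ n) / of_nat p ^ n - of_int a / of_nat p ^ n =
          (of_int (- (a div int p ^ n)) :: rat)"
        using p by (simp add: field_simps)
      then have "abs_circle (of_int (a mod int p ^ n) / of_nat p ^ n) = abs_circle (of_int a / of_nat p ^ n)"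
        unfolding abs_circle_eq_iff by (metis Ints_of_int)
      also have "\<dots> = abs_circle (of_int (coef v k n) / of_nat p ^ n) + abs_circle (of_int (coef w k n) / of_nat p ^ n)"
        by (simp add: a_def add_divide_distrib abs_circle_add)
      finally show ?thesis
        using True coef_add[OF vw True] by (simp add: \<Phi>_def padic_add a_def)
    qed (auto simp: \<Phi>_def)
  qed
  moreover have "inj_on \<Phi> (carrier L)"
  proof (rule inj_onI)
    fix v w assume vw: "v \<in> carrier L" "w \<in> carrier L" and eq: "\<Phi> v = \<Phi> w"
    have "coef v k = coef w k" if k: "k \<in> {1..d}" for k
    proof (rule ext)
      fix n
      have pos: "(of_nat p ^ n :: rat) > 0" using p by simp
      have "\<Phi> v k n = \<Phi> w k n" using eq by simp
      then have "of_int (coef v k n) / of_nat p ^ n - of_int (coef w k n) / of_nat p ^ n \<in> (\<int> :: rat set)"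
        using k by (simp add: \<Phi>_def abs_circle_eq_iff)
      then obtain z :: int where "of_int (coef v k n) / of_nat p ^ n - of_int (coef w k n) / of_nat p ^ n = (of_int z :: rat)"
        by (auto elim: Ints_cases)
      then have "of_int (coef v k n - coef w k n) = (of_int (int p ^ n * z) :: rat)"
        using p by (auto simp: field_simps)
      then have "coef v k n - coef w k n = int p ^ n * z" by (simp only: of_int_eq_iff)
      then have "coef v k n mod int p ^ n = coef w k n mod int p ^ n"
        by (metis dvd_triv_left mod_eq_dvd_iff)
      moreover have "coef v k n \<in> {0..<int p ^ n}" "coef w k n \<in> {0..<int p ^ n}"
        using coef_in[OF vw(1) k] coef_in[OF vw(2) k] by (auto simp: padic_carrier)
      ultimately show "coef v k n = coef w k n" by simp
    qed
    then have "coef v = coef w" by (rule PiE_ext[OF coef(1)[OF vw(1)] coef(1)[OF vw(2)]])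
    then have "(\<Oplus>\<^bsub>L\<^esub>k\<in>{1..d}. coef v k \<odot>\<^bsub>L\<^esub> e k) = (\<Oplus>\<^bsub>L\<^esub>k\<in>{1..d}. coef w k \<odot>\<^bsub>L\<^esub> e k)"
      by (simp only:)
    then show "v = w" unfolding coef(2)[OF vw(1), symmetric] coef(2)[OF vw(2), symmetric] .
  qed
  ultimately show ?thesis by blast
qed

section \<open>Transport of a lattice along an embedding\<close>

text \<open>Of \<open>\<Phi>\<close> only additivity and injectivity are assumed; the scalars are
  carried over by \<open>smul\<close> through the inverse \<open>\<Psi>\<close>.\<close>

locale embedded_lattice =
  fixes p d :: nat and L :: "(nat \<Rightarrow> int, 'a, 'n) module_scheme" and e :: "nat \<Rightarrow> 'a"
    and \<Phi> :: "'a \<Rightarrow> 'b::ab_group_add"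
  assumes prime: "normalization_semidom_class.prime p"
    and module: "Module.module (padic_int p) L"
    and e_basis: "lattice_basis p d L e"
    and \<Phi>_inj: "inj_on \<Phi> (carrier L)"
    and \<Phi>_add: "v \<in> carrier L \<Longrightarrow> w \<in> carrier L \<Longrightarrow> \<Phi> (v \<oplus>\<^bsub>L\<^esub> w) = \<Phi> v + \<Phi> w"
begin

sublocale L: Module.module "padic_int p" L by (rule module)

definition \<Lambda> where "\<Lambda> = \<Phi> ` carrier L"
definition \<Psi> where "\<Psi> = inv_into (carrier L) \<Phi>"
definition smul where "smul c x = \<Phi> (c \<odot>\<^bsub>L\<^esub> \<Psi> x)"
definition P where "P = smul (padic_of_int p (int p))"

lemma \<Psi>_\<Phi>: "v \<in> carrier L \<Longrightarrow> \<Psi> (\<Phi> v) = v"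
  unfolding \<Psi>_def using \<Phi>_inj by (rule inv_into_f_f)

lemma \<Phi>_\<Psi>: "x \<in> \<Lambda> \<Longrightarrow> \<Phi> (\<Psi> x) = x"
  unfolding \<Psi>_def \<Lambda>_def by (rule f_inv_into_f)

lemma \<Phi>_in: "v \<in> carrier L \<Longrightarrow> \<Phi> v \<in> \<Lambda>" by (simp add: \<Lambda>_def)

lemma \<Psi>_in: "x \<in> \<Lambda> \<Longrightarrow> \<Psi> x \<in> carrier L"
  unfolding \<Psi>_def \<Lambda>_def by (rule inv_into_into)

lemma \<Phi>_zero: "\<Phi> \<zero>\<^bsub>L\<^esub> = 0"
  using \<Phi>_add[of "\<zero>\<^bsub>L\<^esub>" "\<zero>\<^bsub>L\<^esub>"] by simp

lemma \<Phi>_neg: "v \<in> carrier L \<Longrightarrow> \<Phi> (\<ominus>\<^bsub>L\<^esub> v) = - \<Phi> v"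
  using \<Phi>_add[of "\<ominus>\<^bsub>L\<^esub> v" v] by (simp add: L.M.l_neg \<Phi>_zero eq_neg_iff_add_eq_0)

lemma \<Phi>_smul: "v \<in> carrier L \<Longrightarrow> \<Phi> (c \<odot>\<^bsub>L\<^esub> v) = smul c (\<Phi> v)"
  by (simp add: smul_def \<Psi>_\<Phi>)

lemma \<Phi>_finsum:
  assumes "\<And>i. i \<in> I \<Longrightarrow> f i \<in> carrier L"
  shows "\<Phi> (\<Oplus>\<^bsub>L\<^esub>i\<in>I. f i) = (\<Sum>i\<in>I. \<Phi> (f i))"
  using assms
proof (induction I rule: infinite_finite_induct)
  case (insert i I)
  then have "(\<Oplus>\<^bsub>L\<^esub>i\<in>insert i I. f i) = f i \<oplus>\<^bsub>L\<^esub> (\<Oplus>\<^bsub>L\<^esub>i\<in>I. f i)"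
    by (intro L.M.finsum_insert) auto
  moreover have "(\<Oplus>\<^bsub>L\<^esub>i\<in>I. f i) \<in> carrier L" using insert by (intro L.M.finsum_closed) auto
  ultimately show ?case using insert by (simp add: \<Phi>_add)
qed (simp_all add: \<Phi>_zero L.M.finsum_infinite)

sublocale padic_module \<Lambda> p smul
proof
  show "0 \<in> \<Lambda>" using \<Phi>_zero \<Phi>_in by (metis L.M.zero_closed)
  show "v - w \<in> \<Lambda>" if vw: "v \<in> \<Lambda>" "w \<in> \<Lambda>" for v w
  proof -
    obtain a b where "a \<in> carrier L" "b \<in> carrier L" "v = \<Phi> a" "w = \<Phi> b" using vw by (auto simp: \<Lambda>_def)
    then have "v - w = \<Phi> (a \<oplus>\<^bsub>L\<^esub> \<ominus>\<^bsub>L\<^esub> b)" "a \<oplus>\<^bsub>L\<^esub> \<ominus>\<^bsub>L\<^esub> b \<in> carrier L" by (simp_all add: \<Phi>_add \<Phi>_neg)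
    then show ?thesis using \<Phi>_in by simp
  qed
qed (auto simp: prime \<Lambda>_def \<Phi>_smul[symmetric] \<Phi>_add[symmetric] L.smult_r_distr L.smult_l_distr L.smult_assoc1)

lemma lattice_basis_iff:
  assumes x: "x \<in> {1..d} \<rightarrow> carrier L"
  shows "lattice_basis p d L x \<longleftrightarrow> basis d (\<Phi> \<circ> x)"
proof -
  have eq: "v = (\<Oplus>\<^bsub>L\<^esub>k\<in>{1..d}. c k \<odot>\<^bsub>L\<^esub> x k) \<longleftrightarrow> \<Phi> v = (\<Sum>k\<in>{1..d}. smul (c k) ((\<Phi> \<circ> x) k))"
    if v: "v \<in> carrier L" and c: "c \<in> {1..d} \<rightarrow>\<^sub>E Zp" for v c
  proof -
    have cx: "c k \<odot>\<^bsub>L\<^esub> x k \<in> carrier L" "x k \<in> carrier L" if "k \<in> {1..d}" for k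
      using x c that by (auto simp: Pi_iff PiE_iff)
    have "\<Phi> (\<Oplus>\<^bsub>L\<^esub>k\<in>{1..d}. c k \<odot>\<^bsub>L\<^esub> x k) = (\<Sum>k\<in>{1..d}. \<Phi> (c k \<odot>\<^bsub>L\<^esub> x k))"
      by (rule \<Phi>_finsum[OF cx(1)])
    also have "\<dots> = (\<Sum>k\<in>{1..d}. smul (c k) ((\<Phi> \<circ> x) k))"
      using cx(2) by (intro sum.cong) (auto simp: \<Phi>_smul)
    finally have "\<Phi> (\<Oplus>\<^bsub>L\<^esub>k\<in>{1..d}. c k \<odot>\<^bsub>L\<^esub> x k) = (\<Sum>k\<in>{1..d}. smul (c k) ((\<Phi> \<circ> x) k))" .
    moreover have "(\<Oplus>\<^bsub>L\<^esub>k\<in>{1..d}. c k \<odot>\<^bsub>L\<^esub> x k) \<in> carrier L"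
      using cx(1) by (intro L.M.finsum_closed) blast
    ultimately show ?thesis using v inj_on_eq_iff[OF \<Phi>_inj] by metis
  qed
  have "(\<exists>!c. c \<in> {1..d} \<rightarrow>\<^sub>E Zp \<and> v = (\<Oplus>\<^bsub>L\<^esub>k\<in>{1..d}. c k \<odot>\<^bsub>L\<^esub> x k)) \<longleftrightarrow>
      (\<exists>!c. c \<in> {1..d} \<rightarrow>\<^sub>E Zp \<and> \<Phi> v = (\<Sum>k\<in>{1..d}. smul (c k) ((\<Phi> \<circ> x) k)))" if "v \<in> carrier L" for v
    using eq[OF that] by (intro ex_cong1 arg_cong[of _ _ Ex1] ext) auto
  moreover have "(\<Phi> \<circ> x) ` {1..d} \<subseteq> \<Lambda>" using x by (auto simp: \<Lambda>_def)
  ultimately show ?thesis using x unfolding lattice_basis_def basis_def by (simp add: \<Lambda>_def)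
qed

lemma e_in: "k \<in> {1..d} \<Longrightarrow> e k \<in> carrier L"
  using e_basis by (auto simp: lattice_basis_def)

lemma basis_e: "basis d (\<Phi> \<circ> e)"
  using lattice_basis_iff[of e] e_basis by (simp add: lattice_basis_def)

sublocale compact_lattice \<Lambda> P
  unfolding P_def by (rule compact_lattice_of_basis[OF basis_e])

lemma add_pow_eq_smult: "v \<in> carrier L \<Longrightarrow> add_pow L n v = padic_of_int p (int n) \<odot>\<^bsub>L\<^esub> v" for n :: nat
proof (induction n)
  case 0
  have "padic_of_int p 0 = \<zero>\<^bsub>padic_int p\<^esub>" by (simp add: padic_of_int_def padic_zero)
  then show ?case using 0 by (simp add: L.smult_l_null add_pow_def)
next
  case (Suc n)
  have "add_pow L (Suc n) v = add_pow L n v \<oplus>\<^bsub>L\<^esub> v" using Suc.prems by (simp add: L.M.add.nat_pow_Suc)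
  also have "\<dots> = (padic_of_int p (int n) \<oplus>\<^bsub>padic_int p\<^esub> \<one>\<^bsub>padic_int p\<^esub>) \<odot>\<^bsub>L\<^esub> v"
    using Suc by (simp add: L.smult_l_distr dig_in)
  also have "padic_of_int p (int n) \<oplus>\<^bsub>padic_int p\<^esub> \<one>\<^bsub>padic_int p\<^esub> = padic_of_int p (int (Suc n))"
    unfolding padic_of_int_one[symmetric] padic_of_int_add[symmetric] by (simp add: add.commute)
  finally show ?case .
qed

lemma Pow_\<Phi>: "v \<in> carrier L \<Longrightarrow> (P ^^ n) (\<Phi> v) = \<Phi> (add_pow L (p ^ n) v)"
proof (induction n)
  case 0
  then show ?case by (simp add: add_pow_eq_smult padic_of_int_one)
next
  case (Suc n)
  have "add_pow L (p ^ n) v \<in> carrier L" using Suc by (simp add: add_pow_eq_smult dig_in)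
  then show ?case
    using Suc by (simp add: P_def \<Phi>_smul[symmetric] add_pow_eq_smult dig_in padic_of_int_mult L.smult_assoc1)
qed

lemma \<Phi>_p_multiple: "M \<subseteq> carrier L \<Longrightarrow> \<Phi> ` p_multiple p L c M = pw c (\<Phi> ` M)"
  unfolding p_multiple_def pw_def image_image using Pow_\<Phi> by (intro image_cong) auto

lemma p_multiple_closed: "M \<subseteq> carrier L \<Longrightarrow> p_multiple p L c M \<subseteq> carrier L"
  by (auto simp: p_multiple_def add_pow_eq_smult dig_in intro!: L.smult_closed)

lemma \<Phi>_image_le_iff: "A \<subseteq> carrier L \<Longrightarrow> B \<subseteq> carrier L \<Longrightarrow> \<Phi> ` A \<subseteq> \<Phi> ` B \<longleftrightarrow> A \<subseteq> B"
  using inj_on_image_subset_iff[OF \<Phi>_inj] .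

lemma openin_coset:
  "v \<in> carrier L \<Longrightarrow> openin (lattice_topology p L) (v <+\<^bsub>L\<^esub> p_multiple p L n (carrier L))"
  unfolding lattice_topology_def by (rule topology_generated_by_Basis) blast

text \<open>Translates the basic open sets of the lattice topology into congruences modulo
  \<open>p^n\<close>.\<close>

lemma mem_coset_iff:
  assumes "v \<in> carrier L" "w \<in> carrier L"
  shows "w \<in> v <+\<^bsub>L\<^esub> p_multiple p L n (carrier L) \<longleftrightarrow> \<Phi> w - \<Phi> v \<in> pw n \<Lambda>"
proof -
  have sub: "p_multiple p L n (carrier L) \<subseteq> carrier L" by (rule p_multiple_closed) simp
  have "w \<in> v <+\<^bsub>L\<^esub> p_multiple p L n (carrier L) \<longleftrightarrow> (\<exists>h\<in>p_multiple p L n (carrier L). w = v \<oplus>\<^bsub>L\<^esub> h)"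
    by (auto simp: a_l_coset_def')
  also have "\<dots> \<longleftrightarrow> (\<exists>h\<in>p_multiple p L n (carrier L). \<Phi> w = \<Phi> v + \<Phi> h)"
  proof (intro bex_cong refl)
    fix h assume "h \<in> p_multiple p L n (carrier L)"
    then have h: "h \<in> carrier L" using sub by blast
    show "w = v \<oplus>\<^bsub>L\<^esub> h \<longleftrightarrow> \<Phi> w = \<Phi> v + \<Phi> h"
      using inj_on_eq_iff[OF \<Phi>_inj assms(2) L.M.a_closed[OF assms(1) h]] \<Phi>_add[OF assms(1) h] by simp
  qed
  also have "\<dots> \<longleftrightarrow> \<Phi> w - \<Phi> v \<in> \<Phi> ` p_multiple p L n (carrier L)" by (simp add: image_iff diff_eq_eq add.commute)
  also have "\<Phi> ` p_multiple p L n (carrier L) = pw n \<Lambda>" by (simp add: \<Phi>_p_multiple \<Lambda>_def)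
  finally show ?thesis .
qed

lemma topspace_lattice_topology: "topspace (lattice_topology p L) = carrier L"
proof
  show "topspace (lattice_topology p L) \<subseteq> carrier L"
    unfolding lattice_topology_def topology_generated_by_topspace
    using p_multiple_closed[OF order_refl] by (auto simp: a_l_coset_def')
  show "carrier L \<subseteq> topspace (lattice_topology p L)"
  proof
    fix v assume v: "v \<in> carrier L"
    have "v \<in> v <+\<^bsub>L\<^esub> p_multiple p L 0 (carrier L)" using mem_coset_iff[OF v v] zero_pw[OF zero_in] by simp
    then show "v \<in> topspace (lattice_topology p L)" using openin_subset[OF openin_coset[OF v]] by blast
  qed
qed

end

locale lattice_representation = embedded_lattice p d L e \<Phi>
  for p d :: nat and L :: "(nat \<Rightarrow> int, 'a, 'n) module_scheme" and e :: "nat \<Rightarrow> 'a"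
    and \<Phi> :: "'a \<Rightarrow> 'b::ab_group_add" +
  fixes G :: "('g, 'm) monoid_scheme" and T :: "'g topology" and act :: "'a \<Rightarrow> 'g \<Rightarrow> 'a"
    and S :: "'g set"
  assumes pro_p: "pro_p_group p G T"
    and S: "finite S" "S \<subseteq> carrier G" "Abstract_Topology.closure_of T (generate G S) = carrier G"
    and action: "continuous_linear_right_action p G T L act"
begin

lemma group_G: "group G" and topspace_T: "topspace T = carrier G"
  using pro_p by (auto simp: pro_p_group_def profinite_group_def topological_group_def)

interpretation G: group G by (rule group_G)

lemma act_in: "v \<in> carrier L \<Longrightarrow> g \<in> carrier G \<Longrightarrow> act v g \<in> carrier L"
  and act_one: "v \<in> carrier L \<Longrightarrow> act v \<one>\<^bsub>G\<^esub> = v"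
  and act_mult: "v \<in> carrier L \<Longrightarrow> g \<in> carrier G \<Longrightarrow> h \<in> carrier G \<Longrightarrow> act v (g \<otimes>\<^bsub>G\<^esub> h) = act (act v g) h"
  and act_add: "v \<in> carrier L \<Longrightarrow> w \<in> carrier L \<Longrightarrow> g \<in> carrier G \<Longrightarrow>
    act (v \<oplus>\<^bsub>L\<^esub> w) g = act v g \<oplus>\<^bsub>L\<^esub> act w g"
  and act_smult: "c \<in> carrier (padic_int p) \<Longrightarrow> v \<in> carrier L \<Longrightarrow> g \<in> carrier G \<Longrightarrow>
    act (c \<odot>\<^bsub>L\<^esub> v) g = c \<odot>\<^bsub>L\<^esub> act v g"
  and act_continuous: "continuous_map (prod_topology (lattice_topology p L) T) (lattice_topology p L) (\<lambda>(v, g). act v g)"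
  using action by (auto simp: continuous_linear_right_action_def)

definition \<tau> where "\<tau> g x = \<Phi> (act (\<Psi> x) g)"

text \<open>Inverses of generators appear so that an induction over \<open>generate\<close> meets an
  operator in each of its base cases.\<close>

definition \<Theta> where "\<Theta> = insert P ((\<lambda>s x. \<tau> s x - x) ` (S \<union> m_inv G ` S))"

lemma \<tau>_\<Phi>: "v \<in> carrier L \<Longrightarrow> \<tau> g (\<Phi> v) = \<Phi> (act v g)"
  by (simp add: \<tau>_def \<Psi>_\<Phi>)

lemma \<tau>_smul': "g \<in> carrier G \<Longrightarrow> c \<in> Zp \<Longrightarrow> x \<in> \<Lambda> \<Longrightarrow> \<tau> g (smul c x) = smul c (\<tau> g x)"
  by (auto simp: \<Lambda>_def \<Phi>_smul[symmetric] \<tau>_\<Phi> act_smult act_in)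

lemma endo_\<tau>': "g \<in> carrier G \<Longrightarrow> endo (\<tau> g)"
  unfolding endo_def
proof (intro conjI ballI)
  fix x y assume g: "g \<in> carrier G" and "x \<in> \<Lambda>" "y \<in> \<Lambda>"
  then show "\<tau> g (x + y) = \<tau> g x + \<tau> g y"
    by (auto simp: \<Lambda>_def \<Phi>_add[symmetric] \<tau>_\<Phi> act_add act_in)
next
  fix x assume "g \<in> carrier G" "x \<in> \<Lambda>"
  then show "\<tau> g x \<in> \<Lambda>" "\<tau> g (P x) = P (\<tau> g x)"
    by (auto simp: P_def \<tau>_smul' dig_in) (auto simp: \<Lambda>_def \<tau>_\<Phi> act_in)
qed

lemma gens_in: "S \<union> m_inv G ` S \<subseteq> carrier G"
  using S(2) by auto

sublocale padic_lattice_ops \<Lambda> P \<Theta> p smul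
proof
  show "finite \<Theta>" using S(1) by (simp add: \<Theta>_def)
  show "P \<in> \<Theta>" by (simp add: \<Theta>_def)
  fix t assume "t \<in> \<Theta>"
  then consider "t = P" | s where "s \<in> carrier G" "t = (\<lambda>x. \<tau> s x - x)"
    using gens_in unfolding \<Theta>_def by blast
  then show "endo t"
  proof cases
    case 2
    note E = endo_\<tau>'[OF 2(1)]
    show ?thesis unfolding endo_def 2(2)
      using endo_in[OF E] endo_add[OF E] endo_P[OF E] by (auto simp: diff_in endo_diff[OF endo_P'])
  qed (simp add: endo_P')
qed (simp add: P_def)

lemma cont_act: "v \<in> carrier L \<Longrightarrow> continuous_map T (lattice_topology p L) (act v)"
proof -
  assume v: "v \<in> carrier L"
  have "continuous_map T (prod_topology (lattice_topology p L) T) (\<lambda>g. (v, g))"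
    using v by (simp add: continuous_map_paired topspace_lattice_topology)
  from continuous_map_compose[OF this act_continuous] show ?thesis by (simp add: comp_def)
qed

lemma openin_near:
  assumes "v \<in> carrier L" "w \<in> carrier L"
  shows "openin T {g \<in> carrier G. \<Phi> (act v g) - \<Phi> w \<in> pw n \<Lambda>}"
proof -
  have "openin T {g \<in> topspace T. act v g \<in> w <+\<^bsub>L\<^esub> p_multiple p L n (carrier L)}"
    by (rule openin_continuous_map_preimage[OF cont_act[OF assms(1)] openin_coset[OF assms(2)]])
  also have "{g \<in> topspace T. act v g \<in> w <+\<^bsub>L\<^esub> p_multiple p L n (carrier L)} =
      {g \<in> carrier G. \<Phi> (act v g) - \<Phi> w \<in> pw n \<Lambda>}"
    using mem_coset_iff[OF assms(2) act_in[OF assms(1)]] by (auto simp: topspace_T)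
  finally show ?thesis .
qed

definition kernel where "kernel = {g \<in> carrier G. \<forall>x\<in>\<Lambda>. \<tau> g x - x \<in> pw 1 \<Lambda>}"

lemma \<tau>_basics:
  assumes "x \<in> \<Lambda>"
  shows "\<tau> \<one>\<^bsub>G\<^esub> x = x"
    and "g \<in> carrier G \<Longrightarrow> h \<in> carrier G \<Longrightarrow> \<tau> (g \<otimes>\<^bsub>G\<^esub> h) x = \<tau> h (\<tau> g x)"
    and "g \<in> carrier G \<Longrightarrow> \<tau> g x \<in> \<Lambda>"
  using assms by (auto simp: \<Lambda>_def \<tau>_\<Phi> act_one act_mult act_in)

text \<open>By linearity, triviality modulo \<open>p\<close> need only be tested on the basis
  vectors, which leaves finitely many open conditions.\<close>

lemma openin_kernel: "openin T kernel"
proof -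
  have "openin T {g \<in> carrier G. \<forall>k\<in>I. \<Phi> (act (e k) g) - \<Phi> (e k) \<in> pw 1 \<Lambda>}" if "finite I" "I \<subseteq> {1..d}" for I
    using that
  proof (induction I)
    case empty
    then show ?case using openin_topspace[of T] by (simp add: topspace_T)
  next
    case (insert k I)
    have "openin T ({g \<in> carrier G. \<Phi> (act (e k) g) - \<Phi> (e k) \<in> pw 1 \<Lambda>} \<inter>
        {g \<in> carrier G. \<forall>k\<in>I. \<Phi> (act (e k) g) - \<Phi> (e k) \<in> pw 1 \<Lambda>})"
      using insert by (intro openin_Int openin_near e_in) auto
    moreover have "{g \<in> carrier G. \<Phi> (act (e k) g) - \<Phi> (e k) \<in> pw 1 \<Lambda>} \<inter>
        {g \<in> carrier G. \<forall>k\<in>I. \<Phi> (act (e k) g) - \<Phi> (e k) \<in> pw 1 \<Lambda>} =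
        {g \<in> carrier G. \<forall>k\<in>insert k I. \<Phi> (act (e k) g) - \<Phi> (e k) \<in> pw 1 \<Lambda>}" by blast
    ultimately show ?case by simp
  qed
  from this[OF finite_atLeastAtMost order_refl]
  have "openin T {g \<in> carrier G. \<forall>k\<in>{1..d}. \<Phi> (act (e k) g) - \<Phi> (e k) \<in> pw 1 \<Lambda>}" .
  also have "{g \<in> carrier G. \<forall>k\<in>{1..d}. \<Phi> (act (e k) g) - \<Phi> (e k) \<in> pw 1 \<Lambda>} = kernel"
  proof (intro equalityI subsetI)
    fix g assume "g \<in> {g \<in> carrier G. \<forall>k\<in>{1..d}. \<Phi> (act (e k) g) - \<Phi> (e k) \<in> pw 1 \<Lambda>}"
    then have g: "g \<in> carrier G" "\<And>k. k \<in> {1..d} \<Longrightarrow> \<Phi> (act (e k) g) - \<Phi> (e k) \<in> pw 1 \<Lambda>" by auto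
    note E = endo_\<tau>'[OF g(1)]
    have "\<tau> g x - x \<in> pw 1 \<Lambda>" if x: "x \<in> \<Lambda>" for x
    proof -
      obtain c where c: "\<forall>k\<in>{1..d}. c k \<in> Zp" "x = (\<Sum>k\<in>{1..d}. smul (c k) ((\<Phi> \<circ> e) k))"
        using basis_coeffs[OF basis_e x] by blast
      note ek = basis_in(2)[OF basis_e]
      have "\<tau> g x = (\<Sum>k\<in>{1..d}. \<tau> g (smul (c k) ((\<Phi> \<circ> e) k)))"
        unfolding c(2) using c(1) ek by (intro endo_sum[OF E] smul_in) auto
      then have "\<tau> g x - x = (\<Sum>k\<in>{1..d}. \<tau> g (smul (c k) ((\<Phi> \<circ> e) k)) - smul (c k) ((\<Phi> \<circ> e) k))"
        unfolding sum_subtractf c(2)[symmetric] by simp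
      also have "\<dots> \<in> pw 1 \<Lambda>"
      proof (rule pw_sum)
        fix k assume k: "k \<in> {1..d}"
        note ck = bspec[OF c(1) k]
        have "smul (c k) (\<tau> g ((\<Phi> \<circ> e) k) - (\<Phi> \<circ> e) k) \<in> pw 1 \<Lambda>"
          using endo_pw[OF endo_smul[OF ck] g(2)[OF k]] e_in[OF k] by (simp add: \<tau>_\<Phi>)
        then show "\<tau> g (smul (c k) ((\<Phi> \<circ> e) k)) - smul (c k) ((\<Phi> \<circ> e) k) \<in> pw 1 \<Lambda>"
          unfolding endo_diff[OF endo_smul[OF ck] \<tau>_basics(3)[OF ek[OF k] g(1)] ek[OF k]]
          using \<tau>_smul'[OF g(1) ck ek[OF k]] by simp
      qed
      finally show ?thesis .
    qed
    then show "g \<in> kernel" using g(1) by (simp add: kernel_def)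
  next
    fix g assume g: "g \<in> kernel"
    then have "\<tau> g (\<Phi> (e k)) - \<Phi> (e k) \<in> pw 1 \<Lambda>" if "k \<in> {1..d}" for k
      using \<Phi>_in[OF e_in[OF that]] by (simp add: kernel_def)
    then show "g \<in> {g \<in> carrier G. \<forall>k\<in>{1..d}. \<Phi> (act (e k) g) - \<Phi> (e k) \<in> pw 1 \<Lambda>}"
      using g e_in by (auto simp: kernel_def \<tau>_\<Phi>)
  qed
  finally show ?thesis .
qed

lemma normal_kernel: "kernel \<lhd> G"
  unfolding G.normal_inv_iff
proof (intro conjI ballI)
  show "subgroup kernel G"
  proof (rule G.subgroupI)
    show "kernel \<subseteq> carrier G" by (auto simp: kernel_def)
    have "\<one>\<^bsub>G\<^esub> \<in> kernel" by (auto simp: kernel_def \<tau>_basics(1) zero_pw zero_in)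
    then show "kernel \<noteq> {}" by blast
  next
    fix g assume "g \<in> kernel"
    then have g: "g \<in> carrier G" "\<And>x. x \<in> \<Lambda> \<Longrightarrow> \<tau> g x - x \<in> pw 1 \<Lambda>" by (auto simp: kernel_def)
    have "\<tau> (inv\<^bsub>G\<^esub> g) x - x \<in> pw 1 \<Lambda>" if x: "x \<in> \<Lambda>" for x
    proof -
      define y where "y = \<tau> (inv\<^bsub>G\<^esub> g) x"
      have y: "y \<in> \<Lambda>" using x g(1) by (simp add: y_def \<tau>_basics(3))
      have "\<tau> g y = x" using \<tau>_basics(2)[OF x, of "inv\<^bsub>G\<^esub> g" g] g(1) x by (simp add: y_def \<tau>_basics(1))
      then have "x - y \<in> pw 1 \<Lambda>" using g(2)[OF y] by simp
      from pw_uminus[OF this] show ?thesis by (simp add: y_def)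
    qed
    then show "inv\<^bsub>G\<^esub> g \<in> kernel" using g(1) by (simp add: kernel_def)
  next
    fix g h assume "g \<in> kernel" "h \<in> kernel"
    then have g: "g \<in> carrier G" "\<And>x. x \<in> \<Lambda> \<Longrightarrow> \<tau> g x - x \<in> pw 1 \<Lambda>"
      and h: "h \<in> carrier G" "\<And>x. x \<in> \<Lambda> \<Longrightarrow> \<tau> h x - x \<in> pw 1 \<Lambda>" by (auto simp: kernel_def)
    have "\<tau> (g \<otimes>\<^bsub>G\<^esub> h) x - x \<in> pw 1 \<Lambda>" if x: "x \<in> \<Lambda>" for x
      using pw_add[OF h(2)[OF \<tau>_basics(3)[OF x g(1)]] g(2)[OF x]] \<tau>_basics(2)[OF x g(1) h(1)] by simp
    then show "g \<otimes>\<^bsub>G\<^esub> h \<in> kernel" using g(1) h(1) by (simp add: kernel_def)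
  qed
next
  fix a g assume a: "a \<in> carrier G" and "g \<in> kernel"
  then have g: "g \<in> carrier G" "\<And>x. x \<in> \<Lambda> \<Longrightarrow> \<tau> g x - x \<in> pw 1 \<Lambda>" by (auto simp: kernel_def)
  have "\<tau> (a \<otimes>\<^bsub>G\<^esub> g \<otimes>\<^bsub>G\<^esub> inv\<^bsub>G\<^esub> a) x - x \<in> pw 1 \<Lambda>" if x: "x \<in> \<Lambda>" for x
  proof -
    have ax: "\<tau> a x \<in> \<Lambda>" "\<tau> g (\<tau> a x) \<in> \<Lambda>" using x a g(1) \<tau>_basics(3) by blast+
    have 1: "\<tau> (a \<otimes>\<^bsub>G\<^esub> g \<otimes>\<^bsub>G\<^esub> inv\<^bsub>G\<^esub> a) x = \<tau> (inv\<^bsub>G\<^esub> a) (\<tau> g (\<tau> a x))"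
      using \<tau>_basics(2)[OF x] a g(1) by simp
    have 2: "x = \<tau> (inv\<^bsub>G\<^esub> a) (\<tau> a x)"
      using \<tau>_basics(2)[OF x a, of "inv\<^bsub>G\<^esub> a"] a x by (simp add: \<tau>_basics(1))
    have "\<tau> (inv\<^bsub>G\<^esub> a) (\<tau> g (\<tau> a x) - \<tau> a x) \<in> pw 1 \<Lambda>"
      using endo_pw[OF endo_\<tau>' g(2)[OF ax(1)]] a by blast
    then show ?thesis
      unfolding 1 using 2 endo_diff[OF endo_\<tau>' ax(2,1), of "inv\<^bsub>G\<^esub> a"] a by simp
  qed
  then show "a \<otimes>\<^bsub>G\<^esub> g \<otimes>\<^bsub>G\<^esub> inv\<^bsub>G\<^esub> a \<in> kernel" using a g(1) by (simp add: kernel_def)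
qed

sublocale padic_representation \<Lambda> P \<Theta> p smul G \<tau> d "\<Phi> \<circ> e"
proof (intro padic_representation.intro padic_representation_axioms.intro)
  show "padic_lattice_ops \<Lambda> P \<Theta> p smul" by unfold_locales
  show "group G" by (rule group_G)
  show "\<exists>k. card (rcosets\<^bsub>G\<^esub> {g \<in> carrier G. \<forall>v\<in>\<Lambda>. \<tau> g v - v \<in> pw 1 \<Lambda>}) = p ^ k"
    using pro_p normal_kernel openin_kernel unfolding pro_p_group_def kernel_def by blast
  show "(\<forall>v\<in>\<Lambda>. t v = P v) \<or> (\<exists>g\<in>carrier G. \<forall>v\<in>\<Lambda>. t v = \<tau> g v - v)" if "t \<in> \<Theta>" for t
    using that gens_in unfolding \<Theta>_def by blast
qed (use basis_e endo_\<tau>' \<tau>_smul' \<tau>_basics in auto)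

text \<open>The identity \<open>hk - 1 = h(k - 1) + (h - 1)\<close> extends the claim from the
  generators to the abstract subgroup that they generate; density of this subgroup, continuity and
  closedness of \<open>aug N\<close> extend it to \<open>G\<close>. So finitely many operators
  account for all of the augmentation ideal.\<close>

lemma diff_mem_aug:
  assumes N: "stable N" and g: "g \<in> carrier G" and n: "n \<in> N"
  shows "\<tau> g n - n \<in> aug N"
proof -
  note cN = stable_csub[OF N] and cA = csub_aug[OF stable_csub[OF N]]
  have le: "aug N \<subseteq> N" by (rule stable_aug_le[OF N])
  have gen: "h \<in> carrier G \<and> (\<forall>n\<in>N. \<tau> h n - n \<in> aug N)" if "h \<in> generate G S" for h
    using that
  proof (induction h)
    case one
    then show ?case using csub_in[OF cN] by (simp add: \<tau>_basics(1) csub_0[OF cA])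
  next
    case (incl h)
    then have "(\<lambda>x. \<tau> h x - x) \<in> \<Theta>" by (auto simp: \<Theta>_def)
    then show ?case using op_mem_aug[OF csub_0[OF cN]] incl S(2) by blast
  next
    case (inv h)
    then have "(\<lambda>x. \<tau> (inv\<^bsub>G\<^esub> h) x - x) \<in> \<Theta>" by (auto simp: \<Theta>_def)
    then show ?case using op_mem_aug[OF csub_0[OF cN]] inv S(2) G.inv_closed by blast
  next
    case (eng h k)
    have "\<tau> (h \<otimes>\<^bsub>G\<^esub> k) n - n \<in> aug N" if n: "n \<in> N" for n
    proof -
      have 1: "\<tau> h n - n \<in> aug N" using eng n by blast
      then have "(\<tau> h n - n) + n \<in> N" using le csub_add[OF cN _ n] by blast
      then have "\<tau> h n \<in> N" by simp
      then have 2: "\<tau> k (\<tau> h n) - \<tau> h n \<in> aug N" using eng by blast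
      have "\<tau> (h \<otimes>\<^bsub>G\<^esub> k) n = \<tau> k (\<tau> h n)" using \<tau>_basics(2)[OF csub_in[OF cN n]] eng by blast
      then show ?thesis using csub_add[OF cA 2 1] by simp
    qed
    then show ?case using eng by auto
  qed
  define v where "v = \<Psi> n"
  have v: "v \<in> carrier L" "n = \<Phi> v" using \<Psi>_in \<Phi>_\<Psi> csub_in[OF cN n] by (auto simp: v_def)
  show ?thesis
  proof (rule csub_closed[OF cA])
    show "\<tau> g n - n \<in> \<Lambda>" using csub_in[OF cN n] g by (intro diff_in \<tau>_basics(3))
    fix k
    \<comment> \<open>An open neighbourhood of \<open>g\<close> on which the orbit map at
      \<open>v\<close> is constant modulo \<open>p^k\<close>.\<close>
    define U where "U = {h \<in> carrier G. \<Phi> (act v h) - \<Phi> (act v g) \<in> pw k \<Lambda>}"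
    have U: "g \<in> U \<and> openin T U"
      using g zero_pw[OF zero_in] openin_near[OF v(1) act_in[OF v(1) g]] by (simp add: U_def)
    have "g \<in> Abstract_Topology.closure_of T (generate G S)" using S(3) g by simp
    then have "\<forall>W. g \<in> W \<and> openin T W \<longrightarrow> (\<exists>h. h \<in> generate G S \<and> h \<in> W)"
      unfolding in_closure_of by (rule conjunct2)
    from mp[OF spec[OF this] U] obtain h where "h \<in> generate G S" "h \<in> U" by (elim exE conjE)
    then have h: "h \<in> generate G S" "\<Phi> (act v h) - \<Phi> (act v g) \<in> pw k \<Lambda>" by (auto simp: U_def)
    have "\<tau> h n - n \<in> aug N" using gen[OF h(1)] n by blast
    moreover have "(\<tau> g n - n) - (\<tau> h n - n) \<in> pw k \<Lambda>"
      using pw_uminus[OF h(2)] by (simp add: v \<tau>_\<Phi>)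
    ultimately show "\<tau> g n - n \<in> aug N + pw k \<Lambda>" unfolding mem_plus_iff by blast
  qed
qed

lemma stable_G_inv: "stable N \<Longrightarrow> g \<in> carrier G \<Longrightarrow> n \<in> N \<Longrightarrow> \<tau> g n \<in> N"
  using csub_add[OF stable_csub, of N "\<tau> g n - n" n] diff_mem_aug[of N g n] stable_aug_le[of N] by auto

section \<open>The action of the group ring\<close>

abbreviation A where "A \<equiv> group_ring (padic_int p) G"

definition supp where "supp a = {g. a g \<noteq> \<zero>\<^bsub>padic_int p\<^esub>}"

lemma A_carrier: "a \<in> carrier A \<longleftrightarrow> (\<forall>g\<in>carrier G. a g \<in> Zp) \<and> (\<forall>g. g \<notin> carrier G \<longrightarrow> a g = \<zero>\<^bsub>padic_int p\<^esub>) \<and> finite (supp a)"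
  by (simp add: group_ring_def supp_def)

lemma A_coeff: "a \<in> carrier A \<Longrightarrow> a g \<in> Zp"
  by (cases "g \<in> carrier G") (auto simp: A_carrier)

lemma supp_finite: "a \<in> carrier A \<Longrightarrow> finite (supp a)"
  and supp_le: "a \<in> carrier A \<Longrightarrow> supp a \<subseteq> carrier G"
  by (auto simp: A_carrier supp_def)

lemma A_add: "(a \<oplus>\<^bsub>A\<^esub> b) g = a g \<oplus>\<^bsub>padic_int p\<^esub> b g"
  and A_zero: "\<zero>\<^bsub>A\<^esub> = (\<lambda>g. \<zero>\<^bsub>padic_int p\<^esub>)"
  by (simp_all add: group_ring_def)

lemma supp_add: "supp (a \<oplus>\<^bsub>A\<^esub> b) \<subseteq> supp a \<union> supp b"
  by (auto simp: supp_def A_add)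

lemma A_add_closed: "a \<in> carrier A \<Longrightarrow> b \<in> carrier A \<Longrightarrow> a \<oplus>\<^bsub>A\<^esub> b \<in> carrier A"
  using finite_subset[OF supp_add[of a b]] by (auto simp: A_carrier A_add)

lemma abelian_group_A: "abelian_group A"
proof (rule abelian_groupI)
  fix a b c assume a: "a \<in> carrier A" and b: "b \<in> carrier A" and c: "c \<in> carrier A"
  show "a \<oplus>\<^bsub>A\<^esub> b \<in> carrier A" using A_add_closed a b .
  show "a \<oplus>\<^bsub>A\<^esub> b \<oplus>\<^bsub>A\<^esub> c = a \<oplus>\<^bsub>A\<^esub> (b \<oplus>\<^bsub>A\<^esub> c)"
    using A_coeff[OF a] A_coeff[OF b] A_coeff[OF c] by (intro ext) (simp add: A_add L.R.a_assoc)
  show "a \<oplus>\<^bsub>A\<^esub> b = b \<oplus>\<^bsub>A\<^esub> a"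
    using A_coeff[OF a] A_coeff[OF b] by (intro ext) (simp add: A_add L.R.a_comm)
  show "\<zero>\<^bsub>A\<^esub> \<oplus>\<^bsub>A\<^esub> a = a" using A_coeff[OF a] by (intro ext) (simp add: A_add A_zero)
  define n where "n = (\<lambda>g. \<ominus>\<^bsub>padic_int p\<^esub> a g)"
  have "supp n \<subseteq> supp a" by (auto simp: supp_def n_def)
  then have "n \<in> carrier A" using a finite_subset by (auto simp: A_carrier n_def)
  moreover have "n \<oplus>\<^bsub>A\<^esub> a = \<zero>\<^bsub>A\<^esub>"
    using A_coeff[OF a] by (intro ext) (simp add: A_add A_zero n_def L.R.l_neg)
  ultimately show "\<exists>y\<in>carrier A. y \<oplus>\<^bsub>A\<^esub> a = \<zero>\<^bsub>A\<^esub>" by blast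
qed (auto simp: A_carrier A_zero supp_def)

interpretation A: abelian_group A by (rule abelian_group_A)

lemma A_mult: "(a \<otimes>\<^bsub>A\<^esub> b) g = (if g \<in> carrier G
    then \<Oplus>\<^bsub>padic_int p\<^esub>h\<in>supp a. a h \<otimes>\<^bsub>padic_int p\<^esub> b (inv\<^bsub>G\<^esub> h \<otimes>\<^bsub>G\<^esub> g) else \<zero>\<^bsub>padic_int p\<^esub>)"
  by (simp add: group_ring_def supp_def)

lemma supp_mult:
  assumes a: "a \<in> carrier A" and b: "b \<in> carrier A"
  shows "supp (a \<otimes>\<^bsub>A\<^esub> b) \<subseteq> (\<lambda>(h, k). h \<otimes>\<^bsub>G\<^esub> k) ` (supp a \<times> supp b)"
proof
  fix g assume g: "g \<in> supp (a \<otimes>\<^bsub>A\<^esub> b)"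
  then have gG: "g \<in> carrier G" by (auto simp: supp_def A_mult split: if_splits)
  have "\<exists>h\<in>supp a. b (inv\<^bsub>G\<^esub> h \<otimes>\<^bsub>G\<^esub> g) \<noteq> \<zero>\<^bsub>padic_int p\<^esub>"
  proof (rule ccontr)
    assume "\<not> ?thesis"
    then have "(\<Oplus>\<^bsub>padic_int p\<^esub>h\<in>supp a. a h \<otimes>\<^bsub>padic_int p\<^esub> b (inv\<^bsub>G\<^esub> h \<otimes>\<^bsub>G\<^esub> g)) =
        (\<Oplus>\<^bsub>padic_int p\<^esub>h\<in>supp a. \<zero>\<^bsub>padic_int p\<^esub>)"
      using A_coeff[OF a] by (intro L.R.finsum_cong') auto
    then show False using g gG by (simp add: supp_def A_mult)
  qed
  then obtain h where h: "h \<in> supp a" "inv\<^bsub>G\<^esub> h \<otimes>\<^bsub>G\<^esub> g \<in> supp b" by (auto simp: supp_def)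
  then have "h \<otimes>\<^bsub>G\<^esub> (inv\<^bsub>G\<^esub> h \<otimes>\<^bsub>G\<^esub> g) = g"
    using supp_le[OF a] gG by (simp add: G.m_assoc[symmetric] subset_iff)
  then show "g \<in> (\<lambda>(h, k). h \<otimes>\<^bsub>G\<^esub> k) ` (supp a \<times> supp b)"
    using h by (intro image_eqI[of _ _ "(h, inv\<^bsub>G\<^esub> h \<otimes>\<^bsub>G\<^esub> g)"]) auto
qed

lemma A_mult_closed:
  assumes a: "a \<in> carrier A" and b: "b \<in> carrier A"
  shows "a \<otimes>\<^bsub>A\<^esub> b \<in> carrier A"
proof -
  have fin: "finite (supp (a \<otimes>\<^bsub>A\<^esub> b))"
    using supp_finite[OF a] supp_finite[OF b] by (intro finite_subset[OF supp_mult[OF a b]]) auto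
  have coeff: "(a \<otimes>\<^bsub>A\<^esub> b) g \<in> Zp" for g
    unfolding A_mult using A_coeff[OF a] A_coeff[OF b] by (auto intro!: L.R.finsum_closed)
  show ?thesis unfolding A_carrier by (intro conjI ballI allI impI coeff fin) (simp add: A_mult)
qed

definition gact where "gact x a = (\<Sum>g\<in>supp a. smul (a g) (\<tau> g x))"

text \<open>Supports of sums and products are only known up to inclusion, so the index set must be
  allowed to grow.\<close>

lemma gact_eq:
  assumes a: "a \<in> carrier A" and x: "x \<in> \<Lambda>" and F: "finite F" "supp a \<subseteq> F" "F \<subseteq> carrier G"
  shows "gact x a = (\<Sum>g\<in>F. smul (a g) (\<tau> g x))"
  unfolding gact_def
proof (rule sum.mono_neutral_left[OF F(1,2)], rule ballI)
  fix g assume "g \<in> F - supp a"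
  then show "smul (a g) (\<tau> g x) = 0"
    using x F(3) by (auto simp: supp_def smul_zero \<tau>_basics(3))
qed

lemma gact_in_csub:
  assumes "csub N" "\<And>g. g \<in> carrier G \<Longrightarrow> \<tau> g x \<in> N" "a \<in> carrier A"
  shows "gact x a \<in> N"
  unfolding gact_def using assms A_coeff[OF assms(3)] supp_le[OF assms(3)]
  by (intro csub_sum csub_smul) auto

lemma gact_in: "x \<in> \<Lambda> \<Longrightarrow> a \<in> carrier A \<Longrightarrow> gact x a \<in> \<Lambda>"
  by (intro gact_in_csub csub_Lambda \<tau>_basics(3))

lemma gact_add:
  assumes a: "a \<in> carrier A" and b: "b \<in> carrier A" and x: "x \<in> \<Lambda>"
  shows "gact x (a \<oplus>\<^bsub>A\<^esub> b) = gact x a + gact x b"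
proof -
  let ?F = "supp a \<union> supp b"
  have F: "finite ?F" "?F \<subseteq> carrier G" using supp_finite supp_le a b by auto
  have "gact x (a \<oplus>\<^bsub>A\<^esub> b) = (\<Sum>g\<in>?F. smul ((a \<oplus>\<^bsub>A\<^esub> b) g) (\<tau> g x))"
    using F supp_add A_add_closed[OF a b] x by (intro gact_eq) auto
  also have "\<dots> = (\<Sum>g\<in>?F. smul (a g) (\<tau> g x) + smul (b g) (\<tau> g x))"
    using F(2) x A_coeff[OF a] A_coeff[OF b]
    by (intro sum.cong refl) (auto simp: A_add smul_add_left \<tau>_basics(3))
  also have "\<dots> = gact x a + gact x b"
    using F a b x by (simp add: sum.distrib gact_eq[of a x ?F] gact_eq[of b x ?F])
  finally show ?thesis .
qed

lemma gact_zero: "gact x \<zero>\<^bsub>A\<^esub> = 0"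
  by (simp add: gact_def supp_def A_zero)

lemma gact_neg: "a \<in> carrier A \<Longrightarrow> x \<in> \<Lambda> \<Longrightarrow> gact x (\<ominus>\<^bsub>A\<^esub> a) = - gact x a"
  using gact_add[of "\<ominus>\<^bsub>A\<^esub> a" a x] by (simp add: A.l_neg gact_zero eq_neg_iff_add_eq_0)

lemma gact_add_pow:
  fixes n :: nat
  assumes a: "a \<in> carrier A" and x: "x \<in> \<Lambda>"
  shows "gact x (add_pow A n a) = smul (padic_of_int p (int n)) (gact x a)"
proof (induction n)
  case 0
  have "padic_of_int p 0 = \<zero>\<^bsub>padic_int p\<^esub>" by (simp add: padic_of_int_def padic_zero)
  then show ?case using gact_in[OF x a] by (simp add: smul_zero gact_zero add_pow_def)
next
  case (Suc n)
  have "gact x (add_pow A (Suc n) a) = gact x (add_pow A n a) + gact x a"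
    using a x by (simp add: A.add.nat_pow_Suc gact_add)
  also have "\<dots> = smul (padic_of_int p (int n) \<oplus>\<^bsub>padic_int p\<^esub> \<one>\<^bsub>padic_int p\<^esub>) (gact x a)"
    using gact_in[OF x a] Suc by (simp add: smul_add_left smul_one dig_in)
  also have "padic_of_int p (int n) \<oplus>\<^bsub>padic_int p\<^esub> \<one>\<^bsub>padic_int p\<^esub> = padic_of_int p (int (Suc n))"
    unfolding padic_of_int_one[symmetric] padic_of_int_add[symmetric] by (simp add: add.commute)
  finally show ?case .
qed

lemma smul_finsum:
  assumes "\<And>i. i \<in> I \<Longrightarrow> f i \<in> Zp" "x \<in> \<Lambda>"
  shows "smul (\<Oplus>\<^bsub>padic_int p\<^esub>i\<in>I. f i) x = (\<Sum>i\<in>I. smul (f i) x)"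
  using assms
proof (induction I rule: infinite_finite_induct)
  case (insert i I)
  then have "(\<Oplus>\<^bsub>padic_int p\<^esub>i\<in>insert i I. f i) = f i \<oplus>\<^bsub>padic_int p\<^esub> (\<Oplus>\<^bsub>padic_int p\<^esub>i\<in>I. f i)"
    by (intro L.R.finsum_insert) auto
  moreover have "(\<Oplus>\<^bsub>padic_int p\<^esub>i\<in>I. f i) \<in> Zp" using insert by (intro L.R.finsum_closed) auto
  ultimately show ?case using insert by (simp add: smul_add_left)
qed (simp_all add: smul_zero L.R.finsum_infinite)

text \<open>For each fixed \<open>h\<close> the convolution is reindexed by \<open>g = hk\<close>;
  the terms with \<open>g\<close> outside \<open>h\<close> times the support of \<open>b\<close>
  vanish. The order of the factors is that of a right action.\<close>

lemma gact_mult: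
  assumes a: "a \<in> carrier A" and b: "b \<in> carrier A" and x: "x \<in> \<Lambda>"
  shows "gact x (a \<otimes>\<^bsub>A\<^esub> b) = gact (gact x a) b"
proof -
  let ?F = "(\<lambda>(h, k). h \<otimes>\<^bsub>G\<^esub> k) ` (supp a \<times> supp b)"
  note aZ = A_coeff[OF a] and bZ = A_coeff[OF b]
  note aG = subsetD[OF supp_le[OF a]] and bG = subsetD[OF supp_le[OF b]]
  have F: "finite ?F" "?F \<subseteq> carrier G" using supp_finite[OF a] supp_finite[OF b] aG bG by auto
  have "gact x (a \<otimes>\<^bsub>A\<^esub> b) = (\<Sum>g\<in>?F. smul ((a \<otimes>\<^bsub>A\<^esub> b) g) (\<tau> g x))"
    by (rule gact_eq[OF A_mult_closed[OF a b] x F(1) supp_mult[OF a b] F(2)])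
  also have "\<dots> = (\<Sum>g\<in>?F. \<Sum>h\<in>supp a. smul (a h \<otimes>\<^bsub>padic_int p\<^esub> b (inv\<^bsub>G\<^esub> h \<otimes>\<^bsub>G\<^esub> g)) (\<tau> g x))"
  proof (rule sum.cong[OF refl])
    fix g assume "g \<in> ?F"
    then have g: "g \<in> carrier G" using F(2) by blast
    then show "smul ((a \<otimes>\<^bsub>A\<^esub> b) g) (\<tau> g x) =
        (\<Sum>h\<in>supp a. smul (a h \<otimes>\<^bsub>padic_int p\<^esub> b (inv\<^bsub>G\<^esub> h \<otimes>\<^bsub>G\<^esub> g)) (\<tau> g x))"
      using aZ bZ \<tau>_basics(3)[OF x g] by (simp add: A_mult smul_finsum)
  qed
  also have "\<dots> = (\<Sum>h\<in>supp a. \<Sum>g\<in>?F. smul (a h \<otimes>\<^bsub>padic_int p\<^esub> b (inv\<^bsub>G\<^esub> h \<otimes>\<^bsub>G\<^esub> g)) (\<tau> g x))"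
    by (rule sum.swap)
  also have "\<dots> = (\<Sum>h\<in>supp a. \<Sum>k\<in>supp b. smul (b k) (\<tau> k (smul (a h) (\<tau> h x))))"
  proof (rule sum.cong[OF refl])
    fix h assume h: "h \<in> supp a"
    have hG: "h \<in> carrier G" using aG[OF h] .
    have "(\<Sum>g\<in>?F. smul (a h \<otimes>\<^bsub>padic_int p\<^esub> b (inv\<^bsub>G\<^esub> h \<otimes>\<^bsub>G\<^esub> g)) (\<tau> g x)) =
        (\<Sum>g\<in>(\<lambda>k. h \<otimes>\<^bsub>G\<^esub> k) ` supp b. smul (a h \<otimes>\<^bsub>padic_int p\<^esub> b (inv\<^bsub>G\<^esub> h \<otimes>\<^bsub>G\<^esub> g)) (\<tau> g x))"
    proof (rule sum.mono_neutral_right[OF F(1)])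
      show "(\<lambda>k. h \<otimes>\<^bsub>G\<^esub> k) ` supp b \<subseteq> ?F" using h by auto
      show "\<forall>g\<in>?F - (\<lambda>k. h \<otimes>\<^bsub>G\<^esub> k) ` supp b. smul (a h \<otimes>\<^bsub>padic_int p\<^esub> b (inv\<^bsub>G\<^esub> h \<otimes>\<^bsub>G\<^esub> g)) (\<tau> g x) = 0"
      proof
        fix g assume g: "g \<in> ?F - (\<lambda>k. h \<otimes>\<^bsub>G\<^esub> k) ` supp b"
        then have gG: "g \<in> carrier G" using F(2) by blast
        have "g = h \<otimes>\<^bsub>G\<^esub> (inv\<^bsub>G\<^esub> h \<otimes>\<^bsub>G\<^esub> g)" using hG gG by (simp add: G.m_assoc[symmetric])
        then have "inv\<^bsub>G\<^esub> h \<otimes>\<^bsub>G\<^esub> g \<notin> supp b" using g by blast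
        then show "smul (a h \<otimes>\<^bsub>padic_int p\<^esub> b (inv\<^bsub>G\<^esub> h \<otimes>\<^bsub>G\<^esub> g)) (\<tau> g x) = 0"
          using aZ \<tau>_basics(3)[OF x gG] by (simp add: supp_def smul_zero)
      qed
    qed
    also have "\<dots> = (\<Sum>k\<in>supp b. smul (a h \<otimes>\<^bsub>padic_int p\<^esub> b (inv\<^bsub>G\<^esub> h \<otimes>\<^bsub>G\<^esub> (h \<otimes>\<^bsub>G\<^esub> k))) (\<tau> (h \<otimes>\<^bsub>G\<^esub> k) x))"
      using hG bG by (intro sum.reindex_cong[of "\<lambda>k. h \<otimes>\<^bsub>G\<^esub> k"] inj_onI refl) auto
    also have "\<dots> = (\<Sum>k\<in>supp b. smul (b k) (\<tau> k (smul (a h) (\<tau> h x))))"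
    proof (rule sum.cong[OF refl])
      fix k assume "k \<in> supp b"
      then have kG: "k \<in> carrier G" using bG by blast
      have "inv\<^bsub>G\<^esub> h \<otimes>\<^bsub>G\<^esub> (h \<otimes>\<^bsub>G\<^esub> k) = k" using hG kG by (simp add: G.m_assoc[symmetric])
      then show "smul (a h \<otimes>\<^bsub>padic_int p\<^esub> b (inv\<^bsub>G\<^esub> h \<otimes>\<^bsub>G\<^esub> (h \<otimes>\<^bsub>G\<^esub> k))) (\<tau> (h \<otimes>\<^bsub>G\<^esub> k) x) =
          smul (b k) (\<tau> k (smul (a h) (\<tau> h x)))"
        using hG kG x aZ bZ \<tau>_basics(3)[OF x hG] \<tau>_basics(3)[OF \<tau>_basics(3)[OF x hG] kG]
        by (simp add: \<tau>_basics(2) \<tau>_smul' smul_mult L.R.m_comm[of "a h"])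
    qed
    finally show "(\<Sum>g\<in>?F. smul (a h \<otimes>\<^bsub>padic_int p\<^esub> b (inv\<^bsub>G\<^esub> h \<otimes>\<^bsub>G\<^esub> g)) (\<tau> g x)) =
        (\<Sum>k\<in>supp b. smul (b k) (\<tau> k (smul (a h) (\<tau> h x))))" .
  qed
  also have "\<dots> = (\<Sum>k\<in>supp b. \<Sum>h\<in>supp a. smul (b k) (\<tau> k (smul (a h) (\<tau> h x))))"
    by (rule sum.swap)
  also have "\<dots> = gact (gact x a) b"
    unfolding gact_def[of _ b]
  proof (rule sum.cong[OF refl])
    fix k assume "k \<in> supp b"
    then have kG: "k \<in> carrier G" using bG by blast
    have in1: "smul (a h) (\<tau> h x) \<in> \<Lambda>" if "h \<in> supp a" for h
      using aZ aG[OF that] x by (intro smul_in \<tau>_basics(3))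
    have "\<tau> k (gact x a) = (\<Sum>h\<in>supp a. \<tau> k (smul (a h) (\<tau> h x)))"
      unfolding gact_def using in1 by (intro endo_sum[OF endo_\<tau>'[OF kG]])
    then show "(\<Sum>h\<in>supp a. smul (b k) (\<tau> k (smul (a h) (\<tau> h x)))) = smul (b k) (\<tau> k (gact x a))"
      using in1 bZ kG by (simp add: smul_sum \<tau>_basics(3))
  qed
  finally show ?thesis .
qed

lemma group_ring_of_in: "g \<in> carrier G \<Longrightarrow> group_ring_of (padic_int p) g \<in> carrier A"
  and gact_group_ring_of: "g \<in> carrier G \<Longrightarrow> x \<in> \<Lambda> \<Longrightarrow> gact x (group_ring_of (padic_int p) g) = \<tau> g x"
proof -
  assume g: "g \<in> carrier G"
  have "\<one>\<^bsub>padic_int p\<^esub> 1 \<noteq> (\<zero>\<^bsub>padic_int p\<^esub> 1)"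
    using prime_gt_1_nat[OF prime] by (simp add: padic_int_def)
  then have "\<one>\<^bsub>padic_int p\<^esub> \<noteq> \<zero>\<^bsub>padic_int p\<^esub>" by metis
  then have s: "supp (group_ring_of (padic_int p) g) = {g}" by (auto simp: supp_def group_ring_of_def)
  then show "group_ring_of (padic_int p) g \<in> carrier A" using g by (auto simp: A_carrier group_ring_of_def)
  show "gact x (group_ring_of (padic_int p) g) = \<tau> g x" if "x \<in> \<Lambda>"
    unfolding gact_def s using that g by (simp add: group_ring_of_def smul_one \<tau>_basics(3))
qed

lemma A_one: "\<one>\<^bsub>A\<^esub> = group_ring_of (padic_int p) \<one>\<^bsub>G\<^esub>"
  by (auto simp: group_ring_def group_ring_of_def)

lemma A_one_in: "\<one>\<^bsub>A\<^esub> \<in> carrier A" and gact_one: "x \<in> \<Lambda> \<Longrightarrow> gact x \<one>\<^bsub>A\<^esub> = x"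
  unfolding A_one using group_ring_of_in[OF G.one_closed] gact_group_ring_of[OF G.one_closed]
  by (auto simp: \<tau>_basics(1))

lemma group_ring_act:
  assumes v: "v \<in> carrier L" and a: "a \<in> carrier A"
  shows "group_ring_act p L act v a \<in> carrier L" "\<Phi> (group_ring_act p L act v a) = gact (\<Phi> v) a"
proof -
  have tm: "a g \<odot>\<^bsub>L\<^esub> act v g \<in> carrier L" if "g \<in> supp a" for g
    using A_coeff[OF a] act_in[OF v] supp_le[OF a] that by (intro L.smult_closed) auto
  have eq: "group_ring_act p L act v a = (\<Oplus>\<^bsub>L\<^esub>g\<in>supp a. a g \<odot>\<^bsub>L\<^esub> act v g)"
    by (simp add: group_ring_act_def supp_def)
  show "group_ring_act p L act v a \<in> carrier L"
    unfolding eq using tm by (intro L.M.finsum_closed) blast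
  have "\<Phi> (group_ring_act p L act v a) = (\<Sum>g\<in>supp a. \<Phi> (a g \<odot>\<^bsub>L\<^esub> act v g))"
    unfolding eq by (rule \<Phi>_finsum[OF tm])
  also have "\<dots> = gact (\<Phi> v) a"
    unfolding gact_def using act_in[OF v] supp_le[OF a] v
    by (intro sum.cong refl) (auto simp: \<Phi>_smul \<tau>_\<Phi>)
  finally show "\<Phi> (group_ring_act p L act v a) = gact (\<Phi> v) a" .
qed

section \<open>The lower p-series\<close>

definition aug_gens where
  "aug_gens = {(group_ring_of (padic_int p) g \<ominus>\<^bsub>A\<^esub> \<one>\<^bsub>A\<^esub>) \<otimes>\<^bsub>A\<^esub> a | g a. g \<in> carrier G \<and> a \<in> carrier A} \<union>
     {add_pow A p a | a. a \<in> carrier A}"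

lemma aug_ideal_eq: "p_augmentation_ideal p G = generate (add_monoid A) aug_gens"
  by (simp add: p_augmentation_ideal_def aug_gens_def Let_def)

lemma group_ring_of_minus_one_in: "g \<in> carrier G \<Longrightarrow> group_ring_of (padic_int p) g \<ominus>\<^bsub>A\<^esub> \<one>\<^bsub>A\<^esub> \<in> carrier A"
  using group_ring_of_in A_one_in by (intro A.minus_closed)

lemma gact_group_ring_of_minus_one:
  "g \<in> carrier G \<Longrightarrow> x \<in> \<Lambda> \<Longrightarrow> gact x (group_ring_of (padic_int p) g \<ominus>\<^bsub>A\<^esub> \<one>\<^bsub>A\<^esub>) = \<tau> g x - x"
  using group_ring_of_in A_one_in
  by (simp add: A.minus_eq gact_add gact_neg gact_group_ring_of gact_one)

lemma aug_gens_le: "aug_gens \<subseteq> carrier A"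
  unfolding aug_gens_def using A_mult_closed group_ring_of_minus_one_in by (auto intro: A.add.nat_pow_closed)

lemma aug_ideal_in: "z \<in> p_augmentation_ideal p G \<Longrightarrow> z \<in> carrier A"
  unfolding aug_ideal_eq using group.generate_incl[OF A.a_group, of aug_gens] aug_gens_le by auto

text \<open>The generators \<open>g - 1\<close> of the ideal run through all of \<open>G\<close>,
  and \<open>diff_mem_aug\<close> reduces them to the finitely many operators.\<close>

lemma aug_ideal_act:
  assumes N: "stable N" and x: "x \<in> N" and z: "z \<in> p_augmentation_ideal p G"
  shows "gact x z \<in> aug N"
  using z unfolding aug_ideal_eq
proof (induction z)
  note x\<Lambda> = csub_in[OF stable_csub[OF N] x]
  note cA = csub_aug[OF stable_csub[OF N]]
  have gens: "gact x h \<in> aug N" if "h \<in> aug_gens" for h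
  proof -
    from that[unfolded aug_gens_def Un_iff mem_Collect_eq] show ?thesis
    proof (elim disjE exE conjE)
      fix g a assume ga: "h = (group_ring_of (padic_int p) g \<ominus>\<^bsub>A\<^esub> \<one>\<^bsub>A\<^esub>) \<otimes>\<^bsub>A\<^esub> a"
        "g \<in> carrier G" "a \<in> carrier A"
      have "gact x h = gact (\<tau> g x - x) a"
        unfolding ga(1) gact_mult[OF group_ring_of_minus_one_in[OF ga(2)] ga(3) x\<Lambda>]
          gact_group_ring_of_minus_one[OF ga(2) x\<Lambda>] ..
      also have "\<dots> \<in> aug N"
        by (rule gact_in_csub[OF cA stable_G_inv[OF stable_aug[OF N] _ diff_mem_aug[OF N ga(2) x]] ga(3)])
      finally show ?thesis .
    next
      fix a assume a: "h = add_pow A p a" "a \<in> carrier A"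
      have "gact x a \<in> N"
        by (rule gact_in_csub[OF stable_csub[OF N] stable_G_inv[OF N _ x] a(2)])
      then have "P (gact x a) \<in> aug N" by (rule op_mem_aug[OF csub_0[OF stable_csub[OF N]] P_op])
      then show ?thesis unfolding a(1) gact_add_pow[OF a(2) x\<Lambda>] P_def .
    qed
  qed
  {
    case one
    then show ?case by (simp add: gact_zero csub_0[OF cA])
  next
    case (incl h)
    then show ?case by (rule gens)
  next
    case (inv h)
    have "gact x (\<ominus>\<^bsub>A\<^esub> h) \<in> aug N"
      using csub_uminus[OF cA gens[OF inv]] subsetD[OF aug_gens_le inv] x\<Lambda> by (simp add: gact_neg)
    then show ?case by (simp add: a_inv_def)
  next
    case (eng h k)
    then have "h \<in> carrier A" "k \<in> carrier A" using aug_ideal_in unfolding aug_ideal_eq by blast+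
    then show ?case using csub_add[OF cA eng.IH] x\<Lambda> by (simp add: gact_add)
  }
qed

lemma aug_power_in: "a \<in> p_augmentation_power p G i \<Longrightarrow> a \<in> carrier A"
proof (induction i arbitrary: a)
  case (Suc i)
  from Suc.prems have "a \<in> ideal_prod A (p_augmentation_power p G i) (p_augmentation_ideal p G)" by simp
  then show ?case
    by induction (auto intro: A_mult_closed A_add_closed Suc.IH aug_ideal_in)
qed simp

lemma aug_power_act: "a \<in> p_augmentation_power p G i \<Longrightarrow> x \<in> \<Lambda> \<Longrightarrow> gact x a \<in> augp i \<Lambda>"
proof (induction i arbitrary: a)
  case (Suc i)
  note st = stable_augp[OF stable_Lambda]
  from Suc.prems(1) have "a \<in> ideal_prod A (p_augmentation_power p G i) (p_augmentation_ideal p G)" by simp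
  then have "a \<in> carrier A \<and> gact x a \<in> aug (augp i \<Lambda>)"
  proof induction
    case (prod y z)
    have in': "y \<in> carrier A" "z \<in> carrier A" using aug_power_in[OF prod(1)] aug_ideal_in[OF prod(2)] .
    have "gact (gact x y) z \<in> aug (augp i \<Lambda>)"
      by (rule aug_ideal_act[OF st Suc.IH[OF prod(1) Suc.prems(2)] prod(2)])
    then show ?case using in' Suc.prems(2) by (simp add: gact_mult A_mult_closed)
  next
    case (sum y z)
    then show ?case
      using Suc.prems(2) csub_add[OF csub_aug[OF csub_augp[OF csub_Lambda]]] by (simp add: gact_add A_add_closed)
  qed
  then show ?case by simp
qed (simp add: gact_in)

abbreviation lps where "lps \<equiv> lower_p_series p G L act"

definition lps_gens where
  "lps_gens i = {group_ring_act p L act v a | v a. v \<in> carrier L \<and> a \<in> p_augmentation_power p G i}"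

lemma lps_eq: "lps i = generate (add_monoid L) (lps_gens i)"
  by (simp add: lower_p_series_def lps_gens_def)

lemma lps_gens_le: "lps_gens i \<subseteq> carrier L"
  unfolding lps_gens_def using group_ring_act(1) aug_power_in by blast

lemma lps_subgroup: "subgroup (lps i) (add_monoid L)"
  unfolding lps_eq using lps_gens_le by (intro group.generate_is_subgroup[OF L.M.a_group]) simp

lemma lps_le: "lps i \<subseteq> carrier L"
  using subgroup.subset[OF lps_subgroup, of i] by simp

lemma lps_image_le: "v \<in> lps i \<Longrightarrow> \<Phi> v \<in> augp i \<Lambda>"
  unfolding lps_eq
proof (induction v rule: generate.induct)
  note cA = csub_augp[OF csub_Lambda, of i]
  have gens: "\<Phi> h \<in> augp i \<Lambda>" if h: "h \<in> lps_gens i" for h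
  proof -
    obtain v a where "v \<in> carrier L" "a \<in> p_augmentation_power p G i" "h = group_ring_act p L act v a"
      using h unfolding lps_gens_def by blast
    then show ?thesis using aug_power_act[of a i "\<Phi> v"] group_ring_act(2)[of v a] aug_power_in[of a i] \<Phi>_in by simp
  qed
  {
    case one
    then show ?case by (simp add: \<Phi>_zero csub_0[OF cA])
  next
    case (incl h)
    then show ?case by (rule gens)
  next
    case (inv h)
    have "\<Phi> (\<ominus>\<^bsub>L\<^esub> h) \<in> augp i \<Lambda>"
      using csub_uminus[OF cA gens[OF inv]] subsetD[OF lps_gens_le inv] by (simp add: \<Phi>_neg)
    then show ?case by (simp add: a_inv_def)
  next
    case (eng h k)
    then have "h \<in> carrier L" "k \<in> carrier L" using lps_le unfolding lps_eq by blast+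
    then show ?case using csub_add[OF cA eng.IH] by (simp add: \<Phi>_add)
  }
qed

lemma lps_image_add: "x \<in> \<Phi> ` lps i \<Longrightarrow> y \<in> \<Phi> ` lps i \<Longrightarrow> x + y \<in> \<Phi> ` lps i"
proof -
  assume "x \<in> \<Phi> ` lps i" "y \<in> \<Phi> ` lps i"
  then obtain a b where ab: "a \<in> lps i" "b \<in> lps i" "x = \<Phi> a" "y = \<Phi> b" by blast
  then have "\<Phi> (a \<oplus>\<^bsub>L\<^esub> b) = x + y" using lps_le by (simp add: \<Phi>_add subset_iff)
  then show ?thesis using subgroup.m_closed[OF lps_subgroup ab(1,2)] by (metis image_eqI monoid.select_convs(1))
qed

lemma lps_image_uminus: "x \<in> \<Phi> ` lps i \<Longrightarrow> - x \<in> \<Phi> ` lps i"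
proof -
  assume "x \<in> \<Phi> ` lps i"
  then obtain a where a: "a \<in> lps i" "x = \<Phi> a" by blast
  then have "\<Phi> (\<ominus>\<^bsub>L\<^esub> a) = - x" using lps_le by (simp add: \<Phi>_neg subset_iff)
  moreover have "\<ominus>\<^bsub>L\<^esub> a \<in> lps i" unfolding a_inv_def by (rule subgroup.m_inv_closed[OF lps_subgroup a(1)])
  ultimately show ?thesis by (metis image_eqI)
qed

lemma lps_image_zero: "0 \<in> \<Phi> ` lps i"
  using subgroup.one_closed[OF lps_subgroup, of i] \<Phi>_zero by (metis image_eqI monoid.select_convs(2))

text \<open>Each operator is the action of an element of the ideal, namely \<open>p\<close> or some
  \<open>s - 1\<close>, so applying it to a generator of the term multiplies the group ring element
  by that element.\<close>

lemma lps_step: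
  assumes t: "t \<in> \<Theta>" and "v \<in> lps i"
  shows "t (\<Phi> v) \<in> \<Phi> ` lps (Suc i)"
proof -
  note E = endo_op[OF t]
  have gens: "t (\<Phi> h) \<in> \<Phi> ` lps (Suc i)" if h: "h \<in> lps_gens i" for h
  proof -
    obtain v y where v: "v \<in> carrier L" and y: "y \<in> p_augmentation_power p G i"
      and h_eq: "h = group_ring_act p L act v y" using h unfolding lps_gens_def by blast
    note yA = aug_power_in[OF y]
    define x where "x = gact (\<Phi> v) y"
    have x: "x \<in> \<Lambda>" "\<Phi> h = x" using gact_in[OF \<Phi>_in[OF v] yA] group_ring_act(2)[OF v yA] by (auto simp: x_def h_eq)
    have "\<exists>z\<in>aug_gens. gact x z = t x"
    proof -
      consider "t = P" | s where "s \<in> carrier G" "t = (\<lambda>x. \<tau> s x - x)"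
        using t gens_in unfolding \<Theta>_def by blast
      then show ?thesis
      proof cases
        case 1
        have "add_pow A p \<one>\<^bsub>A\<^esub> \<in> aug_gens" unfolding aug_gens_def using A_one_in by blast
        moreover have "gact x (add_pow A p \<one>\<^bsub>A\<^esub>) = t x"
          using x(1) 1 A_one_in by (simp add: gact_add_pow gact_one P_def)
        ultimately show ?thesis by blast
      next
        case 2
        let ?z = "(group_ring_of (padic_int p) s \<ominus>\<^bsub>A\<^esub> \<one>\<^bsub>A\<^esub>) \<otimes>\<^bsub>A\<^esub> \<one>\<^bsub>A\<^esub>"
        have "?z \<in> aug_gens" unfolding aug_gens_def using A_one_in 2(1) by blast
        moreover have "gact x ?z = t x"
          using x(1) 2 A_one_in
          by (simp add: gact_mult group_ring_of_minus_one_in gact_group_ring_of_minus_one gact_one diff_in \<tau>_basics(3))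
        ultimately show ?thesis by blast
      qed
    qed
    then obtain z where z: "z \<in> aug_gens" "gact x z = t x" by blast
    have zI: "z \<in> p_augmentation_ideal p G" unfolding aug_ideal_eq using z(1) by (rule generate.incl)
    have yz: "y \<otimes>\<^bsub>A\<^esub> z \<in> p_augmentation_power p G (Suc i)"
      using y zI by (simp add: ideal_prod.prod)
    have "t (\<Phi> h) = gact (\<Phi> v) (y \<otimes>\<^bsub>A\<^esub> z)"
      using z(2) x(2) gact_mult[OF yA aug_ideal_in[OF zI] \<Phi>_in[OF v]] by (simp add: x_def)
    also have "\<dots> = \<Phi> (group_ring_act p L act v (y \<otimes>\<^bsub>A\<^esub> z))"
      using group_ring_act(2)[OF v aug_power_in[OF yz]] by simp
    finally show ?thesis
      unfolding lps_eq lps_gens_def using v yz by (auto intro!: imageI generate.incl)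
  qed
  show ?thesis
    using assms(2) unfolding lps_eq[of i]
  proof (induction v rule: generate.induct)
    case one
    then show ?case by (simp add: \<Phi>_zero endo_0[OF E] lps_image_zero)
  next
    case (incl h)
    then show ?case by (rule gens)
  next
    case (inv h)
    have hL: "h \<in> carrier L" using lps_gens_le inv by blast
    have "t (\<Phi> (\<ominus>\<^bsub>L\<^esub> h)) \<in> \<Phi> ` lps (Suc i)"
      using lps_image_uminus[OF gens[OF inv]] hL by (simp add: \<Phi>_neg endo_uminus[OF E] \<Phi>_in)
    then show ?case by (simp add: a_inv_def)
  next
    case (eng h k)
    then have "h \<in> carrier L" "k \<in> carrier L" using lps_le unfolding lps_eq by blast+
    then show ?case using lps_image_add[OF eng.IH] by (simp add: \<Phi>_add endo_add[OF E] \<Phi>_in)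
  qed
qed

text \<open>\<open>aug\<close> applies each operator to one vector of the previous term, and the
  terms are closed under sums; with \<open>lps_step\<close> this gives the inclusion that
  complements \<open>lps_image_le\<close>.\<close>

lemma lps_image_eq: "\<Phi> ` lps i = augp i \<Lambda>"
proof (induction i)
  case 0
  have "v \<in> lps 0" if v: "v \<in> carrier L" for v
  proof -
    have "\<Phi> (group_ring_act p L act v \<one>\<^bsub>A\<^esub>) = \<Phi> v"
      using group_ring_act(2)[OF v A_one_in] gact_one[OF \<Phi>_in[OF v]] by simp
    then have "group_ring_act p L act v \<one>\<^bsub>A\<^esub> = v"
      using inj_onD[OF \<Phi>_inj] group_ring_act(1)[OF v A_one_in] v by blast
    then have "v \<in> lps_gens 0" using v A_one_in by (auto simp: lps_gens_def intro!: exI[of _ v] exI[of _ "\<one>\<^bsub>A\<^esub>"])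
    then show ?thesis unfolding lps_eq by (rule generate.incl)
  qed
  then have "lps 0 = carrier L" using lps_le by blast
  then show ?case by (simp add: \<Lambda>_def)
next
  case (Suc i)
  show ?case
  proof
    show "\<Phi> ` lps (Suc i) \<subseteq> augp (Suc i) \<Lambda>" using lps_image_le by blast
    show "augp (Suc i) \<Lambda> \<subseteq> \<Phi> ` lps (Suc i)"
    proof
      fix x assume "x \<in> augp (Suc i) \<Lambda>"
      then have "x \<in> aug (\<Phi> ` lps i)" by (simp add: Suc)
      then obtain f where f: "\<And>t. t \<in> \<Theta> \<Longrightarrow> f t \<in> \<Phi> ` lps i" "x = (\<Sum>t\<in>\<Theta>. t (f t))"
        unfolding aug_def by blast
      have "t (f t) \<in> \<Phi> ` lps (Suc i)" if t: "t \<in> \<Theta>" for t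
        using f(1)[OF t] lps_step[OF t] by auto
      then have "(\<Sum>t\<in>F. t (f t)) \<in> \<Phi> ` lps (Suc i)" if "F \<subseteq> \<Theta>" for F
        using that
        by (induction F rule: infinite_finite_induct) (simp_all add: lps_image_zero lps_image_add)
      then show "x \<in> \<Phi> ` lps (Suc i)" using f(2) by blast
    qed
  qed
qed

lemma lps_iff: "v \<in> carrier L \<Longrightarrow> v \<in> lps i \<longleftrightarrow> \<Phi> v \<in> augp i \<Lambda>"
  using lps_image_eq[of i] inj_on_image_mem_iff[OF \<Phi>_inj _ lps_le, of v i] by simp

text \<open>Openness comes from the inclusion of \<open>p^i L\<close> in the term of index
  \<open>i\<close>, and the trivial intersection from the gain of a factor \<open>p\<close> every
  \<open>d\<close> steps.\<close>

lemma filtration_series_lps: "filtration_series p L lps"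
  unfolding filtration_series_def
proof (intro conjI allI)
  note st = stable_augp[OF stable_Lambda]
  note cA = csub_augp[OF csub_Lambda]
  show "lps 0 = carrier L" using lps_iff[of _ 0] lps_le[of 0] \<Phi>_in by auto
  show "lps (Suc i) \<subseteq> lps i" for i
  proof
    fix v assume v: "v \<in> lps (Suc i)"
    have "\<Phi> v \<in> augp i \<Lambda>"
      using lps_image_le[OF v] augp_antimono[OF stable_Lambda, of i "Suc i"] by auto
    then show "v \<in> lps i" using lps_iff subsetD[OF lps_le v] by blast
  qed
  show "submodule (lps i) (padic_int p) L" for i
  proof (rule L.submoduleI[OF lps_le])
    show "\<zero>\<^bsub>L\<^esub> \<in> lps i" using subgroup.one_closed[OF lps_subgroup, of i] by simp
    show "\<ominus>\<^bsub>L\<^esub> a \<in> lps i" if "a \<in> lps i" for a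
      unfolding a_inv_def by (rule subgroup.m_inv_closed[OF lps_subgroup that])
    show "a \<oplus>\<^bsub>L\<^esub> b \<in> lps i" if "a \<in> lps i" "b \<in> lps i" for a b
      using subgroup.m_closed[OF lps_subgroup that] by simp
    show "c \<odot>\<^bsub>L\<^esub> v \<in> lps i" if c: "c \<in> Zp" and v: "v \<in> lps i" for c v
    proof -
      have vL: "v \<in> carrier L" using v lps_le by blast
      then have "\<Phi> (c \<odot>\<^bsub>L\<^esub> v) \<in> augp i \<Lambda>"
        using csub_smul[OF cA c] lps_iff v by (simp add: \<Phi>_smul)
      then show ?thesis using lps_iff L.smult_closed[OF c vL] by blast
    qed
  qed
  show "openin (lattice_topology p L) (lps i)" for i
  proof (subst openin_subopen, rule ballI)
    fix v assume v: "v \<in> lps i"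
    then have vL: "v \<in> carrier L" using lps_le by blast
    let ?U = "v <+\<^bsub>L\<^esub> p_multiple p L i (carrier L)"
    have "openin (lattice_topology p L) ?U" by (rule openin_coset[OF vL])
    moreover have "v \<in> ?U" using mem_coset_iff[OF vL vL] zero_pw[OF zero_in] by simp
    moreover have "?U \<subseteq> lps i"
    proof
      fix w assume w: "w \<in> ?U"
      then have wL: "w \<in> carrier L"
        using openin_subset[OF openin_coset[OF vL]] topspace_lattice_topology by blast
      have "\<Phi> w - \<Phi> v \<in> augp i \<Lambda>" using w mem_coset_iff[OF vL wL] pw_le_augp[OF csub_Lambda] by blast
      then have "(\<Phi> w - \<Phi> v) + \<Phi> v \<in> augp i \<Lambda>" using csub_add[OF cA] v lps_iff[OF vL] by blast
      then show "w \<in> lps i" using lps_iff[OF wL] by simp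
    qed
    ultimately show "\<exists>U. openin (lattice_topology p L) U \<and> v \<in> U \<and> U \<subseteq> lps i" by blast
  qed
  show "(\<Inter>i. lps i) = {\<zero>\<^bsub>L\<^esub>}"
  proof
    show "(\<Inter>i. lps i) \<subseteq> {\<zero>\<^bsub>L\<^esub>}"
    proof
      fix v assume v: "v \<in> (\<Inter>i. lps i)"
      then have vL: "v \<in> carrier L" using lps_le by blast
      have "\<Phi> v \<in> pw n \<Lambda>" for n
        using v lps_iff[OF vL] augp_le_pw[OF augp_d_le, of n] by blast
      then have "\<Phi> v = \<Phi> \<zero>\<^bsub>L\<^esub>" using separated[OF \<Phi>_in[OF vL]] by (simp add: pw_def \<Phi>_zero)
      then show "v \<in> {\<zero>\<^bsub>L\<^esub>}" using inj_onD[OF \<Phi>_inj _ vL] by simp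
    qed
    show "{\<zero>\<^bsub>L\<^esub>} \<subseteq> (\<Inter>i. lps i)" using subgroup.one_closed[OF lps_subgroup] by simp
  qed
qed

section \<open>Stratifications of the given lattice\<close>

lemma frame_sublattice_image:
  assumes x: "x \<in> {1..n} \<rightarrow> carrier L"
  shows "frame_sublattice p L x n m \<subseteq> carrier L"
    and "\<Phi> ` frame_sublattice p L x n m = tsub (\<Phi> \<circ> x) {1..n} m"
proof -
  have tm: "add_pow L (p ^ m k) (c k \<odot>\<^bsub>L\<^esub> x k) \<in> carrier L"
      "\<Phi> (add_pow L (p ^ m k) (c k \<odot>\<^bsub>L\<^esub> x k)) = (P ^^ m k) (smul (c k) ((\<Phi> \<circ> x) k))"
    if c: "\<forall>k\<in>{1..n}. c k \<in> Zp" and k: "k \<in> {1..n}" for c k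
  proof -
    have xk: "x k \<in> carrier L" "c k \<odot>\<^bsub>L\<^esub> x k \<in> carrier L" using x c k by (auto simp: Pi_iff)
    show "add_pow L (p ^ m k) (c k \<odot>\<^bsub>L\<^esub> x k) \<in> carrier L" using xk by (simp add: L.M.add.nat_pow_closed)
    show "\<Phi> (add_pow L (p ^ m k) (c k \<odot>\<^bsub>L\<^esub> x k)) = (P ^^ m k) (smul (c k) ((\<Phi> \<circ> x) k))"
      using xk by (simp add: Pow_\<Phi>[symmetric] \<Phi>_smul)
  qed
  have S: "(\<Oplus>\<^bsub>L\<^esub>k\<in>{1..n}. add_pow L (p ^ m k) (c k \<odot>\<^bsub>L\<^esub> x k)) \<in> carrier L"
      "\<Phi> (\<Oplus>\<^bsub>L\<^esub>k\<in>{1..n}. add_pow L (p ^ m k) (c k \<odot>\<^bsub>L\<^esub> x k)) =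
       (\<Sum>k\<in>{1..n}. (P ^^ m k) (smul (c k) ((\<Phi> \<circ> x) k)))"
    if c: "\<forall>k\<in>{1..n}. c k \<in> Zp" for c
  proof -
    show "(\<Oplus>\<^bsub>L\<^esub>k\<in>{1..n}. add_pow L (p ^ m k) (c k \<odot>\<^bsub>L\<^esub> x k)) \<in> carrier L"
      using tm(1)[OF c] by (intro L.M.finsum_closed) blast
    have "\<Phi> (\<Oplus>\<^bsub>L\<^esub>k\<in>{1..n}. add_pow L (p ^ m k) (c k \<odot>\<^bsub>L\<^esub> x k)) =
        (\<Sum>k\<in>{1..n}. \<Phi> (add_pow L (p ^ m k) (c k \<odot>\<^bsub>L\<^esub> x k)))"
      by (rule \<Phi>_finsum[OF tm(1)[OF c]])
    also have "\<dots> = (\<Sum>k\<in>{1..n}. (P ^^ m k) (smul (c k) ((\<Phi> \<circ> x) k)))"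
      by (rule sum.cong[OF refl tm(2)[OF c]])
    finally show "\<Phi> (\<Oplus>\<^bsub>L\<^esub>k\<in>{1..n}. add_pow L (p ^ m k) (c k \<odot>\<^bsub>L\<^esub> x k)) =
       (\<Sum>k\<in>{1..n}. (P ^^ m k) (smul (c k) ((\<Phi> \<circ> x) k)))" .
  qed
  have Pi: "c \<in> {1..n} \<rightarrow> Zp \<longleftrightarrow> (\<forall>k\<in>{1..n}. c k \<in> Zp)" for c by (auto simp: Pi_iff)
  show "frame_sublattice p L x n m \<subseteq> carrier L"
    unfolding frame_sublattice_def Pi using S(1) by blast
  show "\<Phi> ` frame_sublattice p L x n m = tsub (\<Phi> \<circ> x) {1..n} m"
  proof (intro equalityI subsetI)
    fix y assume "y \<in> \<Phi> ` frame_sublattice p L x n m"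
    then obtain c where c: "\<forall>k\<in>{1..n}. c k \<in> Zp"
      "y = \<Phi> (\<Oplus>\<^bsub>L\<^esub>k\<in>{1..n}. add_pow L (p ^ m k) (c k \<odot>\<^bsub>L\<^esub> x k))"
      unfolding frame_sublattice_def Pi by blast
    then show "y \<in> tsub (\<Phi> \<circ> x) {1..n} m"
      unfolding mem_tsub[OF finite_atLeastAtMost] using S(2)[OF c(1)] by (intro exI[of _ c]) simp
  next
    fix y assume "y \<in> tsub (\<Phi> \<circ> x) {1..n} m"
    then obtain c where c: "\<forall>k\<in>{1..n}. c k \<in> Zp" "y = (\<Sum>k\<in>{1..n}. (P ^^ m k) (smul (c k) ((\<Phi> \<circ> x) k)))"
      unfolding mem_tsub[OF finite_atLeastAtMost] by blast
    have "y = \<Phi> (\<Oplus>\<^bsub>L\<^esub>k\<in>{1..n}. add_pow L (p ^ m k) (c k \<odot>\<^bsub>L\<^esub> x k))" using S(2)[OF c(1)] c(2) by simp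
    then show "y \<in> \<Phi> ` frame_sublattice p L x n m"
      unfolding frame_sublattice_def Pi using c(1) by blast
  qed
qed

lemma strat_term_image:
  assumes "x \<in> {1..d} \<rightarrow> carrier L"
  shows "stratification_term p d L x \<xi> i \<subseteq> carrier L"
    and "\<Phi> ` stratification_term p d L x \<xi> i = strat_term d (\<Phi> \<circ> x) \<xi> i"
  unfolding stratification_term_def strat_term_def fl_def
  using frame_sublattice_image[OF assms] by auto

lemma equivalent_iff:
  assumes x: "x \<in> {1..d} \<rightarrow> carrier L"
  shows "filtration_equivalent p L lps (stratification_term p d L x \<xi>) \<longleftrightarrow>
    (\<exists>c. \<forall>i\<ge>1. pw c (augp i \<Lambda>) \<subseteq> strat_term d (\<Phi> \<circ> x) \<xi> i \<and> pw c (strat_term d (\<Phi> \<circ> x) \<xi> i) \<subseteq> augp i \<Lambda>)"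
proof -
  have "p_multiple p L c M \<subseteq> N \<longleftrightarrow> pw c (\<Phi> ` M) \<subseteq> \<Phi> ` N" if "M \<subseteq> carrier L" "N \<subseteq> carrier L" for c M N
    using \<Phi>_image_le_iff[OF p_multiple_closed[OF that(1), of c] that(2)] \<Phi>_p_multiple[OF that(1), of c] by simp
  note * = this[OF lps_le strat_term_image(1)[OF x]] this[OF strat_term_image(1)[OF x] lps_le]
  show ?thesis unfolding filtration_equivalent_def * lps_image_eq strat_term_image(2)[OF x] ..
qed

lemma has_stratification_iff:
  assumes x: "x \<in> {1..d} \<rightarrow> carrier L"
  shows "has_stratification p d L lps x \<xi> \<longleftrightarrow> (\<forall>k\<in>{1..d}. 0 < \<xi> k) \<and> (\<exists>c. stratified d (\<Phi> \<circ> x) \<xi> c)"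
  unfolding has_stratification_def stratified_def equivalent_iff[OF x] lattice_basis_iff[OF x]
  using filtration_series_lps by (auto intro: less_imp_le)

lemma has_stratificationD:
  assumes "has_stratification p d L lps x \<xi>"
  shows "x \<in> {1..d} \<rightarrow> carrier L" "\<exists>c. stratified d (\<Phi> \<circ> x) \<xi> c"
proof -
  show x: "x \<in> {1..d} \<rightarrow> carrier L" using assms by (simp add: has_stratification_def lattice_basis_def)
  show "\<exists>c. stratified d (\<Phi> \<circ> x) \<xi> c" using assms has_stratification_iff[OF x] by simp
qed

lemma exists_stratification:
  "\<exists>x \<xi>. has_stratification p d L lps x \<xi> \<and> (\<forall>k\<in>{1..d}. \<xi> k \<in> \<rat>)"
proof -
  obtain y \<xi> c where s: "stratified d y \<xi> c" and rat: "\<forall>k\<in>{1..d}. \<xi> k \<in> \<rat>"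
    using stratified_exists[OF basis_e] by blast
  have y: "y k \<in> \<Lambda>" if "k \<in> {1..d}" for k using s basis_in(2) that by (auto simp: stratified_def)
  have x: "\<Psi> \<circ> y \<in> {1..d} \<rightarrow> carrier L" using y \<Psi>_in by auto
  \<comment> \<open>The composite agrees with \<open>y\<close> only on \<open>{1..d}\<close>, which
    is all that bases and terms depend on.\<close>
  have eq: "(\<Phi> \<circ> (\<Psi> \<circ> y)) k = y k" if "k \<in> {1..d}" for k using y[OF that] by (simp add: \<Phi>_\<Psi>)
  have t: "tsub (\<Phi> \<circ> (\<Psi> \<circ> y)) {1..d} m = tsub y {1..d} m" for m
    unfolding tsub_def using eq by (intro sum.cong) auto
  have "(\<Sum>k\<in>{1..d}. smul (b k) ((\<Phi> \<circ> (\<Psi> \<circ> y)) k)) = (\<Sum>k\<in>{1..d}. smul (b k) (y k))" for b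
    using eq by (intro sum.cong) auto
  then have "basis d (\<Phi> \<circ> (\<Psi> \<circ> y)) \<longleftrightarrow> basis d y"
    unfolding basis_def using image_cong[OF refl eq, of "{1..d}"] by simp
  then have s': "stratified d (\<Phi> \<circ> (\<Psi> \<circ> y)) \<xi> c"
    using s unfolding stratified_def strat_term_def t by simp
  have "0 < \<xi> k" if k: "k \<in> {1..d}" for k
  proof -
    \<comment> \<open>The construction gives only nonnegative rates; strict positivity is the lower
      bound \<open>1 / d\<close>.\<close>
    have "0 < 1 / real d" using k by simp
    then show ?thesis using growth_ge[OF s k augp_d_le] by linarith
  qed
  then have "has_stratification p d L lps (\<Psi> \<circ> y) \<xi>" using has_stratification_iff[OF x] s' by blast
  then show ?thesis using rat by blast
qed

lemma has_stratification_unique: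
  assumes "has_stratification p d L lps x \<xi>" "has_stratification p d L lps x' \<xi>'" "k \<in> {1..d}"
  shows "\<xi> k = \<xi>' k"
  using has_stratificationD(2)[OF assms(1)] has_stratificationD(2)[OF assms(2)] growth_unique assms(3) by blast

text \<open>Rationality is known for the stratification that was constructed and passes to every
  other one by uniqueness.\<close>

lemma growth_bounds:
  assumes h: "has_stratification p d L lps x \<xi>" and k: "k \<in> {1..d}"
  shows "1 / real d \<le> \<xi> k \<and> \<xi> k \<le> 1 \<and> \<xi> k \<in> \<rat>"
proof -
  obtain c where s: "stratified d (\<Phi> \<circ> x) \<xi> c" using has_stratificationD(2)[OF h] by blast
  obtain x' \<xi>' where h': "has_stratification p d L lps x' \<xi>'" "\<forall>k\<in>{1..d}. \<xi>' k \<in> \<rat>"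
    using exists_stratification by blast
  have "\<xi> k = \<xi>' k" by (rule has_stratification_unique[OF h h'(1) k])
  then show ?thesis using growth_ge[OF s k augp_d_le] growth_le_1[OF s k] h'(2) k by simp
qed

lemma frame_sublattice_invariant:
  assumes h: "has_stratification p d L lps x \<xi>" and n: "n \<le> d"
    and m: "\<And>j k. k \<in> {1..n} \<Longrightarrow> j \<in> {1..d} \<Longrightarrow> \<xi> j \<le> \<xi> k \<Longrightarrow> j \<le> n \<and> m j \<le> m k"
  shows "group_invariant G act (frame_sublattice p L x n m)"
  unfolding group_invariant_def
proof (intro ballI)
  fix v g assume v: "v \<in> frame_sublattice p L x n m" and g: "g \<in> carrier G"
  obtain c where s: "stratified d (\<Phi> \<circ> x) \<xi> c" using has_stratificationD(2)[OF h] by blast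
  have x: "x \<in> {1..n} \<rightarrow> carrier L" using has_stratificationD(1)[OF h] n by auto
  note im = frame_sublattice_image[OF x, of m]
  have vL: "v \<in> carrier L" using v im(1) by blast
  have "\<Phi> v \<in> tsub (\<Phi> \<circ> x) {1..n} m" using v im(2) by blast
  from tsub_invariant[OF s endo_\<tau>'[OF g] \<tau>_smul'[OF g] stable_G_inv[OF stable_augp[OF stable_Lambda] g] n m this]
  have "\<tau> g (\<Phi> v) \<in> tsub (\<Phi> \<circ> x) {1..n} m" .
  then have "\<Phi> (act v g) \<in> \<Phi> ` frame_sublattice p L x n m" using vL im(2) by (simp add: \<tau>_\<Phi>)
  then show "act v g \<in> frame_sublattice p L x n m"
    using inj_on_image_mem_iff[OF \<Phi>_inj act_in[OF vL g] im(1)] by simp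
qed

text \<open>A strict jump after \<open>n\<close> means that no later vector has a rate as small as
  that of one of the first \<open>n\<close>.\<close>

lemma slow_part_invariant:
  assumes h: "has_stratification p d L lps x \<xi>" and n: "n \<in> {1..d - 1}" "\<xi> n < \<xi> (n + 1)"
  shows "group_invariant G act (frame_sublattice p L x n (\<lambda>_. 0))"
proof (rule frame_sublattice_invariant[OF h])
  show "n \<le> d" using n by auto
  fix j k assume k: "k \<in> {1..n}" and j: "j \<in> {1..d}" and le: "\<xi> j \<le> \<xi> k"
  have mono: "mono_on {1..d} \<xi>" using h by (simp add: has_stratification_def)
  have "j \<le> n"
  proof (rule ccontr)
    assume "\<not> j \<le> n"
    then have "\<xi> (n + 1) \<le> \<xi> j" using j n by (intro mono_onD[OF mono]) auto
    moreover have "\<xi> k \<le> \<xi> n" using k n by (intro mono_onD[OF mono]) auto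
    ultimately show False using le n(2) by linarith
  qed
  then show "j \<le> n \<and> (0::nat) \<le> 0" by simp
qed

lemma stratification_term_invariant:
  assumes h: "has_stratification p d L lps x \<xi>"
  shows "group_invariant G act (stratification_term p d L x \<xi> i)"
  unfolding stratification_term_def
proof (rule frame_sublattice_invariant[OF h order_refl])
  fix j k assume "k \<in> {1..d}" "j \<in> {1..d}" "\<xi> j \<le> \<xi> k"
  then show "j \<le> d \<and> nat \<lfloor>real i * \<xi> j\<rfloor> \<le> nat \<lfloor>real i * \<xi> k\<rfloor>"
    using fl_mono[of "\<xi> j" "\<xi> k" i] by (simp add: fl_def)
qed

end

theorem theorem1p1:
  fixes p d :: nat
    and G :: "('g, 'm) monoid_scheme" and T :: "'g topology"
    and L :: "(nat \<Rightarrow> int, 'a, 'n) module_scheme" and act :: "'a \<Rightarrow> 'g \<Rightarrow> 'a"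
  assumes "normalization_semidom_class.prime p"
    and "pro_p_group p G T"
    and "topologically_finitely_generated G T"
    and "padic_lattice p d L"
    and "continuous_linear_right_action p G T L act"
  shows "(\<exists>x \<xi>. has_stratification p d L (lower_p_series p G L act) x \<xi>) \<and>
    (\<forall>x \<xi> x' \<xi>'. has_stratification p d L (lower_p_series p G L act) x \<xi> \<longrightarrow>
       has_stratification p d L (lower_p_series p G L act) x' \<xi>' \<longrightarrow>
       (\<forall>k\<in>{1..d}. \<xi> k = \<xi>' k)) \<and>
    (\<forall>x \<xi>. has_stratification p d L (lower_p_series p G L act) x \<xi> \<longrightarrow>
       ((\<forall>k\<in>{1..d}. 1 / real d \<le> \<xi> k \<and> \<xi> k \<le> 1 \<and> \<xi> k \<in> \<rat>) \<and> mono_on {1..d} \<xi>) \<and>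
       (\<forall>e\<in>{1..d - 1}. \<xi> e < \<xi> (e + 1) \<longrightarrow>
          group_invariant G act (frame_sublattice p L x e (\<lambda>_. 0))) \<and>
       (\<forall>i. group_invariant G act (stratification_term p d L x \<xi> i)))"
proof -
  obtain e where L: "Module.module (padic_int p) L" and e: "lattice_basis p d L e"
    using assms(4) unfolding padic_lattice_def by blast
  obtain S where S: "finite S" "S \<subseteq> carrier G" "Abstract_Topology.closure_of T (generate G S) = carrier G"
    using assms(3) unfolding topologically_finitely_generated_def by blast
  obtain \<Phi> :: "'a \<Rightarrow> nat \<Rightarrow> nat \<Rightarrow> circle" where \<Phi>: "inj_on \<Phi> (carrier L)"
    "\<forall>v\<in>carrier L. \<forall>w\<in>carrier L. \<Phi> (v \<oplus>\<^bsub>L\<^esub> w) = \<Phi> v + \<Phi> w"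
    using additive_embedding[OF prime_gt_0_nat[OF assms(1)] L e] by blast
  interpret lattice_representation p d L e \<Phi> G T act S
    by (intro lattice_representation.intro embedded_lattice.intro lattice_representation_axioms.intro)
      (use assms L e S \<Phi> in blast)+
  have mono: "mono_on {1..d} \<xi>" if "has_stratification p d L (lower_p_series p G L act) x \<xi>" for x \<xi>
    using that unfolding has_stratification_def by (elim conjE)
  have ex: "\<exists>x \<xi>. has_stratification p d L (lower_p_series p G L act) x \<xi>"
    using exists_stratification by (elim exE conjE) (intro exI)
  show ?thesis
    by (intro conjI allI impI ballI ex has_stratification_unique slow_part_invariant
        stratification_term_invariant mono growth_bounds[THEN conjunct1]
        growth_bounds[THEN conjunct2, THEN conjunct1] growth_bounds[THEN conjunct2, THEN conjunct2])
qed

end
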